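(* Let $X$ be a metrisable space equipped with a proper betweenness, let $d_{\rm sqz}$ be a metric generating the topology on the squeezed space $\mathcal R(X)$, and for $\pi_1,\pi_2\in\Pi(X)$ with filled paths $\overline\pi_1,\overline\pi_2$ set $$d_{\rm H}(\pi_1,\pi_2):=\inf_{C\in{\rm Corr}(\overline\pi_1,\overline\pi_2)}\ \sup_{(z_1,z_2)\in C}d_{\rm sqz}(z_1,z_2),\qquad d_{\rm tot}(\pi_1,\pi_2):=\inf_{C\in{\rm Cor}_+(\overline\pi_1,\overline\pi_2)}\ \sup_{(z_1,z_2)\in C}d_{\rm sqz}(z_1,z_2),$$ $$d_{\rm part}(\pi_1,\pi_2):=d^2_{\rm H}\big(\overline\pi_1^{\langle 2\rangle},\overline\pi_2^{\langle 2\rangle}\big).$$ Then: (a) $d_{\rm H}(\pi_1,\pi_2)\le d_{\rm part}(\pi_1,\pi_2)\le d_{\rm tot}(\pi_1,\pi_2)$ for all $\pi_1,\pi_2\in\Pi(X)$. (b) $d_{\rm tot}$ and $d_{\rm part}$ are metrics on $\Pi(X)$ that generate the same topology, and this topology does not depend on the choice of the metric $d_{\rm sqz}$ generating the topology on $\mathcal R(X)$. (c) If $X$ is Polish, then so is $\Pi(X)$, and so is $\mathcal D_I(X)$ for each closed real interval $I$ of positive length (each equipped with the topology generated by $d_{\rm tot}$, equivalently $d_{\rm part}$). (d) In the special case that $X=\mathbb R$ equipped with the linear betweenness $\langle x,z\rangle=\{(1-p)x+pz:p\in[0,1]\}$, for each closed real interval $I$ of positive length, the metrics $d_{\rm tot}$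 and $d_{\rm part}$ generate Skorokhod's M1 topology on $\mathcal D_I(\mathbb R)$, while $d_{\rm H}$ is a metric on $\mathcal D_I(\mathbb R)$ that generates Skorokhod's M2 topology.
   Context: A topological space is Polish if it is separable and its topology is generated by some complete metric. Let $\overline{\mathbb R}=[-\infty,\infty]$. Squeezed space: for a metrisable space $X$, $\mathcal R(X):=(X\times\mathbb R)\cup\{(\ast,-\infty),(\ast,\infty)\}$, equipped with the unique metrisable topology such that $(x_n,t_n)\to(x,t)$ iff $t_n\to t$ in $\overline{\mathbb R}$ and, if $t\in\mathbb R$, also $x_n\to x$. Paths: $\Pi(X)$ is the set of pairs $(\pi,\preceq)$ (often just written $\pi$) where $\pi$ is a nonempty compact subset of $\mathcal R(X)$ and $\preceq$ is a total order on $\pi$ such that: (i) $\{(z,z')\in\pi^2:z\preceq z'\}$ is closed in $\pi^2$; (ii) if $(x,s),(x',s')\in\pi$ and $s<s'$, then $(x,s)\preceq(x',s')$; (iii) for each $t\in\mathbb R$ the set $\{x\in X:(x,t)\in\pi\}$ has at most two elements. Put $\hat I(\pi):=\{t\in\overline{\mathbb R}:(x,t)\in\pi\text{ for some }x\in X\cup\{\ast\}\}$ and $I(\pi):=\hat I(\pi)\cap\mathbb R$. For $t\in I(\pi)$, $\pi(t-),\pi(t+)$ are defined by $\{x:(x,t)\in\pi\}=\{\pi(t-),\pi(t+)\}$ with $(\pi(t-),t)\preceq(\pi(t+),t)$. Betweenness: a betweenness on a set $X$ assigns to each $x,z\in X$ a set $\langle x,z\rangle\subset X$ such that for all $x,y,z\in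 X$: (1) $\langle x,z\rangle=\langle z,x\rangle$; (2) $x\in\langle x,z\rangle$; (3) $y\in\langle x,z\rangle\Rightarrow\langle x,y\rangle\cap\langle y,z\rangle=\{y\}$; (4) $y\in\langle x,z\rangle\Rightarrow\langle x,y\rangle\cup\langle y,z\rangle=\langle x,z\rangle$. For $y,y'\in\langle x,z\rangle$, setting $y\le_{x,z}y'$ iff $y\in\langle x,y'\rangle$ defines a total order on $\langle x,z\rangle$. A betweenness on a metrisable space $X$ is proper if each $\langle x,z\rangle$ is compact and $(x,z)\mapsto\langle x,z\rangle$ is continuous from $X^2$ to the space of nonempty compact subsets of $X$ with the Hausdorff topology (the topology generated by the Hausdorff metric of any metric generating the topology on $X$). Filled paths: for $\pi\in\Pi(X)$, $\overline\pi:=\{(x,t):t\in I(\pi),\ x\in\langle\pi(t-),\pi(t+)\rangle\}\cup\{(\ast,t):t\in\hat I(\pi)\setminus I(\pi)\}$, equipped with the total order in which $(x,s)\preceq(y,t)$ iff $s<t$, or $s=t\in\mathbb R$ and $x\le_{\pi(t-),\pi(t+)}y$, or $(x,s)=(y,t)$. Put $\overline\pi^{\langle 2\rangle}:=\{(z,z')\in\overline\pi^2:z\preceq z'\}$ (a compact subset of $\mathcal R(X)^2$). Correspondences: ${\rm Corr}(A,B)$ is the set of $C\subset A\times B$ such that every $a\in A$ has some $b\in B$ with $(a,b)\in C$ and every $b\in B$ has some $a\in A$ with $(a,b)\in C$. For totally ordered $A,B$, ${\rm Cor}_+(A,B)$ is the set of $C\in{\rm Corr}(A,B)$ for which there are no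 $(z_1,z_2),(z_1',z_2')\in C$ with $z_1\prec z_1'$ and $z_2'\prec z_2$, where $z\prec z'$ means $z\preceq z'$ and $z\ne z'$. $d^2_{\rm H}$ is the Hausdorff metric on nonempty compact subsets of $\mathcal R(X)^2$ associated with the metric $d^2_{\rm sqz}((z_1,z_1'),(z_2,z_2')):=d_{\rm sqz}(z_1,z_2)\vee d_{\rm sqz}(z_1',z_2')$. The space $\mathcal D_I(X)$: for a closed real interval $I$ of positive length with set of finite endpoints $\partial I$, $\mathcal D_I(X)$ is the set of $\pi\in\Pi(X)$ with $\hat I(\pi)=I\cup\{-\infty,\infty\}$ and $\pi(t-)=\pi(t+)$ for all $t\in\partial I$. It is identified, via $f(t)=\pi(t+)$, with the set of right continuous functions $f:I\to X$ that have a left limit $f(t-)$ at each $t\in I$ other than the left endpoint of $I$ and that satisfy $f(r-)=f(r)$ if $r:=\sup I<\infty$. Skorokhod's M1 and M2 topologies on $\mathcal D_I(\mathbb R)$: for a compact interval $J=[a,b]$, $a<b$, and a right continuous $f:J\to\mathbb R$ with left limits (with the convention $f(a-):=f(a)$), the completed graph is $\Gamma_f:=\{(x,t):t\in J,\ x\text{ in the closed segment with endpoints }f(t-),f(t)\}\subset\mathbb R^2$, totally ordered first by $t$ and then, for equal $t$, from $f(t-)$ to $f(t)$. A parametrisation of $\Gamma_f$ is a continuous nondecreasing surjection $(u,r):[0,1]\to\Gamma_f$. Set $\rho_J(f,g):=\inf\sup_{p\in[0,1]}\big[|u_1(p)-u_2(p)|\vee|r_1(p)-r_2(p)|\big]$,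 the infimum being over parametrisations $(u_1,r_1)$ of $\Gamma_f$ and $(u_2,r_2)$ of $\Gamma_g$, and let $\rho'_J(f,g)$ be the Hausdorff distance between $\Gamma_f$ and $\Gamma_g$. If $I$ is compact, the M1 (resp. M2) topology is the one generated by $\rho_I$ (resp. $\rho'_I$). If $I$ is not compact, it is the metrisable topology in which $f_n\to f$ iff $\rho_J(f_n|_J,f|_J)\to0$ (resp. $\rho'_J(f_n|_J,f|_J)\to0$) for every compact $J=[a,b]\subset I$ with $a<b$ such that each of $a,b$ is either a finite endpoint of $I$ or a continuity point of $f$. *)

theory Defs
  imports "HOL-Analysis.Analysis"
begin

definition metric_generates :: "'a set \<Rightarrow> ('a \<Rightarrow> 'a \<Rightarrow> real) \<Rightarrow> 'a topology \<Rightarrow> bool" where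
  "metric_generates M d T \<longleftrightarrow> Metric_space M d \<and> Metric_space.mtopology M d = T"

definition polish :: "'a topology \<Rightarrow> bool" where
  "polish T \<longleftrightarrow> separable_space T \<and> completely_metrizable_space T"

definition nonempty_compacts :: "'a topology \<Rightarrow> 'a set set" where
  "nonempty_compacts T = {K. compactin T K \<and> K \<noteq> {}}"

text \<open>The locale \<^locale>\<open>Metric_space\<close> requires nonnegativity and symmetry on the whole type and not
  only on the carrier. Here and below, distances are therefore set to 0 outside the set on which
  they are meant. The arguments of \<open>hausdorff_dist\<close> that occur later (orders of filled paths and
  completed graphs) are nonempty compact sets.\<close>

definition hausdorff_dist ::
  "'a topology \<Rightarrow> ('a \<Rightarrow> 'a \<Rightarrow> real) \<Rightarrow> 'a set \<Rightarrow> 'a set \<Rightarrow> real" where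
  "hausdorff_dist T d A B =
     (if A \<in> nonempty_compacts T \<and> B \<in> nonempty_compacts T
      then max (SUP a\<in>A. INF b\<in>B. d a b) (SUP b\<in>B. INF a\<in>A. d a b)
      else 0)"

text \<open>A point \<open>(x, t)\<close> with \<open>x\<close> in the space is \<open>(Some x, ereal t)\<close>; the extra symbol \<open>*\<close> is
  \<^const>\<open>None\<close>.\<close>

type_synonym 'a sqz = "'a option \<times> ereal"

definition squeezed :: "'a topology \<Rightarrow> 'a sqz set" where
  "squeezed X = {(Some x, ereal t) | x t. x \<in> topspace X} \<union> {(None, -\<infinity>), (None, \<infinity>)}"

text \<open>For metrizable \<open>X\<close> there is exactly one topology as in \<open>squeezed_topology\<close> below; with
  \<open>g (ereal t) = t / (1 + \<bar>t\<bar>)\<close>, \<open>g (\<plusminus>\<infinity>) = \<plusminus>1\<close>, and a metric \<open>e \<le> 1\<close> of \<open>X\<close> it is generated by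
  \<open>\<bar>g s - g t\<bar> + min (1 - \<bar>g s\<bar>) (1 - \<bar>g t\<bar>) * e x y\<close>.
  Applying \<^const>\<open>the\<close> to the first coordinates is harmless: if \<open>t\<^sub>n\<close> tends to a real limit,
  then \<open>t\<^sub>n\<close> is eventually real, and then \<open>x\<^sub>n\<close> is not \<open>*\<close>.\<close>

definition squeezed_lim :: "'a topology \<Rightarrow> (nat \<Rightarrow> 'a sqz) \<Rightarrow> 'a sqz \<Rightarrow> bool" where
  "squeezed_lim X zs z \<longleftrightarrow>
     (\<lambda>n. snd (zs n)) \<longlonglongrightarrow> snd z \<and>
     (\<forall>x t. z = (Some x, ereal t) \<longrightarrow> limitin X (\<lambda>n. the (fst (zs n))) x sequentially)"

definition squeezed_topology :: "'a topology \<Rightarrow> 'a sqz topology" where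
  "squeezed_topology X =
     (THE T. metrizable_space T \<and> topspace T = squeezed X \<and>
        (\<forall>zs z. range zs \<subseteq> squeezed X \<and> z \<in> squeezed X \<longrightarrow>
           (limitin T zs z sequentially \<longleftrightarrow> squeezed_lim X zs z)))"

text \<open>A path is a set together with a total order on it, the order being a relation in the sense
  of \<^const>\<open>linear_order_on\<close> (in particular contained in the square of the set).\<close>

type_synonym 'a path = "'a sqz set \<times> 'a sqz rel"

definition paths :: "'a topology \<Rightarrow> 'a path set" where
  "paths X = {(\<pi>, le).
     \<pi> \<noteq> {} \<and> compactin (squeezed_topology X) \<pi> \<and> linear_order_on \<pi> le \<and>
     closedin (prod_topology (subtopology (squeezed_topology X) \<pi>)
                             (subtopology (squeezed_topology X) \<pi>)) le \<and>
     (\<forall>z\<in>\<pi>. \<forall>z'\<in>\<pi>. snd z < snd z' \<longrightarrow> (z, z') \<in> le) \<and>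
     (\<forall>t::real. finite {x. (Some x, ereal t) \<in> \<pi>} \<and> card {x. (Some x, ereal t) \<in> \<pi>} \<le> 2)}"

definition ext_times :: "'a path \<Rightarrow> ereal set" where
  "ext_times p = snd ` fst p"

definition times :: "'a path \<Rightarrow> real set" where
  "times p = {t. ereal t \<in> ext_times p}"

definition path_values :: "'a path \<Rightarrow> real \<Rightarrow> 'a \<Rightarrow> 'a \<Rightarrow> bool" where
  "path_values p t l r \<longleftrightarrow>
     {x. (Some x, ereal t) \<in> fst p} = {l, r} \<and> ((Some l, ereal t), (Some r, ereal t)) \<in> snd p"

definition path_left :: "'a path \<Rightarrow> real \<Rightarrow> 'a" where
  "path_left p t = (THE l. \<exists>r. path_values p t l r)"

definition path_right :: "'a path \<Rightarrow> real \<Rightarrow> 'a" where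
  "path_right p t = (THE r. \<exists>l. path_values p t l r)"

definition betweenness :: "'a set \<Rightarrow> ('a \<Rightarrow> 'a \<Rightarrow> 'a set) \<Rightarrow> bool" where
  "betweenness M B \<longleftrightarrow>
     (\<forall>x\<in>M. \<forall>z\<in>M. B x z \<subseteq> M \<and> B x z = B z x \<and> x \<in> B x z \<and>
        (\<forall>y\<in>B x z. B x y \<inter> B y z = {y} \<and> B x y \<union> B y z = B x z))"

text \<open>The topology generated by the Hausdorff metric depends only on the topology of the space and
  not on the metric \<open>d\<close> generating it, so it does not matter which \<open>d\<close> is used.\<close>

definition proper_betweenness :: "'a topology \<Rightarrow> ('a \<Rightarrow> 'a \<Rightarrow> 'a set) \<Rightarrow> bool" where
  "proper_betweenness X B \<longleftrightarrow>
     betweenness (topspace X) B \<and>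
     (\<forall>x\<in>topspace X. \<forall>z\<in>topspace X. compactin X (B x z)) \<and>
     (\<exists>d. metric_generates (topspace X) d X \<and>
        continuous_map (prod_topology X X)
          (Metric_space.mtopology (nonempty_compacts X) (hausdorff_dist X d))
          (\<lambda>(x, z). B x z))"

definition filled :: "('a \<Rightarrow> 'a \<Rightarrow> 'a set) \<Rightarrow> 'a path \<Rightarrow> 'a sqz set" where
  "filled B p =
     {(Some x, ereal t) | x t. t \<in> times p \<and> x \<in> B (path_left p t) (path_right p t)} \<union>
     {(None, t) | t. t \<in> ext_times p - ereal ` times p}"

text \<open>The order on the filled path. As a set of pairs, it is also the set of all ordered pairs
  in the filled path. The order on a segment \<open>B x z\<close> is: \<open>y \<le> y'\<close> iff \<open>y \<in> B x y'\<close>.\<close>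

definition filled_order :: "('a \<Rightarrow> 'a \<Rightarrow> 'a set) \<Rightarrow> 'a path \<Rightarrow> 'a sqz rel" where
  "filled_order B p = {(z, z'). z \<in> filled B p \<and> z' \<in> filled B p \<and>
     (snd z < snd z' \<or>
      (\<exists>x y t. z = (Some x, ereal t) \<and> z' = (Some y, ereal t) \<and> x \<in> B (path_left p t) y) \<or>
      z = z')}"

definition Corr :: "'a set \<Rightarrow> 'b set \<Rightarrow> ('a \<times> 'b) set set" where
  "Corr A B = {C. C \<subseteq> A \<times> B \<and> (\<forall>a\<in>A. \<exists>b\<in>B. (a, b) \<in> C) \<and> (\<forall>b\<in>B. \<exists>a\<in>A. (a, b) \<in> C)}"

definition Cor_plus ::
  "'a set \<Rightarrow> 'a rel \<Rightarrow> 'b set \<Rightarrow> 'b rel \<Rightarrow> ('a \<times> 'b) set set" where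
  "Cor_plus A leA B leB = {C \<in> Corr A B.
     \<not> (\<exists>z1 z2 z1' z2'. (z1, z2) \<in> C \<and> (z1', z2') \<in> C \<and>
          ((z1, z1') \<in> leA \<and> z1 \<noteq> z1') \<and> ((z2', z2) \<in> leB \<and> z2' \<noteq> z2))}"

definition d_H ::
  "'a topology \<Rightarrow> ('a \<Rightarrow> 'a \<Rightarrow> 'a set) \<Rightarrow> ('a sqz \<Rightarrow> 'a sqz \<Rightarrow> real) \<Rightarrow> 'a path \<Rightarrow> 'a path \<Rightarrow> real" where
  "d_H X B d p q =
     (if p \<in> paths X \<and> q \<in> paths X
      then INF C \<in> Corr (filled B p) (filled B q). SUP (z1, z2) \<in> C. d z1 z2
      else 0)"

definition d_tot ::
  "'a topology \<Rightarrow> ('a \<Rightarrow> 'a \<Rightarrow> 'a set) \<Rightarrow> ('a sqz \<Rightarrow> 'a sqz \<Rightarrow> real) \<Rightarrow> 'a path \<Rightarrow> 'a path \<Rightarrow> real" where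
  "d_tot X B d p q =
     (if p \<in> paths X \<and> q \<in> paths X
      then INF C \<in> Cor_plus (filled B p) (filled_order B p) (filled B q) (filled_order B q).
             SUP (z1, z2) \<in> C. d z1 z2
      else 0)"

definition d_pair :: "('z \<Rightarrow> 'z \<Rightarrow> real) \<Rightarrow> 'z \<times> 'z \<Rightarrow> 'z \<times> 'z \<Rightarrow> real" where
  "d_pair d = (\<lambda>(z1, z1') (z2, z2'). max (d z1 z2) (d z1' z2'))"

definition d_part ::
  "'a topology \<Rightarrow> ('a \<Rightarrow> 'a \<Rightarrow> 'a set) \<Rightarrow> ('a sqz \<Rightarrow> 'a sqz \<Rightarrow> real) \<Rightarrow> 'a path \<Rightarrow> 'a path \<Rightarrow> real" where
  "d_part X B d p q =
     (if p \<in> paths X \<and> q \<in> paths X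
      then hausdorff_dist (prod_topology (squeezed_topology X) (squeezed_topology X)) (d_pair d)
             (filled_order B p) (filled_order B q)
      else 0)"

definition closed_real_interval :: "real set \<Rightarrow> bool" where
  "closed_real_interval I \<longleftrightarrow> closed I \<and> is_interval I \<and> (\<exists>a\<in>I. \<exists>b\<in>I. a < b)"

definition endpoints :: "real set \<Rightarrow> real set" where
  "endpoints I = {t \<in> I. (\<forall>s\<in>I. t \<le> s) \<or> (\<forall>s\<in>I. s \<le> t)}"

definition D_paths :: "real set \<Rightarrow> 'a topology \<Rightarrow> 'a path set" where
  "D_paths I X = {p \<in> paths X.
     ext_times p = ereal ` I \<union> {-\<infinity>, \<infinity>} \<and> (\<forall>t\<in>endpoints I. path_left p t = path_right p t)}"

text \<open>Below, \<open>f\<close> is a total function of which only the values on \<open>{a..b}\<close> matter. The left limit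
  at the left endpoint \<open>a\<close> is by convention \<open>f a\<close>, even if \<open>f\<close> is also defined to the left of \<open>a\<close>.\<close>

definition left_limit :: "real \<Rightarrow> (real \<Rightarrow> real) \<Rightarrow> real \<Rightarrow> real" where
  "left_limit a f t = (if t = a then f a else Lim (at_left t) f)"

definition completed_graph :: "real \<Rightarrow> real \<Rightarrow> (real \<Rightarrow> real) \<Rightarrow> (real \<times> real) set" where
  "completed_graph a b f = {(x, t). t \<in> {a..b} \<and> x \<in> closed_segment (left_limit a f t) (f t)}"

definition graph_le :: "real \<Rightarrow> (real \<Rightarrow> real) \<Rightarrow> real \<times> real \<Rightarrow> real \<times> real \<Rightarrow> bool" where
  "graph_le a f = (\<lambda>(x, s) (y, t).
     s < t \<or> (s = t \<and> \<bar>x - left_limit a f t\<bar> \<le> \<bar>y - left_limit a f t\<bar>))"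

definition parametrisations :: "real \<Rightarrow> real \<Rightarrow> (real \<Rightarrow> real) \<Rightarrow> (real \<Rightarrow> real \<times> real) set" where
  "parametrisations a b f = {\<gamma>.
     continuous_on {0..1} \<gamma> \<and> \<gamma> ` {0..1} = completed_graph a b f \<and>
     (\<forall>p\<in>{0..1}. \<forall>q\<in>{0..1}. p \<le> q \<longrightarrow> graph_le a f (\<gamma> p) (\<gamma> q))}"

definition rho_M1 :: "real \<Rightarrow> real \<Rightarrow> (real \<Rightarrow> real) \<Rightarrow> (real \<Rightarrow> real) \<Rightarrow> real" where
  "rho_M1 a b f g =
     (INF (\<gamma>1, \<gamma>2) \<in> parametrisations a b f \<times> parametrisations a b g.
        SUP p\<in>{0..1}. max \<bar>fst (\<gamma>1 p) - fst (\<gamma>2 p)\<bar> \<bar>snd (\<gamma>1 p) - snd (\<gamma>2 p)\<bar>)"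

definition rho_M2 :: "real \<Rightarrow> real \<Rightarrow> (real \<Rightarrow> real) \<Rightarrow> (real \<Rightarrow> real) \<Rightarrow> real" where
  "rho_M2 a b f g = hausdorff_dist euclidean dist (completed_graph a b f) (completed_graph a b g)"

definition good_point :: "real set \<Rightarrow> (real \<Rightarrow> real) \<Rightarrow> real \<Rightarrow> bool" where
  "good_point I f t \<longleftrightarrow> t \<in> endpoints I \<or> continuous (at t within I) f"

text \<open>A path \<open>p\<close> in \<^term>\<open>D_paths I euclideanreal\<close> is identified with the function
  \<^term>\<open>path_right p\<close> on \<open>I\<close>.\<close>

definition skorokhod_topology ::
  "(real \<Rightarrow> real \<Rightarrow> (real \<Rightarrow> real) \<Rightarrow> (real \<Rightarrow> real) \<Rightarrow> real) \<Rightarrow> real set \<Rightarrow> real path topology" where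
  "skorokhod_topology \<rho> I =
     (let D = D_paths I euclideanreal in
      if compact I
      then Metric_space.mtopology D
             (\<lambda>p q. if p \<in> D \<and> q \<in> D
                    then \<rho> (Inf I) (Sup I) (path_right p) (path_right q) else 0)
      else THE T. metrizable_space T \<and> topspace T = D \<and>
             (\<forall>ps p. range ps \<subseteq> D \<and> p \<in> D \<longrightarrow>
                (limitin T ps p sequentially \<longleftrightarrow>
                 (\<forall>a b. a < b \<and> {a..b} \<subseteq> I \<and>
                    good_point I (path_right p) a \<and> good_point I (path_right p) b \<longrightarrow>
                    (\<lambda>n. \<rho> a b (path_right (ps n)) (path_right p)) \<longlonglongrightarrow> 0))))"

definition M1_topology :: "real set \<Rightarrow> real path topology" where
  "M1_topology = skorokhod_topology rho_M1"

definition M2_topology :: "real set \<Rightarrow> real path topology" where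
  "M2_topology = skorokhod_topology rho_M2"

end

theory Submission
  imports Defs
begin

text \<open>A filled path with its order is a compact chain whose order is closed. If two such orders are
  Hausdorff close as sets of pairs, then the relation \<open>d z w \<le> \<delta>\<close> is a correspondence that violates
  monotonicity only between nearby points; its running maximum and running minimum form a monotone
  correspondence that is hardly worse. This compares \<open>d_part\<close> with \<open>d_tot\<close>, and the same construction,
  applied to a composition of correspondences, gives the triangle inequality for \<open>d_tot\<close>. The orders of
  filled paths form a G-delta set in the hyperspace of compact sets of pairs, whence the Polish spaces.
  For real-valued paths, a closed monotone correspondence between two completed graphs is itself a
  compact densely ordered chain, hence a continuous monotone image of an interval, and this yields the
  pairs of parametrisations in Skorokhod's M1 distance. Convergence of filled paths is reduced to
  convergence of completed graphs on intervals with endpoints at continuity points, all but countably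
  many points being of this kind.\<close>

section \<open>Metric preliminaries\<close>

text \<open>The orders of filled paths are not closed in the hyperspace: an excursion from x to y
  and back within a vanishing time leaves both (x, y) and (y, x) in the limit. Hence a G-delta set
  is aimed at. Failures of size at least 1/(n+1) at times in [-n, n] form closed sets; the bound on
  the time is there because near infinity distances in X are no longer seen. For a similar reason
  \<open>d_part\<close> and \<open>d_tot\<close> are compared at one path at a time: how close two
  orders must be before a correspondence can be made monotone depends on how well the given path
  separates pairs in reversed order. So topologies are transferred, and completeness is never asked
  of \<open>d_part\<close> or \<open>d_tot\<close> themselves. Completeness of the hyperspace
  requires a complete metric on the squeezed space, which the given \<open>d\<close> may fail to be;
  independence of the topology from \<open>d\<close> allows an exchange. The squeezed space is
  specified by its convergent sequences, so closedness, compactness and continuity are handled by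
  sequences throughout.\<close>

abbreviation null :: "(nat \<Rightarrow> real) \<Rightarrow> bool" where
  "null f \<equiv> f \<longlonglongrightarrow> 0"

abbreviation subseq :: "(nat \<Rightarrow> nat) \<Rightarrow> bool" where
  "subseq \<equiv> strict_mono"

text \<open>The radius \<open>\<delta>\<close> may depend on the centre \<open>x\<close>. Such a
  pointwise modulus is all that the comparison of \<open>d_part\<close> with \<open>d_tot\<close>
  yields, and it suffices for the equality of topologies.\<close>

lemma mtopology_eqI:
  assumes "Metric_space M d" "Metric_space M d'"
    and "\<And>x e. x \<in> M \<Longrightarrow> e > 0 \<Longrightarrow> \<exists>\<delta>>0. \<forall>y\<in>M. d x y < \<delta> \<longrightarrow> d' x y < e"
    and "\<And>x e. x \<in> M \<Longrightarrow> e > 0 \<Longrightarrow> \<exists>\<delta>>0. \<forall>y\<in>M. d' x y < \<delta> \<longrightarrow> d x y < e"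
  shows "Metric_space.mtopology M d = Metric_space.mtopology M d'"
proof -
  interpret d: Metric_space M d by fact
  interpret d': Metric_space M d' by fact
  have *: "openin (Metric_space.mtopology M d2) U"
    if ms: "Metric_space M d1" "Metric_space M d2" and op: "openin (Metric_space.mtopology M d1) U"
      and fine: "\<And>x e. x \<in> M \<Longrightarrow> e > 0 \<Longrightarrow> \<exists>\<delta>>0. \<forall>y\<in>M. d2 x y < \<delta> \<longrightarrow> d1 x y < e" for d1 d2 U
    unfolding Metric_space.openin_mtopology[OF ms(2)]
  proof (intro conjI allI impI)
    show "U \<subseteq> M"
      using op Metric_space.openin_mtopology[OF ms(1)] by blast
    fix x assume "x \<in> U"
    then obtain r where "r > 0" and r: "Metric_space.mball M d1 x r \<subseteq> U" and "x \<in> M"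
      using op Metric_space.openin_mtopology[OF ms(1)] by blast
    then obtain \<delta> where "\<delta> > 0" "\<forall>y\<in>M. d2 x y < \<delta> \<longrightarrow> d1 x y < r"
      using fine by blast
    then show "\<exists>r>0. Metric_space.mball M d2 x r \<subseteq> U"
      using r by (auto simp: subset_iff Metric_space.in_mball[OF ms(1)] Metric_space.in_mball[OF ms(2)])
  qed
  show ?thesis
    unfolding topology_eq using *[OF assms(1,2)] *[OF assms(2,1)] assms(3,4) by blast
qed

lemma closedin_metrizable_sequentially:
  assumes "metrizable_space T"
  shows "closedin T S \<longleftrightarrow>
    S \<subseteq> topspace T \<and> (\<forall>\<sigma> l. range \<sigma> \<subseteq> S \<and> limitin T \<sigma> l sequentially \<longrightarrow> l \<in> S)"
  using assms Metric_space.metric_closedin_iff_sequentially_closed Metric_space.topspace_mtopology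
  unfolding metrizable_space_def by metis

text \<open>In a metrizable space the closed sets are the sequentially closed ones, so the
  convergent sequences determine the topology. This is the uniqueness behind both uses of
  \<open>THE\<close>, in \<open>squeezed_topology\<close> and in
  \<open>skorokhod_topology\<close>.\<close>

lemma metrizable_topology_eqI:
  assumes "metrizable_space T" "metrizable_space T'" "topspace T = topspace T'"
    and lim: "\<And>\<sigma> l. range \<sigma> \<subseteq> topspace T \<Longrightarrow> l \<in> topspace T \<Longrightarrow>
      limitin T \<sigma> l sequentially \<longleftrightarrow> limitin T' \<sigma> l sequentially"
  shows "T = T'"
proof -
  have "limitin T \<sigma> l sequentially \<longleftrightarrow> limitin T' \<sigma> l sequentially"
    if "range \<sigma> \<subseteq> topspace T" for \<sigma> l
    using lim[OF that] limitin_topspace[of T \<sigma> l] limitin_topspace[of T' \<sigma> l] assms(3) by blast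
  then have "closedin T S \<longleftrightarrow> closedin T' S" for S
    unfolding closedin_metrizable_sequentially[OF assms(1)] closedin_metrizable_sequentially[OF assms(2)]
      assms(3)[symmetric] by (meson subset_trans)
  then show ?thesis
    by (metis assms(3) openin_closedin_eq topology_eq)
qed

lemma separable_space_metric:
  assumes "Metric_space M d"
  shows "separable_space (Metric_space.mtopology M d) \<longleftrightarrow>
    (\<exists>C. countable C \<and> C \<subseteq> M \<and> (\<forall>x\<in>M. \<forall>e>0. \<exists>c\<in>C. d x c < e))"
proof -
  interpret Metric_space M d by fact
  have "mtopology closure_of C = M \<longleftrightarrow> (\<forall>x\<in>M. \<forall>e>0. \<exists>c\<in>C. d x c < e)" if "C \<subseteq> M" for C
  proof -
    have "mtopology closure_of C \<subseteq> M"
      by (metis closure_of_subset_topspace topspace_mtopology)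
    moreover have "x \<in> mtopology closure_of C \<longleftrightarrow> (\<forall>e>0. \<exists>c\<in>C. d x c < e)" if "x \<in> M" for x
      using that \<open>C \<subseteq> M\<close> unfolding metric_closure_of by simp (meson subsetD)
    ultimately show ?thesis
      by blast
  qed
  then show ?thesis
    unfolding separable_space_def topspace_mtopology by (intro ex_cong1 conj_cong refl)
qed

text \<open>A countable dense set may miss \<open>S\<close> altogether. Instead, one point of
  \<open>S\<close> is picked from each ball of radius \<open>1 / real (Suc n)\<close> about a dense
  point, whenever that ball meets \<open>S\<close>.\<close>

lemma separable_space_metric_subset:
  assumes "Metric_space M d" "separable_space (Metric_space.mtopology M d)" "S \<subseteq> M"
  shows "separable_space (Metric_space.mtopology S d)"
proof -
  interpret Metric_space M d by fact
  obtain C where C: "countable C" "C \<subseteq> M" "\<And>x e. x \<in> M \<Longrightarrow> e > 0 \<Longrightarrow> \<exists>c\<in>C. d x c < e"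
    using assms separable_space_metric by metis
  have ms: "Metric_space S d"
    using assms(3) subspace by blast
  define P where "P = (\<lambda>c n y. y \<in> S \<and> d y c < 1 / real (Suc n))"
  define pick where "pick = (\<lambda>(c, n). SOME y. P c n y)"
  define C' where "C' = pick ` {(c, n). c \<in> C \<and> (\<exists>y. P c n y)}"
  have pick: "P c n (pick (c, n))" if "\<exists>y. P c n y" for c n
    unfolding pick_def using that by (simp add: someI_ex)
  have "countable C'"
    unfolding C'_def
    by (rule countable_image, rule countable_subset[of _ "C \<times> UNIV"]) (use C in auto)
  moreover have "C' \<subseteq> S"
    unfolding C'_def using pick by (auto simp: P_def)
  moreover have "\<exists>c\<in>C'. d x c < e" if x: "x \<in> S" and e: "e > 0" for x e
  proof -
    obtain n where n: "1 / real (Suc n) < e / 2"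
      using e by (meson half_gt_zero nat_approx_posE)
    obtain c where c: "c \<in> C" "d x c < 1 / real (Suc n)"
      using C(3)[of x "1 / real (Suc n)"] x assms(3) by auto
    have ex: "\<exists>y. P c n y"
      using x c by (auto simp: P_def)
    define y where "y = pick (c, n)"
    have y: "y \<in> S" "d y c < 1 / real (Suc n)" "y \<in> C'"
      using pick[OF ex] ex c by (auto simp: P_def y_def C'_def)
    have "d x y \<le> d x c + d c y"
      using x y c C assms(3) by (meson subsetD triangle)
    then show ?thesis
      using y c n commute by (smt (verit) field_sum_of_halves)
  qed
  ultimately show ?thesis
    unfolding separable_space_metric[OF ms] by blast
qed

text \<open>A distance given as an infimum is used only through the relation \<open>R r p q\<close>, which lies between
  \<open>\<delta> p q < r\<close> and \<open>\<delta> p q \<le> r\<close>.\<close>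

lemma metric_from_closeness:
  fixes \<delta> :: "'p \<Rightarrow> 'p \<Rightarrow> real"
  assumes le: "\<And>r p q. p \<in> P \<Longrightarrow> q \<in> P \<Longrightarrow> R r p q \<Longrightarrow> \<delta> p q \<le> r"
    and less: "\<And>r p q. p \<in> P \<Longrightarrow> q \<in> P \<Longrightarrow> \<delta> p q < r \<Longrightarrow> R r p q"
    and out: "\<And>p q. p \<notin> P \<or> q \<notin> P \<Longrightarrow> \<delta> p q = 0"
    and refl: "\<And>p. p \<in> P \<Longrightarrow> R 0 p p"
    and nonneg: "\<And>r p q. p \<in> P \<Longrightarrow> q \<in> P \<Longrightarrow> R r p q \<Longrightarrow> 0 \<le> r"
    and sym: "\<And>r p q. p \<in> P \<Longrightarrow> q \<in> P \<Longrightarrow> R r p q \<Longrightarrow> R r q p"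
    and trans: "\<And>r s p q u. p \<in> P \<Longrightarrow> q \<in> P \<Longrightarrow> u \<in> P \<Longrightarrow> R r p q \<Longrightarrow> R s q u \<Longrightarrow> R (r + s) p u"
    and sep: "\<And>p q. p \<in> P' \<Longrightarrow> q \<in> P' \<Longrightarrow> (\<And>r. r > 0 \<Longrightarrow> R r p q) \<Longrightarrow> p = q"
    and sub: "P' \<subseteq> P"
  shows "Metric_space P' \<delta>"
proof
  have nn: "0 \<le> \<delta> p q" if "p \<in> P" "q \<in> P" for p q
  proof (rule ccontr)
    assume "\<not> 0 \<le> \<delta> p q"
    \<comment> \<open>A negative number lies below its half, so \<open>less\<close> would give
      closeness with a negative radius.\<close>
    then have "\<delta> p q < \<delta> p q / 2"
      by simp
    from less[OF that this] nonneg[OF that] \<open>\<not> 0 \<le> \<delta> p q\<close> show False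
      by fastforce
  qed
  show "0 \<le> \<delta> p q" for p q
    using nn out by (metis order.refl)
  have cle: "\<delta> p q \<le> \<delta> q p" if "p \<in> P" "q \<in> P" for p q
  proof (rule field_le_epsilon)
    fix e :: real assume "e > 0"
    then show "\<delta> p q \<le> \<delta> q p + e"
      using le[OF that sym[OF that(2,1) less[OF that(2,1), of "\<delta> q p + e"]]] by simp
  qed
  show "\<delta> p q = \<delta> q p" for p q
    using cle[of p q] cle[of q p] out[of p q] out[of q p] by (cases "p \<in> P \<and> q \<in> P") auto
  show "\<delta> p q = 0 \<longleftrightarrow> p = q" if "p \<in> P'" "q \<in> P'" for p q
  proof
    assume "\<delta> p q = 0"
    then show "p = q"
      using that sub by (intro sep less) auto
  next
    assume "p = q"
    then show "\<delta> p q = 0"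
      using that sub refl le nn by (meson antisym subsetD)
  qed
  show "\<delta> p u \<le> \<delta> p q + \<delta> q u" if "p \<in> P'" "q \<in> P'" "u \<in> P'" for p q u
  proof (rule field_le_epsilon)
    fix e :: real assume "e > 0"
    then have "R (\<delta> p q + e / 2) p q" "R (\<delta> q u + e / 2) q u"
      using that sub by (auto intro!: less)
    then have "R ((\<delta> p q + e / 2) + (\<delta> q u + e / 2)) p u"
      using that sub by (intro trans[of p q u]) auto
    then show "\<delta> p u \<le> \<delta> p q + \<delta> q u + e"
      using le[of p u] that sub by (smt (verit) field_sum_of_halves subsetD)
  qed
qed

lemma lim_1_over_Suc: "null (\<lambda>n. 1 / real (Suc n))"
  using LIMSEQ_inverse_real_of_nat by (simp add: inverse_eq_divide)

lemma strict_mono_subseq_tendsto: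
  assumes "strict_mono (r :: nat \<Rightarrow> nat)" "X \<longlonglongrightarrow> l"
  shows "(\<lambda>n. X (r n)) \<longlonglongrightarrow> l"
  using LIMSEQ_subseq_LIMSEQ[OF assms(2,1)] by (simp add: o_def)

context Metric_space begin

lemma seq_limitin_iff:
  assumes "\<And>n. \<sigma> n \<in> M" "l \<in> M"
  shows "limitin mtopology \<sigma> l sequentially \<longleftrightarrow> null (\<lambda>n. d (\<sigma> n) l)"
  using assms by (simp add: limitin_metric_dist_null)

lemma seq_unique:
  assumes "\<And>n. \<sigma> n \<in> M" "l \<in> M" "l' \<in> M" "null (\<lambda>n. d (\<sigma> n) l)" "null (\<lambda>n. d (\<sigma> n) l')"
  shows "l = l'"
  using assms limitin_metric_unique seq_limitin_iff by (metis trivial_limit_sequentially)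

lemma seq_dist:
  assumes M: "\<And>n. \<sigma> n \<in> M" "\<And>n. \<tau> n \<in> M" "x \<in> M" "y \<in> M"
    and "null (\<lambda>n. d (\<sigma> n) x)" "null (\<lambda>n. d (\<tau> n) y)"
  shows "(\<lambda>n. d (\<sigma> n) (\<tau> n)) \<longlonglongrightarrow> d x y"
proof -
  have "null (\<lambda>n. d (\<sigma> n) x + d (\<tau> n) y)"
    using tendsto_add[OF assms(5,6)] by simp
  moreover have "\<bar>d (\<sigma> n) (\<tau> n) - d x y\<bar> \<le> d (\<sigma> n) x + d (\<tau> n) y" for n
    using triangle[OF M(1)[of n] M(3) M(2)[of n]] triangle[OF M(3) M(4) M(2)[of n]]
      triangle[OF M(3) M(1)[of n] M(4)] triangle[OF M(1)[of n] M(2)[of n] M(4)]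
      commute[of x "\<sigma> n"] commute[of y "\<tau> n"] by linarith
  ultimately have "null (\<lambda>n. d (\<sigma> n) (\<tau> n) - d x y)"
    by (intro Lim_null_comparison[of "\<lambda>n. d (\<sigma> n) (\<tau> n) - d x y"]) (auto intro!: always_eventually)
  then show ?thesis
    using LIM_zero_iff by blast
qed

lemma seq_near:
  assumes "\<And>n. \<sigma> n \<in> M" "\<And>n. \<tau> n \<in> M" "x \<in> M"
    and "null (\<lambda>n. d (\<sigma> n) x)" "null (\<lambda>n. d (\<sigma> n) (\<tau> n))"
  shows "null (\<lambda>n. d (\<tau> n) x)"
proof (rule Lim_null_comparison)
  show "null (\<lambda>n. d (\<sigma> n) (\<tau> n) + d (\<sigma> n) x)"
    using tendsto_add[OF assms(5,4)] by simp
  show "\<forall>\<^sub>F n in sequentially. norm (d (\<tau> n) x) \<le> d (\<sigma> n) (\<tau> n) + d (\<sigma> n) x"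
    using assms(1-3) by (simp add: triangle'')
qed

lemma compact_seq:
  fixes \<sigma> :: "nat \<Rightarrow> 'a"
  assumes "compactin mtopology A" "\<And>n. \<sigma> n \<in> A"
  obtains l r where "l \<in> A" "strict_mono r" "null (\<lambda>n. d (\<sigma> (r n)) l)"
proof -
  have A: "A \<subseteq> M"
    using assms(1) compactin_sequentially by blast
  obtain l r where lr: "l \<in> A" "strict_mono r" "limitin mtopology (\<sigma> \<circ> r) l sequentially"
    using assms(1)[unfolded compactin_sequentially] assms(2) by (meson image_subsetI)
  then show thesis
    by (intro that[of l r]) (auto simp: limitin_metric_dist_null o_def)
qed

lemma compact_seqI:
  assumes "A \<subseteq> M" "\<And>\<sigma>. (\<And>n::nat. \<sigma> n \<in> A) \<Longrightarrow> \<exists>l\<in>A. \<exists>r. subseq r \<and> null (\<lambda>n. d (\<sigma> (r n)) l)"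
  shows "compactin mtopology A"
  unfolding compactin_sequentially
proof (intro conjI allI impI)
  fix \<sigma> :: "nat \<Rightarrow> 'a" assume rg: "range \<sigma> \<subseteq> A"
  then obtain l r where lr: "l \<in> A" "strict_mono r" "null (\<lambda>n. d (\<sigma> (r n)) l)"
    using assms(2)[of \<sigma>] by blast
  moreover have "limitin mtopology (\<sigma> \<circ> r) l sequentially"
    using lr rg assms(1) by (subst seq_limitin_iff) (auto simp: o_def)
  ultimately show "\<exists>l r. l \<in> A \<and> strict_mono r \<and> limitin mtopology (\<sigma> \<circ> r) l sequentially"
    by blast
qed (use assms in auto)

lemma compact_near_seq:
  fixes \<sigma> :: "nat \<Rightarrow> 'a"
  assumes "compactin mtopology A" "\<And>n. \<sigma> n \<in> A" "\<And>n. \<tau> n \<in> M" "null (\<lambda>n. d (\<sigma> n) (\<tau> n))"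
  obtains l r where "l \<in> A" "strict_mono r" "null (\<lambda>n. d (\<sigma> (r n)) l)" "null (\<lambda>n. d (\<tau> (r n)) l)"
proof -
  obtain l r where lr: "l \<in> A" "strict_mono r" "null (\<lambda>n. d (\<sigma> (r n)) l)"
    by (rule compact_seq[OF assms(1,2)])
  have "A \<subseteq> M"
    using assms(1) compactin_sequentially by blast
  then have "\<sigma> n \<in> M" "l \<in> M" for n
    using assms(2) lr(1) by blast+
  then have "null (\<lambda>n. d (\<tau> (r n)) l)"
    using seq_near[OF _ assms(3) _ lr(3) strict_mono_subseq_tendsto[OF lr(2) assms(4)]] by blast
  then show thesis
    by (rule that[OF lr])
qed

lemma compact_subset: "compactin mtopology A \<Longrightarrow> A \<subseteq> M"
  by (metis compactin_subset_topspace topspace_mtopology)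

lemma compact_dist_bounded:
  assumes "compactin mtopology A" "compactin mtopology B"
  shows "\<exists>b. \<forall>x\<in>A. \<forall>y\<in>B. d x y \<le> b"
proof -
  have "mbounded (A \<union> B)"
    using assms compactin_imp_mbounded mbounded_Un by blast
  then show ?thesis
    unfolding mbounded_alt by blast
qed

lemma compact_seq_closed:
  assumes "compactin mtopology A" "\<And>n. \<sigma> n \<in> A" "l \<in> M" "null (\<lambda>n. d (\<sigma> n) l)"
  shows "l \<in> A"
  using assms compactin_imp_closedin[OF Hausdorff_space_mtopology assms(1)] compactin_subset_topspace[OF assms(1)]
  unfolding metric_closedin_iff_sequentially_closed
  by (metis image_subset_iff seq_limitin_iff subsetD)

lemma Metric_space_d_pair: "Metric_space (M \<times> M) (d_pair d)"
proof
  fix x y z :: "'a \<times> 'a"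
  show "0 \<le> d_pair d x y" "d_pair d x y = d_pair d y x"
    by (auto simp: d_pair_def commute le_max_iff_disj split: prod.splits)
  assume "x \<in> M \<times> M" "y \<in> M \<times> M"
  then show "d_pair d x y = 0 \<longleftrightarrow> x = y"
    by (auto simp: d_pair_def max_def split: prod.splits) (metis nonneg antisym zero)+
next
  fix x y z :: "'a \<times> 'a"
  assume *: "x \<in> M \<times> M" "y \<in> M \<times> M" "z \<in> M \<times> M"
  have "d (fst x) (fst z) \<le> d (fst x) (fst y) + d (fst y) (fst z)"
    "d (snd x) (snd z) \<le> d (snd x) (snd y) + d (snd y) (snd z)"
    using * by (auto intro: triangle)
  then show "d_pair d x z \<le> d_pair d x y + d_pair d y z"
    by (auto simp: d_pair_def split: prod.splits)
qed

lemma mtopology_d_pair: "Metric_space.mtopology (M \<times> M) (d_pair d) = prod_topology mtopology mtopology"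
proof -
  interpret P: Metric_space12 M d M d ..
  have "Metric_space.mtopology (M \<times> M) (d_pair d) = P.Prod_metric.mtopology"
  proof (rule mtopology_eqI[OF Metric_space_d_pair P.prod_metric])
    fix x :: "'a \<times> 'a" and e :: real assume "e > 0"
    have "prod_dist d d x y \<le> d_pair d x y + d_pair d x y" for y
    proof -
      have "prod_dist d d x y \<le> d (fst x) (fst y) + d (snd x) (snd y)"
        using sqrt_sum_squares_le_sum[of "d (fst x) (fst y)" "d (snd x) (snd y)"]
        by (auto simp: prod_dist_def split: prod.splits)
      also have "\<dots> \<le> d_pair d x y + d_pair d x y"
        by (intro add_mono) (auto simp: d_pair_def split: prod.splits)
      finally show ?thesis .
    qed
    then show "\<exists>\<delta>>0. \<forall>y\<in>M \<times> M. d_pair d x y < \<delta> \<longrightarrow> prod_dist d d x y < e"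
      using \<open>e > 0\<close> by (intro exI[of _ "e / 2"]) (auto, smt (verit) field_sum_of_halves)
    have "d_pair d x y \<le> prod_dist d d x y" for y
      by (auto simp: prod_dist_def d_pair_def intro: real_sqrt_sum_squares_ge1 real_sqrt_sum_squares_ge2 split: prod.splits)
    then show "\<exists>\<delta>>0. \<forall>y\<in>M \<times> M. prod_dist d d x y < \<delta> \<longrightarrow> d_pair d x y < e"
      using \<open>e > 0\<close> by (intro exI[of _ "e"]) (auto, smt (verit))
  qed
  then show ?thesis
    using P.mtopology_prod_metric by simp
qed

lemma d_pair_tendsto_iff:
  "null (\<lambda>n. d_pair d (\<sigma> n, \<tau> n) (x, y)) \<longleftrightarrow> null (\<lambda>n. d (\<sigma> n) x) \<and> null (\<lambda>n. d (\<tau> n) y)"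
proof
  assume L: "null (\<lambda>n. d_pair d (\<sigma> n, \<tau> n) (x, y))"
  show "null (\<lambda>n. d (\<sigma> n) x) \<and> null (\<lambda>n. d (\<tau> n) y)"
    by (intro conjI; rule Lim_null_comparison[OF _ L]) (auto simp: d_pair_def)
next
  assume "null (\<lambda>n. d (\<sigma> n) x) \<and> null (\<lambda>n. d (\<tau> n) y)"
  then show "null (\<lambda>n. d_pair d (\<sigma> n, \<tau> n) (x, y))"
    using tendsto_max[of "\<lambda>n. d (\<sigma> n) x" 0 sequentially "\<lambda>n. d (\<tau> n) y" 0] by (simp add: d_pair_def)
qed

end

lemma metric_generates_tendsto_iff:
  assumes "metric_generates M d T" "metric_generates M d' T" "\<And>n. \<sigma> n \<in> M" "l \<in> M"
  shows "null (\<lambda>n. d (\<sigma> n) l) \<longleftrightarrow> null (\<lambda>n. d' (\<sigma> n) l)"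
  using assms unfolding metric_generates_def by (metis Metric_space.seq_limitin_iff)

section \<open>The Hausdorff metric\<close>

text \<open>Stated pointwise and with \<open>\<le>\<close>, so that neither attained infima nor
  compactness enters. For nonempty compact sets it is implied by Hausdorff distance less than
  \<open>r\<close> and implies Hausdorff distance at most \<open>r\<close>.\<close>

definition hclose :: "('a \<Rightarrow> 'b \<Rightarrow> real) \<Rightarrow> real \<Rightarrow> 'a set \<Rightarrow> 'b set \<Rightarrow> bool" where
  "hclose d r A B \<longleftrightarrow> (\<forall>a\<in>A. \<exists>b\<in>B. d a b \<le> r) \<and> (\<forall>b\<in>B. \<exists>a\<in>A. d a b \<le> r)"

context Metric_space begin

lemma hausdorff_dist_le:
  assumes AB: "A \<in> nonempty_compacts mtopology" "B \<in> nonempty_compacts mtopology" and "hclose d r A B"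
  shows "hausdorff_dist mtopology d A B \<le> r"
proof -
  have "A \<noteq> {}" "B \<noteq> {}"
    using AB by (auto simp: nonempty_compacts_def)
  moreover have "bdd_below (d a ` B)" "bdd_below ((\<lambda>a. d a b) ` A)" for a b
    by (rule bdd_belowI[of _ 0]; auto)+
  ultimately have "(SUP a\<in>A. INF b\<in>B. d a b) \<le> r" "(SUP b\<in>B. INF a\<in>A. d a b) \<le> r"
    using assms(3) by (auto simp: hclose_def intro!: cSUP_least) (meson cINF_lower2)+
  then show ?thesis
    using AB by (simp add: hausdorff_dist_def)
qed

lemma hausdorff_dist_less:
  assumes AB: "A \<in> nonempty_compacts mtopology" "B \<in> nonempty_compacts mtopology"
    and less: "hausdorff_dist mtopology d A B < r"
  shows "hclose d r A B"
proof -
  have ne: "A \<noteq> {}" "B \<noteq> {}"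
    using AB by (auto simp: nonempty_compacts_def)
  then obtain a0 b0 where 0: "a0 \<in> A" "b0 \<in> B"
    by blast
  obtain c where c: "\<And>a b. a \<in> A \<Longrightarrow> b \<in> B \<Longrightarrow> d a b \<le> c"
    using compact_dist_bounded[of A B] AB unfolding nonempty_compacts_def by blast
  have bel: "bdd_below (d a ` B)" "bdd_below ((\<lambda>a. d a b) ` A)" for a b
    by (rule bdd_belowI[of _ 0]; auto)+
  have "bdd_above ((\<lambda>a. INF b\<in>B. d a b) ` A)"
    using c 0 bel by (intro bdd_aboveI[of _ c]) (auto intro: cINF_lower2)
  moreover have "bdd_above ((\<lambda>b. INF a\<in>A. d a b) ` B)"
    using c 0 bel by (intro bdd_aboveI[of _ c]) (auto intro: cINF_lower2)
  moreover have "(SUP a\<in>A. INF b\<in>B. d a b) < r" "(SUP b\<in>B. INF a\<in>A. d a b) < r"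
    using AB less by (simp_all add: hausdorff_dist_def)
  ultimately have "(INF b\<in>B. d a b) < r" if "a \<in> A" for a
    using that by (meson cSUP_upper le_less_trans)
  moreover have "(INF a\<in>A. d a b) < r" if "b \<in> B" for b
    using that \<open>bdd_above ((\<lambda>b. INF a\<in>A. d a b) ` B)\<close> \<open>(SUP b\<in>B. INF a\<in>A. d a b) < r\<close>
    by (meson cSUP_upper le_less_trans)
  ultimately show ?thesis
    using ne bel by (auto simp: hclose_def cINF_less_iff) (metis less_imp_le)+
qed

lemma hclose_sym: "hclose d r A B \<Longrightarrow> hclose d r B A"
  unfolding hclose_def by (metis commute)

lemma hclose_refl: "A \<subseteq> M \<Longrightarrow> hclose d 0 A A"
  unfolding hclose_def by (metis mdist_zero order.refl subsetD)

lemma hclose_trans: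
  assumes "hclose d r A B" "hclose d s B C" "A \<subseteq> M" "B \<subseteq> M" "C \<subseteq> M"
  shows "hclose d (r + s) A C"
proof -
  have "\<exists>c\<in>C. d a c \<le> r + s" if a: "a \<in> A" for a
  proof -
    obtain b where b: "b \<in> B" "d a b \<le> r"
      using assms(1) a by (auto simp: hclose_def)
    obtain c where c: "c \<in> C" "d b c \<le> s"
      using assms(2) b by (auto simp: hclose_def)
    have "d a c \<le> d a b + d b c"
      using a b c assms by (meson subsetD triangle)
    then show ?thesis using b c by (meson add_mono order_trans)
  qed
  moreover have "\<exists>a\<in>A. d a c \<le> r + s" if c: "c \<in> C" for c
  proof -
    obtain b where b: "b \<in> B" "d b c \<le> s"
      using assms(2) c by (auto simp: hclose_def)
    obtain a where a: "a \<in> A" "d a b \<le> r"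
      using assms(1) b by (auto simp: hclose_def)
    have "d a c \<le> d a b + d b c"
      using a b c assms by (meson subsetD triangle)
    then show ?thesis using a b by (meson add_mono order_trans)
  qed
  ultimately show ?thesis
    by (auto simp: hclose_def)
qed

lemma hclose_nonneg: "hclose d r A B \<Longrightarrow> A \<noteq> {} \<Longrightarrow> 0 \<le> r"
  unfolding hclose_def by (meson all_not_in_conv nonneg order_trans)

lemma hclose_limit_subset:
  assumes "\<And>r. r > 0 \<Longrightarrow> hclose d r A B" "A \<subseteq> M" "compactin mtopology B"
  shows "A \<subseteq> B"
proof
  fix a assume a: "a \<in> A"
  have "\<exists>b. b \<in> B \<and> d b a \<le> 1 / real (Suc n)" for n
    using assms(1)[of "1 / real (Suc n)"] a by (simp add: hclose_def) (metis commute)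
  then obtain b where b: "\<And>n. b n \<in> B" "\<And>n. d (b n) a \<le> 1 / real (Suc n)"
    by metis
  have "null (\<lambda>n. d (b n) a)"
    by (rule Lim_null_comparison[OF _ lim_1_over_Suc]) (use b(2) in simp)
  then show "a \<in> B"
    by (rule compact_seq_closed[of B b, OF assms(3) b(1) subsetD[OF assms(2) a]])
qed

lemma hclose_limit_eq:
  assumes "\<And>r. r > 0 \<Longrightarrow> hclose d r A B" "compactin mtopology A" "compactin mtopology B"
  shows "A = B"
proof
  show "A \<subseteq> B"
    by (rule hclose_limit_subset[OF assms(1) compact_subset[OF assms(2)] assms(3)])
  show "B \<subseteq> A"
    by (rule hclose_limit_subset[OF hclose_sym[OF assms(1)] compact_subset[OF assms(3)] assms(2)])
qed

lemma Metric_space_hausdorff_dist: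
  "Metric_space (nonempty_compacts mtopology) (hausdorff_dist mtopology d)"
proof (rule metric_from_closeness[where R = "hclose d" and P = "nonempty_compacts mtopology"])
  have sub: "A \<subseteq> M" if "A \<in> nonempty_compacts mtopology" for A
    using that compact_subset by (simp add: nonempty_compacts_def)
  show "hclose d 0 p p" if "p \<in> nonempty_compacts mtopology" for p
    using that sub hclose_refl by blast
  show "hclose d (r + s) p u" if "p \<in> nonempty_compacts mtopology" "q \<in> nonempty_compacts mtopology"
    "u \<in> nonempty_compacts mtopology" "hclose d r p q" "hclose d s q u" for r s p q u
    using that sub hclose_trans by blast
  show "p = q" if "p \<in> nonempty_compacts mtopology" "q \<in> nonempty_compacts mtopology"
    "\<And>r. r > 0 \<Longrightarrow> hclose d r p q" for p q
    using that by (intro hclose_limit_eq) (auto simp: nonempty_compacts_def)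
qed (use hausdorff_dist_le hausdorff_dist_less hclose_sym hclose_nonneg in
    \<open>auto simp: hausdorff_dist_def nonempty_compacts_def\<close>)

end

section \<open>Monotone correspondences between compact ordered sets\<close>

lemma Corr_sym: "C \<in> Corr A A' \<Longrightarrow> C\<inverse> \<in> Corr A' A"
  by (auto simp: Corr_def)

lemma Cor_plus_sym: "C \<in> Cor_plus A le A' le' \<Longrightarrow> C\<inverse> \<in> Cor_plus A' le' A le"
  unfolding Cor_plus_def mem_Collect_eq converse_iff using Corr_sym by metis

lemma frequently_subseq:
  assumes "\<not> (\<forall>\<^sub>F n in sequentially. \<not> P n)"
  shows "\<exists>r. subseq r \<and> (\<forall>n. P (r n))"
proof -
  have "infinite {n. P n}"
    using assms unfolding eventually_sequentially infinite_nat_iff_unbounded_le by auto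
  then show ?thesis
    using infinite_enumerate[of "{n. P n}"] by blast
qed

context Metric_space begin

text \<open>A nonempty compact chain whose order is closed in the square of \<open>A\<close>.
  Closedness is phrased by sequences with limits in \<open>A\<close>, the form in which limits of
  ordered pairs occur below.\<close>

definition corder :: "'a set \<Rightarrow> 'a rel \<Rightarrow> bool" where
  "corder A le \<longleftrightarrow> A \<noteq> {} \<and> compactin mtopology A \<and> linear_order_on A le \<and>
     (\<forall>\<sigma> \<tau> x y. (\<forall>n::nat. (\<sigma> n, \<tau> n) \<in> le) \<longrightarrow> x \<in> A \<longrightarrow> y \<in> A \<longrightarrow>
        null (\<lambda>n. d (\<sigma> n) x) \<longrightarrow> null (\<lambda>n. d (\<tau> n) y) \<longrightarrow> (x, y) \<in> le)"

lemma corderD: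
  assumes "corder A le"
  shows corder_nonempty: "A \<noteq> {}"
    and corder_compact: "compactin mtopology A"
    and corder_subset: "A \<subseteq> M"
    and corder_linear: "linear_order_on A le"
    and corder_dom: "(x, y) \<in> le \<Longrightarrow> x \<in> A" "(x, y) \<in> le \<Longrightarrow> y \<in> A"
    and corder_refl: "x \<in> A \<Longrightarrow> (x, x) \<in> le"
    and corder_antisym: "(x, y) \<in> le \<Longrightarrow> (y, x) \<in> le \<Longrightarrow> x = y"
    and corder_trans: "(x, y) \<in> le \<Longrightarrow> (y, z) \<in> le \<Longrightarrow> (x, z) \<in> le"
    and corder_total: "x \<in> A \<Longrightarrow> y \<in> A \<Longrightarrow> (x, y) \<in> le \<or> (y, x) \<in> le"
proof -
  show 1: "A \<noteq> {}" "compactin mtopology A" and lin: "linear_order_on A le"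
    using assms unfolding corder_def by blast+
  show "A \<subseteq> M"
    using 1 compact_subset by blast
  have "le \<subseteq> A \<times> A" and r: "refl_on A le" and "trans le" "antisym le" "total_on A le"
    using lin unfolding linear_order_on_def partial_order_on_def preorder_on_def by blast+
  then show "(x, y) \<in> le \<Longrightarrow> x \<in> A" "(x, y) \<in> le \<Longrightarrow> y \<in> A"
    "(x, y) \<in> le \<Longrightarrow> (y, x) \<in> le \<Longrightarrow> x = y"
    "(x, y) \<in> le \<Longrightarrow> (y, z) \<in> le \<Longrightarrow> (x, z) \<in> le"
    by (auto dest: antisymD transD)
  show "x \<in> A \<Longrightarrow> (x, x) \<in> le"
    using r by (simp add: refl_on_def)
  then show "x \<in> A \<Longrightarrow> y \<in> A \<Longrightarrow> (x, y) \<in> le \<or> (y, x) \<in> le"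
    using \<open>total_on A le\<close> unfolding total_on_def by metis
qed

lemma corder_closed:
  fixes \<sigma> \<tau> :: "nat \<Rightarrow> 'a"
  assumes "corder A le" "\<And>n. (\<sigma> n, \<tau> n) \<in> le" "x \<in> A" "y \<in> A"
    "null (\<lambda>n. d (\<sigma> n) x)" "null (\<lambda>n. d (\<tau> n) y)"
  shows "(x, y) \<in> le"
  using assms unfolding corder_def by metis

lemma corder_converse:
  assumes "corder A le"
  shows "corder A (le\<inverse>)"
  using assms unfolding corder_def linear_order_on_converse converse_iff by metis

text \<open>The order is closed, so its complement is open; as the order is total, this says that
  strict inequalities between limits hold between the late terms.\<close>

lemma corder_eventually_not:
  fixes \<sigma> \<tau> :: "nat \<Rightarrow> 'a"
  assumes A: "corder A le" and xy: "x \<in> A" "y \<in> A" "(x, y) \<notin> le"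
    and "null (\<lambda>n. d (\<sigma> n) x)" "null (\<lambda>n. d (\<tau> n) y)"
  shows "\<forall>\<^sub>F n in sequentially. (\<sigma> n, \<tau> n) \<notin> le"
proof (rule ccontr)
  assume "\<not> ?thesis"
  then obtain r :: "nat \<Rightarrow> nat" where r: "strict_mono r" "\<And>n. (\<sigma> (r n), \<tau> (r n)) \<in> le"
    using frequently_subseq[of "\<lambda>n. (\<sigma> n, \<tau> n) \<in> le"] by blast
  have "(x, y) \<in> le"
    by (rule corder_closed[of A le "\<lambda>n. \<sigma> (r n)" "\<lambda>n. \<tau> (r n)", OF A r(2) xy(1,2)])
      (rule strict_mono_subseq_tendsto[OF r(1)], fact)+
  then show False
    using xy(3) by blast
qed

text \<open>The sets \<open>F m\<close> of elements of \<open>S\<close> above a given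
  \<open>m\<close> are closed, and any finitely many of them meet, in the largest of the chosen
  elements. By compactness they all have a common point, which is the maximum.\<close>

lemma corder_max:
  assumes A: "corder A le" and S: "S \<subseteq> A" "S \<noteq> {}"
    and cl: "\<And>(\<sigma>::nat \<Rightarrow> 'a) x. (\<And>n. \<sigma> n \<in> S) \<Longrightarrow> x \<in> A \<Longrightarrow> null (\<lambda>n. d (\<sigma> n) x) \<Longrightarrow> x \<in> S"
  shows "\<exists>m\<in>S. \<forall>x\<in>S. (x, m) \<in> le"
proof -
  define F where "F m = {x \<in> S. (m, x) \<in> le}" for m
  have AM: "A \<subseteq> M"
    by (rule corder_subset[OF A])
  have "closedin mtopology (F m)" if "m \<in> S" for m
    unfolding metric_closedin_iff_sequentially_closed
  proof (intro conjI allI impI)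
    show "F m \<subseteq> M"
      using S AM by (auto simp: F_def)
    fix \<sigma> :: "nat \<Rightarrow> 'a" and l assume *: "range \<sigma> \<subseteq> F m \<and> limitin mtopology \<sigma> l sequentially"
    then have \<sigma>: "\<And>n. \<sigma> n \<in> S" "\<And>n. (m, \<sigma> n) \<in> le" and l: "l \<in> M"
      using limitin_mspace by (auto simp: F_def image_subset_iff)
    have conv: "null (\<lambda>n. d (\<sigma> n) l)"
      using * by (simp add: limitin_metric_dist_null)
    have lA: "l \<in> A"
      by (rule compact_seq_closed[of A \<sigma>, OF corder_compact[OF A] _ l conv]) (use \<sigma> S in auto)
    have "l \<in> S"
      by (rule cl[OF \<sigma>(1) lA conv])
    moreover have "(m, l) \<in> le"
      by (rule corder_closed[of A le "\<lambda>n. m" \<sigma>, OF A \<sigma>(2)]) (use that S AM lA conv in auto)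
    ultimately show "l \<in> F m"
      by (simp add: F_def)
  qed
  moreover have fin: "\<exists>x\<in>S. \<forall>m\<in>T. (m, x) \<in> le" if "finite T" "T \<subseteq> S" for T
    using that
  proof (induction T)
    case empty
    then show ?case using S by blast
  next
    case (insert m T)
    then obtain x where x: "x \<in> S" "\<forall>m\<in>T. (m, x) \<in> le"
      by auto
    show ?case
    proof (cases "(m, x) \<in> le")
      case True
      then show ?thesis using x by blast
    next
      case False
      then have "(x, m) \<in> le" "(m, m) \<in> le"
        using corder_total[OF A] corder_refl[OF A] insert.prems x S by blast+
      then show ?thesis
        using x corder_trans[OF A] insert.prems by blast
    qed
  qed
  have "A \<inter> \<Inter>\<F> \<noteq> {}" if \<F>: "finite \<F>" "\<F> \<subseteq> F ` S" for \<F>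
  proof -
    obtain T where T: "T \<subseteq> S" "finite T" "\<F> = F ` T"
      using \<F> by (meson finite_subset_image)
    then obtain x where "x \<in> S" "\<forall>m\<in>T. (m, x) \<in> le"
      using fin by blast
    then have "x \<in> A \<inter> \<Inter>\<F>"
      using T S by (auto simp: F_def)
    then show ?thesis by blast
  qed
  ultimately have "A \<inter> \<Inter>(F ` S) \<noteq> {}"
    using corder_compact[OF A] unfolding compactin_fip by (metis (no_types, lifting) imageE)
  then obtain m where m: "m \<in> A" "\<And>x. x \<in> S \<Longrightarrow> m \<in> F x"
    by blast
  then have "m \<in> S"
    using S by (auto simp: F_def)
  then show ?thesis
    using m by (auto simp: F_def)
qed

lemma corder_min:
  assumes A: "corder A le" and S: "S \<subseteq> A" "S \<noteq> {}"
    and cl: "\<And>(\<sigma>::nat \<Rightarrow> 'a) x. (\<And>n. \<sigma> n \<in> S) \<Longrightarrow> x \<in> A \<Longrightarrow> null (\<lambda>n. d (\<sigma> n) x) \<Longrightarrow> x \<in> S"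
  shows "\<exists>m\<in>S. \<forall>x\<in>S. (m, x) \<in> le"
proof -
  have "\<exists>m\<in>S. \<forall>x\<in>S. (x, m) \<in> le\<inverse>"
  proof (rule corder_max[OF corder_converse[OF A] S])
    fix \<sigma> :: "nat \<Rightarrow> 'a" and x
    assume *: "\<And>n. \<sigma> n \<in> S" "x \<in> A" "null (\<lambda>n. d (\<sigma> n) x)"
    show "x \<in> S"
      by (rule cl[of \<sigma>, OF *])
  qed
  then show ?thesis
    by simp
qed

definition cclosed :: "'a set \<Rightarrow> 'a set \<Rightarrow> 'a rel \<Rightarrow> bool" where
  "cclosed A A' C \<longleftrightarrow> (\<forall>\<sigma> \<tau> x y. (\<forall>n::nat. (\<sigma> n, \<tau> n) \<in> C) \<longrightarrow> x \<in> A \<longrightarrow> y \<in> A' \<longrightarrow>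
        null (\<lambda>n. d (\<sigma> n) x) \<longrightarrow> null (\<lambda>n. d (\<tau> n) y) \<longrightarrow> (x, y) \<in> C)"

lemma cclosedD:
  fixes \<sigma> \<tau> :: "nat \<Rightarrow> 'a"
  assumes "cclosed A A' C" "\<And>n. (\<sigma> n, \<tau> n) \<in> C" "x \<in> A" "y \<in> A'"
    "null (\<lambda>n. d (\<sigma> n) x)" "null (\<lambda>n. d (\<tau> n) y)"
  shows "(x, y) \<in> C"
  using assms unfolding cclosed_def by metis

text \<open>For \<open>d_tot\<close> this is what \<open>hclose\<close> is for the Hausdorff
  distance: closeness within \<open>r\<close> witnessed by an actual correspondence, without
  reference to the infimum.\<close>

definition tclose :: "real \<Rightarrow> 'a set \<Rightarrow> 'a rel \<Rightarrow> 'a set \<Rightarrow> 'a rel \<Rightarrow> bool" where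
  "tclose r A le A' le' \<longleftrightarrow> (\<exists>C\<in>Cor_plus A le A' le'. \<forall>(z, w)\<in>C. d z w \<le> r)"

text \<open>\<open>\<phi> z\<close> is the largest partner of any point up to \<open>z\<close>; it
  exists because the set of these partners is closed, by compactness of \<open>A\<close>. Let
  \<open>u\<close> be a point up to \<open>z\<close> with partner \<open>\<phi> z\<close>, and
  \<open>w\<close> a partner of \<open>z\<close>. If \<open>u = z\<close> or
  \<open>w = \<phi> z\<close>, then \<open>near\<close> bounds the distance of \<open>z\<close> and
  \<open>\<phi> z\<close>; otherwise the two pairs cross, and \<open>cross\<close> bounds
  it.\<close>

lemma running_max:
  assumes A: "corder A le" and A': "corder A' le'" and C: "C \<in> Corr A A'" and cl: "cclosed A A' C"
    and near: "\<And>z w. (z, w) \<in> C \<Longrightarrow> d z w \<le> R"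
    and cross: "\<And>z w z' w'. (z, w) \<in> C \<Longrightarrow> (z', w') \<in> C \<Longrightarrow> (z, z') \<in> le \<Longrightarrow> z \<noteq> z' \<Longrightarrow>
      (w', w) \<in> le' \<Longrightarrow> w' \<noteq> w \<Longrightarrow> d z' w \<le> R"
  shows "\<exists>\<phi>. (\<forall>z\<in>A. \<phi> z \<in> A' \<and> d z (\<phi> z) \<le> R \<and> (\<exists>u. (u, z) \<in> le \<and> (u, \<phi> z) \<in> C)) \<and>
    (\<forall>z u w. (u, z) \<in> le \<longrightarrow> (u, w) \<in> C \<longrightarrow> (w, \<phi> z) \<in> le')"
proof -
  have CA: "z \<in> A" "w \<in> A'" if "(z, w) \<in> C" for z w
    using that C by (auto simp: Corr_def)
  have ex: "\<exists>w. (z, w) \<in> C" if "z \<in> A" for z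
    using that C by (auto simp: Corr_def)
  define S where "S z = {w. \<exists>u. (u, z) \<in> le \<and> (u, w) \<in> C}" for z
  have "\<exists>m\<in>S z. \<forall>w\<in>S z. (w, m) \<in> le'" if z: "z \<in> A" for z
  proof (rule corder_max[OF A'])
    show "S z \<subseteq> A'" "S z \<noteq> {}"
      using CA ex[OF z] corder_refl[OF A z] by (auto simp: S_def)
    fix \<sigma> :: "nat \<Rightarrow> 'a" and w
    assume \<sigma>: "\<And>n. \<sigma> n \<in> S z" and w: "w \<in> A'" and lim: "null (\<lambda>n. d (\<sigma> n) w)"
    obtain u where u: "\<And>n. (u n, z) \<in> le" "\<And>n. (u n, \<sigma> n) \<in> C"
      using \<sigma> unfolding S_def by simp metis
    obtain l r where lr: "l \<in> A" "strict_mono r" "null (\<lambda>n. d (u (r n)) l)"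
      by (rule compact_seq[OF corder_compact[OF A], of u]) (use CA u in blast)
    have "(l, z) \<in> le"
      by (rule corder_closed[of A le "\<lambda>n. u (r n)" "\<lambda>n. z", OF A u(1) lr(1) z lr(3)])
        (use z corder_subset[OF A] in auto)
    moreover have "(l, w) \<in> C"
      by (rule cclosedD[of A A' C "\<lambda>n. u (r n)" "\<lambda>n. \<sigma> (r n)", OF cl u(2) lr(1) w lr(3)])
        (rule strict_mono_subseq_tendsto[OF lr(2) lim])
    ultimately show "w \<in> S z"
      by (auto simp: S_def)
  qed
  then obtain \<phi> where \<phi>S: "\<And>z. z \<in> A \<Longrightarrow> \<phi> z \<in> S z"
    and \<phi>max: "\<And>z w. z \<in> A \<Longrightarrow> w \<in> S z \<Longrightarrow> (w, \<phi> z) \<in> le'"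
    by metis
  have d\<phi>: "d z (\<phi> z) \<le> R" if z: "z \<in> A" for z
  proof -
    obtain u where u: "(u, z) \<in> le" "(u, \<phi> z) \<in> C"
      using \<phi>S[OF z] by (auto simp: S_def)
    obtain w where w: "(z, w) \<in> C"
      using ex[OF z] by blast
    have "w \<in> S z"
      using w corder_refl[OF A z] by (auto simp: S_def)
    then have "(w, \<phi> z) \<in> le'"
      using \<phi>max z by blast
    then show ?thesis
      using near cross[OF u(2) w u(1)] u w by metis
  qed
  show ?thesis
  proof (intro exI[of _ \<phi>] conjI ballI allI impI)
    show "\<phi> z \<in> A'" "\<exists>u. (u, z) \<in> le \<and> (u, \<phi> z) \<in> C" if "z \<in> A" for z
      using \<phi>S[OF that] CA unfolding S_def by blast+
    show "(w, \<phi> z) \<in> le'" if "(u, z) \<in> le" "(u, w) \<in> C" for z u w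
      using \<phi>max[of z w] corder_dom(2)[OF A that(1)] that unfolding S_def by blast
  qed (rule d\<phi>)
qed

text \<open>The correspondence consists of the graphs of two monotone maps \<open>\<phi> : A \<rightarrow> A'\<close> and
  \<open>\<psi> : A' \<rightarrow> A\<close> forming a Galois connection, namely the running maximum of \<open>C\<close> seen from \<open>A\<close> and its
  running minimum seen from \<open>A'\<close>.\<close>

lemma monotonise:
  assumes A: "corder A le" and A': "corder A' le'" and C: "C \<in> Corr A A'" and cl: "cclosed A A' C"
    and near: "\<And>z w. (z, w) \<in> C \<Longrightarrow> d z w \<le> R"
    and cross: "\<And>z w z' w'. (z, w) \<in> C \<Longrightarrow> (z', w') \<in> C \<Longrightarrow> (z, z') \<in> le \<Longrightarrow> z \<noteq> z' \<Longrightarrow>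
      (w', w) \<in> le' \<Longrightarrow> w' \<noteq> w \<Longrightarrow> d z w' \<le> R \<and> d z' w \<le> R"
  shows "tclose R A le A' le'"
proof -
  have "\<exists>\<phi>. (\<forall>z\<in>A. \<phi> z \<in> A' \<and> d z (\<phi> z) \<le> R \<and> (\<exists>u. (u, z) \<in> le \<and> (u, \<phi> z) \<in> C)) \<and>
      (\<forall>z u w. (u, z) \<in> le \<longrightarrow> (u, w) \<in> C \<longrightarrow> (w, \<phi> z) \<in> le')"
    by (rule running_max[OF A A' C cl near cross[THEN conjunct2]])
  then obtain \<phi> where \<Phi>: "(\<forall>z\<in>A. \<phi> z \<in> A' \<and> d z (\<phi> z) \<le> R \<and> (\<exists>u. (u, z) \<in> le \<and> (u, \<phi> z) \<in> C)) \<and>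
      (\<forall>z u w. (u, z) \<in> le \<longrightarrow> (u, w) \<in> C \<longrightarrow> (w, \<phi> z) \<in> le')" ..
  then have \<phi>: "\<phi> z \<in> A'" "d z (\<phi> z) \<le> R" "\<exists>u. (u, z) \<in> le \<and> (u, \<phi> z) \<in> C" if "z \<in> A" for z
    using that by simp_all
  have \<phi>max: "(w, \<phi> z) \<in> le'" if "(u, z) \<in> le" "(u, w) \<in> C" for z u w
    using \<Phi> that by simp
  have cl': "cclosed A' A (C\<inverse>)"
    using cl unfolding cclosed_def by simp
  \<comment> \<open>The running minimum seen from \<open>A'\<close> is the running maximum for the
    converse orders and the converse correspondence. Here the other half of \<open>cross\<close> is
    used.\<close>
  have "\<exists>\<psi>. (\<forall>w\<in>A'. \<psi> w \<in> A \<and> d w (\<psi> w) \<le> R \<and> (\<exists>u. (u, w) \<in> le'\<inverse> \<and> (u, \<psi> w) \<in> C\<inverse>)) \<and>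
      (\<forall>w u z. (u, w) \<in> le'\<inverse> \<longrightarrow> (u, z) \<in> C\<inverse> \<longrightarrow> (z, \<psi> w) \<in> le\<inverse>)"
  proof (rule running_max[OF corder_converse[OF A'] corder_converse[OF A] Corr_sym[OF C] cl'])
    show "d w z \<le> R" if "(w, z) \<in> C\<inverse>" for w z
      using near[of z w] that commute by simp
    show "d w' z \<le> R" if "(w, z) \<in> C\<inverse>" "(w', z') \<in> C\<inverse>" "(w, w') \<in> le'\<inverse>" "w \<noteq> w'" "(z', z) \<in> le\<inverse>" "z' \<noteq> z"
      for w z w' z'
      using cross[of z w z' w'] that commute[of z w'] by auto
  qed
  then obtain \<psi> where \<Psi>: "(\<forall>w\<in>A'. \<psi> w \<in> A \<and> d w (\<psi> w) \<le> R \<and> (\<exists>u. (u, w) \<in> le'\<inverse> \<and> (u, \<psi> w) \<in> C\<inverse>)) \<and>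
      (\<forall>w u z. (u, w) \<in> le'\<inverse> \<longrightarrow> (u, z) \<in> C\<inverse> \<longrightarrow> (z, \<psi> w) \<in> le\<inverse>)" ..
  then have \<psi>: "\<psi> w \<in> A" "d (\<psi> w) w \<le> R" "\<exists>u. (w, u) \<in> le' \<and> (\<psi> w, u) \<in> C" if "w \<in> A'" for w
    using that commute[of "\<psi> w" w] by simp_all
  have \<psi>min: "(\<psi> w, z) \<in> le" if "(w, u) \<in> le'" "(z, u) \<in> C" for w u z
    using \<Psi> that by simp
  have m\<phi>: "(\<phi> z, \<phi> z') \<in> le'" if "(z, z') \<in> le" for z z'
    using \<phi>(3)[of z] \<phi>max[of _ z'] corder_dom[OF A that] corder_trans[OF A _ that] by blast
  have m\<psi>: "(\<psi> w, \<psi> w') \<in> le" if "(w, w') \<in> le'" for w w'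
    using \<psi>(3)[of w'] \<psi>min[of w] corder_dom[OF A' that] corder_trans[OF A' that] by blast
  have g1: "(w, \<phi> z) \<in> le'" if "(\<psi> w, z) \<in> le" "w \<in> A'" for z w
    using \<psi>(3)[OF that(2)] \<phi>max[OF that(1)] corder_trans[OF A'] by blast
  have g2: "(\<psi> w, z) \<in> le" if "(w, \<phi> z) \<in> le'" "z \<in> A" for z w
    using \<phi>(3)[OF that(2)] \<psi>min[OF that(1)] corder_trans[OF A] by blast
  define D where "D = {(z, \<phi> z) | z. z \<in> A} \<union> {(\<psi> w, w) | w. w \<in> A'}"
  have "D \<in> Corr A A'"
    using \<phi>(1) \<psi>(1) by (auto simp: D_def Corr_def)
  moreover have False if D: "(z, w) \<in> D" "(z', w') \<in> D"
    and less: "(z, z') \<in> le" "z \<noteq> z'" "(w', w) \<in> le'" "w' \<noteq> w" for z w z' w'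
  proof -
    note dom = corder_dom[OF A less(1)] corder_dom[OF A' less(3)]
    \<comment> \<open>Either both pairs lie on the same graph, where monotonicity of
      \<open>\<phi>\<close> or \<open>\<psi>\<close> applies, or they lie on different graphs, where
      \<open>g1\<close> and \<open>g2\<close> turn an inequality on one side into one on the
      other.\<close>
    have "w = \<phi> z \<and> w' = \<phi> z' \<or> z = \<psi> w \<and> z' = \<psi> w' \<or> w = \<phi> z \<and> z' = \<psi> w' \<or> z = \<psi> w \<and> w' = \<phi> z'"
      using D by (auto simp: D_def)
    then have "(w, w') \<in> le' \<or> (z', z) \<in> le"
      using m\<phi>[OF less(1)] m\<psi>[OF less(3)] g1[of w z'] g2[of w' z] less dom by metis
    then show False
      using less corder_antisym[OF A] corder_antisym[OF A'] by blast
  qed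
  ultimately have "D \<in> Cor_plus A le A' le'"
    unfolding Cor_plus_def by blast
  moreover have "\<forall>(z, w)\<in>D. d z w \<le> R"
    using \<phi>(2) \<psi>(2) by (auto simp: D_def)
  ultimately show ?thesis
    unfolding tclose_def by blast
qed

text \<open>The closure of a monotone correspondence in \<open>A \<times> A'\<close> is taken. Two
  crossing pairs of the closure would be limits of pairs of \<open>C\<close> that eventually cross
  as well, because strict inequalities are open; and the bound \<open>r\<close> survives by
  continuity of the metric. Closedness is what later makes running maxima attained.\<close>

lemma tclose_closed:
  assumes A: "corder A le" and A': "corder A' le'" and "tclose r A le A' le'"
  obtains C where "C \<in> Cor_plus A le A' le'" "cclosed A A' C" "\<And>z w. (z, w) \<in> C \<Longrightarrow> d z w \<le> r"
proof -
  obtain C where C: "C \<in> Cor_plus A le A' le'" "\<And>z w. (z, w) \<in> C \<Longrightarrow> d z w \<le> r"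
    using assms(3) unfolding tclose_def by auto
  have AM: "A \<subseteq> M" "A' \<subseteq> M"
    using corder_subset A A' by auto
  have CA: "z \<in> A" "w \<in> A'" if "(z, w) \<in> C" for z w
    using that C by (auto simp: Cor_plus_def Corr_def)
  define D where "D = {(z, w). z \<in> A \<and> w \<in> A' \<and> (\<exists>\<sigma> \<tau>. (\<forall>n::nat. (\<sigma> n, \<tau> n) \<in> C) \<and>
        null (\<lambda>n. d (\<sigma> n) z) \<and> null (\<lambda>n. d (\<tau> n) w))}"
  have "C \<subseteq> D"
  proof clarify
    fix z w assume zw: "(z, w) \<in> C"
    then have "d z z = 0" "d w w = 0"
      using CA AM by (auto intro!: mdist_zero)
    then have "\<exists>\<sigma> \<tau>. (\<forall>n::nat. (\<sigma> n, \<tau> n) \<in> C) \<and> null (\<lambda>n. d (\<sigma> n) z) \<and> null (\<lambda>n. d (\<tau> n) w)"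
      using zw by (intro exI[of _ "\<lambda>n. z"] exI[of _ "\<lambda>n. w"]) simp
    then show "(z, w) \<in> D"
      unfolding D_def using CA[OF zw] by blast
  qed
  moreover have "D \<subseteq> A \<times> A'"
    by (auto simp: D_def)
  ultimately have "D \<in> Corr A A'"
    using C(1) unfolding Cor_plus_def Corr_def by blast
  moreover have False if D: "(z, w) \<in> D" "(z', w') \<in> D"
    and less: "(z, z') \<in> le" "z \<noteq> z'" "(w', w) \<in> le'" "w' \<noteq> w" for z w z' w'
  proof -
    obtain \<sigma> \<tau> where s: "\<And>n::nat. (\<sigma> n, \<tau> n) \<in> C" "null (\<lambda>n. d (\<sigma> n) z)" "null (\<lambda>n. d (\<tau> n) w)"
      using D(1) unfolding D_def by auto
    obtain \<sigma>' \<tau>' where s': "\<And>n::nat. (\<sigma>' n, \<tau>' n) \<in> C" "null (\<lambda>n. d (\<sigma>' n) z')" "null (\<lambda>n. d (\<tau>' n) w')"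
      using D(2) unfolding D_def by auto
    have "(z', z) \<notin> le" "(w, w') \<notin> le'"
      using less corder_antisym A A' by blast+
    then have "\<forall>\<^sub>F n in sequentially. (\<sigma>' n, \<sigma> n) \<notin> le" "\<forall>\<^sub>F n in sequentially. (\<tau> n, \<tau>' n) \<notin> le'"
      using corder_eventually_not[OF A _ _ _ s'(2) s(2)] corder_eventually_not[OF A' _ _ _ s(3) s'(3)]
        corder_dom[OF A less(1)] corder_dom[OF A' less(3)] by blast+
    then have "\<forall>\<^sub>F n in sequentially. (\<sigma>' n, \<sigma> n) \<notin> le \<and> (\<tau> n, \<tau>' n) \<notin> le'"
      by (rule eventually_conj)
    then obtain n where n: "(\<sigma>' n, \<sigma> n) \<notin> le" "(\<tau> n, \<tau>' n) \<notin> le'"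
      using eventually_sequentially by auto
    then have "(\<sigma> n, \<sigma>' n) \<in> le" "(\<tau>' n, \<tau> n) \<in> le'" "\<sigma> n \<noteq> \<sigma>' n" "\<tau>' n \<noteq> \<tau> n"
      using corder_total[OF A] corder_total[OF A'] corder_refl[OF A] corder_refl[OF A']
        CA[OF s(1)[of n]] CA[OF s'(1)[of n]] by metis+
    then show False
      using C(1) s(1)[of n] s'(1)[of n] unfolding Cor_plus_def by blast
  qed
  ultimately have "D \<in> Cor_plus A le A' le'"
    unfolding Cor_plus_def by blast
  moreover have "cclosed A A' D"
    unfolding cclosed_def
  proof (intro allI impI)
    fix \<sigma> \<tau> :: "nat \<Rightarrow> 'a" and x y
    assume D: "\<forall>n. (\<sigma> n, \<tau> n) \<in> D" and xy: "x \<in> A" "y \<in> A'"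
      and lim: "null (\<lambda>n. d (\<sigma> n) x)" "null (\<lambda>n. d (\<tau> n) y)"
    \<comment> \<open>Diagonal choice: each pair of the sequence is itself a limit of pairs of
      \<open>C\<close> and is replaced by one of them within
      \<open>1 / real (Suc n)\<close>.\<close>
    have "\<exists>u v. (u, v) \<in> C \<and> d (\<sigma> n) u \<le> 1 / real (Suc n) \<and> d (\<tau> n) v \<le> 1 / real (Suc n)" for n
    proof -
      obtain s t where st: "\<And>n::nat. (s n, t n) \<in> C" "null (\<lambda>k. d (s k) (\<sigma> n))" "null (\<lambda>k. d (t k) (\<tau> n))"
        using D[rule_format, of n] unfolding D_def by auto
      have pos: "0 < 1 / real (Suc n)"
        by simp
      have "\<forall>\<^sub>F k in sequentially. d (s k) (\<sigma> n) < 1 / real (Suc n) \<and> d (t k) (\<tau> n) < 1 / real (Suc n)"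
        using order_tendstoD(2)[OF st(2) pos] order_tendstoD(2)[OF st(3) pos] by (rule eventually_conj)
      then obtain k where "d (s k) (\<sigma> n) < 1 / real (Suc n)" "d (t k) (\<tau> n) < 1 / real (Suc n)"
        using eventually_sequentially by auto
      then show ?thesis
        using st(1)[of k] commute by (metis less_imp_le)
    qed
    then obtain u v where uv: "\<And>n. (u n, v n) \<in> C" "\<And>n. d (\<sigma> n) (u n) \<le> 1 / real (Suc n)"
      "\<And>n. d (\<tau> n) (v n) \<le> 1 / real (Suc n)"
      by metis
    have M: "\<sigma> n \<in> M" "\<tau> n \<in> M" "u n \<in> M" "v n \<in> M" "x \<in> M" "y \<in> M" for n
      using D AM CA[OF uv(1)[of n]] xy unfolding D_def by blast+
    have "null (\<lambda>n. d (\<sigma> n) (u n))"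
      by (rule Lim_null_comparison[OF _ lim_1_over_Suc]) (use uv in simp)
    then have 1: "null (\<lambda>n. d (u n) x)"
      by (rule seq_near[OF M(1,3,5) lim(1)])
    have "null (\<lambda>n. d (\<tau> n) (v n))"
      by (rule Lim_null_comparison[OF _ lim_1_over_Suc]) (use uv in simp)
    then have "null (\<lambda>n. d (v n) y)"
      by (rule seq_near[OF M(2,4,6) lim(2)])
    then show "(x, y) \<in> D"
      unfolding D_def using xy uv(1) 1 by blast
  qed
  moreover have "d z w \<le> r" if zw: "(z, w) \<in> D" for z w
  proof -
    obtain \<sigma> \<tau> where s: "\<And>n::nat. (\<sigma> n, \<tau> n) \<in> C" "null (\<lambda>n. d (\<sigma> n) z)" "null (\<lambda>n. d (\<tau> n) w)"
      and zwA: "z \<in> A" "w \<in> A'"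
      using zw unfolding D_def by auto
    have "(\<lambda>n. d (\<sigma> n) (\<tau> n)) \<longlonglongrightarrow> d z w"
      by (rule seq_dist[OF _ _ _ _ s(2,3)]) (use CA[OF s(1)] AM zwA in blast)+
    then show ?thesis
      by (rule LIMSEQ_le_const2) (use C(2)[OF s(1)] in blast)
  qed
  ultimately show thesis
    using that by blast
qed

lemma tclose_refl:
  assumes "corder A le"
  shows "tclose 0 A le A le"
proof -
  have "Id_on A \<in> Cor_plus A le A le"
    using corder_antisym[OF assms] by (auto simp: Cor_plus_def Corr_def)
  moreover have "\<forall>(z, w)\<in>Id_on A. d z w \<le> 0"
    using corder_subset[OF assms] by (auto simp: subset_iff)
  ultimately show ?thesis
    unfolding tclose_def by blast
qed

lemma tclose_sym: "tclose r A le A' le' \<Longrightarrow> tclose r A' le' A le"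
  unfolding tclose_def using Cor_plus_sym commute by (metis (no_types, lifting) case_prodI2 case_prod_conv converse_iff)

text \<open>A composition of monotone correspondences can fail to be monotone, but crossing pairs of
  it must pass through the same middle point. Exchanging their ends then gives pairs of the
  composition again, which are within \<open>r + s\<close>. So \<open>monotonise\<close> applies
  with no loss in the radius.\<close>

lemma tclose_trans:
  assumes A: "corder A le" and A': "corder A' le'" and A'': "corder A'' le''"
    and "tclose r A le A' le'" "tclose s A' le' A'' le''"
  shows "tclose (r + s) A le A'' le''"
proof -
  obtain C where C: "C \<in> Cor_plus A le A' le'" "cclosed A A' C" "\<And>z w. (z, w) \<in> C \<Longrightarrow> d z w \<le> r"
    using tclose_closed[OF A A' assms(4)] by blast
  obtain C' where C': "C' \<in> Cor_plus A' le' A'' le''" "cclosed A' A'' C'" "\<And>z w. (z, w) \<in> C' \<Longrightarrow> d z w \<le> s"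
    using tclose_closed[OF A' A'' assms(5)] by blast
  have CC: "C \<in> Corr A A'" "C' \<in> Corr A' A''"
    using C(1) C'(1) by (auto simp: Cor_plus_def)
  have CA: "z \<in> A" "w \<in> A'" if "(z, w) \<in> C" for z w
    using that CC by (auto simp: Corr_def)
  have CA': "z \<in> A'" "w \<in> A''" if "(z, w) \<in> C'" for z w
    using that CC by (auto simp: Corr_def)
  have near: "d z w \<le> r + s" if zw: "(z, w) \<in> C O C'" for z w
  proof -
    obtain y where y: "(z, y) \<in> C" "(y, w) \<in> C'"
      using zw by blast
    then have "d z w \<le> d z y + d y w"
      using CA CA' corder_subset[OF A] corder_subset[OF A'] corder_subset[OF A'']
      by (meson subsetD triangle)
    also have "\<dots> \<le> r + s"
      using C(3) C'(3) y by (intro add_mono) auto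
    finally show ?thesis .
  qed
  show ?thesis
  proof (rule monotonise[OF A A'', of "C O C'"])
    have "\<exists>c. (a, c) \<in> C O C'" if a: "a \<in> A" for a
    proof -
      obtain b where "(a, b) \<in> C" "b \<in> A'"
        using CC(1) a unfolding Corr_def by blast
      moreover then obtain c where "(b, c) \<in> C'"
        using CC(2) unfolding Corr_def by blast
      ultimately show ?thesis by blast
    qed
    moreover have "\<exists>a. (a, c) \<in> C O C'" if c: "c \<in> A''" for c
    proof -
      obtain b where "(b, c) \<in> C'" "b \<in> A'"
        using CC(2) c unfolding Corr_def by blast
      moreover then obtain a where "(a, b) \<in> C"
        using CC(1) unfolding Corr_def by blast
      ultimately show ?thesis by blast
    qed
    moreover have "C O C' \<subseteq> A \<times> A''"
      using CC by (auto simp: Corr_def)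
    ultimately show "C O C' \<in> Corr A A''"
      unfolding Corr_def by blast
    show "cclosed A A'' (C O C')"
      unfolding cclosed_def
    proof (intro allI impI)
      fix \<sigma> \<tau> :: "nat \<Rightarrow> 'a" and x y
      assume D: "\<forall>n. (\<sigma> n, \<tau> n) \<in> C O C'" and xy: "x \<in> A" "y \<in> A''"
        and lim: "null (\<lambda>n. d (\<sigma> n) x)" "null (\<lambda>n. d (\<tau> n) y)"
      have "\<exists>u. (\<sigma> n, u) \<in> C \<and> (u, \<tau> n) \<in> C'" for n
        using D by blast
      then obtain u where u: "\<And>n. (\<sigma> n, u n) \<in> C" "\<And>n. (u n, \<tau> n) \<in> C'"
        by metis
      obtain l k where lk: "l \<in> A'" "strict_mono k" "null (\<lambda>n. d (u (k n)) l)"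
        by (rule compact_seq[OF corder_compact[OF A'], of u]) (use CA u in blast)
      have "(x, l) \<in> C"
        by (rule cclosedD[of A A' C "\<lambda>n. \<sigma> (k n)" "\<lambda>n. u (k n)", OF C(2) u(1) xy(1) lk(1) _ lk(3)])
          (rule strict_mono_subseq_tendsto[OF lk(2) lim(1)])
      moreover have "(l, y) \<in> C'"
        by (rule cclosedD[of A' A'' C' "\<lambda>n. u (k n)" "\<lambda>n. \<tau> (k n)", OF C'(2) u(2) lk(1) xy(2) lk(3)])
          (rule strict_mono_subseq_tendsto[OF lk(2) lim(2)])
      ultimately show "(x, y) \<in> C O C'"
        by blast
    qed
    show "d z w' \<le> r + s \<and> d z' w \<le> r + s" if zw: "(z, w) \<in> C O C'" "(z', w') \<in> C O C'"
      and less: "(z, z') \<in> le" "z \<noteq> z'" "(w', w) \<in> le''" "w' \<noteq> w" for z w z' w'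
    proof -
      obtain y where y: "(z, y) \<in> C" "(y, w) \<in> C'"
        using zw(1) by blast
      obtain y' where y': "(z', y') \<in> C" "(y', w') \<in> C'"
        using zw(2) by blast
      have "\<not> ((y', y) \<in> le' \<and> y' \<noteq> y)"
        using C(1) y(1) y'(1) less unfolding Cor_plus_def by blast
      moreover have "\<not> ((y, y') \<in> le' \<and> y \<noteq> y')"
        using C'(1) y(2) y'(2) less unfolding Cor_plus_def by blast
      ultimately have "y = y'"
        using corder_total[OF A', of y y'] CA[OF y(1)] CA[OF y'(1)] by metis
      then show ?thesis
        using near y y' by blast
    qed
  qed (rule near)
qed

text \<open>Partners of two ordered points are ordered, because a strict inequality the other way
  round would be a crossing. Hence a pair of one order is matched with a pair of the other.\<close>

lemma tclose_imp_hclose_pair: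
  assumes A: "corder A le" and A': "corder A' le'" and "tclose r A le A' le'"
  shows "hclose (d_pair d) r le le'"
proof -
  obtain C where C: "C \<in> Cor_plus A le A' le'" "\<And>z w. (z, w) \<in> C \<Longrightarrow> d z w \<le> r"
    using assms(3) unfolding tclose_def by auto
  have CC: "C \<in> Corr A A'"
    using C(1) by (auto simp: Cor_plus_def)
  have "\<exists>b\<in>le'. d_pair d a b \<le> r" if a: "a \<in> le" for a
  proof -
    obtain z z' where zz: "a = (z, z')" "(z, z') \<in> le" "z \<in> A" "z' \<in> A"
      using a corder_dom[OF A] by (cases a) auto
    obtain w where w: "(z, w) \<in> C" "w \<in> A'"
      using CC zz unfolding Corr_def by blast
    \<comment> \<open>One point may have several partners in no particular order, so for a pair on
      the diagonal the same partner is taken twice.\<close>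
    obtain w' where w': "(z', w') \<in> C" "w' \<in> A'" "z = z' \<longrightarrow> w = w'"
      using CC zz w unfolding Corr_def by blast
    have "(w, w') \<in> le'"
      using C(1) w w' zz corder_total[OF A', of w w'] corder_refl[OF A', of w] unfolding Cor_plus_def by blast
    then show ?thesis
      using C(2) w w' zz by (intro bexI[of _ "(w, w')"]) (auto simp: d_pair_def)
  qed
  moreover have "\<exists>a\<in>le. d_pair d a b \<le> r" if b: "b \<in> le'" for b
  proof -
    obtain w w' where ww: "b = (w, w')" "(w, w') \<in> le'" "w \<in> A'" "w' \<in> A'"
      using b corder_dom[OF A'] by (cases b) auto
    obtain z where z: "(z, w) \<in> C" "z \<in> A"
      using CC ww unfolding Corr_def by blast
    obtain z' where z': "(z', w') \<in> C" "z' \<in> A" "w = w' \<longrightarrow> z = z'"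
      using CC ww z unfolding Corr_def by blast
    have "(z, z') \<in> le"
      using C(1) z z' ww corder_total[OF A, of z z'] corder_refl[OF A, of z] unfolding Cor_plus_def by blast
    then show ?thesis
      using C(2) z z' ww by (intro bexI[of _ "(z, z')"]) (auto simp: d_pair_def)
  qed
  ultimately show ?thesis
    by (auto simp: hclose_def)
qed

text \<open>By reflexivity a point of \<open>A\<close> is a diagonal pair of the order; a pair near
  it has each of its coordinates near that point.\<close>

lemma hclose_pair_imp_hclose:
  assumes A: "corder A le" and A': "corder A' le'" and "hclose (d_pair d) r le le'"
  shows "hclose d r A A'"
  unfolding hclose_def
proof (intro conjI ballI)
  fix a assume "a \<in> A"
  then have "(a, a) \<in> le"
    by (rule corder_refl[OF A])
  then obtain b where "b \<in> le'" "d_pair d (a, a) b \<le> r"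
    using assms(3) unfolding hclose_def by blast
  then show "\<exists>b\<in>A'. d a b \<le> r"
    using corder_dom[OF A'] by (cases b) (auto simp: d_pair_def)
next
  fix b assume "b \<in> A'"
  then have "(b, b) \<in> le'"
    by (rule corder_refl[OF A'])
  then obtain a where "a \<in> le" "d_pair d a (b, b) \<le> r"
    using assms(3) unfolding hclose_def by blast
  then show "\<exists>a\<in>A. d a b \<le> r"
    using corder_dom[OF A] by (cases a) (auto simp: d_pair_def)
qed

text \<open>The full product is a closed correspondence, and with \<open>R\<close> bounding all
  distances it can be made monotone. This shows that the infimum defining \<open>d_tot\<close> is
  taken over a nonempty family.\<close>

lemma tclose_exists:
  assumes A: "corder A le" and A': "corder A' le'"
  shows "\<exists>R. tclose R A le A' le'"
proof -
  obtain R where R: "\<And>z w. z \<in> A \<Longrightarrow> w \<in> A' \<Longrightarrow> d z w \<le> R"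
    using compact_dist_bounded[OF corder_compact[OF A] corder_compact[OF A']] by blast
  have "tclose R A le A' le'"
  proof (rule monotonise[OF A A', of "A \<times> A'"])
    show "A \<times> A' \<in> Corr A A'"
      using corder_nonempty[OF A] corder_nonempty[OF A'] by (auto simp: Corr_def)
  qed (use R in \<open>auto simp: cclosed_def\<close>)
  then show ?thesis ..
qed

text \<open>If \<open>(z, z')\<close> is in the order and \<open>z, z'\<close> are far apart, then \<open>(z', z)\<close> is far from the order, by
  compactness. Hence the relation \<open>d z w \<le> \<delta>\<close> can only violate monotonicity between points that are
  close to each other.\<close>

lemma hclose_pair_imp_tclose:
  assumes A: "corder A le" and e: "e > 0"
  obtains \<delta> where "\<delta> > 0"
    "\<And>A' le'. corder A' le' \<Longrightarrow> hclose (d_pair d) \<delta> le le' \<Longrightarrow> tclose e A le A' le'"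
proof -
  have AM: "A \<subseteq> M"
    by (rule corder_subset[OF A])
  have "\<exists>\<eta>>0. \<forall>z z' u u'. (z, z') \<in> le \<and> d z z' \<ge> e / 2 \<and> (u, u') \<in> le \<longrightarrow> \<not> (d z' u \<le> \<eta> \<and> d z u' \<le> \<eta>)"
  proof (rule ccontr)
    assume *: "\<not> ?thesis"
    have "\<exists>z z' u u'. (z, z') \<in> le \<and> d z z' \<ge> e / 2 \<and> (u, u') \<in> le \<and> d z' u \<le> 1 / real (Suc n) \<and>
        d z u' \<le> 1 / real (Suc n)" for n
      using *[unfolded not_ex, rule_format, of "1 / real (Suc n)"] by auto
    then obtain z z' u u' where zu: "\<And>n. (z n, z' n) \<in> le" "\<And>n. d (z n) (z' n) \<ge> e / 2"
      "\<And>n. (u n, u' n) \<in> le" "\<And>n. d (z' n) (u n) \<le> 1 / real (Suc n)" "\<And>n. d (z n) (u' n) \<le> 1 / real (Suc n)"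
      by metis
    note zA = corder_dom[OF A zu(1)] and uA = corder_dom[OF A zu(3)]
    obtain l r where lr: "l \<in> A" "strict_mono r" "null (\<lambda>n. d (z (r n)) l)"
      by (rule compact_seq[OF corder_compact[OF A], of z]) (rule zA)
    obtain l' s where ls: "l' \<in> A" "strict_mono s" "null (\<lambda>n. d (z' (r (s n))) l')"
      by (rule compact_seq[OF corder_compact[OF A], of "\<lambda>n. z' (r n)"]) (rule zA)
    define k where "k n = r (s n)" for n
    have k: "strict_mono k"
      using lr(2) ls(2) unfolding k_def strict_mono_def by blast
    have cz: "null (\<lambda>n. d (z (k n)) l)" "null (\<lambda>n. d (z' (k n)) l')"
      using strict_mono_subseq_tendsto[OF ls(2) lr(3)] ls(3) by (simp_all add: k_def)
    have inM: "z (k n) \<in> M" "z' (k n) \<in> M" "u (k n) \<in> M" "u' (k n) \<in> M" for n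
      using zA uA AM by blast+
    have lM: "l \<in> M" "l' \<in> M"
      using lr(1) ls(1) AM by blast+
    have "null (\<lambda>n. d (z (k n)) (u' (k n)))"
      by (rule Lim_null_comparison[OF _ strict_mono_subseq_tendsto[OF k lim_1_over_Suc]]) (use zu(5) in simp)
    then have cu': "null (\<lambda>n. d (u' (k n)) l)"
      by (rule seq_near[OF inM(1,4) lM(1) cz(1)])
    have "null (\<lambda>n. d (z' (k n)) (u (k n)))"
      by (rule Lim_null_comparison[OF _ strict_mono_subseq_tendsto[OF k lim_1_over_Suc]]) (use zu(4) in simp)
    then have cu: "null (\<lambda>n. d (u (k n)) l')"
      by (rule seq_near[OF inM(2,3) lM(2) cz(2)])
    have "(l, l') \<in> le"
      by (rule corder_closed[of A le "\<lambda>n. z (k n)" "\<lambda>n. z' (k n)", OF A zu(1) lr(1) ls(1) cz])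
    moreover have "(l', l) \<in> le"
      by (rule corder_closed[of A le "\<lambda>n. u (k n)" "\<lambda>n. u' (k n)", OF A zu(3) ls(1) lr(1) cu cu'])
    ultimately have "l = l'"
      by (rule corder_antisym[OF A])
    have "(\<lambda>n. d (z (k n)) (z' (k n))) \<longlonglongrightarrow> d l l'"
      by (rule seq_dist[OF inM(1,2) lM cz])
    then have "e / 2 \<le> d l l'"
      by (rule LIMSEQ_le_const) (use zu(2) in blast)
    then show False
      using \<open>l = l'\<close> lM e by simp
  qed
  then obtain \<eta> where \<eta>: "\<eta> > 0"
    "\<And>z z' u u'. (z, z') \<in> le \<Longrightarrow> (u, u') \<in> le \<Longrightarrow> d z' u \<le> \<eta> \<Longrightarrow> d z u' \<le> \<eta> \<Longrightarrow> d z z' < e / 2"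
    by (metis not_le)
  \<comment> \<open>Passing from \<open>z'\<close> over \<open>w'\<close> to \<open>u\<close>, and
    from \<open>z\<close> over \<open>w\<close> to \<open>u'\<close>, costs two steps of length
    \<open>\<delta>\<close>, which must stay within \<open>\<eta>\<close>. The final estimate is
    \<open>e / 2\<close> plus one step, for which \<open>e / 4\<close> is ample.\<close>
  define \<delta> where "\<delta> = min (\<eta> / 2) (e / 4)"
  have \<delta>: "\<delta> > 0" "2 * \<delta> \<le> \<eta>" "4 * \<delta> \<le> e"
    using \<eta>(1) e by (auto simp: \<delta>_def)
  show thesis
  proof (rule that[OF \<delta>(1)])
    fix A' le' assume A': "corder A' le'" and cl: "hclose (d_pair d) \<delta> le le'"
    have AM': "A' \<subseteq> M"
      by (rule corder_subset[OF A'])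
    have h: "hclose d \<delta> A A'"
      by (rule hclose_pair_imp_hclose[OF A A' cl])
    define C where "C = {(z, w). z \<in> A \<and> w \<in> A' \<and> d z w \<le> \<delta>}"
    show "tclose e A le A' le'"
    proof (rule monotonise[OF A A', of C])
      show "C \<in> Corr A A'"
        using h by (auto simp: C_def Corr_def hclose_def)
      show "cclosed A A' C"
        unfolding cclosed_def
      proof (intro allI impI)
        fix \<sigma> \<tau> :: "nat \<Rightarrow> 'a" and x y
        assume D: "\<forall>n. (\<sigma> n, \<tau> n) \<in> C" and xy: "x \<in> A" "y \<in> A'"
          and lim: "null (\<lambda>n. d (\<sigma> n) x)" "null (\<lambda>n. d (\<tau> n) y)"
        have "(\<lambda>n. d (\<sigma> n) (\<tau> n)) \<longlonglongrightarrow> d x y"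
          by (rule seq_dist[OF _ _ _ _ lim]) (use D xy AM AM' in \<open>unfold C_def, blast\<close>)+
        then have "d x y \<le> \<delta>"
          by (rule LIMSEQ_le_const2) (use D in \<open>auto simp: C_def\<close>)
        then show "(x, y) \<in> C"
          using xy by (simp add: C_def)
      qed
      show "d z w \<le> e" if "(z, w) \<in> C" for z w
        using that \<delta> by (auto simp: C_def)
      show "d z w' \<le> e \<and> d z' w \<le> e" if C: "(z, w) \<in> C" "(z', w') \<in> C"
        and less: "(z, z') \<in> le" "z \<noteq> z'" "(w', w) \<in> le'" "w' \<noteq> w" for z w z' w'
      proof -
        obtain u u' where u: "(u, u') \<in> le" "d u w' \<le> \<delta>" "d u' w \<le> \<delta>"
          using cl less(3) unfolding hclose_def d_pair_def by fastforce
        have M: "z \<in> M" "z' \<in> M" "w \<in> M" "w' \<in> M" "u \<in> M" "u' \<in> M"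
          using C corder_dom[OF A u(1)] AM AM' by (auto simp: C_def)
        have dz: "d z w \<le> \<delta>" "d z' w' \<le> \<delta>"
          using C by (auto simp: C_def)
        have "d z' u \<le> d z' w' + d u w'" "d z u' \<le> d z w + d u' w"
          using M triangle' commute by metis+
        then have "d z z' < e / 2"
          using dz u \<delta> by (intro \<eta>(2)[OF less(1) u(1)]) linarith+
        moreover have "d z w' \<le> d z z' + d z' w'" "d z' w \<le> d z z' + d z w"
          using M triangle triangle'' by metis+
        ultimately show ?thesis
          using dz \<delta> by linarith
      qed
    qed
  qed
qed

text \<open>Continuity of the identity map from \<open>d\<close> to \<open>d'\<close> is uniform
  along a compact set, even with the second point ranging over the whole space: a violating sequence
  of pairs would have a subsequence converging to one point of \<open>A\<close> in both
  coordinates.\<close>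

lemma uniform_near_compact:
  assumes d': "Metric_space M d'" "Metric_space.mtopology M d' = mtopology"
    and A: "compactin mtopology A" and e: "e > 0"
  obtains \<delta> where "\<delta> > 0" "\<And>z w. z \<in> A \<Longrightarrow> w \<in> M \<Longrightarrow> d z w \<le> \<delta> \<Longrightarrow> d' z w \<le> e"
proof -
  interpret D: Metric_space M d' by fact
  have gen: "metric_generates M d mtopology" "metric_generates M d' mtopology"
    using d' Metric_space_axioms by (auto simp: metric_generates_def)
  have "\<exists>\<delta>>0. \<forall>z\<in>A. \<forall>w\<in>M. d z w \<le> \<delta> \<longrightarrow> d' z w \<le> e"
  proof (rule ccontr)
    assume *: "\<not> ?thesis"
    have "\<exists>z w. z \<in> A \<and> w \<in> M \<and> d z w \<le> 1 / real (Suc n) \<and> d' z w > e" for n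
      using *[unfolded not_ex, rule_format, of "1 / real (Suc n)"] by (auto simp: not_le)
    then obtain z w where zw: "\<And>n. z n \<in> A" "\<And>n. w n \<in> M" "\<And>n. d (z n) (w n) \<le> 1 / real (Suc n)" "\<And>n. d' (z n) (w n) > e"
      by metis
    have "null (\<lambda>n. d (z n) (w n))"
      by (rule Lim_null_comparison[OF _ lim_1_over_Suc]) (use zw(3) in simp)
    then obtain l r where lr: "l \<in> A" "strict_mono r" "null (\<lambda>n. d (z (r n)) l)" "null (\<lambda>n. d (w (r n)) l)"
      by (rule compact_near_seq[OF A zw(1,2)])
    have zM: "z n \<in> M" and lM: "l \<in> M" for n
      using zw(1) lr(1) compact_subset[OF A] by blast+
    have 1: "null (\<lambda>n. d' (z (r n)) l)"
      using metric_generates_tendsto_iff[OF gen, of "\<lambda>n. z (r n)" l] zM lM lr(3) by blast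
    have 2: "null (\<lambda>n. d' (w (r n)) l)"
      using metric_generates_tendsto_iff[OF gen, of "\<lambda>n. w (r n)" l] zw(2) lM lr(4) by blast
    have "(\<lambda>n. d' (z (r n)) (w (r n))) \<longlonglongrightarrow> d' l l"
      by (rule D.seq_dist[OF zM zw(2) lM lM 1 2])
    then have "e \<le> d' l l"
      by (rule LIMSEQ_le_const) (use zw(4) in \<open>auto intro: less_imp_le\<close>)
    then show False
      using e lM by simp
  qed
  then show thesis
    using that by blast
qed

text \<open>Infima and suprema of reals are informative only for nonempty bounded families.
  Compactness bounds the suprema, and nonemptiness of \<open>A\<close> makes every correspondence
  nonempty, so that all suprema are at least 0.\<close>

lemma inf_sup_le:
  assumes A: "compactin mtopology A" "compactin mtopology A'" "A \<noteq> {}"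
    and \<C>: "\<C> \<subseteq> Corr A A'" "C \<in> \<C>" and r: "\<forall>(z, w)\<in>C. d z w \<le> r"
  shows "(INF C\<in>\<C>. SUP (z, w)\<in>C. d z w) \<le> r"
proof -
  obtain R where R: "\<And>z w. z \<in> A \<Longrightarrow> w \<in> A' \<Longrightarrow> d z w \<le> R"
    using compact_dist_bounded[OF A(1,2)] by blast
  have ne: "C' \<noteq> {}" if "C' \<in> \<C>" for C'
    using that \<C>(1) A(3) by (auto simp: Corr_def)
  have "0 \<le> (SUP (z, w)\<in>C'. d z w)" if C': "C' \<in> \<C>" for C'
  proof -
    obtain z w where zw: "(z, w) \<in> C'"
      using ne[OF C'] by auto
    have "C' \<subseteq> A \<times> A'"
      using C' \<C>(1) unfolding Corr_def by blast
    then have "bdd_above ((\<lambda>(z, w). d z w) ` C')"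
      using R by (intro bdd_aboveI[of _ R]) auto
    then have "d z w \<le> (SUP (z, w)\<in>C'. d z w)"
      using cSUP_upper[OF zw] by fastforce
    then show ?thesis
      using nonneg order_trans by blast
  qed
  then have "bdd_below ((\<lambda>C'. SUP (z, w)\<in>C'. d z w) ` \<C>)"
    by (intro bdd_belowI[of _ 0]) auto
  then show ?thesis
    using \<C>(2) ne[OF \<C>(2)] r by (intro cINF_lower2) (auto intro!: cSUP_least)
qed

lemma inf_sup_less:
  assumes A: "compactin mtopology A" "compactin mtopology A'"
    and \<C>: "\<C> \<subseteq> Corr A A'" "\<C> \<noteq> {}" and less: "(INF C\<in>\<C>. SUP (z, w)\<in>C. d z w) < r"
  obtains C where "C \<in> \<C>" "\<forall>(z, w)\<in>C. d z w \<le> r"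
proof -
  obtain R where R: "\<And>z w. z \<in> A \<Longrightarrow> w \<in> A' \<Longrightarrow> d z w \<le> R"
    using compact_dist_bounded[OF A(1,2)] by blast
  obtain x where "x \<in> (\<lambda>C'. SUP (z, w)\<in>C'. d z w) ` \<C>" "x < r"
    using cInf_lessD[OF _ less] \<C>(2) by blast
  then obtain C where C: "C \<in> \<C>" "(SUP (z, w)\<in>C. d z w) < r"
    by blast
  have "C \<subseteq> A \<times> A'"
    using C \<C>(1) unfolding Corr_def by blast
  then have "bdd_above ((\<lambda>(z, w). d z w) ` C)"
    using R by (intro bdd_aboveI[of _ R]) auto
  then have "\<forall>(z, w)\<in>C. d z w \<le> r"
    using C(2) cSUP_upper[of _ C "\<lambda>(z, w). d z w"] by fastforce
  then show thesis
    using that C(1) by blast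
qed

end

section \<open>The squeezed space\<close>

definition squash :: "ereal \<Rightarrow> real" where
  "squash t = (if t = \<infinity> then 1 else if t = -\<infinity> then -1 else real_of_ereal t / (1 + \<bar>real_of_ereal t\<bar>))"

lemma squash_simps [simp]:
  "squash (ereal t) = t / (1 + \<bar>t\<bar>)" "squash \<infinity> = 1" "squash (-\<infinity>) = -1"
  by (simp_all add: squash_def)

lemma squash_real_less1: "\<bar>squash (ereal t)\<bar> < 1"
  by (simp add: abs_if field_simps)

lemma squash_le1: "\<bar>squash t\<bar> \<le> 1"
  using squash_real_less1 by (cases t) (auto intro: less_imp_le simp del: squash_simps(1))

lemma squash_less_iff: "squash s < squash t \<longleftrightarrow> s < t"
proof -
  have real: "squash (ereal s) < squash (ereal t)" if "s < t" for s t
  proof (cases "s \<ge> 0")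
    case True
    then show ?thesis using that by (simp add: field_simps)
  next
    case s: False
    show ?thesis
    proof (cases "t \<ge> 0")
      case True
      then have "squash (ereal s) < 0" "0 \<le> squash (ereal t)"
        using s by (simp_all add: divide_neg_pos)
      then show ?thesis by linarith
    next
      case False
      have "s * (1 - t) < t * (1 - s)"
        using that by (simp add: algebra_simps)
      then show ?thesis using s False by (simp add: field_simps)
    qed
  qed
  have *: "squash s < squash t" if st: "s < t" for s t
  proof (cases s; cases t)
    fix a b assume "s = ereal a" "t = ereal b"
    then show ?thesis using real st by simp
  next
    fix a assume "s = ereal a" "t = \<infinity>"
    then show ?thesis using squash_real_less1[of a] by (simp del: squash_simps(1))
  next
    fix b assume "s = -\<infinity>" "t = ereal b"
    then show ?thesis using squash_real_less1[of b] by (simp del: squash_simps(1))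
  qed (use st in auto)
  then show ?thesis
    by (metis less_asym not_less_iff_gr_or_eq)
qed

lemma squash_eq_iff: "squash s = squash t \<longleftrightarrow> s = t"
  using squash_less_iff by (metis less_irrefl not_less_iff_gr_or_eq)

lemma squash_surj:
  assumes "\<bar>y\<bar> < 1"
  obtains t where "squash (ereal t) = y"
proof -
  have "1 + \<bar>y\<bar> / (1 - \<bar>y\<bar>) = 1 / (1 - \<bar>y\<bar>)"
    using assms by (simp add: field_simps)
  then have "squash (ereal (y / (1 - \<bar>y\<bar>))) = y"
    using assms by (simp add: abs_divide)
  then show thesis
    by (rule that)
qed

text \<open>A strictly increasing map of the extended line onto the interval from -1 to 1 is a
  homeomorphism for the order topologies; the two directions transport the thresholds of
  \<open>order_tendstoI\<close>.\<close>

lemma squash_tendsto_iff: "((\<lambda>n. squash (f n)) \<longlongrightarrow> squash t) F \<longleftrightarrow> (f \<longlongrightarrow> t) F"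
proof
  assume L: "((\<lambda>n. squash (f n)) \<longlongrightarrow> squash t) F"
  show "(f \<longlongrightarrow> t) F"
  proof (rule order_tendstoI)
    fix a assume "a < t"
    then have "\<forall>\<^sub>F n in F. squash a < squash (f n)"
      by (intro order_tendstoD(1)[OF L]) (simp add: squash_less_iff)
    then show "\<forall>\<^sub>F n in F. a < f n"
      by (simp add: squash_less_iff)
  next
    fix a assume "t < a"
    then have "\<forall>\<^sub>F n in F. squash (f n) < squash a"
      by (intro order_tendstoD(2)[OF L]) (simp add: squash_less_iff)
    then show "\<forall>\<^sub>F n in F. f n < a"
      by (simp add: squash_less_iff)
  qed
next
  assume L: "(f \<longlongrightarrow> t) F"
  show "((\<lambda>n. squash (f n)) \<longlongrightarrow> squash t) F"
  proof (rule order_tendstoI)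
    fix a assume a: "a < squash t"
    show "\<forall>\<^sub>F n in F. a < squash (f n)"
    proof (cases "a < -1")
      case True
      then show ?thesis
        using squash_le1 by (intro always_eventually) (smt (verit))
    next
      case False
      \<comment> \<open>Thresholds below -1 are trivial. Otherwise an intermediate value has
        absolute value less than 1 and is the image of a real time, while \<open>a\<close> itself
        may equal -1.\<close>
      obtain a' where a': "a < a'" "a' < squash t"
        using dense a by blast
      then have "\<bar>a'\<bar> < 1"
        using False squash_le1[of t] by linarith
      then obtain s where s: "squash (ereal s) = a'"
        by (rule squash_surj)
      then have "\<forall>\<^sub>F n in F. ereal s < f n"
        using a' by (intro order_tendstoD(1)[OF L]) (simp add: squash_less_iff[symmetric])
      then show ?thesis
        by (rule eventually_mono) (use a' s squash_less_iff in \<open>metis less_trans\<close>)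
    qed
  next
    fix a assume a: "squash t < a"
    show "\<forall>\<^sub>F n in F. squash (f n) < a"
    proof (cases "1 < a")
      case True
      then show ?thesis
        using squash_le1 by (intro always_eventually) (smt (verit))
    next
      case False
      obtain a' where a': "squash t < a'" "a' < a"
        using dense a by blast
      then have "\<bar>a'\<bar> < 1"
        using False squash_le1[of t] by linarith
      then obtain s where s: "squash (ereal s) = a'"
        by (rule squash_surj)
      then have "\<forall>\<^sub>F n in F. f n < ereal s"
        using a' by (intro order_tendstoD(2)[OF L]) (simp add: squash_less_iff[symmetric])
      then show ?thesis
        by (rule eventually_mono) (use a' s squash_less_iff in \<open>metis less_trans\<close>)
    qed
  qed
qed

text \<open>The weight of the second summand vanishes as soon as one of the points lies at infinity,
  so the unspecified value of \<open>the None\<close> does no harm there.\<close>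

definition sqz_dist :: "('a \<Rightarrow> 'a \<Rightarrow> real) \<Rightarrow> 'a sqz \<Rightarrow> 'a sqz \<Rightarrow> real" where
  "sqz_dist e z w = \<bar>squash (snd z) - squash (snd w)\<bar> +
     min (1 - \<bar>squash (snd z)\<bar>) (1 - \<bar>squash (snd w)\<bar>) * e (the (fst z)) (the (fst w))"

lemma squeezed_cases:
  assumes "z \<in> squeezed X"
  obtains x t where "z = (Some x, ereal t)" "x \<in> topspace X" | "z = (None, -\<infinity>)" | "z = (None, \<infinity>)"
  using assms by (auto simp: squeezed_def)

lemma squeezed_iff [simp]:
  "(Some x, t) \<in> squeezed X \<longleftrightarrow> x \<in> topspace X \<and> \<bar>t\<bar> \<noteq> \<infinity>"
  "(None, t) \<in> squeezed X \<longleftrightarrow> t = -\<infinity> \<or> t = \<infinity>"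
  by (auto simp: squeezed_def)

lemma squeezed_real:
  assumes "z \<in> squeezed X" "\<bar>snd z\<bar> \<noteq> \<infinity>"
  shows "z = (Some (the (fst z)), ereal (real_of_ereal (snd z)))" "the (fst z) \<in> topspace X"
  using assms by (auto elim!: squeezed_cases)

lemma squeezed_inf:
  assumes "z \<in> squeezed X" "\<bar>snd z\<bar> = \<infinity>"
  shows "z = (None, snd z)"
  using assms by (auto elim!: squeezed_cases)

lemma squeezed_weight:
  assumes "z \<in> squeezed X"
  shows "0 < 1 - \<bar>squash (snd z)\<bar> \<longleftrightarrow> \<bar>snd z\<bar> \<noteq> \<infinity>"
  using assms squash_real_less1 by (auto elim!: squeezed_cases simp del: squash_simps(1))

text \<open>The delicate axiom is the triangle inequality, for the sake of which \<open>e\<close> is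
  bounded by 1. If the weight of the middle point is at least the weight \<open>m\<close> of the
  outer pair, the triangle inequality of \<open>e\<close> is multiplied by \<open>m\<close>; the
  other case is the interesting one.\<close>

lemma Metric_space_sqz_dist:
  assumes "Metric_space M e" and e1: "\<And>x y. e x y \<le> 1"
  shows "Metric_space (squeezed (Metric_space.mtopology M e)) (sqz_dist e)"
proof -
  interpret Metric_space M e by fact
  let ?Z = "squeezed mtopology"
  show ?thesis
  proof
    fix z w :: "'a sqz"
    show "0 \<le> sqz_dist e z w"
      using squash_le1[of "snd z"] squash_le1[of "snd w"] by (simp add: sqz_dist_def)
    show "sqz_dist e z w = sqz_dist e w z"
      using commute by (simp add: sqz_dist_def abs_minus_commute min.commute)
  next
    fix z w assume zw: "z \<in> ?Z" "w \<in> ?Z"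
    show "sqz_dist e z w = 0 \<longleftrightarrow> z = w"
    proof
      assume 0: "sqz_dist e z w = 0"
      have nn: "0 \<le> min (1 - \<bar>squash (snd z)\<bar>) (1 - \<bar>squash (snd w)\<bar>) * e (the (fst z)) (the (fst w))"
        using squash_le1[of "snd z"] squash_le1[of "snd w"] by simp
      then have "\<bar>squash (snd z) - squash (snd w)\<bar> = 0"
        using 0 unfolding sqz_dist_def by linarith
      then have t: "snd z = snd w"
        by (simp add: squash_eq_iff)
      show "z = w"
      proof (cases "\<bar>snd z\<bar> = \<infinity>")
        case True
        then show ?thesis
          using squeezed_inf[OF zw(1)] squeezed_inf[OF zw(2)] t by metis
      next
        case False
        then have "0 < 1 - \<bar>squash (snd z)\<bar>"
          by (rule squeezed_weight[OF zw(1), THEN iffD2])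
        then have "e (the (fst z)) (the (fst w)) = 0"
          using 0 t unfolding sqz_dist_def by auto
        then have "the (fst z) = the (fst w)"
          using squeezed_real[OF zw(1)] squeezed_real[OF zw(2)] False t by (metis topspace_mtopology zero)
        then show ?thesis
          using squeezed_real(1)[OF zw(1)] squeezed_real(1)[OF zw(2)] False t by metis
      qed
    next
      assume "z = w"
      then show "sqz_dist e z w = 0"
        using squeezed_real[OF zw(1)] squeezed_weight[OF zw(1)] squash_le1[of "snd z"]
        by (cases "\<bar>snd z\<bar> = \<infinity>") (auto simp: sqz_dist_def)
    qed
  next
    fix z w v assume Z: "z \<in> ?Z" "w \<in> ?Z" "v \<in> ?Z"
    define a b c where abc: "a = squash (snd z)" "b = squash (snd w)" "c = squash (snd v)"
    define e1 e2 E where ee: "e1 = e (the (fst z)) (the (fst w))" "e2 = e (the (fst w)) (the (fst v))"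
      "E = e (the (fst z)) (the (fst v))"
    have abs1: "\<bar>a\<bar> \<le> 1" "\<bar>b\<bar> \<le> 1" "\<bar>c\<bar> \<le> 1"
      using squash_le1 by (auto simp: abc)
    have pos: "0 \<le> e1" "0 \<le> e2" "0 \<le> E" "E \<le> 1"
      using assms(2) by (auto simp: ee)
    have inM: "the (fst u) \<in> M" if "u \<in> ?Z" "0 < 1 - \<bar>squash (snd u)\<bar>" for u
      using squeezed_weight[OF that(1)] squeezed_real(2)[OF that(1)] that(2) by simp
    have tri: "E \<le> e1 + e2" if "0 < 1 - \<bar>a\<bar>" "0 < 1 - \<bar>b\<bar>" "0 < 1 - \<bar>c\<bar>"
      unfolding ee by (intro triangle inM Z that[unfolded abc])
    define m where "m = min (1 - \<bar>a\<bar>) (1 - \<bar>c\<bar>)"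
    have m: "m \<ge> 0" "m \<le> 1 - \<bar>a\<bar>" "m \<le> 1 - \<bar>c\<bar>"
      using abs1 by (auto simp: m_def)
    have "\<bar>a - c\<bar> + m * E \<le> (\<bar>a - b\<bar> + min (1 - \<bar>a\<bar>) (1 - \<bar>b\<bar>) * e1) + (\<bar>b - c\<bar> + min (1 - \<bar>b\<bar>) (1 - \<bar>c\<bar>) * e2)"
    proof (cases "m \<le> 1 - \<bar>b\<bar>")
      case True
      have mE: "m * E \<le> m * (e1 + e2)"
      proof (cases "m = 0")
        case False
        then show ?thesis
          using tri m True by (intro mult_left_mono) auto
      qed simp
      have m12: "m * e1 \<le> min (1 - \<bar>a\<bar>) (1 - \<bar>b\<bar>) * e1" "m * e2 \<le> min (1 - \<bar>b\<bar>) (1 - \<bar>c\<bar>) * e2"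
        using m True pos by (intro mult_right_mono; simp)+
      have "\<bar>a - c\<bar> + m * E \<le> (\<bar>a - b\<bar> + \<bar>b - c\<bar>) + (m * e1 + m * e2)"
        using mE unfolding distrib_left by (intro add_mono) linarith+
      also have "\<dots> \<le> (\<bar>a - b\<bar> + \<bar>b - c\<bar>) +
          (min (1 - \<bar>a\<bar>) (1 - \<bar>b\<bar>) * e1 + min (1 - \<bar>b\<bar>) (1 - \<bar>c\<bar>) * e2)"
        by (intro add_mono order_refl m12)
      finally show ?thesis
        by (simp only: ac_simps)
    next
      case False
      \<comment> \<open>The middle point is closer to infinity than both ends, and its weight
        \<open>k\<close> is too small to cover \<open>m * E\<close>. The missing part is at most
        \<open>m - k\<close>, and it is paid for by the first summands, since the squashed times
        make a detour over \<open>b\<close>.\<close>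
      define k where "k = 1 - \<bar>b\<bar>"
      have k: "0 \<le> k" "k < m" "min (1 - \<bar>a\<bar>) (1 - \<bar>b\<bar>) = k" "min (1 - \<bar>b\<bar>) (1 - \<bar>c\<bar>) = k"
        using False m abs1 by (auto simp: k_def)
      have "k * E \<le> k * (e1 + e2)"
      proof (cases "k = 0")
        case False
        then show ?thesis
          using tri m k by (intro mult_left_mono) (auto simp: k_def)
      qed simp
      moreover have "(m - k) * E \<le> m - k"
        using k pos mult_left_mono[of E 1 "m - k"] by simp
      moreover have "\<bar>a - c\<bar> + (m - k) \<le> \<bar>a - b\<bar> + \<bar>b - c\<bar>"
        using m k(2) unfolding k_def by linarith
      ultimately show ?thesis
        unfolding k by (simp add: algebra_simps)
    qed
    then show "sqz_dist e z v \<le> sqz_dist e z w + sqz_dist e w v"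
      unfolding sqz_dist_def abc ee m_def .
  qed
qed

lemma squeezed_lim_eventually_real:
  assumes "\<And>n. zs n \<in> squeezed X" "\<bar>snd z\<bar> \<noteq> \<infinity>" "(\<lambda>n. snd (zs n)) \<longlonglongrightarrow> snd z"
  shows "\<forall>\<^sub>F n in sequentially. \<bar>snd (zs n)\<bar> \<noteq> \<infinity>"
proof -
  have "-\<infinity> < snd z" "snd z < \<infinity>"
    using assms(2) by (cases "snd z"; simp)+
  then have "\<forall>\<^sub>F n in sequentially. -\<infinity> < snd (zs n) \<and> snd (zs n) < \<infinity>"
    by (intro eventually_conj order_tendstoD[OF assms(3)])
  then show ?thesis
    by (rule eventually_mono) auto
qed

lemma sqz_dist_lim_iff:
  assumes "Metric_space M e" and e1: "\<And>x y. e x y \<le> 1"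
    and zs: "\<And>n. zs n \<in> squeezed (Metric_space.mtopology M e)" "z \<in> squeezed (Metric_space.mtopology M e)"
  shows "null (\<lambda>n. sqz_dist e (zs n) z) \<longleftrightarrow> squeezed_lim (Metric_space.mtopology M e) zs z"
proof -
  interpret Metric_space M e by fact
  define g where "g n = squash (snd (zs n))" for n
  define b where "b = squash (snd z)"
  define m where "m n = min (1 - \<bar>g n\<bar>) (1 - \<bar>b\<bar>)" for n
  define E where "E n = e (the (fst (zs n))) (the (fst z))" for n
  have m0: "0 \<le> m n" for n
    using squash_le1 by (auto simp: m_def g_def b_def)
  have E: "0 \<le> E n" "E n \<le> 1" for n
    using e1 by (auto simp: E_def)
  have D: "sqz_dist e (zs n) z = \<bar>g n - b\<bar> + m n * E n" for n
    by (simp add: sqz_dist_def g_def b_def m_def E_def)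
  have time: "(\<lambda>n. snd (zs n)) \<longlonglongrightarrow> snd z \<longleftrightarrow> g \<longlonglongrightarrow> b"
    unfolding g_def b_def by (simp add: squash_tendsto_iff)
  have mlim: "m \<longlonglongrightarrow> 1 - \<bar>b\<bar>" if "g \<longlonglongrightarrow> b"
  proof -
    have "m \<longlonglongrightarrow> min (1 - \<bar>b\<bar>) (1 - \<bar>b\<bar>)"
      unfolding m_def using that by (intro tendsto_intros)
    then show ?thesis by simp
  qed
  show ?thesis
  proof
    assume L: "null (\<lambda>n. sqz_dist e (zs n) z)"
    have "null (\<lambda>n. g n - b)"
      by (rule Lim_null_comparison[OF always_eventually L]) (use m0 E in \<open>simp add: D\<close>)
    then have g: "g \<longlonglongrightarrow> b"
      using LIM_zero_iff by blast
    have "limitin mtopology (\<lambda>n. the (fst (zs n))) x sequentially" if z: "z = (Some x, ereal t)" for x t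
    proof -
      have x: "x \<in> M"
        using zs(2) z by simp
      have b: "0 < 1 - \<bar>b\<bar>"
        using squash_real_less1[of t] by (simp add: b_def z del: squash_simps(1))
      have "null (\<lambda>n. m n * E n)"
        by (rule Lim_null_comparison[OF always_eventually L]) (use m0 E in \<open>simp add: D\<close>)
      \<comment> \<open>At a real limiting time the weights have a positive limit, so dividing by
        them recovers the distances in the space, for all but finitely many
        \<open>n\<close>.\<close>
      then have "(\<lambda>n. m n * E n / m n) \<longlonglongrightarrow> 0 / (1 - \<bar>b\<bar>)"
        using b by (intro tendsto_divide mlim g) auto
      then have "null (\<lambda>n. m n * E n / m n)"
        by simp
      moreover have "\<forall>\<^sub>F n in sequentially. m n * E n / m n = E n"
        using order_tendstoD(1)[OF mlim[OF g] b] by (rule eventually_mono) simp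
      ultimately have "E \<longlonglongrightarrow> 0"
        by (rule Lim_transform_eventually)
      moreover have "\<forall>\<^sub>F n in sequentially. \<bar>snd (zs n)\<bar> \<noteq> \<infinity>"
        by (rule squeezed_lim_eventually_real[of zs mtopology z]) (use z zs(1) g time in auto)
      then have "\<forall>\<^sub>F n in sequentially. the (fst (zs n)) \<in> M"
        by (rule eventually_mono) (use squeezed_real(2)[OF zs(1)] in simp)
      ultimately show ?thesis
        using x unfolding limitin_metric_dist_null E_def z by simp
    qed
    then show "squeezed_lim mtopology zs z"
      unfolding squeezed_lim_def using g time by blast
  next
    assume L: "squeezed_lim mtopology zs z"
    then have g: "g \<longlonglongrightarrow> b"
      unfolding squeezed_lim_def time by blast
    have "null (\<lambda>n. \<bar>g n - b\<bar>)"
      using g by (simp add: tendsto_rabs_zero_iff LIM_zero)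
    moreover have "null (\<lambda>n. m n * E n)"
      using zs(2)
    proof (cases rule: squeezed_cases)
      case (1 x t)
      then have "limitin mtopology (\<lambda>n. the (fst (zs n))) x sequentially"
        using L unfolding squeezed_lim_def by blast
      then have "E \<longlonglongrightarrow> 0"
        unfolding limitin_metric_dist_null E_def 1 by simp
      then have "(\<lambda>n. m n * E n) \<longlonglongrightarrow> (1 - \<bar>b\<bar>) * 0"
        by (intro tendsto_mult mlim g)
      then show ?thesis by simp
    next
      case 2
      then have "m n = 0" for n
        using m0[of n] by (simp add: m_def b_def)
      then show ?thesis by simp
    next
      case 3
      then have "m n = 0" for n
        using m0[of n] by (simp add: m_def b_def)
      then show ?thesis by simp
    qed
    ultimately show "null (\<lambda>n. sqz_dist e (zs n) z)"
      unfolding D using tendsto_add by fastforce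
  qed
qed

lemma squeezed_topology_eq:
  assumes "Metric_space M e" and e1: "\<And>x y. e x y \<le> 1"
  shows "squeezed_topology (Metric_space.mtopology M e) =
    Metric_space.mtopology (squeezed (Metric_space.mtopology M e)) (sqz_dist e)"
proof -
  let ?X = "Metric_space.mtopology M e"
  interpret Z: Metric_space "squeezed ?X" "sqz_dist e"
    by (rule Metric_space_sqz_dist[OF assms])
  have lim: "limitin Z.mtopology zs z sequentially \<longleftrightarrow> squeezed_lim ?X zs z"
    if "range zs \<subseteq> squeezed ?X" "z \<in> squeezed ?X" for zs z
    using that Z.seq_limitin_iff[of zs z] sqz_dist_lim_iff[OF assms, of zs z] by blast
  show ?thesis
    unfolding squeezed_topology_def
  proof (rule the_equality)
    show "metrizable_space Z.mtopology \<and> topspace Z.mtopology = squeezed ?X \<and>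
      (\<forall>zs z. range zs \<subseteq> squeezed ?X \<and> z \<in> squeezed ?X \<longrightarrow>
        limitin Z.mtopology zs z sequentially = squeezed_lim ?X zs z)"
      using lim Z.metrizable_space_mtopology by simp
    fix T assume T: "metrizable_space T \<and> topspace T = squeezed ?X \<and>
      (\<forall>zs z. range zs \<subseteq> squeezed ?X \<and> z \<in> squeezed ?X \<longrightarrow>
        limitin T zs z sequentially = squeezed_lim ?X zs z)"
    show "T = Z.mtopology"
      by (rule metrizable_topology_eqI) (use T lim Z.metrizable_space_mtopology in auto)
  qed
qed

lemma metrizable_capped:
  assumes "metrizable_space X"
  shows "\<exists>M e. Metric_space M e \<and> (\<forall>x y. e x y \<le> (1::real)) \<and> X = Metric_space.mtopology M e"
proof -
  obtain M e where M: "Metric_space M e" and X: "X = Metric_space.mtopology M e"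
    using assms unfolding metrizable_space_def by blast
  interpret Metric_space M e by fact
  have "\<forall>x y. capped_dist 1 x y \<le> 1"
    by (simp add: capped_dist_def)
  then show ?thesis
    using capped_dist[of 1] mtopology_capped_metric[of 1] X by metis
qed

text \<open>Metrics that generate the same topology have the same convergent sequences, so the
  explicit metric decides for all of them. The limit rules for an arbitrary \<open>d\<close> below
  are derived from this criterion.\<close>

lemma squeezed_lim_iff:
  assumes X: "metrizable_space X" and d: "metric_generates (squeezed X) d (squeezed_topology X)"
    and zs: "\<And>n. zs n \<in> squeezed X" "z \<in> squeezed X"
  shows "null (\<lambda>n. d (zs n) z) \<longleftrightarrow> squeezed_lim X zs z"
proof -
  obtain M e where e: "Metric_space M e" "\<And>x y. e x y \<le> (1::real)" "X = Metric_space.mtopology M e"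
    using metrizable_capped[OF X] by blast
  have "metric_generates (squeezed X) (sqz_dist e) (squeezed_topology X)"
    using Metric_space_sqz_dist[OF e(1,2)] squeezed_topology_eq[OF e(1,2)] e(3)
    by (simp add: metric_generates_def)
  then have "null (\<lambda>n. d (zs n) z) \<longleftrightarrow> null (\<lambda>n. sqz_dist e (zs n) z)"
    by (rule metric_generates_tendsto_iff[OF d _ zs])
  also have "\<dots> \<longleftrightarrow> squeezed_lim X zs z"
    using sqz_dist_lim_iff[OF e(1,2)] zs e(3) by simp
  finally show ?thesis .
qed

text \<open>Along a Cauchy sequence the squashed times converge. If their limit is 1 or -1, the
  sequence converges to a point at infinity, whatever its first coordinates do. Otherwise the
  weights stay away from zero, and the first coordinates are Cauchy from some index on. For density,
  rational times are combined with a dense subset of \<open>X\<close>.\<close>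

lemma polish_squeezed:
  assumes "polish X"
  obtains d where "metric_generates (squeezed X) d (squeezed_topology X)"
    "Metric_space.mcomplete (squeezed X) d" "separable_space (squeezed_topology X)"
proof -
  obtain M e0 where e0: "Metric_space M e0" "Metric_space.mcomplete M e0" "X = Metric_space.mtopology M e0"
    using assms unfolding polish_def completely_metrizable_space_def by blast
  define e where "e = Metric_space.capped_dist e0 1"
  have eM: "Metric_space M e" and X: "X = Metric_space.mtopology M e" and ec: "Metric_space.mcomplete M e"
    and e1: "\<And>x y. e x y \<le> 1"
    unfolding e_def using e0(2,3) Metric_space.capped_dist[OF e0(1)] Metric_space.mtopology_capped_metric[OF e0(1)]
      Metric_space.mcomplete_capped_metric[OF e0(1)]
    by (simp_all, simp add: Metric_space.capped_dist_def[OF e0(1)])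
  interpret Metric_space M e by fact
  interpret Z: Metric_space "squeezed X" "sqz_dist e"
    using Metric_space_sqz_dist[OF eM e1] X by simp
  have top: "squeezed_topology X = Z.mtopology"
    using squeezed_topology_eq[OF eM e1] X by simp
  have lim: "null (\<lambda>n. sqz_dist e (zs n) z) \<longleftrightarrow> squeezed_lim X zs z"
    if "\<And>n. zs n \<in> squeezed X" "z \<in> squeezed X" for zs z
    using sqz_dist_lim_iff[OF eM e1] that X by simp
  have X_M [simp]: "topspace X = M"
    using X by simp
  have "Z.mcomplete"
    unfolding Z.mcomplete_def
  proof (intro allI impI)
    fix zs assume C: "Z.MCauchy zs"
    then have zs: "\<And>n. zs n \<in> squeezed X"
      and cau: "\<And>\<epsilon>. \<epsilon> > 0 \<Longrightarrow> \<exists>N. \<forall>n n'. N \<le> n \<longrightarrow> N \<le> n' \<longrightarrow> sqz_dist e (zs n) (zs n') < \<epsilon>"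
      unfolding Z.MCauchy_def by auto
    define g where "g n = squash (snd (zs n))" for n
    have gD: "\<bar>g n - g k\<bar> \<le> sqz_dist e (zs n) (zs k)" for n k
      using squash_le1[of "snd (zs n)"] squash_le1[of "snd (zs k)"] by (simp add: sqz_dist_def g_def)
    have "Cauchy g"
      unfolding Cauchy_def dist_real_def
    proof (intro allI impI)
      fix \<epsilon> :: real assume "\<epsilon> > 0"
      then obtain N where "\<forall>n n'. N \<le> n \<longrightarrow> N \<le> n' \<longrightarrow> sqz_dist e (zs n) (zs n') < \<epsilon>"
        using cau by blast
      then show "\<exists>N. \<forall>n\<ge>N. \<forall>k\<ge>N. \<bar>g n - g k\<bar> < \<epsilon>"
        using gD by (meson le_less_trans)
    qed
    then obtain L where L: "g \<longlonglongrightarrow> L"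
      using Cauchy_convergent convergent_def by blast
    have absL: "\<bar>L\<bar> \<le> 1"
      by (rule LIMSEQ_le_const2[OF tendsto_rabs[OF L]]) (use squash_le1 in \<open>auto simp: g_def\<close>)
    have "\<exists>z\<in>squeezed X. squeezed_lim X zs z"
    proof (cases "\<bar>L\<bar> = 1")
      case True
      define z :: "'a sqz" where "z = (None, if L = 1 then \<infinity> else -\<infinity>)"
      have "squash (snd z) = L"
        using True by (auto simp: z_def)
      then have "(\<lambda>n. snd (zs n)) \<longlonglongrightarrow> snd z"
        using L squash_tendsto_iff[of "\<lambda>n. snd (zs n)"] unfolding g_def by metis
      then show ?thesis
        by (intro bexI[of _ z]) (auto simp: squeezed_lim_def z_def)
    next
      case False
      then obtain t where t: "squash (ereal t) = L"
        using squash_surj[of L] absL by (metis order_less_le)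
      then have tl: "(\<lambda>n. snd (zs n)) \<longlonglongrightarrow> ereal t"
        using L squash_tendsto_iff[of "\<lambda>n. snd (zs n)"] unfolding g_def by metis
      \<comment> \<open>Half the limiting weight: an eventual lower bound for the weights, so that
        distances in \<open>X\<close> are at most \<open>1 / c\<close> times the squeezed
        ones.\<close>
      define c where "c = (1 - \<bar>L\<bar>) / 2"
      have c: "0 < c" "c < 1 - \<bar>L\<bar>"
        using False absL by (auto simp: c_def)
      have "(\<lambda>n. 1 - \<bar>g n\<bar>) \<longlonglongrightarrow> 1 - \<bar>L\<bar>"
        by (intro tendsto_intros L)
      then have "\<forall>\<^sub>F n in sequentially. c < 1 - \<bar>g n\<bar>"
        using c order_tendstoD(1) by blast
      then obtain N where N: "\<And>n. n \<ge> N \<Longrightarrow> c < 1 - \<bar>g n\<bar>"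
        unfolding eventually_sequentially by blast
      define xs where "xs n = the (fst (zs (n + N)))" for n
      have xsM: "xs n \<in> M" for n
        using N[of "n + N"] c squeezed_weight[OF zs[of "n + N"]] squeezed_real(2)[OF zs[of "n + N"]]
        by (auto simp: xs_def g_def)
      have "MCauchy xs"
        unfolding MCauchy_def
      proof (intro conjI allI impI)
        show "range xs \<subseteq> M"
          using xsM by blast
        fix \<epsilon> :: real assume "\<epsilon> > 0"
        then have "\<epsilon> * c > 0"
          using c by simp
        then obtain K where K: "\<And>n k. K \<le> n \<Longrightarrow> K \<le> k \<Longrightarrow> sqz_dist e (zs n) (zs k) < \<epsilon> * c"
          using cau by blast
        have "e (xs n) (xs k) < \<epsilon>" if nk: "K \<le> n" "K \<le> k" for n k
        proof -
          have "c * e (xs n) (xs k) \<le> min (1 - \<bar>g (n + N)\<bar>) (1 - \<bar>g (k + N)\<bar>) * e (xs n) (xs k)"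
            using N[of "n + N"] N[of "k + N"] by (intro mult_right_mono) auto
          also have "\<dots> \<le> sqz_dist e (zs (n + N)) (zs (k + N))"
            by (simp add: sqz_dist_def xs_def g_def)
          also have "\<dots> < \<epsilon> * c"
            using K nk by simp
          finally show ?thesis
            using c by (simp add: mult.commute)
        qed
        then show "\<exists>N. \<forall>n n'. N \<le> n \<longrightarrow> N \<le> n' \<longrightarrow> e (xs n) (xs n') < \<epsilon>"
          by blast
      qed
      then obtain x where x: "limitin mtopology xs x sequentially"
        using ec unfolding mcomplete_def by blast
      then have "limitin X (\<lambda>n. the (fst (zs n))) x sequentially"
        unfolding X xs_def by (rule limitin_sequentially_offset_rev)
      then show ?thesis
        using tl limitin_mspace[OF x] by (intro bexI[of _ "(Some x, ereal t)"]) (auto simp: squeezed_lim_def)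
    qed
    then obtain z where "z \<in> squeezed X" "squeezed_lim X zs z"
      by blast
    then have "limitin Z.mtopology zs z sequentially"
      using Z.seq_limitin_iff[of zs z] lim[of zs z] zs by blast
    then show "\<exists>x. limitin Z.mtopology zs x sequentially"
      by blast
  qed
  moreover have "separable_space Z.mtopology"
  proof -
    obtain C where C: "countable C" "C \<subseteq> M" "\<And>x \<epsilon>. x \<in> M \<Longrightarrow> \<epsilon> > 0 \<Longrightarrow> \<exists>c\<in>C. e x c < \<epsilon>"
      using assms unfolding polish_def X separable_space_metric[OF eM] by blast
    define D where "D = (\<lambda>(c, q). (Some c, ereal q)) ` (C \<times> \<rat>) \<union> {(None, -\<infinity>), (None, \<infinity>)}"
    have "countable D"
      unfolding D_def using C(1) countable_rat by (intro countable_Un countable_image countable_SIGMA) auto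
    moreover have "D \<subseteq> squeezed X"
      using C(2) by (auto simp: D_def)
    moreover have "\<exists>c\<in>D. sqz_dist e z c < \<epsilon>" if z: "z \<in> squeezed X" and \<epsilon>: "\<epsilon> > 0" for z \<epsilon>
      using z
    proof (cases rule: squeezed_cases)
      case (1 x t)
      have "\<exists>c\<in>C. e x c < 1 / real (Suc n)" for n
        using C(3) 1(2) by simp
      then obtain c where c: "\<And>n. c n \<in> C" "\<And>n. e x (c n) < 1 / real (Suc n)"
        by metis
      have "\<exists>q\<in>\<rat>. t < q \<and> q < t + 1 / real (Suc n)" for n
        using Rats_dense_in_real[of t "t + 1 / real (Suc n)"] by simp
      then obtain q where q: "\<And>n. q n \<in> \<rat>" "\<And>n. t < q n" "\<And>n. q n < t + 1 / real (Suc n)"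
        by metis
      define zs where "zs n = (Some (c n), ereal (q n))" for n
      have zsX: "zs n \<in> squeezed X" "zs n \<in> D" for n
        using c(1) q(1) C(2) by (auto simp: zs_def D_def)
      have "null (\<lambda>n. q n - t)"
      proof (rule Lim_null_comparison[OF always_eventually lim_1_over_Suc], intro allI)
        show "norm (q n - t) \<le> 1 / real (Suc n)" for n
          using q(2)[of n] q(3)[of n] unfolding real_norm_def by linarith
      qed
      then have "q \<longlonglongrightarrow> t"
        using LIM_zero_iff by blast
      moreover have "null (\<lambda>n. e (c n) x)"
        by (rule Lim_null_comparison[OF always_eventually lim_1_over_Suc])
          (use c(2) in \<open>simp add: commute less_imp_le\<close>)
      then have "limitin X c x sequentially"
        unfolding X using seq_limitin_iff[of c x] c(1) C(2) 1(2) by auto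
      ultimately have "squeezed_lim X zs z"
        unfolding squeezed_lim_def zs_def 1 by simp
      then have "null (\<lambda>n. sqz_dist e (zs n) z)"
        using lim[of zs z] zsX z by blast
      then have "\<forall>\<^sub>F n in sequentially. sqz_dist e (zs n) z < \<epsilon>"
        using \<epsilon> order_tendstoD(2) by blast
      then obtain n where "sqz_dist e (zs n) z < \<epsilon>"
        using eventually_sequentially by auto
      then show ?thesis
        using zsX(2) Z.commute by metis
    next
      case 2
      then have "sqz_dist e z z < \<epsilon>" "z \<in> D"
        using z \<epsilon> by (auto simp: D_def)
      then show ?thesis by blast
    next
      case 3
      then have "sqz_dist e z z < \<epsilon>" "z \<in> D"
        using z \<epsilon> by (auto simp: D_def)
      then show ?thesis by blast
    qed
    ultimately show ?thesis
      unfolding separable_space_metric[OF Z.Metric_space_axioms] by blast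
  qed
  ultimately show thesis
    using that[of "sqz_dist e"] Z.Metric_space_axioms top by (simp add: metric_generates_def)
qed

section \<open>Betweenness\<close>

locale between =
  fixes M :: "'a set" and B :: "'a \<Rightarrow> 'a \<Rightarrow> 'a set"
  assumes betweenness: "betweenness M B"
begin

lemma bt_all:
  assumes "x \<in> M" "z \<in> M"
  shows "B x z \<subseteq> M \<and> B x z = B z x \<and> x \<in> B x z \<and>
    (\<forall>y\<in>B x z. B x y \<inter> B y z = {y} \<and> B x y \<union> B y z = B x z)"
  using betweenness[unfolded betweenness_def, rule_format, OF assms] .

lemma bt_subset: "x \<in> M \<Longrightarrow> z \<in> M \<Longrightarrow> B x z \<subseteq> M"
  and bt_sym: "x \<in> M \<Longrightarrow> z \<in> M \<Longrightarrow> B x z = B z x"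
  and bt_left: "x \<in> M \<Longrightarrow> z \<in> M \<Longrightarrow> x \<in> B x z"
  and bt_Int: "x \<in> M \<Longrightarrow> z \<in> M \<Longrightarrow> y \<in> B x z \<Longrightarrow> B x y \<inter> B y z = {y}"
  and bt_Un: "x \<in> M \<Longrightarrow> z \<in> M \<Longrightarrow> y \<in> B x z \<Longrightarrow> B x y \<union> B y z = B x z"
  using bt_all[of x z] by metis+

lemma bt_right: "x \<in> M \<Longrightarrow> z \<in> M \<Longrightarrow> z \<in> B x z"
  using bt_left bt_sym by blast

lemma bt_self: "x \<in> M \<Longrightarrow> B x x = {x}"
  using bt_Int[of x x x] bt_left[of x x] by blast

lemma bt_antisym:
  assumes "x \<in> M" "y \<in> M" "y' \<in> M" "y \<in> B x y'" "y' \<in> B x y"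
  shows "y = y'"
proof -
  have "y \<in> B x y \<inter> B y y'" "y' \<in> B x y \<inter> B y y'"
    using assms bt_right bt_left by blast+
  moreover have "B x y \<inter> B y y' = {y}"
    using bt_Int assms by blast
  ultimately show ?thesis by simp
qed

lemma bt_trans:
  assumes "x \<in> M" "y \<in> M" "y' \<in> M" "y \<in> B x y'" "w \<in> B x y"
  shows "w \<in> B x y'"
  using bt_Un[of x y' y] assms by blast

text \<open>If neither holds, each of the two points lies between the other one and
  \<open>z\<close>, which antisymmetry forbids when the segment is read from
  \<open>z\<close>.\<close>

lemma bt_total:
  assumes "x \<in> M" "z \<in> M" "y \<in> B x z" "y' \<in> B x z"
  shows "y \<in> B x y' \<or> y' \<in> B x y"
proof (rule ccontr)
  assume *: "\<not> ?thesis"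
  have M: "y \<in> M" "y' \<in> M"
    using assms bt_subset by blast+
  have "y' \<in> B y z" "y \<in> B y' z"
    using * bt_Un[OF assms(1-3)] bt_Un[OF assms(1,2,4)] assms by blast+
  then have "y \<in> B z y'" "y' \<in> B z y"
    using bt_sym M assms by blast+
  then have "y = y'"
    using bt_antisym M assms by blast
  then show False
    using * bt_right M assms by blast
qed

text \<open>Cutting \<open>B x w\<close> at \<open>u\<close> puts \<open>y\<close> on one of the two
  pieces; if the piece is \<open>B x u\<close>, then \<open>u\<close> and \<open>y\<close> precede
  each other and coincide. This is the source of the fourth clause of
  \<open>good_order\<close>.\<close>

lemma bt_sub_middle:
  assumes "x \<in> M" "w \<in> M" "y \<in> B x w" "u \<in> B x y"
  shows "y \<in> B u w"
proof -
  have M: "y \<in> M" "u \<in> M"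
    using assms bt_subset by blast+
  have u: "u \<in> B x w"
    using bt_trans[of x y w u] assms M by blast
  then have "y \<in> B x u \<or> y \<in> B u w"
    using bt_Un[of x w u] assms by blast
  then show ?thesis
    using bt_antisym[of x y u] assms M bt_left by blast
qed

text \<open>Two points of a segment are comparable, so the segment can be cut at the later one and
  the initial piece once more at the earlier one.\<close>

lemma bt_sub_segment:
  assumes "l \<in> M" "r \<in> M" "x \<in> B l r" "w \<in> B l r"
  shows "B x w \<subseteq> B l r"
proof -
  have *: "B u v \<subseteq> B l r" if "u \<in> B l v" "v \<in> B l r" for u v
  proof -
    have M: "v \<in> M" "u \<in> M"
      using that assms bt_subset by blast+
    then show ?thesis
      using bt_Un[of l v u] bt_Un[of l r v] that assms by blast
  qed
  have "x \<in> M" "w \<in> M"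
    using assms bt_subset by blast+
  then show ?thesis
    using bt_total[OF assms] *[of x w] *[of w x] assms bt_sym by blast
qed

end

section \<open>Filled paths\<close>

locale path_space =
  fixes X :: "'a topology" and B :: "'a \<Rightarrow> 'a \<Rightarrow> 'a set" and d :: "'a sqz \<Rightarrow> 'a sqz \<Rightarrow> real"
  assumes X: "metrizable_space X" and proper: "proper_betweenness X B"
    and d: "metric_generates (squeezed X) d (squeezed_topology X)"
begin

abbreviation fl :: "'a path \<Rightarrow> 'a sqz set" where
  "fl \<equiv> filled B"

abbreviation fo :: "'a path \<Rightarrow> 'a sqz rel" where
  "fo \<equiv> filled_order B"

sublocale Z: Metric_space "squeezed X" d
  using d by (simp add: metric_generates_def)

sublocale between "topspace X" B
  using proper by unfold_locales (simp add: proper_betweenness_def)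

lemma mtop: "Z.mtopology = squeezed_topology X"
  using d by (simp add: metric_generates_def)

section \<open>Limits in the squeezed space and limits of segments\<close>

lemma lim_time:
  assumes "\<And>n. \<sigma> n \<in> squeezed X" "z \<in> squeezed X" "null (\<lambda>n. d (\<sigma> n) z)"
  shows "(\<lambda>n. snd (\<sigma> n)) \<longlonglongrightarrow> snd z"
  using squeezed_lim_iff[OF X d assms(1,2)] assms(3) by (simp add: squeezed_lim_def)

lemma lim_val:
  assumes "\<And>n. \<sigma> n \<in> squeezed X" "(Some x, ereal t) \<in> squeezed X" "null (\<lambda>n. d (\<sigma> n) (Some x, ereal t))"
  shows "limitin X (\<lambda>n. the (fst (\<sigma> n))) x sequentially"
  using squeezed_lim_iff[OF X d assms(1,2)] assms(3) by (simp add: squeezed_lim_def)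

lemma lim_inf:
  assumes "\<And>n. \<sigma> n \<in> squeezed X" "(None, t) \<in> squeezed X" "(\<lambda>n. snd (\<sigma> n)) \<longlonglongrightarrow> t"
  shows "null (\<lambda>n. d (\<sigma> n) (None, t))"
  using squeezed_lim_iff[OF X d assms(1,2)] assms(3) by (simp add: squeezed_lim_def)

lemma lim_real:
  assumes "\<And>n. \<sigma> n \<in> squeezed X" "x \<in> topspace X" "(\<lambda>n. snd (\<sigma> n)) \<longlonglongrightarrow> ereal t"
    "limitin X (\<lambda>n. the (fst (\<sigma> n))) x sequentially"
  shows "null (\<lambda>n. d (\<sigma> n) (Some x, ereal t))"
  using squeezed_lim_iff[OF X d assms(1), of "(Some x, ereal t)"] assms by (simp add: squeezed_lim_def)

text \<open>Every later use of the continuity of the betweenness passes through this form. The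
  metric \<open>e\<close> is existential because \<open>proper_betweenness\<close> provides some
  generating metric of \<open>X\<close>, not a prescribed one.\<close>

lemma between_seq:
  assumes M: "\<And>n. xs n \<in> topspace X" "\<And>n. zs n \<in> topspace X"
    and lim: "limitin X xs x sequentially" "limitin X zs z sequentially"
  shows "\<exists>e \<delta>. Metric_space (topspace X) e \<and> Metric_space.mtopology (topspace X) e = X \<and>
    \<delta> \<longlonglongrightarrow> 0 \<and> (\<forall>n. hclose e (\<delta> n) (B (xs n) (zs n)) (B x z))"
proof -
  obtain e where e: "metric_generates (topspace X) e X" and
    cont: "continuous_map (prod_topology X X)
          (Metric_space.mtopology (nonempty_compacts X) (hausdorff_dist X e)) (\<lambda>(x, z). B x z)"
    using proper unfolding proper_betweenness_def by blast
  have ms: "Metric_space (topspace X) e" and top: "Metric_space.mtopology (topspace X) e = X"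
    using e by (auto simp: metric_generates_def)
  interpret E: Metric_space "topspace X" e by fact
  interpret H: Metric_space "nonempty_compacts X" "hausdorff_dist X e"
    using E.Metric_space_hausdorff_dist top by simp
  have seg: "B x z \<in> nonempty_compacts X" if "x \<in> topspace X" "z \<in> topspace X" for x z
    using that proper bt_left unfolding proper_betweenness_def nonempty_compacts_def by blast
  have "\<exists>\<delta>. \<delta> \<longlonglongrightarrow> 0 \<and> (\<forall>n. hclose e (\<delta> n) (B (xs n) (zs n)) (B x z))"
  proof -
    have xz: "x \<in> topspace X" "z \<in> topspace X"
      using lim[THEN limitin_topspace] .
    have "limitin (prod_topology X X) (\<lambda>n. (xs n, zs n)) (x, z) sequentially"
      using lim by (simp add: limitin_pairwise o_def)
    then have "limitin H.mtopology ((\<lambda>(x, z). B x z) \<circ> (\<lambda>n. (xs n, zs n))) ((\<lambda>(x, z). B x z) (x, z)) sequentially"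
      by (rule continuous_map_limit[OF cont])
    then have "null (\<lambda>n. hausdorff_dist X e (B (xs n) (zs n)) (B x z))"
      by (simp add: H.limitin_metric_dist_null o_def)
    \<comment> \<open>The extra summand makes the bound strict, as
      \<open>hausdorff_dist_less\<close> requires, and still tends to 0.\<close>
    then have "null (\<lambda>n. hausdorff_dist X e (B (xs n) (zs n)) (B x z) + 1 / real (Suc n))"
      using tendsto_add[OF _ lim_1_over_Suc] by fastforce
    moreover have "hclose e (hausdorff_dist X e (B (xs n) (zs n)) (B x z) + 1 / real (Suc n)) (B (xs n) (zs n)) (B x z)" for n
      using E.hausdorff_dist_less[unfolded top, OF seg[OF M(1) M(2)] seg[OF xz]] by simp
    ultimately show ?thesis
      by blast
  qed
  with ms top show ?thesis
    by blast
qed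

lemma between_approx:
  assumes "\<And>n. xs n \<in> topspace X" "\<And>n. zs n \<in> topspace X"
    "limitin X xs x sequentially" "limitin X zs z sequentially" "y \<in> B x z"
  shows "\<exists>ys. (\<forall>n. ys n \<in> B (xs n) (zs n)) \<and> limitin X ys y sequentially"
proof -
  obtain e \<delta> where e: "Metric_space (topspace X) e" "Metric_space.mtopology (topspace X) e = X"
    and \<delta>: "\<delta> \<longlonglongrightarrow> 0" "\<And>n. hclose e (\<delta> n) (B (xs n) (zs n)) (B x z)"
    using between_seq[OF assms(1-4)] by blast
  interpret E: Metric_space "topspace X" e by fact
  have "\<exists>y'. y' \<in> B (xs n) (zs n) \<and> e y' y \<le> \<delta> n" for n
    using \<delta>(2)[of n] assms(5) unfolding hclose_def by blast
  then obtain ys where ys: "\<And>n. ys n \<in> B (xs n) (zs n)" "\<And>n. e (ys n) y \<le> \<delta> n"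
    by metis
  have "x \<in> topspace X" "z \<in> topspace X"
    using assms(3,4)[THEN limitin_topspace] .
  then have y: "y \<in> topspace X"
    using assms(5) bt_subset by blast
  have ysM: "ys n \<in> topspace X" for n
    using ys(1)[of n] bt_subset[OF assms(1,2)[of n]] by blast
  have "null (\<lambda>n. e (ys n) y)"
    by (rule Lim_null_comparison[OF always_eventually \<delta>(1)]) (use ys(2) in simp)
  then have "limitin X ys y sequentially"
    using E.seq_limitin_iff[of ys y] ysM y e(2) by simp
  then show ?thesis
    using ys(1) by blast
qed

lemma between_compact:
  assumes M: "\<And>n. xs n \<in> topspace X" "\<And>n. zs n \<in> topspace X"
    and "limitin X xs x sequentially" "limitin X zs z sequentially" and ys: "\<And>n. ys n \<in> B (xs n) (zs n)"
  shows "\<exists>y\<in>B x z. \<exists>r. subseq r \<and> limitin X (\<lambda>n. ys (r n)) y sequentially"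
proof -
  obtain e \<delta> where e: "Metric_space (topspace X) e" "Metric_space.mtopology (topspace X) e = X"
    and \<delta>: "\<delta> \<longlonglongrightarrow> 0" "\<And>n. hclose e (\<delta> n) (B (xs n) (zs n)) (B x z)"
    using between_seq[OF assms(1-4)] by blast
  interpret E: Metric_space "topspace X" e by fact
  have xz: "x \<in> topspace X" "z \<in> topspace X"
    using assms(3,4)[THEN limitin_topspace] .
  have "\<exists>y'. y' \<in> B x z \<and> e (ys n) y' \<le> \<delta> n" for n
    using \<delta>(2)[of n] ys[of n] unfolding hclose_def by blast
  then obtain vs where vs: "\<And>n. vs n \<in> B x z" "\<And>n. e (ys n) (vs n) \<le> \<delta> n"
    by metis
  have ysM: "ys n \<in> topspace X" for n
    using ys[of n] bt_subset[OF M[of n]] by blast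
  have comp: "compactin E.mtopology (B x z)"
    using proper xz e(2) unfolding proper_betweenness_def by simp
  have "null (\<lambda>n. e (vs n) (ys n))"
    by (rule Lim_null_comparison[OF always_eventually \<delta>(1)]) (use vs(2) E.commute in simp)
  then obtain l r where lr: "l \<in> B x z" "strict_mono r" "null (\<lambda>n. e (ys (r n)) l)"
    by (rule E.compact_near_seq[OF comp vs(1) ysM])
  then have "limitin X (\<lambda>n. ys (r n)) l sequentially"
    using E.seq_limitin_iff[of "\<lambda>n. ys (r n)" l] ysM bt_subset[OF xz] e(2) by auto
  then show ?thesis
    using lr by blast
qed

lemma limitin_subseq:
  assumes "limitin X f l sequentially" "subseq r"
  shows "limitin X (\<lambda>n. f (r n)) l sequentially"
  using limitin_subsequence[OF assms(2,1)] by (simp add: o_def)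

lemma between_closed:
  assumes M: "\<And>n. xs n \<in> topspace X" "\<And>n. zs n \<in> topspace X"
    and "limitin X xs x sequentially" "limitin X zs z sequentially" "\<And>n. ys n \<in> B (xs n) (zs n)"
    and "limitin X ys y sequentially"
  shows "y \<in> B x z"
proof -
  obtain y' r where y': "y' \<in> B x z" "subseq r" "limitin X (\<lambda>n. ys (r n)) y' sequentially"
    using between_compact[OF assms(1-5)] by blast
  have "limitin X (\<lambda>n. ys (r n)) y sequentially"
    by (rule limitin_subseq[OF assms(6) y'(2)])
  then have "y = y'"
    using limitin_Hausdorff_unique[OF _ y'(3) trivial_limit_sequentially metrizable_imp_Hausdorff_space[OF X]]
    by simp
  then show ?thesis
    using y'(1) by simp
qed

section \<open>Paths as compact chains and their fibres over a time\<close>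

lemma path_corder:
  assumes "p \<in> paths X"
  shows "Z.corder (fst p) (snd p)"
proof -
  obtain \<pi> le where p: "p = (\<pi>, le)"
    by (cases p)
  have *: "\<pi> \<noteq> {}" "compactin Z.mtopology \<pi>" "linear_order_on \<pi> le"
    "closedin (prod_topology (subtopology Z.mtopology \<pi>) (subtopology Z.mtopology \<pi>)) le"
    using assms unfolding paths_def p mtop by auto
  have sub: "\<pi> \<subseteq> squeezed X"
    using * Z.compact_subset by blast
  show ?thesis
    unfolding p fst_conv snd_conv Z.corder_def
  proof (intro conjI allI impI)
    fix \<sigma> \<tau> :: "nat \<Rightarrow> 'a sqz" and x y
    assume le: "\<forall>n. (\<sigma> n, \<tau> n) \<in> le" and xy: "x \<in> \<pi>" "y \<in> \<pi>"
      and lim: "null (\<lambda>n. d (\<sigma> n) x)" "null (\<lambda>n. d (\<tau> n) y)"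
    have "le \<subseteq> \<pi> \<times> \<pi>"
      using *(3) unfolding linear_order_on_def partial_order_on_def preorder_on_def by blast
    then have \<sigma>\<tau>: "\<sigma> n \<in> \<pi>" "\<tau> n \<in> \<pi>" for n
      using le by blast+
    have "limitin (subtopology Z.mtopology \<pi>) \<sigma> x sequentially"
      unfolding limitin_subtopology using Z.seq_limitin_iff[of \<sigma> x] \<sigma>\<tau> xy sub lim by auto
    moreover have "limitin (subtopology Z.mtopology \<pi>) \<tau> y sequentially"
      unfolding limitin_subtopology using Z.seq_limitin_iff[of \<tau> y] \<sigma>\<tau> xy sub lim by auto
    ultimately have "limitin (prod_topology (subtopology Z.mtopology \<pi>) (subtopology Z.mtopology \<pi>))
        (\<lambda>n. (\<sigma> n, \<tau> n)) (x, y) sequentially"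
      unfolding limitin_pairwise o_def by simp
    then show "(x, y) \<in> le"
      by (rule limitin_closedin[OF _ *(4)]) (use le in auto)
  qed (use * in auto)
qed

lemma path_sub: "p \<in> paths X \<Longrightarrow> fst p \<subseteq> squeezed X"
  by (rule Z.corder_subset[OF path_corder])

lemma path_time:
  assumes "p \<in> paths X" "z \<in> fst p" "w \<in> fst p" "snd z < snd w"
  shows "(z, w) \<in> snd p"
  using assms unfolding paths_def by auto

lemma times_iff:
  assumes "p \<in> paths X"
  shows "t \<in> times p \<longleftrightarrow> (\<exists>x. (Some x, ereal t) \<in> fst p)"
proof
  assume "t \<in> times p"
  then obtain z where z: "z \<in> fst p" "snd z = ereal t"
    by (auto simp: times_def ext_times_def)
  then have "z = (Some (the (fst z)), ereal t)"
    using squeezed_real(1)[of z X] path_sub[OF assms] by auto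
  then show "\<exists>x. (Some x, ereal t) \<in> fst p"
    using z(1) by metis
next
  assume "\<exists>x. (Some x, ereal t) \<in> fst p"
  then show "t \<in> times p"
    by (force simp: times_def ext_times_def image_iff)
qed

lemma ext_times_iff:
  assumes "p \<in> paths X"
  shows "t \<in> ext_times p - ereal ` times p \<longleftrightarrow> \<bar>t\<bar> = \<infinity> \<and> (None, t) \<in> fst p"
proof
  assume t: "t \<in> ext_times p - ereal ` times p"
  then obtain z where z: "z \<in> fst p" "snd z = t"
    by (auto simp: ext_times_def)
  have "\<bar>t\<bar> = \<infinity>"
    using t by (cases t) (auto simp: times_def)
  then show "\<bar>t\<bar> = \<infinity> \<and> (None, t) \<in> fst p"
    using squeezed_inf[of z X] path_sub[OF assms] z by auto
next
  assume "\<bar>t\<bar> = \<infinity> \<and> (None, t) \<in> fst p"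
  then show "t \<in> ext_times p - ereal ` times p"
    by (force simp: ext_times_def image_iff)
qed

text \<open>The values at time \<open>t\<close> are comparable, hence can be named in order, and
  antisymmetry makes the naming unique. So the descriptions in \<open>path_left\<close> and
  \<open>path_right\<close> are proper; a single value plays both parts.\<close>

lemma path_values_exist:
  assumes p: "p \<in> paths X" and t: "t \<in> times p"
  shows "path_values p t (path_left p t) (path_right p t)"
proof -
  define S where "S = {x. (Some x, ereal t) \<in> fst p}"
  have S: "finite S" "card S \<le> 2" "S \<noteq> {}"
    using p t times_iff[OF p] unfolding S_def paths_def by auto
  have ord: "Z.corder (fst p) (snd p)"
    by (rule path_corder[OF p])
  have "\<exists>l r. path_values p t l r"
  proof -
    have "card S = 1 \<or> card S = 2"
      using S by (metis One_nat_def Suc_1 card_0_eq le_Suc_eq le_zero_eq)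
    then obtain x y where xy: "S = {x, y}"
      by (metis card_1_singletonE card_2_iff insert_absorb2)
    then have "(Some x, ereal t) \<in> fst p" "(Some y, ereal t) \<in> fst p"
      unfolding S_def by blast+
    then have "((Some x, ereal t), (Some y, ereal t)) \<in> snd p \<or> ((Some y, ereal t), (Some x, ereal t)) \<in> snd p"
      using Z.corder_total[OF ord] by blast
    then have "path_values p t x y \<or> path_values p t y x"
      using xy unfolding path_values_def S_def[symmetric] by blast
    then show ?thesis by blast
  qed
  then obtain l r where lr: "path_values p t l r"
    by blast
  have uniq: "l' = l \<and> r' = r" if "path_values p t l' r'" for l' r'
  proof -
    have "{l', r'} = {l, r}"
      using lr that by (simp add: path_values_def)
    moreover have "((Some l, ereal t), (Some r, ereal t)) \<in> snd p" "((Some l', ereal t), (Some r', ereal t)) \<in> snd p"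
      using lr that by (simp_all add: path_values_def)
    ultimately show ?thesis
      using Z.corder_antisym[OF ord] by (metis doubleton_eq_iff option.inject prod.inject)
  qed
  have "path_left p t = l" "path_right p t = r"
    unfolding path_left_def path_right_def by (rule the_equality; use lr uniq in blast)+
  then show ?thesis
    using lr by simp
qed

lemma path_fibre:
  assumes "p \<in> paths X"
  shows "(Some x, ereal t) \<in> fst p \<longleftrightarrow> t \<in> times p \<and> (x = path_left p t \<or> x = path_right p t)"
  using path_values_exist[OF assms, of t] times_iff[OF assms, of t] unfolding path_values_def by blast

lemma path_left_right:
  assumes "p \<in> paths X" "t \<in> times p"
  shows "(Some (path_left p t), ereal t) \<in> fst p" "(Some (path_right p t), ereal t) \<in> fst p"
    "((Some (path_left p t), ereal t), (Some (path_right p t), ereal t)) \<in> snd p"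
    "path_left p t \<in> topspace X" "path_right p t \<in> topspace X"
proof -
  show 1: "(Some (path_left p t), ereal t) \<in> fst p" "(Some (path_right p t), ereal t) \<in> fst p"
    using path_fibre[OF assms(1)] assms(2) by blast+
  show "((Some (path_left p t), ereal t), (Some (path_right p t), ereal t)) \<in> snd p"
    using path_values_exist[OF assms] by (simp add: path_values_def)
  show "path_left p t \<in> topspace X" "path_right p t \<in> topspace X"
    using subsetD[OF path_sub[OF assms(1)] 1(1)] subsetD[OF path_sub[OF assms(1)] 1(2)] by auto
qed

lemma filled_iff:
  assumes "p \<in> paths X"
  shows "(Some x, t) \<in> fl p \<longleftrightarrow>
      (\<exists>s. t = ereal s \<and> s \<in> times p \<and> x \<in> B (path_left p s) (path_right p s))"
    "(None, t) \<in> fl p \<longleftrightarrow> \<bar>t\<bar> = \<infinity> \<and> (None, t) \<in> fst p"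
  using ext_times_iff[OF assms] unfolding filled_def by auto

lemma filled_sub:
  assumes "p \<in> paths X"
  shows "fl p \<subseteq> squeezed X"
proof
  fix z assume z: "z \<in> fl p"
  show "z \<in> squeezed X"
  proof (cases z)
    case (Pair a t)
    show ?thesis
    proof (cases a)
      case None
      then show ?thesis
        using z filled_iff(2)[OF assms] path_sub[OF assms] Pair by blast
    next
      case (Some x)
      then obtain s where "t = ereal s" "s \<in> times p" "x \<in> B (path_left p s) (path_right p s)"
        using z filled_iff(1)[OF assms] Pair by blast
      then show ?thesis
        using Pair Some subsetD[OF bt_subset[OF path_left_right(4,5)[OF assms]]] by simp
    qed
  qed
qed

lemma path_sub_filled:
  assumes "p \<in> paths X"
  shows "fst p \<subseteq> fl p"
proof
  fix z assume z: "z \<in> fst p"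
  then have "z \<in> squeezed X"
    using path_sub[OF assms] by blast
  then show "z \<in> fl p"
    using z filled_iff[OF assms] path_fibre[OF assms] path_left_right[OF assms] bt_left bt_right
    by (auto elim!: squeezed_cases)
qed

lemma snd_filled:
  assumes "p \<in> paths X" "z \<in> fl p"
  shows "snd z \<in> ext_times p"
  using assms unfolding filled_def times_def by auto

text \<open>The ends of the segment through \<open>z\<close> (\<open>lo\<close> and
  \<open>hi\<close>) belong to the path itself, so the compactness of the path applies to them; a
  point at infinity is its own segment.\<close>

definition lo :: "'a path \<Rightarrow> 'a sqz \<Rightarrow> 'a sqz" where
  "lo p z = (if \<bar>snd z\<bar> = \<infinity> then z else (Some (path_left p (real_of_ereal (snd z))), snd z))"

definition hi :: "'a path \<Rightarrow> 'a sqz \<Rightarrow> 'a sqz" where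
  "hi p z = (if \<bar>snd z\<bar> = \<infinity> then z else (Some (path_right p (real_of_ereal (snd z))), snd z))"

lemma snd_lo_hi [simp]: "snd (lo p z) = snd z" "snd (hi p z) = snd z"
  by (simp_all add: lo_def hi_def)

lemma lo_hi_Some [simp]:
  "lo p (Some x, ereal t) = (Some (path_left p t), ereal t)"
  "hi p (Some x, ereal t) = (Some (path_right p t), ereal t)"
  by (simp_all add: lo_def hi_def)

lemma filled_cases:
  assumes "p \<in> paths X" "z \<in> fl p"
  obtains x t where "z = (Some x, ereal t)" "t \<in> times p" "x \<in> B (path_left p t) (path_right p t)" "x \<in> topspace X"
  | t where "z = (None, t)" "\<bar>t\<bar> = \<infinity>" "z \<in> fst p"
proof (cases "fst z")
  case None
  then show ?thesis
    using that(2)[of "snd z"] assms filled_iff(2)[OF assms(1), of "snd z"] by (metis prod.collapse)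
next
  case (Some x)
  then obtain s where "snd z = ereal s" "s \<in> times p" "x \<in> B (path_left p s) (path_right p s)"
    using assms filled_iff(1)[OF assms(1), of x "snd z"] by (metis prod.collapse)
  then show ?thesis
    using that(1)[of x s] Some path_left_right(4,5)[OF assms(1)] bt_subset by (metis prod.collapse subsetD)
qed

lemma lo_hi:
  assumes "p \<in> paths X" "z \<in> fl p"
  shows "lo p z \<in> fst p" "hi p z \<in> fst p" "(lo p z, hi p z) \<in> snd p"
proof -
  have "lo p z \<in> fst p \<and> hi p z \<in> fst p \<and> (lo p z, hi p z) \<in> snd p"
    using assms
  proof (cases rule: filled_cases)
    case (1 x t)
    then show ?thesis
      using path_left_right[OF assms(1)] by simp
  next
    case (2 t)
    then show ?thesis
      using Z.corder_refl[OF path_corder[OF assms(1)]] by (simp add: lo_def hi_def)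
  qed
  then show "lo p z \<in> fst p" "hi p z \<in> fst p" "(lo p z, hi p z) \<in> snd p"
    by auto
qed

text \<open>When times converge to \<open>t\<close>, the ends of the corresponding segments
  accumulate at points \<open>a\<close> and \<open>b\<close> of the path in this order. With two
  values available, the limiting segment is the left point, the right point or the full segment over
  \<open>t\<close>.\<close>

lemma fibre_between:
  assumes p: "p \<in> paths X" and ab: "((Some a, ereal t), (Some b, ereal t)) \<in> snd p"
  shows "B a b \<subseteq> B (path_left p t) (path_right p t)" "t \<in> times p"
    "b = path_left p t \<Longrightarrow> a = path_left p t" "a = path_right p t \<Longrightarrow> b = path_right p t"
    "a = path_left p t \<or> a = path_right p t" "b = path_left p t \<or> b = path_right p t"
proof -
  note ord = path_corder[OF p]
  have mem: "(Some a, ereal t) \<in> fst p" "(Some b, ereal t) \<in> fst p"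
    using Z.corder_dom[OF ord ab] by auto
  then show t: "t \<in> times p"
    and a: "a = path_left p t \<or> a = path_right p t" and b: "b = path_left p t \<or> b = path_right p t"
    using path_fibre[OF p] by blast+
  note lr = path_left_right[OF p t]
  show "b = path_left p t \<Longrightarrow> a = path_left p t" "a = path_right p t \<Longrightarrow> b = path_right p t"
    using a b ab lr(3) Z.corder_antisym[OF ord] by (metis option.inject prod.inject)+
  show "B a b \<subseteq> B (path_left p t) (path_right p t)"
    using a b lr(4,5) bt_left bt_right by (intro bt_sub_segment) auto
qed

text \<open>First the ends of the segments are made to converge, within the compact path. If the
  limiting time is infinite, convergence of the times is enough; if it is real, continuity of the
  betweenness yields a limit in the segment from \<open>a\<close> to \<open>b\<close>. These limits
  of the ends are part of the conclusion because the closedness of the order depends on which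
  segment arises.\<close>

lemma filled_seq:
  assumes p: "p \<in> paths X" and z: "\<And>n. z n \<in> fl p"
  shows "\<exists>l\<in>fl p. \<exists>r a b. subseq r \<and> null (\<lambda>n. d (z (r n)) l) \<and>
     (a, b) \<in> snd p \<and> null (\<lambda>n. d (lo p (z (r n))) a) \<and> null (\<lambda>n. d (hi p (z (r n))) b) \<and>
     snd a = snd l \<and> snd b = snd l \<and>
     (\<forall>x. fst l = Some x \<longrightarrow> x \<in> B (the (fst a)) (the (fst b)))"
proof -
  note ord = path_corder[OF p] and sub = path_sub[OF p]
  have zX: "z n \<in> squeezed X" for n
    using z filled_sub[OF p] by blast
  obtain a r1 where 1: "a \<in> fst p" "strict_mono r1" "null (\<lambda>n. d (lo p (z (r1 n))) a)"
    by (rule Z.compact_seq[OF Z.corder_compact[OF ord], of "\<lambda>n. lo p (z n)"]) (rule lo_hi(1)[OF p z])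
  obtain b r2 where 2: "b \<in> fst p" "strict_mono r2" "null (\<lambda>n. d (hi p (z (r1 (r2 n)))) b)"
    by (rule Z.compact_seq[OF Z.corder_compact[OF ord], of "\<lambda>n. hi p (z (r1 n))"]) (rule lo_hi(2)[OF p z])
  define k where "k n = r1 (r2 n)" for n
  have k: "strict_mono k"
    using 1(2) 2(2) unfolding k_def strict_mono_def by blast
  have la: "null (\<lambda>n. d (lo p (z (k n))) a)" and lb: "null (\<lambda>n. d (hi p (z (k n))) b)"
    using strict_mono_subseq_tendsto[OF 2(2) 1(3)] 2(3) by (simp_all add: k_def)
  have loX: "lo p (z n) \<in> squeezed X" "hi p (z n) \<in> squeezed X" for n
    using lo_hi[OF p z] sub by blast+
  have abX: "a \<in> squeezed X" "b \<in> squeezed X"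
    using 1 2 sub by blast+
  have ab: "(a, b) \<in> snd p"
    by (rule Z.corder_closed[of _ _ "\<lambda>n. lo p (z (k n))" "\<lambda>n. hi p (z (k n))", OF ord lo_hi(3)[OF p z] 1(1) 2(1) la lb])
  have ta: "(\<lambda>n. snd (z (k n))) \<longlonglongrightarrow> snd a"
    using lim_time[of "\<lambda>n. lo p (z (k n))" a, OF loX(1) abX(1) la] by simp
  have tb: "(\<lambda>n. snd (z (k n))) \<longlonglongrightarrow> snd b"
    using lim_time[of "\<lambda>n. hi p (z (k n))" b, OF loX(2) abX(2) lb] by simp
  have tab: "snd b = snd a"
    by (rule LIMSEQ_unique[OF tb ta])
  show ?thesis
  proof (cases "\<bar>snd a\<bar> = \<infinity>")
    case True
    then have a: "a = (None, snd a)"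
      by (rule squeezed_inf[OF abX(1)])
    have "null (\<lambda>n. d (z (k n)) (None, snd a))"
      by (rule lim_inf[OF zX _ ta]) (use a abX(1) in simp)
    then have "null (\<lambda>n. d (z (k n)) a)"
      using a by simp
    moreover have "a \<in> fl p"
      using 1(1) path_sub_filled[OF p] by blast
    moreover have "fst a = None"
      using a by (metis fst_conv)
    ultimately show ?thesis
      using k ab la lb tab by (intro bexI[of _ a] exI[of _ k] exI[of _ a] exI[of _ b]) auto
  next
    case False
    obtain a1 t where a: "a = (Some a1, ereal t)" "a1 \<in> topspace X"
      using abX(1) False by (auto elim!: squeezed_cases)
    obtain b1 where b: "b = (Some b1, ereal t)" "b1 \<in> topspace X"
      using abX(2) tab a(1) by (auto elim!: squeezed_cases)
    have "\<forall>\<^sub>F n in sequentially. \<bar>snd (z (k n))\<bar> \<noteq> \<infinity>"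
      by (rule squeezed_lim_eventually_real[OF zX False ta])
    then obtain N where N: "\<And>n. n \<ge> N \<Longrightarrow> \<bar>snd (z (k n))\<bar> \<noteq> \<infinity>"
      unfolding eventually_sequentially by blast
    \<comment> \<open>The limiting time is real, so only finitely many terms can lie at infinity;
      they are dropped.\<close>
    define j where "j n = k (n + N)" for n
    have j: "strict_mono j"
      using k unfolding j_def strict_mono_def by simp
    have "\<exists>x s. z (j n) = (Some x, ereal s) \<and> s \<in> times p \<and> x \<in> B (path_left p s) (path_right p s)" for n
      using p z[of "j n"]
    proof (cases rule: filled_cases)
      case (2 t)
      then show ?thesis using N[of "n + N"] by (simp add: j_def)
    qed blast
    then obtain x s where xs: "\<And>n. z (j n) = (Some (x n), ereal (s n))" "\<And>n. s n \<in> times p"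
      "\<And>n. x n \<in> B (path_left p (s n)) (path_right p (s n))"
      by metis
    have tj: "(\<lambda>n. snd (z (j n))) \<longlonglongrightarrow> ereal t"
      using LIMSEQ_ignore_initial_segment[OF ta, of N] a by (simp add: j_def)
    have laj: "null (\<lambda>n. d (lo p (z (j n))) a)" and lbj: "null (\<lambda>n. d (hi p (z (j n))) b)"
      using LIMSEQ_ignore_initial_segment[OF la, of N] LIMSEQ_ignore_initial_segment[OF lb, of N]
      by (simp_all add: j_def)
    have "limitin X (\<lambda>n. the (fst (lo p (z (j n))))) a1 sequentially"
      by (rule lim_val[OF loX(1) abX(1)[unfolded a(1)] laj[unfolded a(1)]])
    then have l1: "limitin X (\<lambda>n. path_left p (s n)) a1 sequentially"
      by (simp add: xs)
    have "limitin X (\<lambda>n. the (fst (hi p (z (j n))))) b1 sequentially"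
      by (rule lim_val[OF loX(2) abX(2)[unfolded b(1)] lbj[unfolded b(1)]])
    then have l2: "limitin X (\<lambda>n. path_right p (s n)) b1 sequentially"
      by (simp add: xs)
    obtain y r3 where y: "y \<in> B a1 b1" "subseq r3" "limitin X (\<lambda>n. x (r3 n)) y sequentially"
      using between_compact[OF path_left_right(4)[OF p xs(2)] path_left_right(5)[OF p xs(2)] l1 l2 xs(3)] by blast
    define r where "r n = j (r3 n)" for n
    have r: "strict_mono r"
      using j y(2) unfolding r_def strict_mono_def by blast
    have yX: "y \<in> topspace X"
      using y(1) a(2) b(2) bt_subset by blast
    have "null (\<lambda>n. d (z (r n)) (Some y, ereal t))"
    proof (rule lim_real[OF zX yX])
      show "(\<lambda>n. snd (z (r n))) \<longlonglongrightarrow> ereal t"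
        unfolding r_def by (rule LIMSEQ_subseq_LIMSEQ[OF tj y(2), unfolded o_def])
      show "limitin X (\<lambda>n. the (fst (z (r n)))) y sequentially"
        using y(3) by (simp add: r_def xs)
    qed
    moreover have "(Some y, ereal t) \<in> fl p"
      using fibre_between(1,2)[OF p, of a1 t b1] ab y(1) unfolding filled_iff(1)[OF p] a(1) b(1) by blast
    moreover have "null (\<lambda>n. d (lo p (z (r n))) a)" "null (\<lambda>n. d (hi p (z (r n))) b)"
      unfolding r_def by (rule strict_mono_subseq_tendsto[OF y(2)], fact)+
    ultimately show ?thesis
      using r ab a b y(1)
      by (intro bexI[of _ "(Some y, ereal t)"] exI[of _ r] exI[of _ a] exI[of _ b]) auto
  qed
qed

lemma filled_compact:
  assumes "p \<in> paths X"
  shows "compactin Z.mtopology (fl p)"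
  by (rule Z.compact_seqI[OF filled_sub[OF assms]]) (use filled_seq[OF assms] in blast)

lemma filled_orderI:
  assumes p: "p \<in> paths X" and "(Some x, ereal t) \<in> fl p" "(Some y, ereal t) \<in> fl p" "x \<in> B (path_left p t) y"
  shows "((Some x, ereal t), (Some y, ereal t)) \<in> fo p"
  using assms unfolding filled_order_def by blast

lemma filled_order_fibre:
  assumes p: "p \<in> paths X"
  shows "((Some x, ereal t), (Some y, ereal t)) \<in> fo p \<longleftrightarrow>
    t \<in> times p \<and> x \<in> B (path_left p t) (path_right p t) \<and> y \<in> B (path_left p t) (path_right p t) \<and>
    x \<in> B (path_left p t) y"
proof -
  have "y \<in> B (path_left p t) y" if "t \<in> times p" "y \<in> B (path_left p t) (path_right p t)"
    using that path_left_right(4,5)[OF p] bt_subset bt_right by blast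
  then show ?thesis
    unfolding filled_order_def using filled_iff(1)[OF p] by auto
qed

lemma filled_order_time:
  "(z, w) \<in> fo p \<Longrightarrow> snd z \<le> snd w"
  "z \<in> fl p \<Longrightarrow> w \<in> fl p \<Longrightarrow> snd z < snd w \<Longrightarrow> (z, w) \<in> fo p"
  unfolding filled_order_def by auto

lemma filled_order_dom:
  "(z, w) \<in> fo p \<Longrightarrow> z \<in> fl p \<and> w \<in> fl p"
  unfolding filled_order_def by auto

lemma filled_linear:
  assumes p: "p \<in> paths X"
  shows "linear_order_on (fl p) (fo p)"
proof -
  have same_inf: "z = w" if "z \<in> fl p" "w \<in> fl p" "snd z = snd w" "\<bar>snd z\<bar> = \<infinity>" for z w
    using squeezed_inf[of z X] squeezed_inf[of w X] that filled_sub[OF p] by (metis subsetD)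
  have same: "\<exists>x y t. z = (Some x, ereal t) \<and> w = (Some y, ereal t)"
    if "z \<in> fl p" "w \<in> fl p" "snd z = snd w" "\<bar>snd z\<bar> \<noteq> \<infinity>" for z w
    using squeezed_real(1)[of z X] squeezed_real(1)[of w X] that filled_sub[OF p] by (metis subsetD)
  have M: "path_left p t \<in> topspace X" "path_right p t \<in> topspace X" "x \<in> topspace X"
    if "t \<in> times p" "x \<in> B (path_left p t) (path_right p t)" for t x
    using that path_left_right(4,5)[OF p] bt_subset by blast+
  have "trans (fo p)"
  proof (rule transI)
    fix z w v assume zw: "(z, w) \<in> fo p" and wv: "(w, v) \<in> fo p"
    then have t: "snd z \<le> snd w" "snd w \<le> snd v" and F: "z \<in> fl p" "w \<in> fl p" "v \<in> fl p"
      using filled_order_time(1) filled_order_dom by blast+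
    show "(z, v) \<in> fo p"
    proof (cases "snd z < snd v")
      case True
      then show ?thesis using F filled_order_time(2) by blast
    next
      case False
      then have eq: "snd z = snd w" "snd w = snd v"
        using t by auto
      show ?thesis
      proof (cases "\<bar>snd z\<bar> = \<infinity>")
        case True
        then show ?thesis
          using same_inf[of z w] zw wv F eq by simp
      next
        case False
        then obtain x y t where zw': "z = (Some x, ereal t)" "w = (Some y, ereal t)"
          using same[OF F(1,2) eq(1) False] by blast
        then have "\<bar>snd w\<bar> \<noteq> \<infinity>"
          by simp
        from same[OF F(2,3) eq(2) this]
        obtain y' u t' where "w = (Some y', ereal t')" "v = (Some u, ereal t')"
          by blast
        then have v: "v = (Some u, ereal t)"
          using zw' by simp
        show ?thesis
          using zw wv unfolding zw' v filled_order_fibre[OF p] using bt_trans[of "path_left p t" y u x] M by blast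
      qed
    qed
  qed
  moreover have "antisym (fo p)"
  proof (rule antisymI)
    fix z w assume zw: "(z, w) \<in> fo p" and wz: "(w, z) \<in> fo p"
    then have eq: "snd z = snd w" and F: "z \<in> fl p" "w \<in> fl p"
      using filled_order_time(1) filled_order_dom by (blast intro: antisym)+
    show "z = w"
    proof (cases "\<bar>snd z\<bar> = \<infinity>")
      case True
      then show ?thesis by (rule same_inf[OF F eq])
    next
      case False
      from same[OF F eq this] obtain x y t where zw': "z = (Some x, ereal t)" "w = (Some y, ereal t)"
        by blast
      show ?thesis
        using zw wz unfolding zw' filled_order_fibre[OF p] using bt_antisym[of "path_left p t" x y] M by blast
    qed
  qed
  moreover have "total_on (fl p) (fo p)"
  proof (rule total_onI)
    fix z w assume F: "z \<in> fl p" "w \<in> fl p" "z \<noteq> w"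
    show "(z, w) \<in> fo p \<or> (w, z) \<in> fo p"
    proof (cases "snd z = snd w")
      case False
      then show ?thesis using F filled_order_time(2) by (metis linorder_neqE)
    next
      case eq: True
      have "\<bar>snd z\<bar> \<noteq> \<infinity>"
        using same_inf[OF F(1,2) eq] F(3) by argo
      from same[OF F(1,2) eq this] obtain x y t where zw': "z = (Some x, ereal t)" "w = (Some y, ereal t)"
        by blast
      show ?thesis
        using F(1,2) unfolding zw' filled_order_fibre[OF p] filled_iff(1)[OF p]
        using bt_total[of "path_left p t" "path_right p t" x y] M by auto
    qed
  qed
  moreover have "refl_on (fl p) (fo p)" "fo p \<subseteq> fl p \<times> fl p"
    by (auto simp: refl_on_def filled_order_def)
  ultimately show ?thesis
    unfolding linear_order_on_def partial_order_on_def preorder_on_def by blast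
qed

text \<open>Limits at different times and limits at infinity are immediate. At a common real time it
  matters whether the two points come infinitely often from different times or eventually from the
  same time, that is, from one segment.\<close>

lemma filled_order_closed:
  assumes p: "p \<in> paths X" and zw: "\<And>n::nat. (z n, w n) \<in> fo p"
    and lF: "lz \<in> fl p" "lw \<in> fl p"
    and lim: "null (\<lambda>n. d (z n) lz)" "null (\<lambda>n. d (w n) lw)"
  shows "(lz, lw) \<in> fo p"
proof -
  note ord = path_corder[OF p] and sub = path_sub[OF p] and fsub = filled_sub[OF p]
  have zF: "z n \<in> fl p" "w n \<in> fl p" for n
    using zw[of n] filled_order_dom by blast+
  then have zX: "z n \<in> squeezed X" "w n \<in> squeezed X" and lX: "lz \<in> squeezed X" "lw \<in> squeezed X" for n
    using lF fsub by blast+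
  have tz: "(\<lambda>n. snd (z n)) \<longlonglongrightarrow> snd lz" and tw: "(\<lambda>n. snd (w n)) \<longlonglongrightarrow> snd lw"
    using lim_time zX lX lim by blast+
  have tle: "snd lz \<le> snd lw"
    by (rule LIMSEQ_le[OF tz tw]) (use filled_order_time(1)[OF zw] in auto)
  show ?thesis
  proof (cases "snd lz < snd lw")
    case True
    then show ?thesis using lF filled_order_time(2) by blast
  next
    case False
    then have teq: "snd lz = snd lw"
      using tle by simp
    show ?thesis
    proof (cases "\<bar>snd lz\<bar> = \<infinity>")
      case True
      then have "lz = lw"
        using squeezed_inf[OF lX(1)] squeezed_inf[OF lX(2)] teq by metis
      then show ?thesis
        using lF by (simp add: filled_order_def)
    next
      case False
      obtain x t where lz: "lz = (Some x, ereal t)" "x \<in> topspace X"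
        using lX(1) False by (auto elim!: squeezed_cases)
      obtain y where lw: "lw = (Some y, ereal t)" "y \<in> topspace X"
        using lX(2) teq lz(1) by (auto elim!: squeezed_cases)
      obtain l1 r1 a b where 1: "l1 \<in> fl p" "subseq r1" "null (\<lambda>n. d (z (r1 n)) l1)"
        "(a, b) \<in> snd p" "null (\<lambda>n. d (lo p (z (r1 n))) a)" "null (\<lambda>n. d (hi p (z (r1 n))) b)"
        "snd a = snd l1" "snd b = snd l1" "\<forall>x. fst l1 = Some x \<longrightarrow> x \<in> B (the (fst a)) (the (fst b))"
        using filled_seq[of p z, OF p zF(1)] by blast
      have "l1 = lz"
        using Z.seq_unique[of "\<lambda>n. z (r1 n)" l1 lz, OF zX(1) _ lX(1) 1(3) strict_mono_subseq_tendsto[OF 1(2) lim(1)]]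
          1(1) fsub by blast
      obtain l2 r2 a' b' where 2: "l2 \<in> fl p" "subseq r2" "null (\<lambda>n. d (w (r1 (r2 n))) l2)"
        "(a', b') \<in> snd p" "null (\<lambda>n. d (lo p (w (r1 (r2 n)))) a')" "null (\<lambda>n. d (hi p (w (r1 (r2 n)))) b')"
        "snd a' = snd l2" "snd b' = snd l2" "\<forall>x. fst l2 = Some x \<longrightarrow> x \<in> B (the (fst a')) (the (fst b'))"
        using filled_seq[of p "\<lambda>n. w (r1 n)", OF p zF(2)] by blast
      define k where "k n = r1 (r2 n)" for n
      have k: "strict_mono k"
        using 1(2) 2(2) unfolding k_def strict_mono_def by blast
      have "l2 = lw"
        using Z.seq_unique[of "\<lambda>n. w (k n)" l2 lw, OF zX(2) _ lX(2) _ strict_mono_subseq_tendsto[OF k lim(2)]]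
          2(1,3) fsub by (auto simp: k_def)
      have F: "a \<in> fst p" "b \<in> fst p" "a' \<in> fst p" "b' \<in> fst p"
        using Z.corder_dom[OF ord 1(4)] Z.corder_dom[OF ord 2(4)] by blast+
      then have fX: "a \<in> squeezed X" "b \<in> squeezed X" "a' \<in> squeezed X" "b' \<in> squeezed X"
        using sub by blast+
      obtain a1 b1 where ab: "a = (Some a1, ereal t)" "b = (Some b1, ereal t)"
        using fX(1,2) 1(7,8) \<open>l1 = lz\<close> lz(1) by (auto elim!: squeezed_cases)
      obtain a2 b2 where ab': "a' = (Some a2, ereal t)" "b' = (Some b2, ereal t)"
        using fX(3,4) 2(7,8) \<open>l2 = lw\<close> lw(1) by (auto elim!: squeezed_cases)
      have x: "x \<in> B a1 b1" and y: "y \<in> B a2 b2"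
        using 1(9) 2(9) \<open>l1 = lz\<close> \<open>l2 = lw\<close> lz(1) lw(1) ab ab' by auto
      have lims: "null (\<lambda>n. d (lo p (z (k n))) a)" "null (\<lambda>n. d (hi p (z (k n))) b)"
        "null (\<lambda>n. d (lo p (w (k n))) a')" "null (\<lambda>n. d (hi p (w (k n))) b')"
        using strict_mono_subseq_tendsto[OF 2(2) 1(5)] strict_mono_subseq_tendsto[OF 2(2) 1(6)] 2(5,6)
        by (simp_all add: k_def)
      note fb = fibre_between[OF p, of a1 t b1, folded ab, OF 1(4)]
      note fb' = fibre_between[OF p, of a2 t b2, folded ab', OF 2(4)]
      note lr = path_left_right[OF p fb(2)]
      have goal: "x \<in> B (path_left p t) y \<Longrightarrow> ?thesis"
        using lF unfolding lz(1) lw(1) by (rule filled_orderI[OF p])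
      show ?thesis
      proof (cases "\<forall>\<^sub>F n in sequentially. \<not> snd (z (k n)) < snd (w (k n))")
        case False
        then obtain j :: "nat \<Rightarrow> nat" where j: "strict_mono j" "\<And>n. snd (z (k (j n))) < snd (w (k (j n)))"
          using frequently_subseq[of "\<lambda>n. snd (z (k n)) < snd (w (k n))"] by blast
        \<comment> \<open>The segment of \<open>z\<close> is infinitely often strictly earlier than
          that of \<open>w\<close>, so its end precedes the start of the other, also in the limit.
          With two values over \<open>t\<close>, either the first limiting segment is the left point
          or the second one is the right point; both settle the claim.\<close>
        have "(b, a') \<in> snd p"
        proof (rule Z.corder_closed[of _ _ "\<lambda>n. hi p (z (k (j n)))" "\<lambda>n. lo p (w (k (j n)))", OF ord _ F(2,3)])
          show "(hi p (z (k (j n))), lo p (w (k (j n)))) \<in> snd p" for n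
            using path_time[OF p lo_hi(2)[OF p zF(1)] lo_hi(1)[OF p zF(2)]] j(2) by simp
        qed (rule strict_mono_subseq_tendsto[OF j(1)], rule lims)+
        note fb'' = fibre_between[OF p, of b1 t a2, folded ab ab', OF this]
        show ?thesis
        proof (cases "b1 = path_left p t")
          case True
          then have "a1 = path_left p t"
            using fb(3) by blast
          then have "x = path_left p t"
            using x True bt_self lr(4) by simp
          then show ?thesis
            using goal bt_left lr(4) lw(2) by blast
        next
          case False
          then have "b1 = path_right p t"
            using fb(6) by blast
          then have "a2 = path_right p t" "b2 = path_right p t"
            using fb''(4) fb'(4) by blast+
          then have "y = path_right p t"
            using y bt_self lr(5) by simp
          then show ?thesis
            using goal fb(1) x by blast
        qed
      next
        case True
        moreover have "\<forall>\<^sub>F n in sequentially. \<bar>snd (z (k n))\<bar> \<noteq> \<infinity>"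
          using squeezed_lim_eventually_real[of "\<lambda>n. z (k n)", OF zX(1) False] LIMSEQ_subseq_LIMSEQ[OF tz k]
          by (simp add: o_def)
        ultimately have "\<forall>\<^sub>F n in sequentially. \<not> snd (z (k n)) < snd (w (k n)) \<and> \<bar>snd (z (k n))\<bar> \<noteq> \<infinity>"
          by (rule eventually_conj)
        then obtain N where N: "\<And>n. n \<ge> N \<Longrightarrow> \<not> snd (z (k n)) < snd (w (k n)) \<and> \<bar>snd (z (k n))\<bar> \<noteq> \<infinity>"
          unfolding eventually_sequentially by blast
        define j where "j n = k (n + N)" for n
        have j: "strict_mono j"
          using k unfolding j_def strict_mono_def by simp
        have "\<exists>xs ys s. z (j n) = (Some xs, ereal s) \<and> w (j n) = (Some ys, ereal s) \<and> s \<in> times p \<and>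
            xs \<in> B (path_left p s) ys \<and> xs \<in> topspace X \<and> ys \<in> topspace X" for n
        proof -
          have eq: "snd (z (j n)) = snd (w (j n))"
            using N[of "n + N"] filled_order_time(1)[OF zw[of "j n"]] by (auto simp: j_def)
          obtain xs s where z': "z (j n) = (Some xs, ereal s)" "xs \<in> topspace X"
            using zX(1)[of "j n"] N[of "n + N"] by (auto elim!: squeezed_cases simp: j_def)
          obtain ys where w': "w (j n) = (Some ys, ereal s)" "ys \<in> topspace X"
            using zX(2)[of "j n"] eq z' by (auto elim!: squeezed_cases)
          show ?thesis
            using zw[of "j n"] z' w' unfolding z'(1) w'(1) filled_order_fibre[OF p] by blast
        qed
        then obtain xs ys s where zs: "\<And>n. z (j n) = (Some (xs n), ereal (s n))" "\<And>n. w (j n) = (Some (ys n), ereal (s n))"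
          "\<And>n. s n \<in> times p" "\<And>n. xs n \<in> B (path_left p (s n)) (ys n)" "\<And>n. xs n \<in> topspace X" "\<And>n. ys n \<in> topspace X"
          by metis
        have limj: "null (\<lambda>n. d (lo p (z (j n))) a)" "null (\<lambda>n. d (hi p (z (j n))) b)"
          "null (\<lambda>n. d (lo p (w (j n))) a')" "null (\<lambda>n. d (hi p (w (j n))) b')"
          using lims[THEN LIMSEQ_ignore_initial_segment, of N] by (simp_all add: j_def)
        have loX: "lo p (z n) \<in> squeezed X" "hi p (z n) \<in> squeezed X" for n
          using lo_hi[OF p zF(1)] sub by blast+
        have "a' = a"
          by (rule Z.seq_unique[of "\<lambda>n. lo p (z (j n))" a' a, OF loX(1) fX(3,1) _ limj(1)])
            (use limj(3) in \<open>simp add: zs\<close>)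
        have "b' = b"
          by (rule Z.seq_unique[of "\<lambda>n. hi p (z (j n))" b' b, OF loX(2) fX(4,2) _ limj(2)])
            (use limj(4) in \<open>simp add: zs\<close>)
        have "limitin X (\<lambda>n. the (fst (lo p (z (j n))))) a1 sequentially"
          by (rule lim_val[OF loX(1) fX(1)[unfolded ab(1)] limj(1)[unfolded ab(1)]])
        then have l1: "limitin X (\<lambda>n. path_left p (s n)) a1 sequentially"
          by (simp add: zs)
        have "limitin X (\<lambda>n. the (fst (z (j n)))) x sequentially"
          by (rule lim_val[OF zX(1) lX(1)[unfolded lz(1)] strict_mono_subseq_tendsto[OF j lim(1)[unfolded lz(1)]]])
        then have lx: "limitin X xs x sequentially"
          by (simp add: zs)
        have "limitin X (\<lambda>n. the (fst (w (j n)))) y sequentially"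
          by (rule lim_val[OF zX(2) lX(2)[unfolded lw(1)] strict_mono_subseq_tendsto[OF j lim(2)[unfolded lw(1)]]])
        then have ly: "limitin X ys y sequentially"
          by (simp add: zs)
        \<comment> \<open>Both points now come from one segment, so the limiting segments agree and
          the relation between the points passes to the limit. It is read from \<open>a1\<close>; if
          that is not the left value, the limiting segment is the single right point.\<close>
        have xy: "x \<in> B a1 y"
          by (rule between_closed[OF path_left_right(4)[OF p zs(3)] zs(6) l1 ly zs(4) lx])
        show ?thesis
        proof (cases "a1 = path_left p t")
          case True
          then show ?thesis using goal xy by blast
        next
          case False
          then have "a1 = path_right p t" "b1 = path_right p t"
            using fb(4,5) by blast+
          then have "x = path_right p t" "y = path_right p t"
            using x y bt_self lr(5) \<open>a' = a\<close> \<open>b' = b\<close> ab ab' by auto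
          then show ?thesis
            using goal bt_right lr by simp
        qed
      qed
    qed
  qed
qed

lemma filled_corder:
  assumes "p \<in> paths X"
  shows "Z.corder (fl p) (fo p)"
  unfolding Z.corder_def
proof (intro conjI allI impI)
  show "fl p \<noteq> {}"
    using path_sub_filled[OF assms] Z.corder_nonempty[OF path_corder[OF assms]] by blast
qed (use filled_compact[OF assms] filled_linear[OF assms] filled_order_closed[OF assms] in blast)+

end

section \<open>The three distances on paths\<close>

lemma (in Metric_space) corder_pair_compact:
  assumes "corder A le"
  shows "le \<in> nonempty_compacts (prod_topology mtopology mtopology)"
proof -
  interpret P: Metric_space "M \<times> M" "d_pair d"
    by (rule Metric_space_d_pair)
  have "compactin P.mtopology le"
  proof (rule P.compact_seqI)
    show "le \<subseteq> M \<times> M"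
      using corder_dom[OF assms] corder_subset[OF assms] by auto
    fix \<sigma> :: "nat \<Rightarrow> 'a \<times> 'a" assume \<sigma>: "\<And>n. \<sigma> n \<in> le"
    then have le: "(fst (\<sigma> n), snd (\<sigma> n)) \<in> le" for n
      by simp
    obtain a r where 1: "a \<in> A" "strict_mono r" "null (\<lambda>n. d (fst (\<sigma> (r n))) a)"
      by (rule compact_seq[OF corder_compact[OF assms], of "\<lambda>n. fst (\<sigma> n)"]) (rule corder_dom[OF assms le])
    obtain b s where 2: "b \<in> A" "strict_mono s" "null (\<lambda>n. d (snd (\<sigma> (r (s n)))) b)"
      by (rule compact_seq[OF corder_compact[OF assms], of "\<lambda>n. snd (\<sigma> (r n))"]) (rule corder_dom[OF assms le])
    have 3: "null (\<lambda>n. d (fst (\<sigma> (r (s n)))) a)"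
      by (rule strict_mono_subseq_tendsto[OF 2(2) 1(3)])
    have "(a, b) \<in> le"
      by (rule corder_closed[of _ _ "\<lambda>n. fst (\<sigma> (r (s n)))" "\<lambda>n. snd (\<sigma> (r (s n)))", OF assms le 1(1) 2(1) 3 2(3)])
    moreover have "null (\<lambda>n. d_pair d (\<sigma> (r (s n))) (a, b))"
      using d_pair_tendsto_iff[of "\<lambda>n. fst (\<sigma> (r (s n)))" "\<lambda>n. snd (\<sigma> (r (s n)))" a b] 2(3) 3 by simp
    moreover have "strict_mono (\<lambda>n. r (s n))"
      using 1(2) 2(2) unfolding strict_mono_def by blast
    ultimately show "\<exists>l\<in>le. \<exists>r. subseq r \<and> null (\<lambda>n. d_pair d (\<sigma> (r n)) l)"
      by (intro bexI[of _ "(a, b)"] exI[of _ "\<lambda>n. r (s n)"]) simp_all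
  qed
  moreover have "le \<noteq> {}"
    using corder_nonempty[OF assms] corder_refl[OF assms] by blast
  ultimately show ?thesis
    by (simp add: nonempty_compacts_def mtopology_d_pair)
qed

text \<open>If any correspondence stays within \<open>r\<close>, then so does the largest relation
  that does, given by \<open>d z w \<le> r\<close>.\<close>

lemma hclose_iff_Corr:
  "hclose d r A A' \<longleftrightarrow> (\<exists>C\<in>Corr A A'. \<forall>(z, w)\<in>C. d z w \<le> r)"
proof
  assume "hclose d r A A'"
  then have "{(z, w). z \<in> A \<and> w \<in> A' \<and> d z w \<le> r} \<in> Corr A A'"
    by (auto simp: Corr_def hclose_def)
  then show "\<exists>C\<in>Corr A A'. \<forall>(z, w)\<in>C. d z w \<le> r"
    by (rule bexI[rotated]) auto
next
  assume "\<exists>C\<in>Corr A A'. \<forall>(z, w)\<in>C. d z w \<le> r"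
  then obtain C where C: "C \<in> Corr A A'" "\<And>z w. (z, w) \<in> C \<Longrightarrow> d z w \<le> r"
    by auto
  show "hclose d r A A'"
    unfolding hclose_def using C unfolding Corr_def by blast
qed

context path_space begin

text \<open>\<open>filled_order\<close> is built from times and betweenness and refers to the given
  order only through the naming of left and right values. It extends the order of the path, and an
  extension of a total order adds nothing on the same points without violating antisymmetry.\<close>

lemma path_order_eq:
  assumes p: "p \<in> paths X"
  shows "snd p = fo p \<inter> (fst p \<times> fst p)"
proof -
  note ord = path_corder[OF p] and ford = filled_corder[OF p]
  have *: "(z, w) \<in> fo p" if zw: "(z, w) \<in> snd p" for z w
  proof -
    have P: "z \<in> fst p" "w \<in> fst p"
      using Z.corder_dom[OF ord zw] by auto
    then have F: "z \<in> fl p" "w \<in> fl p" and zX: "z \<in> squeezed X" "w \<in> squeezed X"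
      using path_sub_filled[OF p] path_sub[OF p] by blast+
    show ?thesis
    proof (cases "snd z < snd w")
      case True
      then show ?thesis using F filled_order_time(2) by blast
    next
      case False
      then have eq: "snd z = snd w"
        using path_time[OF p P(2,1)] zw Z.corder_antisym[OF ord zw] by (metis linorder_neqE)
      show ?thesis
      proof (cases "\<bar>snd z\<bar> = \<infinity>")
        case True
        then have "z = w"
          using squeezed_inf[OF zX(1)] squeezed_inf[OF zX(2)] eq by metis
        then show ?thesis
          using F by (simp add: filled_order_def)
      next
        case False
        obtain a t where z: "z = (Some a, ereal t)" "a \<in> topspace X"
          using zX(1) False by (auto elim!: squeezed_cases)
        obtain b where w: "w = (Some b, ereal t)" "b \<in> topspace X"
          using zX(2) eq z(1) by (auto elim!: squeezed_cases)
        note fb = fibre_between[OF p zw[unfolded z(1) w(1)]]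
        have "a \<in> B (path_left p t) b"
          using fb(4,5) bt_left bt_right path_left_right(4,5)[OF p fb(2)] w(2) by metis
        then show ?thesis
          using F unfolding z(1) w(1) by (intro filled_orderI[OF p])
      qed
    qed
  qed
  have "(z, w) \<in> snd p" if zw: "(z, w) \<in> fo p" "z \<in> fst p" "w \<in> fst p" for z w
    using Z.corder_total[OF ord zw(2,3)] *[of w z] Z.corder_antisym[OF ford zw(1)] Z.corder_refl[OF ord zw(2)]
    by blast
  then show ?thesis
    using * Z.corder_dom[OF ord] by auto
qed

text \<open>The diagonal of the order returns the filled path, and the points of the path at a given
  time are the first and the last point of the filled path there. Both are visible in the order
  alone.\<close>

lemma filled_order_inj:
  assumes p: "p \<in> paths X" and q: "q \<in> paths X" and eq: "fo p = fo q"
  shows "p = q"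
proof -
  have feq: "fl p = fl q"
    using Z.corder_refl[OF filled_corder[OF p]] Z.corder_refl[OF filled_corder[OF q]]
      Z.corder_dom[OF filled_corder[OF p]] Z.corder_dom[OF filled_corder[OF q]] eq by blast
  have sub: "fst p \<subseteq> fst q"
    if p: "p \<in> paths X" and q: "q \<in> paths X" and eq: "fo p = fo q"
      and feq: "fl p = fl q" for p q
  proof
    fix z assume z: "z \<in> fst p"
    then have F: "z \<in> fl q"
      using path_sub_filled[OF p] feq by blast
    show "z \<in> fst q"
      using q F
    proof (cases rule: filled_cases)
      case (1 x t)
      have tp: "t \<in> times p"
        using z 1(1) times_iff[OF p] by blast
      note lp = path_left_right[OF p tp] and lq = path_left_right[OF q 1(2)]
      let ?lp = "(Some (path_left p t), ereal t)" and ?rp = "(Some (path_right p t), ereal t)"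
      let ?lq = "(Some (path_left q t), ereal t)" and ?rq = "(Some (path_right q t), ereal t)"
      have mem: "path_left q t \<in> B (path_left p t) (path_right p t)" "path_right q t \<in> B (path_left p t) (path_right p t)"
        "path_left p t \<in> B (path_left q t) (path_right q t)" "path_right p t \<in> B (path_left q t) (path_right q t)"
        using path_sub_filled[OF q] path_sub_filled[OF p] lp(1,2) lq(1,2) feq filled_iff(1)[OF p] filled_iff(1)[OF q]
        by (metis ereal.inject subsetD)+
      have "(?lp, ?lq) \<in> fo p" "(?rq, ?rp) \<in> fo p"
        unfolding filled_order_fibre[OF p] using tp mem lp(4,5) lq(4,5) bt_left bt_right by blast+
      moreover have "(?lq, ?lp) \<in> fo p" "(?rp, ?rq) \<in> fo p"
        unfolding eq filled_order_fibre[OF q] using 1(2) mem lp(4,5) lq(4,5) bt_left bt_right by blast+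
      ultimately have "?lp = ?lq" "?rp = ?rq"
        using Z.corder_antisym[OF filled_corder[OF p]] by blast+
      then show ?thesis
        using z 1 path_fibre[OF p] path_fibre[OF q] by auto
    qed
  qed
  have "fst p = fst q"
    using sub[OF p q eq feq] sub[OF q p eq[symmetric] feq[symmetric]] by blast
  then show ?thesis
    using path_order_eq[OF p] path_order_eq[OF q] eq by (metis prod_eqI)
qed

section \<open>The distances as infima, their comparison and the metric axioms\<close>

lemma d_H_le:
  assumes "p \<in> paths X" "q \<in> paths X" "hclose d r (fl p) (fl q)"
  shows "d_H X B d p q \<le> r"
proof -
  obtain C where C: "C \<in> Corr (fl p) (fl q)" "\<forall>(z, w)\<in>C. d z w \<le> r"
    using assms(3) unfolding hclose_iff_Corr by blast
  show ?thesis
    unfolding d_H_def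
    using assms(1,2) Z.inf_sup_le[OF filled_compact[OF assms(1)] filled_compact[OF assms(2)]
        Z.corder_nonempty[OF filled_corder[OF assms(1)]] order_refl C] by simp
qed

lemma d_H_less:
  assumes "p \<in> paths X" "q \<in> paths X" "d_H X B d p q < r"
  shows "hclose d r (fl p) (fl q)"
proof -
  have less: "(INF C\<in>Corr (fl p) (fl q). SUP (z, w)\<in>C. d z w) < r"
    using assms unfolding d_H_def by simp
  have "fl p \<times> fl q \<in> Corr (fl p) (fl q)"
    using Z.corder_nonempty[OF filled_corder[OF assms(1)]] Z.corder_nonempty[OF filled_corder[OF assms(2)]]
    by (auto simp: Corr_def)
  then have "Corr (fl p) (fl q) \<noteq> {}"
    by blast
  then obtain C where "C \<in> Corr (fl p) (fl q)" "\<forall>(z, w)\<in>C. d z w \<le> r"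
    using Z.inf_sup_less[OF filled_compact[OF assms(1)] filled_compact[OF assms(2)] order_refl _ less] by blast
  then show ?thesis
    unfolding hclose_iff_Corr by blast
qed

abbreviation tclosep :: "real \<Rightarrow> 'a path \<Rightarrow> 'a path \<Rightarrow> bool" where
  "tclosep r p q \<equiv> Z.tclose r (fl p) (fo p) (fl q) (fo q)"

lemma d_tot_le:
  assumes "p \<in> paths X" "q \<in> paths X" "tclosep r p q"
  shows "d_tot X B d p q \<le> r"
proof -
  let ?\<C> = "Cor_plus (fl p) (fo p) (fl q) (fo q)"
  obtain C where C: "C \<in> ?\<C>" "\<forall>(z, w)\<in>C. d z w \<le> r"
    using assms(3) unfolding Z.tclose_def by blast
  have "?\<C> \<subseteq> Corr (fl p) (fl q)"
    by (auto simp: Cor_plus_def)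
  then show ?thesis
    unfolding d_tot_def
    using assms(1,2) Z.inf_sup_le[OF filled_compact[OF assms(1)] filled_compact[OF assms(2)]
        Z.corder_nonempty[OF filled_corder[OF assms(1)]] _ C] by simp
qed

lemma d_tot_less:
  assumes "p \<in> paths X" "q \<in> paths X" "d_tot X B d p q < r"
  shows "tclosep r p q"
proof -
  let ?\<C> = "Cor_plus (fl p) (fo p) (fl q) (fo q)"
  have less: "(INF C\<in>?\<C>. SUP (z, w)\<in>C. d z w) < r"
    using assms unfolding d_tot_def by simp
  have "?\<C> \<noteq> {}"
    using Z.tclose_exists[OF filled_corder[OF assms(1)] filled_corder[OF assms(2)]] unfolding Z.tclose_def by blast
  moreover have "?\<C> \<subseteq> Corr (fl p) (fl q)"
    by (auto simp: Cor_plus_def)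
  ultimately obtain C where "C \<in> ?\<C>" "\<forall>(z, w)\<in>C. d z w \<le> r"
    using Z.inf_sup_less[OF filled_compact[OF assms(1)] filled_compact[OF assms(2)] _ _ less] by blast
  then show ?thesis
    unfolding Z.tclose_def by blast
qed

lemma pair_metric: "Metric_space (squeezed X \<times> squeezed X) (d_pair d)"
  by (rule Z.Metric_space_d_pair)

lemma pair_mtop: "Metric_space.mtopology (squeezed X \<times> squeezed X) (d_pair d) =
    prod_topology (squeezed_topology X) (squeezed_topology X)"
  using Z.mtopology_d_pair mtop by simp

lemma filled_order_compact:
  assumes "p \<in> paths X"
  shows "fo p \<in> nonempty_compacts (prod_topology (squeezed_topology X) (squeezed_topology X))"
  using Z.corder_pair_compact[OF filled_corder[OF assms]] mtop by simp

lemma d_part_le: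
  assumes "p \<in> paths X" "q \<in> paths X" "hclose (d_pair d) r (fo p) (fo q)"
  shows "d_part X B d p q \<le> r"
  using assms Metric_space.hausdorff_dist_le[OF pair_metric, unfolded pair_mtop, OF filled_order_compact filled_order_compact]
  by (simp add: d_part_def)

lemma d_part_less:
  assumes "p \<in> paths X" "q \<in> paths X" "d_part X B d p q < r"
  shows "hclose (d_pair d) r (fo p) (fo q)"
  using assms Metric_space.hausdorff_dist_less[OF pair_metric, unfolded pair_mtop, OF filled_order_compact filled_order_compact]
  by (simp add: d_part_def)

lemma d_H_le_d_part:
  assumes "p \<in> paths X" "q \<in> paths X"
  shows "d_H X B d p q \<le> d_part X B d p q"
proof (rule field_le_epsilon)
  fix e :: real assume "e > 0"
  then have "hclose (d_pair d) (d_part X B d p q + e) (fo p) (fo q)"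
    using assms by (intro d_part_less) auto
  then have "hclose d (d_part X B d p q + e) (fl p) (fl q)"
    by (rule Z.hclose_pair_imp_hclose[OF filled_corder[OF assms(1)] filled_corder[OF assms(2)]])
  then show "d_H X B d p q \<le> d_part X B d p q + e"
    by (rule d_H_le[OF assms])
qed

lemma d_part_le_d_tot:
  assumes "p \<in> paths X" "q \<in> paths X"
  shows "d_part X B d p q \<le> d_tot X B d p q"
proof (rule field_le_epsilon)
  fix e :: real assume "e > 0"
  then have "tclosep (d_tot X B d p q + e) p q"
    using assms by (intro d_tot_less) auto
  then have "hclose (d_pair d) (d_tot X B d p q + e) (fo p) (fo q)"
    by (rule Z.tclose_imp_hclose_pair[OF filled_corder[OF assms(1)] filled_corder[OF assms(2)]])
  then show "d_part X B d p q \<le> d_tot X B d p q + e"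
    by (rule d_part_le[OF assms])
qed

lemma Metric_space_d_part: "Metric_space (paths X) (d_part X B d)"
proof (rule metric_from_closeness[where P = "paths X" and
      R = "\<lambda>r p q. hclose (d_pair d) r (fo p) (fo q)"])
  interpret P: Metric_space "squeezed X \<times> squeezed X" "d_pair d"
    by (rule pair_metric)
  have K: "compactin P.mtopology (fo p)" "fo p \<subseteq> squeezed X \<times> squeezed X"
    "fo p \<noteq> {}" if "p \<in> paths X" for p
    using filled_order_compact[OF that] P.compact_subset by (auto simp: pair_mtop nonempty_compacts_def)
  show "hclose (d_pair d) 0 (fo p) (fo p)" if "p \<in> paths X" for p
    by (rule P.hclose_refl[OF K(2)[OF that]])
  show "0 \<le> r" if "p \<in> paths X" "hclose (d_pair d) r (fo p) (fo q)" for p q r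
    by (rule P.hclose_nonneg[OF that(2) K(3)[OF that(1)]])
  show "hclose (d_pair d) (r + s) (fo p) (fo u)"
    if "p \<in> paths X" "q \<in> paths X" "u \<in> paths X" "hclose (d_pair d) r (fo p) (fo q)"
      "hclose (d_pair d) s (fo q) (fo u)" for r s p q u
    by (rule P.hclose_trans[OF that(4,5) K(2)[OF that(1)] K(2)[OF that(2)] K(2)[OF that(3)]])
  show "p = q" if "p \<in> paths X" "q \<in> paths X"
    "\<And>r. r > 0 \<Longrightarrow> hclose (d_pair d) r (fo p) (fo q)" for p q
    by (rule filled_order_inj[OF that(1,2) P.hclose_limit_eq[OF that(3) K(1)[OF that(1)] K(1)[OF that(2)]]])
  show "hclose (d_pair d) r (fo q) (fo p)"
    if "hclose (d_pair d) r (fo p) (fo q)" for r p q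
    by (rule P.hclose_sym[OF that])
qed (use d_part_le d_part_less in \<open>auto simp: d_part_def\<close>)

text \<open>Separation of points is inherited from \<open>d_part\<close>, which \<open>d_tot\<close>
  dominates; the hard axiom, the triangle inequality, is \<open>tclose_trans\<close>.\<close>

lemma Metric_space_d_tot: "Metric_space (paths X) (d_tot X B d)"
proof (rule metric_from_closeness[where P = "paths X" and R = tclosep])
  interpret D: Metric_space "paths X" "d_part X B d"
    by (rule Metric_space_d_part)
  have part: "d_part X B d p q \<le> r" if "p \<in> paths X" "q \<in> paths X" "tclosep r p q" for p q r
    by (rule d_part_le[OF that(1,2) Z.tclose_imp_hclose_pair[OF filled_corder[OF that(1)] filled_corder[OF that(2)] that(3)]])
  show "tclosep 0 p p" if "p \<in> paths X" for p
    by (rule Z.tclose_refl[OF filled_corder[OF that]])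
  show "0 \<le> r" if "p \<in> paths X" "q \<in> paths X" "tclosep r p q" for p q r
    using part[OF that] D.nonneg order_trans by blast
  show "tclosep (r + s) p u"
    if "p \<in> paths X" "q \<in> paths X" "u \<in> paths X" "tclosep r p q" "tclosep s q u" for r s p q u
    by (rule Z.tclose_trans[OF filled_corder[OF that(1)] filled_corder[OF that(2)] filled_corder[OF that(3)] that(4,5)])
  show "p = q" if pq: "p \<in> paths X" "q \<in> paths X" "\<And>r. r > 0 \<Longrightarrow> tclosep r p q" for p q
  proof -
    have "d_part X B d p q \<le> 0"
      using part[OF pq(1,2) pq(3)] by (rule field_le_epsilon[of _ 0, simplified])
    then show ?thesis
      using D.nonneg[of p q] D.zero[OF pq(1,2)] by linarith
  qed
  show "tclosep r q p" if "tclosep r p q" for r p q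
    by (rule Z.tclose_sym[OF that])
qed (use d_tot_le d_tot_less in \<open>auto simp: d_tot_def\<close>)

lemma d_part_imp_d_tot:
  assumes p: "p \<in> paths X" and e: "e > 0"
  shows "\<exists>\<delta>>0. \<forall>q\<in>paths X. d_part X B d p q < \<delta> \<longrightarrow> d_tot X B d p q < e"
proof -
  obtain \<delta> where \<delta>: "\<delta> > 0"
    "\<And>A' le'. Z.corder A' le' \<Longrightarrow> hclose (d_pair d) \<delta> (fo p) le' \<Longrightarrow>
      Z.tclose (e / 2) (fl p) (fo p) A' le'"
    using Z.hclose_pair_imp_tclose[OF filled_corder[OF p], of "e / 2"] e half_gt_zero by blast
  have "d_tot X B d p q < e" if "q \<in> paths X" "d_part X B d p q < \<delta>" for q
    using d_tot_le[OF p that(1) \<delta>(2)[OF filled_corder[OF that(1)] d_part_less[OF p that]]] e by linarith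
  then show ?thesis
    using \<delta>(1) by blast
qed

lemma d_tot_d_part_topology:
  assumes "P \<subseteq> paths X"
  shows "Metric_space.mtopology P (d_tot X B d) = Metric_space.mtopology P (d_part X B d)"
proof (rule mtopology_eqI)
  show "Metric_space P (d_tot X B d)" "Metric_space P (d_part X B d)"
    by (rule Metric_space.subspace[OF _ assms], rule Metric_space_d_tot Metric_space_d_part)+
  fix p :: "'a path" and e :: real assume p: "p \<in> P" and e: "e > 0"
  show "\<exists>\<delta>>0. \<forall>q\<in>P. d_tot X B d p q < \<delta> \<longrightarrow> d_part X B d p q < e"
  proof (intro exI[of _ e] conjI ballI impI)
    fix q assume "q \<in> P" "d_tot X B d p q < e"
    then show "d_part X B d p q < e"
      using d_part_le_d_tot[of p q] p assms by (meson le_less_trans subsetD)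
  qed (rule e)
  show "\<exists>\<delta>>0. \<forall>q\<in>P. d_part X B d p q < \<delta> \<longrightarrow> d_tot X B d p q < e"
    using d_part_imp_d_tot[OF _ e, of p] p assms by blast
qed

text \<open>Membership in \<open>Cor_plus\<close> does not mention the metric, so the same
  correspondence serves for both metrics. Its first coordinates lie in one compact filled path,
  along which closeness for one metric implies closeness for the other uniformly.\<close>

lemma d_tot_topology_indep:
  assumes d': "metric_generates (squeezed X) d' (squeezed_topology X)"
  shows "Metric_space.mtopology (paths X) (d_tot X B d') = Metric_space.mtopology (paths X) (d_tot X B d)"
proof -
  have fine: "\<exists>\<delta>>0. \<forall>q\<in>paths X. d_tot X B d1 p q < \<delta> \<longrightarrow> d_tot X B d2 p q < e"
    if 1: "path_space X B d1" and 2: "path_space X B d2" and p: "p \<in> paths X" and e: "e > 0" for d1 d2 p e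
  proof -
    interpret P1: path_space X B d1 by fact
    interpret P2: path_space X B d2 by fact
    have "P2.Z.mtopology = P1.Z.mtopology"
      using P1.mtop P2.mtop by simp
    then obtain \<delta> where \<delta>: "\<delta> > 0" "\<And>z w. z \<in> fl p \<Longrightarrow> w \<in> squeezed X \<Longrightarrow> d1 z w \<le> \<delta> \<Longrightarrow> d2 z w \<le> e / 2"
      using P1.Z.uniform_near_compact[OF P2.Z.Metric_space_axioms _ P1.filled_compact[OF p], of "e / 2"] e half_gt_zero
      by blast
    have "d_tot X B d2 p q < e" if q: "q \<in> paths X" "d_tot X B d1 p q < \<delta>" for q
    proof -
      obtain C where C: "C \<in> Cor_plus (fl p) (fo p) (fl q) (fo q)"
        "\<And>z w. (z, w) \<in> C \<Longrightarrow> d1 z w \<le> \<delta>"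
        using P1.d_tot_less[OF p q] unfolding P1.Z.tclose_def by auto
      have "z \<in> fl p \<and> w \<in> squeezed X" if "(z, w) \<in> C" for z w
        using C(1) that P1.filled_sub[OF q(1)] unfolding Cor_plus_def Corr_def by blast
      then have "P2.tclosep (e / 2) p q"
        unfolding P2.Z.tclose_def using C \<delta>(2) by (intro bexI[OF _ C(1)]) auto
      then show ?thesis
        using P2.d_tot_le[OF p q(1)] e by fastforce
    qed
    then show ?thesis
      using \<delta>(1) by blast
  qed
  have ps: "path_space X B d" "path_space X B d'"
    using d' X proper by unfold_locales
  show ?thesis
    by (rule mtopology_eqI) (use path_space.Metric_space_d_tot ps fine in auto)
qed

end

section \<open>The hyperspace of compact sets\<close>

context Metric_space begin

text \<open>Hausdorff convergence with explicit radii, kept free of \<open>hausdorff_dist\<close> so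
  that membership in \<open>nonempty_compacts\<close> need not be carried along.\<close>

definition hseq :: "(nat \<Rightarrow> 'a set) \<Rightarrow> 'a set \<Rightarrow> bool" where
  "hseq K L \<longleftrightarrow> (\<exists>\<delta>. \<delta> \<longlonglongrightarrow> 0 \<and> (\<forall>n. hclose d (\<delta> n) (K n) L))"

lemma hseq_subseq:
  assumes "hseq K L" "strict_mono r"
  shows "hseq (\<lambda>n. K (r n)) L"
proof -
  obtain \<delta> where \<delta>: "\<delta> \<longlonglongrightarrow> 0" "\<And>n. hclose d (\<delta> n) (K n) L"
    using assms(1) unfolding hseq_def by blast
  have "null (\<lambda>n. \<delta> (r n))"
    by (rule strict_mono_subseq_tendsto[OF assms(2) \<delta>(1)])
  then show ?thesis
    unfolding hseq_def by (rule exI[of _ "\<lambda>n. \<delta> (r n)", OF conjI]) (use \<delta>(2) in blast)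
qed

lemma hseq_compact:
  assumes "hseq K L" "compactin mtopology L" "\<And>n. K n \<subseteq> M" "\<And>n. u n \<in> K n"
  shows "\<exists>l\<in>L. \<exists>r. subseq r \<and> null (\<lambda>n. d (u (r n)) l)"
proof -
  obtain \<delta> where \<delta>: "\<delta> \<longlonglongrightarrow> 0" "\<And>n. hclose d (\<delta> n) (K n) L"
    using assms(1) unfolding hseq_def by blast
  have "\<exists>v. v \<in> L \<and> d (u n) v \<le> \<delta> n" for n
    using \<delta>(2)[of n] assms(4)[of n] unfolding hclose_def by blast
  then obtain v where v: "\<And>n. v n \<in> L" "\<And>n. d (u n) (v n) \<le> \<delta> n"
    by metis
  have uM: "u n \<in> M" for n
    using assms(3,4) by blast
  have "null (\<lambda>n. d (v n) (u n))"
    by (rule Lim_null_comparison[OF always_eventually \<delta>(1)]) (use v(2) commute in simp)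
  then obtain l r where "l \<in> L" "strict_mono r" "null (\<lambda>n. d (u (r n)) l)"
    by (rule compact_near_seq[OF assms(2) v(1) uM])
  then show ?thesis by blast
qed

lemma hseq_approx:
  assumes "hseq K L" "l \<in> L"
  shows "\<exists>u. (\<forall>n. u n \<in> K n) \<and> null (\<lambda>n. d (u n) l)"
proof -
  obtain \<delta> where \<delta>: "\<delta> \<longlonglongrightarrow> 0" "\<And>n. hclose d (\<delta> n) (K n) L"
    using assms(1) unfolding hseq_def by blast
  have "\<exists>v. v \<in> K n \<and> d v l \<le> \<delta> n" for n
    using \<delta>(2)[of n] assms(2) unfolding hclose_def by blast
  then obtain v where v: "\<And>n. v n \<in> K n" "\<And>n. d (v n) l \<le> \<delta> n"
    by metis
  have "null (\<lambda>n. d (v n) l)"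
    by (rule Lim_null_comparison[OF always_eventually \<delta>(1)]) (use v(2) in simp)
  then show ?thesis
    using v(1) by blast
qed

lemma hseq_limit:
  assumes "hseq K L" "compactin mtopology L" "\<And>n. K n \<subseteq> M" "\<And>n. u n \<in> K n" "l \<in> M" "null (\<lambda>n. d (u n) l)"
  shows "l \<in> L"
proof -
  obtain l' r where l': "l' \<in> L" "subseq r" "null (\<lambda>n. d (u (r n)) l')"
    using hseq_compact[OF assms(1-4)] by blast
  have "l = l'"
  proof (rule seq_unique[of "\<lambda>n. u (r n)" l l', OF _ assms(5) _ _ l'(3)])
    show "null (\<lambda>n. d (u (r n)) l)"
      by (rule strict_mono_subseq_tendsto[OF l'(2) assms(6)])
  qed (use assms(3,4) l'(1) compact_subset[OF assms(2)] in blast)+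
  then show ?thesis
    using l'(1) by simp
qed

lemma hseq_away:
  assumes "hseq K L" "L \<subseteq> M" "\<And>n. K n \<subseteq> M" "\<And>n. u n \<in> M" "l \<in> M" "null (\<lambda>n. d (u n) l)"
    and away: "\<And>n v. v \<in> K n \<Longrightarrow> e \<le> d (u n) v" and v: "v \<in> L"
  shows "e \<le> d l v"
proof -
  obtain w where w: "\<And>n. w n \<in> K n" "null (\<lambda>n. d (w n) v)"
    using hseq_approx[OF assms(1) v] by blast
  have "(\<lambda>n. d (u n) (w n)) \<longlonglongrightarrow> d l v"
    by (rule seq_dist[OF assms(4) _ assms(5) _ assms(6) w(2)]) (use w(1) assms(2,3) v in blast)+
  then show ?thesis
    by (rule LIMSEQ_le_const) (use away w(1) in blast)
qed

lemma hyper_closedI: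
  assumes sub: "S \<subseteq> nonempty_compacts mtopology"
    and cl: "\<And>K L. (\<And>n. K n \<in> S) \<Longrightarrow> L \<in> nonempty_compacts mtopology \<Longrightarrow> hseq K L \<Longrightarrow> L \<in> S"
  shows "closedin (Metric_space.mtopology (nonempty_compacts mtopology) (hausdorff_dist mtopology d)) S"
proof -
  interpret H: Metric_space "nonempty_compacts mtopology" "hausdorff_dist mtopology d"
    by (rule Metric_space_hausdorff_dist)
  show ?thesis
    unfolding H.metric_closedin_iff_sequentially_closed
  proof (intro conjI allI impI)
    fix K L assume *: "range K \<subseteq> S \<and> limitin H.mtopology K L sequentially"
    then have KS: "\<And>n. K n \<in> S" and L: "L \<in> nonempty_compacts mtopology"
      and lim: "null (\<lambda>n. hausdorff_dist mtopology d (K n) L)"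
      unfolding H.limitin_metric_dist_null by auto
    have "null (\<lambda>n. hausdorff_dist mtopology d (K n) L + 1 / real (Suc n))"
      using tendsto_add[OF lim lim_1_over_Suc] by simp
    moreover have "hclose d (hausdorff_dist mtopology d (K n) L + 1 / real (Suc n)) (K n) L" for n
      using KS sub L by (intro hausdorff_dist_less) auto
    ultimately have "hseq K L"
      unfolding hseq_def by blast
    then show "L \<in> S"
      by (rule cl[OF KS L])
  qed (rule sub)
qed

lemma compact_away:
  assumes "compactin mtopology K" "z \<in> M" "z \<notin> K"
  shows "\<exists>n. \<forall>v\<in>K. 1 / real (Suc n) \<le> d z v"
proof (rule ccontr)
  assume "\<not> ?thesis"
  then have "\<exists>v. v \<in> K \<and> d v z \<le> 1 / real (Suc n)" for n
    using commute by (metis less_imp_le not_le)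
  then obtain v where v: "\<And>n. v n \<in> K" "\<And>n. d (v n) z \<le> 1 / real (Suc n)"
    by metis
  have "null (\<lambda>n. d (v n) z)"
    by (rule Lim_null_comparison[OF always_eventually lim_1_over_Suc]) (use v(2) in simp)
  then show False
    using compact_seq_closed[of K v z, OF assms(1) v(1) assms(2)] assms(3) by blast
qed

text \<open>The limit is the set of points approached by all late sets. The union of a Cauchy
  sequence of compact sets is totally bounded, so in a complete space any sequence of points picked
  from these sets has a convergent subsequence. This provides enough points in the limit, and its
  compactness.\<close>

lemma hausdorff_mcomplete:
  assumes mcomplete
  shows "Metric_space.mcomplete (nonempty_compacts mtopology) (hausdorff_dist mtopology d)"
proof -
  interpret H: Metric_space "nonempty_compacts mtopology" "hausdorff_dist mtopology d"
    by (rule Metric_space_hausdorff_dist)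
  show ?thesis
    unfolding H.mcomplete_def
  proof (intro allI impI)
    fix K assume C: "H.MCauchy K"
    have K: "K n \<in> nonempty_compacts mtopology" for n
      using C unfolding H.MCauchy_def by blast
    have KM: "K n \<subseteq> M" and Kc: "compactin mtopology (K n)" and Kne: "K n \<noteq> {}" for n
      using K[of n] compact_subset by (auto simp: nonempty_compacts_def)
    have cau: "\<exists>N. \<forall>n\<ge>N. \<forall>m\<ge>N. hclose d \<epsilon> (K n) (K m)" if \<epsilon>: "\<epsilon> > 0" for \<epsilon>
    proof -
      obtain N where "\<forall>n n'. N \<le> n \<longrightarrow> N \<le> n' \<longrightarrow> hausdorff_dist mtopology d (K n) (K n') < \<epsilon>"
        using C \<epsilon> unfolding H.MCauchy_def by blast
      then show ?thesis
        using hausdorff_dist_less[OF K K] by blast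
    qed
    \<comment> \<open>All sets beyond some \<open>N\<close> lie within \<open>\<epsilon> / 2\<close>
      of \<open>K N\<close>, so a finite \<open>\<epsilon> / 2\<close>-net of the first sets is an
      \<open>\<epsilon>\<close>-net of the union.\<close>
    define U where "U = (\<Union>n. K n)"
    have UM: "U \<subseteq> M"
      using KM by (auto simp: U_def)
    have tb: "mtotally_bounded U"
      unfolding mtotally_bounded_def
    proof (intro allI impI)
      fix \<epsilon> :: real assume \<epsilon>: "\<epsilon> > 0"
      obtain N where N: "\<And>n. n \<ge> N \<Longrightarrow> hclose d (\<epsilon> / 2) (K n) (K N)"
        using cau[of "\<epsilon> / 2"] \<epsilon> by auto
      have "compactin mtopology (\<Union>n\<le>N. K n)"
        using Kc by (intro compactin_Union) auto
      then have "mtotally_bounded (\<Union>n\<le>N. K n)"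
        by (rule compactin_imp_mtotally_bounded)
      then obtain F where F: "finite F" "F \<subseteq> (\<Union>n\<le>N. K n)" "(\<Union>n\<le>N. K n) \<subseteq> (\<Union>x\<in>F. mball x (\<epsilon> / 2))"
        using \<epsilon> unfolding mtotally_bounded_def by (meson half_gt_zero)
      have "U \<subseteq> (\<Union>x\<in>F. mball x \<epsilon>)"
      proof
        fix y assume "y \<in> U"
        then obtain n where n: "y \<in> K n"
          by (auto simp: U_def)
        have "\<exists>x\<in>(\<Union>n\<le>N. K n). d y x \<le> \<epsilon> / 2"
        proof (cases "n \<le> N")
          case True
          then show ?thesis
            using n KM \<epsilon> by (intro bexI[of _ y]) (auto simp: subset_iff)
        next
          case False
          then have "hclose d (\<epsilon> / 2) (K n) (K N)"
            by (intro N) simp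
          then obtain x where "x \<in> K N" "d y x \<le> \<epsilon> / 2"
            using n unfolding hclose_def by blast
          then show ?thesis
            by (intro bexI[of _ x]) auto
        qed
        then obtain x where x: "x \<in> (\<Union>n\<le>N. K n)" "d y x \<le> \<epsilon> / 2"
          by blast
        then obtain f where f: "f \<in> F" "f \<in> M" "x \<in> M" "d f x < \<epsilon> / 2"
          using F(3) by auto
        have yM: "y \<in> M"
          using n KM by blast
        have "d f y < \<epsilon>"
          using triangle[OF f(2,3) yM] commute[of x y] f(4) x(2) by linarith
        then show "y \<in> (\<Union>x\<in>F. mball x \<epsilon>)"
          using f yM by auto
      qed
      then show "\<exists>F. finite F \<and> F \<subseteq> U \<and> U \<subseteq> (\<Union>x\<in>F. mball x \<epsilon>)"
      proof (intro exI[of _ F] conjI)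
        show "F \<subseteq> U"
          using F(2) by (auto simp: U_def)
      qed (rule F(1))
    qed
    have seq: "\<exists>y r. y \<in> M \<and> subseq r \<and> null (\<lambda>n. d (\<sigma> (r n)) y)" if "\<And>n. \<sigma> n \<in> U" for \<sigma>
    proof -
      have "range \<sigma> \<subseteq> U"
        using that by blast
      then obtain r where r: "strict_mono r" "MCauchy (\<sigma> \<circ> r)"
        using tb unfolding mtotally_bounded_sequentially by blast
      then obtain y where "limitin mtopology (\<sigma> \<circ> r) y sequentially"
        using assms unfolding mcomplete_def by blast
      then show ?thesis
        using r(1) by (auto simp: limitin_metric_dist_null)
    qed
    define L where "L = {x \<in> M. \<forall>\<epsilon>>0. \<exists>N. \<forall>n\<ge>N. \<exists>y\<in>K n. d y x \<le> \<epsilon>}"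
    \<comment> \<open>Limits of points taken from sets of growing index are approached by all late
      sets, since these are close to each other.\<close>
    have inL: "y \<in> L" if y: "y \<in> M" and \<sigma>: "null (\<lambda>n. d (\<sigma> n) y)" "\<And>n. \<sigma> n \<in> K (m n)" "\<And>n. n \<le> m n" for y \<sigma> m
      unfolding L_def
    proof (intro CollectI conjI allI impI y)
      fix \<epsilon> :: real assume \<epsilon>: "\<epsilon> > 0"
      obtain N where N: "\<And>n k. n \<ge> N \<Longrightarrow> k \<ge> N \<Longrightarrow> hclose d (\<epsilon> / 2) (K n) (K k)"
        using cau[of "\<epsilon> / 2"] \<epsilon> by auto
      obtain k where k: "k \<ge> N" "d (\<sigma> k) y < \<epsilon> / 2"
        using order_tendstoD(2)[OF \<sigma>(1), of "\<epsilon> / 2"] \<epsilon> unfolding eventually_sequentially by (meson half_gt_zero linear)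
      have "\<exists>x\<in>K n. d x y \<le> \<epsilon>" if n: "n \<ge> N" for n
      proof -
        obtain x where x: "x \<in> K n" "d x (\<sigma> k) \<le> \<epsilon> / 2"
          using N[OF n, of "m k"] k(1) \<sigma>(3)[of k] \<sigma>(2)[of k] unfolding hclose_def by auto
        have "d x y \<le> d x (\<sigma> k) + d (\<sigma> k) y"
          using triangle x(1) \<sigma>(2) KM y by blast
        then show ?thesis
          using x k(2) by (intro bexI[of _ x]) auto
      qed
      then show "\<exists>N. \<forall>n\<ge>N. \<exists>x\<in>K n. d x y \<le> \<epsilon>"
        by blast
    qed
    have LM: "L \<subseteq> M"
      by (auto simp: L_def)
    have near: "\<exists>N. \<forall>n\<ge>N. hclose d \<epsilon> (K n) L" if \<epsilon>: "\<epsilon> > 0" for \<epsilon>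
    proof -
      obtain N where N: "\<And>n k. n \<ge> N \<Longrightarrow> k \<ge> N \<Longrightarrow> hclose d (\<epsilon> / 2) (K n) (K k)"
        using cau[of "\<epsilon> / 2"] \<epsilon> by auto
      have "\<exists>y\<in>L. d x y \<le> \<epsilon>" if n: "n \<ge> N" and x: "x \<in> K n" for n x
      proof -
        have "\<exists>v. v \<in> K (n + k) \<and> d x v \<le> \<epsilon> / 2" for k
          using N[OF n, of "n + k"] n x unfolding hclose_def by auto
        then obtain v where v: "\<And>k. v k \<in> K (n + k)" "\<And>k. d x (v k) \<le> \<epsilon> / 2"
          by metis
        obtain y r where y: "y \<in> M" "subseq r" "null (\<lambda>k. d (v (r k)) y)"
          using seq[of v] v(1) unfolding U_def by blast
        have "y \<in> L"
          by (rule inL[OF y(1,3) v(1)]) (use seq_suble[OF y(2)] in \<open>simp add: trans_le_add2\<close>)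
        moreover have "(\<lambda>k. d x (v (r k))) \<longlonglongrightarrow> d x y"
          by (rule seq_dist[OF _ _ _ y(1) _ y(3)]) (use x v(1) KM mdist_zero in \<open>auto simp: subset_iff\<close>)
        then have "d x y \<le> \<epsilon> / 2"
          by (rule LIMSEQ_le_const2) (use v(2) in blast)
        ultimately show ?thesis
          using \<epsilon> by (intro bexI[of _ y]) simp_all
      qed
      moreover have "\<exists>x\<in>K n. d x y \<le> \<epsilon>" if n: "n \<ge> N" and y: "y \<in> L" for n y
      proof -
        obtain N' where N': "\<And>k. k \<ge> N' \<Longrightarrow> \<exists>v\<in>K k. d v y \<le> \<epsilon> / 2"
          using y half_gt_zero[OF \<epsilon>] unfolding L_def by blast
        obtain v where v: "v \<in> K (max N N')" "d v y \<le> \<epsilon> / 2"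
          using N'[of "max N N'"] by auto
        obtain x where x: "x \<in> K n" "d x v \<le> \<epsilon> / 2"
          using N[OF n, of "max N N'"] v(1) unfolding hclose_def by auto
        have "d x y \<le> d x v + d v y"
          using triangle x(1) v(1) KM LM y by blast
        then show ?thesis
          using x v by (intro bexI[of _ x]) auto
      qed
      ultimately show ?thesis
        unfolding hclose_def by blast
    qed
    have Lne: "L \<noteq> {}"
    proof -
      obtain N where "hclose d 1 (K N) L"
        using near[of 1] by auto
      then show ?thesis
        using Kne[of N] unfolding hclose_def by blast
    qed
    have "compactin mtopology L"
    proof (rule compact_seqI[OF LM])
      fix \<sigma> :: "nat \<Rightarrow> 'a" assume \<sigma>: "\<And>n. \<sigma> n \<in> L"
      have "\<exists>m v. n \<le> m \<and> v \<in> K m \<and> d v (\<sigma> n) \<le> 1 / real (Suc n)" for n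
      proof -
        have "0 < 1 / real (Suc n)"
          by simp
        then obtain N where "\<forall>k\<ge>N. \<exists>v\<in>K k. d v (\<sigma> n) \<le> 1 / real (Suc n)"
          using \<sigma>[of n] unfolding L_def by blast
        then show ?thesis
          by (meson max.cobounded1 max.cobounded2)
      qed
      then obtain m v where v: "\<And>n. n \<le> m n" "\<And>n. v n \<in> K (m n)" "\<And>n. d (v n) (\<sigma> n) \<le> 1 / real (Suc n)"
        by metis
      obtain y r where y: "y \<in> M" "subseq r" "null (\<lambda>k. d (v (r k)) y)"
        using seq[of v] v(2) unfolding U_def by blast
      have "null (\<lambda>n. d (v (r n)) (\<sigma> (r n)))"
        by (rule Lim_null_comparison[OF _ strict_mono_subseq_tendsto[OF y(2) lim_1_over_Suc]]) (use v(3) in simp)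
      then have "null (\<lambda>n. d (\<sigma> (r n)) y)"
        by (rule seq_near[OF _ _ y(1,3), rotated 2]) (use v(2) KM \<sigma> LM in blast)+
      moreover have "y \<in> L"
        by (rule inL[OF y(1,3) v(2)]) (use seq_suble[OF y(2)] v(1) in \<open>blast intro: order_trans\<close>)
      ultimately show "\<exists>l\<in>L. \<exists>r. subseq r \<and> null (\<lambda>n. d (\<sigma> (r n)) l)"
        using y(2) by blast
    qed
    then have L: "L \<in> nonempty_compacts mtopology"
      using Lne by (simp add: nonempty_compacts_def)
    have "limitin H.mtopology K L sequentially"
      unfolding H.limit_metric_sequentially
    proof (intro conjI allI impI L)
      fix \<epsilon> :: real assume \<epsilon>: "\<epsilon> > 0"
      then obtain N where N: "\<And>n. n \<ge> N \<Longrightarrow> hclose d (\<epsilon> / 2) (K n) L"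
        using near[of "\<epsilon> / 2"] by auto
      have "hausdorff_dist mtopology d (K n) L < \<epsilon>" if "n \<ge> N" for n
        using hausdorff_dist_le[OF K L N[OF that]] \<epsilon> by linarith
      then show "\<exists>N. \<forall>n\<ge>N. K n \<in> nonempty_compacts mtopology \<and> hausdorff_dist mtopology d (K n) L < \<epsilon>"
        using K by blast
    qed
    then show "\<exists>L. limitin H.mtopology K L sequentially"
      by blast
  qed
qed

text \<open>Nonempty finite subsets of a countable dense set are dense in the hyperspace: a compact
  set is covered by finitely many balls of radius \<open>e / 4\<close>, and each centre is moved by
  less than \<open>e / 4\<close> into the dense set.\<close>

lemma hausdorff_separable:
  assumes "separable_space mtopology"
  shows "separable_space (Metric_space.mtopology (nonempty_compacts mtopology) (hausdorff_dist mtopology d))"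
proof -
  obtain C where C: "countable C" "C \<subseteq> M" "\<And>x e. x \<in> M \<Longrightarrow> e > 0 \<Longrightarrow> \<exists>c\<in>C. d x c < e"
    using assms separable_space_metric[OF Metric_space_axioms] by blast
  define D where "D = {F. F \<subseteq> C \<and> finite F} - {{}}"
  have "countable D"
    unfolding D_def using countable_Collect_finite_subset[OF C(1)] by (simp add: conj_commute countable_Diff)
  moreover have DN: "D \<subseteq> nonempty_compacts mtopology"
    using C(2) by (auto simp: D_def nonempty_compacts_def intro!: finite_imp_compactin)
  moreover have "\<exists>F\<in>D. hausdorff_dist mtopology d K F < e"
    if K: "K \<in> nonempty_compacts mtopology" and e: "e > 0" for K e
  proof -
    have Kc: "compactin mtopology K" "K \<noteq> {}"
      using K by (auto simp: nonempty_compacts_def)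
    note KM = compact_subset[OF Kc(1)]
    have "mtotally_bounded K"
      using compactin_imp_mtotally_bounded Kc by blast
    then obtain F where F: "finite F" "F \<subseteq> K" "K \<subseteq> (\<Union>x\<in>F. mball x (e / 4))"
      using e unfolding mtotally_bounded_def by (meson zero_less_divide_iff zero_less_numeral)
    have "\<exists>c. c \<in> C \<and> d x c < e / 4" if "x \<in> F" for x
      using C(3)[of x "e / 4"] that F(2) KM e by auto
    then obtain g where g: "\<And>x. x \<in> F \<Longrightarrow> g x \<in> C" "\<And>x. x \<in> F \<Longrightarrow> d x (g x) < e / 4"
      by metis
    have "F \<noteq> {}"
      using F(3) Kc(2) by auto
    then have gD: "g ` F \<in> D"
      using F(1) g(1) by (auto simp: D_def)
    have "hclose d (e / 2) K (g ` F)"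
      unfolding hclose_def
    proof (intro conjI ballI)
      fix x assume x: "x \<in> K"
      then obtain f where f: "f \<in> F" "d f x < e / 4"
        using F(3) by auto
      have "d x (g f) \<le> d f x + d f (g f)"
        using triangle''[OF subsetD[OF KM x] subsetD[OF KM subsetD[OF F(2) f(1)]] subsetD[OF C(2) g(1)[OF f(1)]]] .
      then show "\<exists>b\<in>g ` F. d x b \<le> e / 2"
        using f g(2)[OF f(1)] by (intro bexI[of _ "g f"]) auto
    next
      fix y assume "y \<in> g ` F"
      then obtain f where f: "f \<in> F" "y = g f"
        by blast
      then show "\<exists>a\<in>K. d a y \<le> e / 2"
        using g(2)[OF f(1)] F(2) e by (intro bexI[of _ f]) auto
    qed
    then have "hausdorff_dist mtopology d K (g ` F) \<le> e / 2"
      using gD DN K by (intro hausdorff_dist_le) auto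
    then show ?thesis
      using gD e by (intro bexI[of _ "g ` F"]) auto
  qed
  ultimately show ?thesis
    unfolding separable_space_metric[OF Metric_space_hausdorff_dist] by blast
qed

end

lemma gdelta_in_complements:
  assumes "\<And>n::nat. closedin T {x \<in> topspace T. Bad n x}"
  shows "gdelta_in T {x \<in> topspace T. \<forall>n. \<not> Bad n x}"
proof -
  have "gdelta_in T (topspace T - {x \<in> topspace T. Bad n x})" for n
    using assms[of n] by (intro open_imp_gdelta_in) (simp add: openin_diff)
  then have "gdelta_in T (\<Inter>n. topspace T - {x \<in> topspace T. Bad n x})"
    by (intro gdelta_in_Inter) auto
  moreover have "(\<Inter>n. topspace T - {x \<in> topspace T. Bad n x}) = {x \<in> topspace T. \<forall>n. \<not> Bad n x}"
    by auto
  ultimately show ?thesis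
    by simp
qed

section \<open>Polish path spaces\<close>

context path_space begin

sublocale P: Metric_space "squeezed X \<times> squeezed X" "d_pair d"
  by (rule pair_metric)

abbreviation hyper :: "'a sqz rel set" where
  "hyper \<equiv> nonempty_compacts P.mtopology"

abbreviation hyper_dist :: "'a sqz rel \<Rightarrow> 'a sqz rel \<Rightarrow> real" where
  "hyper_dist \<equiv> hausdorff_dist P.mtopology (d_pair d)"

sublocale H: Metric_space hyper hyper_dist
  by (rule P.Metric_space_hausdorff_dist)

lemma hyperD:
  assumes "K \<in> hyper"
  shows "compactin P.mtopology K" "K \<subseteq> squeezed X \<times> squeezed X"
    "(a, b) \<in> K \<Longrightarrow> a \<in> squeezed X" "(a, b) \<in> K \<Longrightarrow> b \<in> squeezed X"
  using assms P.compact_subset by (auto simp: nonempty_compacts_def)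

lemma pair_seq_compact:
  assumes K: "\<And>n. K n \<in> hyper" and L: "L \<in> hyper" and lim: "P.hseq K L" and ab: "\<And>n. (a n, b n) \<in> K n"
  obtains a' b' r where "(a', b') \<in> L" "subseq r"
    "null (\<lambda>n. d (a (r n)) a')" "null (\<lambda>n. d (b (r n)) b')"
proof -
  obtain l r where l: "l \<in> L" "subseq r" "null (\<lambda>n. d_pair d (a (r n), b (r n)) l)"
    using P.hseq_compact[of K L "\<lambda>n. (a n, b n)", OF lim hyperD(1)[OF L] hyperD(2)[OF K] ab] by blast
  obtain a' b' where ab': "l = (a', b')"
    by (cases l)
  show thesis
    using l(3) unfolding ab' Z.d_pair_tendsto_iff[of "\<lambda>n. a (r n)" "\<lambda>n. b (r n)"]
    by (intro that[of a' b' r, OF l(1)[unfolded ab'] l(2)]) auto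
qed

lemma pair_seq_approx:
  assumes lim: "P.hseq K L" and ab: "(a, b) \<in> L"
  obtains u v where "\<forall>n. (u n, v n) \<in> K n" "null (\<lambda>n. d (u n) a)" "null (\<lambda>n. d (v n) b)"
proof -
  obtain w where w: "\<forall>n. w n \<in> K n" "null (\<lambda>n. d_pair d (w n) (a, b))"
    using P.hseq_approx[OF lim ab] by blast
  have "null (\<lambda>n. d_pair d (fst (w n), snd (w n)) (a, b))"
    using w(2) by simp
  then show thesis
    using w(1) unfolding Z.d_pair_tendsto_iff[of "\<lambda>n. fst (w n)" "\<lambda>n. snd (w n)"]
    by (intro that[of "\<lambda>n. fst (w n)" "\<lambda>n. snd (w n)"]) auto
qed

lemma pair_seq_limit:
  assumes K: "\<And>n. K n \<in> hyper" and L: "L \<in> hyper" and lim: "P.hseq K L" and uv: "\<And>n. (u n, v n) \<in> K n"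
    and ab: "a \<in> squeezed X" "b \<in> squeezed X" "null (\<lambda>n. d (u n) a)" "null (\<lambda>n. d (v n) b)"
  shows "(a, b) \<in> L"
  by (rule P.hseq_limit[of K L "\<lambda>n. (u n, v n)", OF lim hyperD(1)[OF L] hyperD(2)[OF K] uv])
    (use ab Z.d_pair_tendsto_iff[of u v a b] in auto)

lemma pair_seq_away:
  assumes K: "\<And>n. K n \<in> hyper" and L: "L \<in> hyper" and lim: "P.hseq K L"
    and M: "\<And>n. u n \<in> squeezed X" "\<And>n. v n \<in> squeezed X" "a \<in> squeezed X" "b \<in> squeezed X"
    and conv: "null (\<lambda>n. d (u n) a)" "null (\<lambda>n. d (v n) b)"
    and away: "\<And>n. \<forall>w\<in>K n. e \<le> d_pair d (u n, v n) w"
  shows "\<forall>w\<in>L. e \<le> d_pair d (a, b) w"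
proof
  fix w assume w: "w \<in> L"
  show "e \<le> d_pair d (a, b) w"
    by (rule P.hseq_away[of K L "\<lambda>n. (u n, v n)" "(a, b)", OF lim hyperD(2)[OF L] hyperD(2)[OF K] _ _ _ _ w])
      (use M conv away Z.d_pair_tendsto_iff[of u v a b] in auto)
qed

text \<open>Describes the orders of filled paths inside the hyperspace by clauses suited to limits:
  the first three give closed sets, the last two G-delta sets. Antisymmetry and transitivity do not
  behave well under limits; they are consequences of these clauses, mainly of the fourth.\<close>

definition good_order :: "'a sqz rel \<Rightarrow> bool" where
  "good_order K \<longleftrightarrow>
    (\<forall>z w. (z, w) \<in> K \<longrightarrow> snd z \<le> snd w) \<and>
    (\<forall>z w. (z, w) \<in> K \<longrightarrow> (z, z) \<in> K \<and> (w, w) \<in> K) \<and>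
    (\<forall>z w. (z, z) \<in> K \<longrightarrow> (w, w) \<in> K \<longrightarrow> (z, w) \<in> K \<or> (w, z) \<in> K) \<and>
    (\<forall>x y w t. ((Some x, ereal t), (Some y, ereal t)) \<in> K \<longrightarrow> ((Some y, ereal t), (Some w, ereal t)) \<in> K \<longrightarrow>
       y \<in> B x w) \<and>
    (\<forall>x w y t. ((Some x, ereal t), (Some w, ereal t)) \<in> K \<longrightarrow> y \<in> B x w \<longrightarrow>
       ((Some y, ereal t), (Some y, ereal t)) \<in> K)"

lemma filled_order_hyper: "p \<in> paths X \<Longrightarrow> fo p \<in> hyper"
  using filled_order_compact pair_mtop by simp

lemma good_filled_order:
  assumes p: "p \<in> paths X"
  shows "good_order (fo p)"
proof -
  note ord = filled_corder[OF p]
  have M: "path_left p t \<in> topspace X" "path_right p t \<in> topspace X" "x \<in> topspace X"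
    if "t \<in> times p" "x \<in> B (path_left p t) (path_right p t)" for t x
    using that path_left_right(4,5)[OF p] bt_subset by blast+
  show ?thesis
    unfolding good_order_def
  proof (intro conjI allI impI)
    fix x y w t
    assume "((Some x, ereal t), (Some y, ereal t)) \<in> fo p" "((Some y, ereal t), (Some w, ereal t)) \<in> fo p"
    then show "y \<in> B x w"
      unfolding filled_order_fibre[OF p] using bt_sub_middle[of "path_left p t" w y x] M by blast
  next
    fix x w y t
    assume *: "((Some x, ereal t), (Some w, ereal t)) \<in> fo p" and y: "y \<in> B x w"
    then have "y \<in> B (path_left p t) (path_right p t)"
      unfolding filled_order_fibre[OF p] using bt_sub_segment[of "path_left p t" "path_right p t" x w] M by blast
    then show "((Some y, ereal t), (Some y, ereal t)) \<in> fo p"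
      using * unfolding filled_order_fibre[OF p] using M[of t y] bt_right[of "path_left p t" y] by blast
  next
    fix z w assume zw: "(z, w) \<in> fo p"
    show "snd z \<le> snd w"
      by (rule filled_order_time(1)[OF zw])
    show "(z, z) \<in> fo p" "(w, w) \<in> fo p"
      using Z.corder_refl[OF ord Z.corder_dom(1)[OF ord zw]] Z.corder_refl[OF ord Z.corder_dom(2)[OF ord zw]] .
  next
    fix z w assume "(z, z) \<in> fo p" "(w, w) \<in> fo p"
    then show "(z, w) \<in> fo p \<or> (w, z) \<in> fo p"
      using Z.corder_total[OF ord] Z.corder_dom(1)[OF ord] by blast
  qed
qed

text \<open>The path is recovered from its filled path by keeping only the first and the last point at each
  time.\<close>

lemma good_order_path:
  assumes KH: "K \<in> hyper" and good: "good_order K"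
  shows "\<exists>p\<in>paths X. fo p = K"
proof -
  note g = good[unfolded good_order_def]
  have time: "(z, w) \<in> K \<Longrightarrow> snd z \<le> snd w" for z w
    using g[THEN conjunct1, rule_format] .
  note g = g[THEN conjunct2]
  have dom: "(z, w) \<in> K \<Longrightarrow> (z, z) \<in> K \<and> (w, w) \<in> K" for z w
    using g[THEN conjunct1] by blast
  note g = g[THEN conjunct2]
  have total: "(z, z) \<in> K \<Longrightarrow> (w, w) \<in> K \<Longrightarrow> (z, w) \<in> K \<or> (w, z) \<in> K" for z w
    using g[THEN conjunct1] by blast
  note g = g[THEN conjunct2]
  have seg: "((Some x, ereal t), (Some y, ereal t)) \<in> K \<Longrightarrow> ((Some y, ereal t), (Some u, ereal t)) \<in> K \<Longrightarrow> y \<in> B x u"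
    for x y u t
    using g[THEN conjunct1, rule_format] .
  have fill: "((Some x, ereal t), (Some u, ereal t)) \<in> K \<Longrightarrow> y \<in> B x u \<Longrightarrow> ((Some y, ereal t), (Some y, ereal t)) \<in> K"
    for x y u t
    using g[THEN conjunct2, rule_format] .
  \<comment> \<open>Both entries of a pair of \<open>K\<close> are reflexive, so the diagonal
    recovers the underlying set.\<close>
  define A where "A = {z. (z, z) \<in> K}"
  have KA: "z \<in> A" "w \<in> A" if "(z, w) \<in> K" for z w
    using dom[OF that] by (auto simp: A_def)
  have AX: "A \<subseteq> squeezed X"
    using hyperD(3)[OF KH] by (auto simp: A_def)
  have lt: "(z, w) \<in> K" if "z \<in> A" "w \<in> A" "snd z < snd w" for z w
  proof -
    have "(z, w) \<in> K \<or> (w, z) \<in> K"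
      using total that(1,2) by (simp add: A_def)
    moreover have "(w, z) \<notin> K"
      using time[of w z] that(3) by auto
    ultimately show ?thesis
      by blast
  qed
  have inf_eq: "z = w" if "z \<in> A" "w \<in> A" "snd z = snd w" "\<bar>snd z\<bar> = \<infinity>" for z w
    using squeezed_inf[of z X] squeezed_inf[of w X] that AX by (metis subsetD)
  have fin: "\<exists>x. z = (Some x, ereal t) \<and> x \<in> topspace X" if "z \<in> A" "snd z = ereal t" for z t
    using subsetD[OF AX that(1)] that(2) by (auto elim!: squeezed_cases)
  text \<open>Antisymmetry and transitivity hold because \<open>x, y, w\<close> cannot lie between each other cyclically.\<close>
  have asym: "z = w" if zw: "(z, w) \<in> K" "(w, z) \<in> K" for z w
  proof -
    have t: "snd z = snd w"
      using time zw by (blast intro: antisym)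
    show ?thesis
    proof (cases "\<bar>snd z\<bar> = \<infinity>")
      case True
      then show ?thesis
        by (rule inf_eq[OF KA[OF zw(1)] t])
    next
      case False
      then obtain t' where t': "snd z = ereal t'" "snd w = ereal t'"
        using t by (cases "snd z") auto
      obtain x y where "z = (Some x, ereal t')" "w = (Some y, ereal t')" "x \<in> topspace X"
        using fin[OF KA(1)[OF zw(1)] t'(1)] fin[OF KA(2)[OF zw(1)] t'(2)] by blast
      then show ?thesis
        using seg[of x t' y x] zw bt_self by simp
    qed
  qed
  have tran: "(z, v) \<in> K" if zwv: "(z, w) \<in> K" "(w, v) \<in> K" for z w v
  proof (cases "snd z < snd v")
    case True
    then show ?thesis
      using lt KA zwv by blast
  next
    case False
    then have t: "snd z = snd w" "snd v = snd w"
      using time[OF zwv(1)] time[OF zwv(2)] by auto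
    show ?thesis
    proof (cases "\<bar>snd z\<bar> = \<infinity>")
      case True
      then have "z = w"
        by (rule inf_eq[OF KA[OF zwv(1)] t(1)])
      then show ?thesis
        using zwv(2) by simp
    next
      case False
      then obtain t' where t': "snd z = ereal t'" "snd w = ereal t'" "snd v = ereal t'"
        using t by (cases "snd z") auto
      obtain x y u where xyu: "z = (Some x, ereal t')" "w = (Some y, ereal t')" "v = (Some u, ereal t')"
        and M: "x \<in> topspace X" "y \<in> topspace X" "u \<in> topspace X"
        using fin[OF KA(1)[OF zwv(1)] t'(1)] fin[OF KA(2)[OF zwv(1)] t'(2)] fin[OF KA(2)[OF zwv(2)] t'(3)] by blast
      have "x = y" if "(v, z) \<in> K"
      proof -
        have "y \<in> B x u" "x \<in> B u y"
          using seg[of x t' y u] seg[of u t' x y] zwv that by (simp_all add: xyu)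
        then show ?thesis
          using bt_all[OF M(1,3)] bt_subset[OF M(2,3)] bt_all[OF M(2,3)] bt_all[OF M(1,2)] by (metis Int_iff singletonD)
      qed
      then show ?thesis
        using total[of z v, OF dom[OF zwv(1), THEN conjunct1] dom[OF zwv(2), THEN conjunct2]] zwv(2) unfolding xyu by blast
    qed
  qed

  \<comment> \<open>\<open>K\<close> as a closed order on a compact set\<close>
  have Kc: "compactin P.mtopology K" and Kne: "K \<noteq> {}"
    using KH by (auto simp: nonempty_compacts_def)
  have Kcl: "(x, y) \<in> K" if "\<And>n. (\<sigma> n, \<tau> n) \<in> K" "x \<in> squeezed X" "y \<in> squeezed X"
    "null (\<lambda>n. d (\<sigma> n) x)" "null (\<lambda>n. d (\<tau> n) y)" for \<sigma> \<tau> x y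
    by (rule P.compact_seq_closed[of K "\<lambda>n. (\<sigma> n, \<tau> n)", OF Kc that(1)])
      (use that Z.d_pair_tendsto_iff[of \<sigma> \<tau> x y] in auto)
  have ord: "Z.corder A K"
    unfolding Z.corder_def
  proof (intro conjI allI impI)
    show "A \<noteq> {}"
      using Kne KA by auto
    show "compactin Z.mtopology A"
    proof (rule Z.compact_seqI[OF AX])
      fix \<sigma> :: "nat \<Rightarrow> 'a sqz" assume \<sigma>: "\<And>n. \<sigma> n \<in> A"
      obtain l r where l: "l \<in> K" "strict_mono r" "null (\<lambda>n. d_pair d (\<sigma> (r n), \<sigma> (r n)) l)"
        by (rule P.compact_seq[of K "\<lambda>n. (\<sigma> n, \<sigma> n)", OF Kc]) (use \<sigma> in \<open>simp add: A_def\<close>)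
      obtain a b where ab: "l = (a, b)"
        by (cases l)
      have "null (\<lambda>n. d (\<sigma> (r n)) a)"
        using l(3) unfolding ab Z.d_pair_tendsto_iff[of "\<lambda>n. \<sigma> (r n)" "\<lambda>n. \<sigma> (r n)"] by simp
      moreover have "a \<in> A"
        using l(1) KA unfolding ab by blast
      ultimately show "\<exists>l\<in>A. \<exists>r. subseq r \<and> null (\<lambda>n. d (\<sigma> (r n)) l)"
        using l(2) by blast
    qed
    have "K \<subseteq> A \<times> A"
      using KA by auto
    moreover have "refl_on A K"
      by (simp add: A_def refl_on_def)
    moreover have "trans K"
      by (rule transI) (rule tran)
    moreover have "antisym K"
      by (rule antisymI) (rule asym)
    moreover have "total_on A K"
      by (rule total_onI) (simp add: A_def total)
    ultimately show "linear_order_on A K"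
      unfolding linear_order_on_def partial_order_on_def preorder_on_def by blast
  next
    fix \<sigma> \<tau> :: "nat \<Rightarrow> 'a sqz" and x y
    assume *: "\<forall>n. (\<sigma> n, \<tau> n) \<in> K" "x \<in> A" "y \<in> A" "null (\<lambda>n. d (\<sigma> n) x)" "null (\<lambda>n. d (\<tau> n) y)"
    show "(x, y) \<in> K"
      by (rule Kcl[of \<sigma> \<tau>, OF *(1)[rule_format] subsetD[OF AX *(2)] subsetD[OF AX *(3)] *(4,5)])
  qed

  \<comment> \<open>First and last points at each time\<close>
  define mn where "mn z \<longleftrightarrow> z \<in> A \<and> (\<forall>w\<in>A. snd w = snd z \<longrightarrow> (z, w) \<in> K)" for z
  define mx where "mx z \<longleftrightarrow> z \<in> A \<and> (\<forall>w\<in>A. snd w = snd z \<longrightarrow> (w, z) \<in> K)" for z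
  have fibre_closed: "x \<in> {w \<in> A. snd w = t}"
    if "\<And>n::nat. \<sigma> n \<in> {w \<in> A. snd w = t}" "x \<in> A" "null (\<lambda>n. d (\<sigma> n) x)" for \<sigma> x t
  proof -
    have "(\<lambda>n. snd (\<sigma> n)) \<longlonglongrightarrow> snd x"
      by (rule lim_time[of \<sigma> x, OF subsetD[OF AX] subsetD[OF AX that(2)] that(3)]) (use that(1) in blast)
    moreover have "snd (\<sigma> n) = t" for n
      using that(1)[of n] by simp
    ultimately have "snd x = t"
      by (simp add: LIMSEQ_const_iff)
    then show ?thesis
      using that(2) by simp
  qed
  have mn_ex: "\<exists>m. mn m \<and> snd m = snd z" if "z \<in> A" for z
  proof -
    have "\<exists>m\<in>{w \<in> A. snd w = snd z}. \<forall>x\<in>{w \<in> A. snd w = snd z}. (m, x) \<in> K"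
    proof (rule Z.corder_min[OF ord])
      show "\<And>\<sigma> x. (\<And>n::nat. \<sigma> n \<in> {w \<in> A. snd w = snd z}) \<Longrightarrow> x \<in> A \<Longrightarrow> null (\<lambda>n. d (\<sigma> n) x) \<Longrightarrow>
        x \<in> {w \<in> A. snd w = snd z}"
        by (rule fibre_closed)
      show "{w \<in> A. snd w = snd z} \<noteq> {}"
        using that by blast
    qed blast
    then show ?thesis
      by (auto simp: mn_def)
  qed
  have mx_ex: "\<exists>m. mx m \<and> snd m = snd z" if "z \<in> A" for z
  proof -
    have "\<exists>m\<in>{w \<in> A. snd w = snd z}. \<forall>x\<in>{w \<in> A. snd w = snd z}. (x, m) \<in> K"
    proof (rule Z.corder_max[OF ord])
      show "\<And>\<sigma> x. (\<And>n::nat. \<sigma> n \<in> {w \<in> A. snd w = snd z}) \<Longrightarrow> x \<in> A \<Longrightarrow> null (\<lambda>n. d (\<sigma> n) x) \<Longrightarrow>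
        x \<in> {w \<in> A. snd w = snd z}"
        by (rule fibre_closed)
      show "{w \<in> A. snd w = snd z} \<noteq> {}"
        using that by blast
    qed blast
    then show ?thesis
      by (auto simp: mx_def)
  qed
  have mn_uniq: "m = m'" if "mn m" "mn m'" "snd m = snd m'" for m m'
    using that asym unfolding mn_def by metis
  have mx_uniq: "m = m'" if "mx m" "mx m'" "snd m = snd m'" for m m'
    using that asym unfolding mx_def by metis
  define \<pi> where "\<pi> = {z. mn z \<or> mx z}"
  define p where "p = (\<pi>, K \<inter> (\<pi> \<times> \<pi>))"
  have \<pi>A: "\<pi> \<subseteq> A"
    by (auto simp: \<pi>_def mn_def mx_def)
  have \<pi>closed: "z \<in> \<pi>" if \<sigma>: "\<And>n::nat. \<sigma> n \<in> \<pi>" and z: "z \<in> A" and lim: "null (\<lambda>n. d (\<sigma> n) z)" for \<sigma> z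
  proof -
    \<comment> \<open>Each term is compared with the fibre over the time of the limit: an earlier
      term precedes the whole fibre, a later one follows it, and a term of the fibre is its first or
      its last point. One of the two relations holds infinitely often, and the limit inherits
      it.\<close>
    define Q1 where "Q1 n \<longleftrightarrow> (\<forall>w\<in>A. snd w = snd z \<longrightarrow> (\<sigma> n, w) \<in> K)" for n
    define Q2 where "Q2 n \<longleftrightarrow> (\<forall>w\<in>A. snd w = snd z \<longrightarrow> (w, \<sigma> n) \<in> K)" for n
    have \<sigma>A: "\<sigma> n \<in> A" for n
      using \<sigma> \<pi>A by blast
    have Q: "Q1 n \<or> Q2 n" for n
    proof -
      consider "snd (\<sigma> n) < snd z" | "snd z < snd (\<sigma> n)" | "snd (\<sigma> n) = snd z"
        by fastforce
      then show ?thesis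
      proof cases
        case 1
        then have "Q1 n"
          unfolding Q1_def using lt \<sigma>A by simp
        then show ?thesis ..
      next
        case 2
        then have "Q2 n"
          unfolding Q2_def using lt \<sigma>A by simp
        then show ?thesis ..
      next
        case 3
        then show ?thesis
          using \<sigma>[of n] unfolding Q1_def Q2_def \<pi>_def mn_def mx_def by auto
      qed
    qed
    show ?thesis
    proof (cases "\<forall>\<^sub>F n in sequentially. \<not> Q1 n")
      case False
      then obtain r :: "nat \<Rightarrow> nat" where r: "strict_mono r" "\<And>n. Q1 (r n)"
        using frequently_subseq[of Q1] by blast
      have "(z, w) \<in> K" if w: "w \<in> A" "snd w = snd z" for w
      proof (rule Z.corder_closed[of A K "\<lambda>n. \<sigma> (r n)" "\<lambda>n. w", OF ord _ z w(1)])
        show "(\<sigma> (r n), w) \<in> K" for n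
          using r(2)[of n] w unfolding Q1_def by blast
        show "null (\<lambda>n. d (\<sigma> (r n)) z)"
          by (rule strict_mono_subseq_tendsto[OF r(1) lim])
        show "null (\<lambda>n. d w w)"
          by (simp add: Z.mdist_zero[OF subsetD[OF AX w(1)]])
      qed
      then show ?thesis
        using z by (simp add: \<pi>_def mn_def)
    next
      case True
      then obtain N where N: "\<And>n. n \<ge> N \<Longrightarrow> \<not> Q1 n"
        unfolding eventually_sequentially by blast
      define r where "r n = n + N" for n
      have r: "strict_mono r" "Q2 (r n)" for n
        using Q[of "r n"] N[of "r n"] by (auto simp: r_def strict_mono_def)
      have "(w, z) \<in> K" if w: "w \<in> A" "snd w = snd z" for w
      proof (rule Z.corder_closed[of A K "\<lambda>n. w" "\<lambda>n. \<sigma> (r n)", OF ord _ w(1) z])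
        show "(w, \<sigma> (r n)) \<in> K" for n
          using r(2)[of n] w unfolding Q2_def by blast
        show "null (\<lambda>n. d (\<sigma> (r n)) z)"
          by (rule strict_mono_subseq_tendsto[OF r(1) lim])
        show "null (\<lambda>n. d w w)"
          by (simp add: Z.mdist_zero[OF subsetD[OF AX w(1)]])
      qed
      then show ?thesis
        using z by (simp add: \<pi>_def mx_def)
    qed
  qed

  \<comment> \<open>The extreme points form a path\<close>
  have p: "p \<in> paths X"
    unfolding paths_def p_def mem_Collect_eq case_prod_conv
  proof (intro conjI)
    obtain z where "z \<in> A"
      using Z.corder_nonempty[OF ord] by blast
    from mn_ex[OF this] show "\<pi> \<noteq> {}"
      unfolding \<pi>_def by blast
    show "compactin (squeezed_topology X) \<pi>"
      unfolding mtop[symmetric]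
    proof (rule Z.compact_seqI)
      show "\<pi> \<subseteq> squeezed X"
        using \<pi>A AX by blast
      fix \<sigma> :: "nat \<Rightarrow> 'a sqz" assume \<sigma>: "\<And>n. \<sigma> n \<in> \<pi>"
      obtain l r where l: "l \<in> A" "strict_mono r" "null (\<lambda>n. d (\<sigma> (r n)) l)"
        by (rule Z.compact_seq[of A \<sigma>, OF Z.corder_compact[OF ord]]) (use \<sigma> \<pi>A in blast)
      have "l \<in> \<pi>"
        by (rule \<pi>closed[of "\<lambda>n. \<sigma> (r n)", OF \<sigma> l(1,3)])
      then show "\<exists>l\<in>\<pi>. \<exists>r. subseq r \<and> null (\<lambda>n. d (\<sigma> (r n)) l)"
        using l by blast
    qed
    have \<pi>K: "(z, z) \<in> K" if "z \<in> \<pi>" for z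
      using subsetD[OF \<pi>A that] by (simp add: A_def)
    have "refl_on \<pi> (K \<inter> \<pi> \<times> \<pi>)"
      by (simp add: refl_on_def \<pi>K)
    moreover have "trans (K \<inter> \<pi> \<times> \<pi>)"
      by (rule transI) (blast intro: tran)
    moreover have "antisym (K \<inter> \<pi> \<times> \<pi>)"
      by (rule antisymI) (blast intro: asym)
    moreover have "total_on \<pi> (K \<inter> \<pi> \<times> \<pi>)"
      by (rule total_onI) (use total \<pi>K in blast)
    ultimately show "linear_order_on \<pi> (K \<inter> \<pi> \<times> \<pi>)"
      unfolding linear_order_on_def partial_order_on_def preorder_on_def by blast
    have "closedin P.mtopology K"
      by (rule compactin_imp_closedin[OF P.Hausdorff_space_mtopology Kc])
    then show "closedin (prod_topology (subtopology (squeezed_topology X) \<pi>) (subtopology (squeezed_topology X) \<pi>)) (K \<inter> \<pi> \<times> \<pi>)"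
      unfolding pair_mtop subtopology_Times[symmetric] closedin_subtopology by blast
    show "\<forall>z\<in>\<pi>. \<forall>z'\<in>\<pi>. snd z < snd z' \<longrightarrow> (z, z') \<in> K \<inter> \<pi> \<times> \<pi>"
      using lt \<pi>A by blast
    show "\<forall>t. finite {x. (Some x, ereal t) \<in> \<pi>} \<and> card {x. (Some x, ereal t) \<in> \<pi>} \<le> 2"
    proof
      fix t
      define S1 S2 where "S1 = {x. mn (Some x, ereal t)}" and "S2 = {x. mx (Some x, ereal t)}"
      have "x = y" if "x \<in> S1" "y \<in> S1" for x y
        using mn_uniq[of "(Some x, ereal t)" "(Some y, ereal t)"] that by (simp add: S1_def)
      then have 1: "finite S1 \<and> card S1 \<le> 1"
        by (metis One_nat_def card_le_Suc0_iff_eq finite.emptyI finite_insert insertCI subsetI subset_singletonD)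
      have "x = y" if "x \<in> S2" "y \<in> S2" for x y
        using mx_uniq[of "(Some x, ereal t)" "(Some y, ereal t)"] that by (simp add: S2_def)
      then have 2: "finite S2 \<and> card S2 \<le> 1"
        by (metis One_nat_def card_le_Suc0_iff_eq finite.emptyI finite_insert insertCI subsetI subset_singletonD)
      have "{x. (Some x, ereal t) \<in> \<pi>} = S1 \<union> S2"
        by (auto simp: \<pi>_def S1_def S2_def)
      then show "finite {x. (Some x, ereal t) \<in> \<pi>} \<and> card {x. (Some x, ereal t) \<in> \<pi>} \<le> 2"
        using 1 2 card_Un_le[of S1 S2] by auto
    qed
  qed
  have fp: "fst p = \<pi>"
    by (simp add: p_def)
  have left: "mn (Some (path_left p t), ereal t)" and right: "mx (Some (path_right p t), ereal t)"
    if t: "t \<in> times p" for t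
  proof -
    let ?pl = "(Some (path_left p t), ereal t)" and ?pr = "(Some (path_right p t), ereal t)"
    note lr = path_left_right[OF p t]
    have lA: "?pl \<in> A"
      using lr(1) \<pi>A fp by blast
    obtain m where m: "mn m" "snd m = ereal t"
      using mn_ex[OF lA] by auto
    obtain m' where m': "mx m'" "snd m' = ereal t"
      using mx_ex[OF lA] by auto
    obtain x where x: "m = (Some x, ereal t)"
      using fin[of m] m by (auto simp: mn_def)
    obtain x' where x': "m' = (Some x', ereal t)"
      using fin[of m'] m' by (auto simp: mx_def)
    \<comment> \<open>The first and the last point of \<open>A\<close> over \<open>t\<close> belong
      to the path, which has no values there but its left and right one; the order between these
      decides which is which.\<close>
    have "m = ?pl \<or> m = ?pr" "m' = ?pl \<or> m' = ?pr"
      using path_fibre[OF p, of x t] path_fibre[OF p, of x' t] m(1) m'(1) unfolding fp \<pi>_def x x' by auto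
    moreover have "(m, ?pl) \<in> K" "(?pr, m') \<in> K"
      using m m' lA lr(2) \<pi>A fp unfolding mn_def mx_def by auto
    moreover have "(?pl, ?pr) \<in> K"
      using lr(3) by (simp add: p_def)
    ultimately have "m = ?pl" "m' = ?pr"
      using asym by metis+
    then show "mn ?pl" "mx ?pr"
      using m m' by simp_all
  qed
  have tA: "t \<in> times p" if xt: "(Some x, ereal t) \<in> A" for x t
  proof -
    obtain m where "mn m" "snd m = ereal t"
      using mn_ex[OF xt] unfolding snd_conv by blast
    then have "m \<in> \<pi>" "snd m = ereal t"
      by (simp_all add: \<pi>_def)
    then show ?thesis
      by (force simp: times_def ext_times_def fp)
  qed

  \<comment> \<open>The filled path of the extreme points is the original set\<close>
  have minl: "((Some (path_left p t), ereal t), (Some x, ereal t)) \<in> K"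
    and maxr: "((Some x, ereal t), (Some (path_right p t), ereal t)) \<in> K"
    if "(Some x, ereal t) \<in> A" for x t
    using left[OF tA[OF that]] right[OF tA[OF that]] that unfolding mn_def mx_def by auto
  have AF: "A \<subseteq> fl p"
  proof
    fix z assume z: "z \<in> A"
    show "z \<in> fl p"
    proof (cases "\<bar>snd z\<bar> = \<infinity>")
      case True
      obtain m where "mn m" "snd m = snd z"
        using mn_ex[OF z] by blast
      then have "z \<in> \<pi>"
        using inf_eq[of m z] z True by (auto simp: mn_def \<pi>_def)
      then show ?thesis
        using path_sub_filled[OF p] fp by blast
    next
      case False
      then obtain x t where "z = (Some x, ereal t)"
        using fin[OF z] by (cases "snd z") auto
      then show ?thesis
        using seg[OF minl maxr] tA z filled_iff(1)[OF p] by auto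
    qed
  qed
  have FA: "fl p \<subseteq> A"
  proof
    fix z assume "z \<in> fl p"
    with p show "z \<in> A"
    proof (cases rule: filled_cases)
      case (1 x t)
      have "((Some (path_left p t), ereal t), (Some (path_right p t), ereal t)) \<in> K"
        using path_left_right(3)[OF p 1(2)] by (simp add: p_def)
      then show ?thesis
        using fill 1 by (simp add: A_def)
    next
      case (2 t)
      then show ?thesis
        using \<pi>A fp by blast
    qed
  qed
  note ford = filled_corder[OF p]
  have sub: "(z, w) \<in> fo p" if zw: "(z, w) \<in> K" for z w
  proof -
    have F: "z \<in> fl p" "w \<in> fl p" and zA: "z \<in> A" "w \<in> A"
      using KA[OF zw] AF by blast+
    show ?thesis
    proof (cases "snd z < snd w")
      case True
      then show ?thesis using F filled_order_time(2) by blast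
    next
      case False
      then have eq: "snd z = snd w"
        using time[OF zw] by simp
      show ?thesis
      proof (cases "\<bar>snd z\<bar> = \<infinity>")
        case True
        then show ?thesis
          using inf_eq[OF zA eq] Z.corder_refl[OF ford] F by metis
      next
        case False
        obtain x t where z: "z = (Some x, ereal t)"
          using squeezed_real(1)[of z X] False zA AX by blast
        obtain y where w: "w = (Some y, ereal t)"
          using subsetD[OF AX zA(2)] eq z by (auto elim!: squeezed_cases)
        have "x \<in> B (path_left p t) y"
          by (rule seg[OF minl]) (use zA zw z w in auto)
        then show ?thesis
          using F unfolding z w by (intro filled_orderI[OF p])
      qed
    qed
  qed
  have "(z, w) \<in> K" if zw: "(z, w) \<in> fo p" for z w
  proof -
    have zA: "z \<in> A" "w \<in> A"
      using filled_order_dom[OF zw] FA by blast+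
    then have "(z, w) \<in> K \<or> (w, z) \<in> K"
      using total by (simp add: A_def)
    then show ?thesis
      using sub[of w z] Z.corder_antisym[OF ford zw] zA by (auto simp: A_def)
  qed
  then have "fo p = K"
    using sub by auto
  then show ?thesis
    using p by blast
qed

section \<open>Closed and G-delta conditions on relations\<close>

lemma closed_good_time: "closedin H.mtopology {K \<in> hyper. \<forall>z w. (z, w) \<in> K \<longrightarrow> snd z \<le> snd w}"
proof (rule P.hyper_closedI)
  fix K L assume K: "\<And>n. K n \<in> {K \<in> hyper. \<forall>z w. (z, w) \<in> K \<longrightarrow> snd z \<le> snd w}"
    and L: "L \<in> hyper" and lim: "P.hseq K L"
  have KH: "K n \<in> hyper" for n using K by blast
  have "snd z \<le> snd w" if zw: "(z, w) \<in> L" for z w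
  proof -
    obtain u v where uv: "\<forall>n. (u n, v n) \<in> K n" "null (\<lambda>n. d (u n) z)" "null (\<lambda>n. d (v n) w)"
      by (rule pair_seq_approx[OF lim zw])
    have "(\<lambda>n. snd (u n)) \<longlonglongrightarrow> snd z"
      by (rule lim_time[of u z, OF hyperD(3)[OF KH] hyperD(3)[OF L zw] uv(2)]) (use uv(1) in blast)
    moreover have "(\<lambda>n. snd (v n)) \<longlonglongrightarrow> snd w"
      by (rule lim_time[of v w, OF hyperD(4)[OF KH] hyperD(4)[OF L zw] uv(3)]) (use uv(1) in blast)
    ultimately show ?thesis
      by (rule LIMSEQ_le) (use K uv(1) in blast)
  qed
  then show "L \<in> {K \<in> hyper. \<forall>z w. (z, w) \<in> K \<longrightarrow> snd z \<le> snd w}"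
    using L by blast
qed blast

text \<open>The two clauses are treated together because a diagonal pair of the limit is
  approximated by pairs whose entries may differ; reflexivity of the approximating relations turns
  their entries into comparable points. The comparison that holds infinitely often passes to the
  limit.\<close>

lemma closed_good_total:
  "closedin H.mtopology {K \<in> hyper. (\<forall>z w. (z, w) \<in> K \<longrightarrow> (z, z) \<in> K \<and> (w, w) \<in> K) \<and>
    (\<forall>z w. (z, z) \<in> K \<longrightarrow> (w, w) \<in> K \<longrightarrow> (z, w) \<in> K \<or> (w, z) \<in> K)}" (is "closedin _ ?S")
proof (rule P.hyper_closedI)
  fix K L assume K: "\<And>n. K n \<in> ?S" and L: "L \<in> hyper" and lim: "P.hseq K L"
  have KH: "K n \<in> hyper" for n using K by blast
  have refl: "(u, u) \<in> K n" "(v, v) \<in> K n" if "(u, v) \<in> K n" for u v n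
    using K[of n] that by blast+
  have "(z, z) \<in> L \<and> (w, w) \<in> L" if zw: "(z, w) \<in> L" for z w
  proof -
    obtain u v where uv: "\<forall>n. (u n, v n) \<in> K n" "null (\<lambda>n. d (u n) z)" "null (\<lambda>n. d (v n) w)"
      by (rule pair_seq_approx[OF lim zw])
    then have uv': "\<And>n. (u n, u n) \<in> K n" "\<And>n. (v n, v n) \<in> K n"
      using refl by blast+
    have M: "z \<in> squeezed X" "w \<in> squeezed X"
      using hyperD(3,4)[OF L zw] .
    show ?thesis
      using pair_seq_limit[of K L u u z z, OF KH L lim uv'(1) M(1) M(1) uv(2) uv(2)]
        pair_seq_limit[of K L v v w w, OF KH L lim uv'(2) M(2) M(2) uv(3) uv(3)] by blast
  qed
  moreover have "(z, w) \<in> L \<or> (w, z) \<in> L" if zw: "(z, z) \<in> L" "(w, w) \<in> L" for z w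
  proof -
    obtain u u' where u: "\<forall>n. (u n, u' n) \<in> K n" "null (\<lambda>n. d (u n) z)"
      by (rule pair_seq_approx[OF lim zw(1)])
    obtain v v' where v: "\<forall>n. (v n, v' n) \<in> K n" "null (\<lambda>n. d (v n) w)"
      by (rule pair_seq_approx[OF lim zw(2)])
    have M: "z \<in> squeezed X" "w \<in> squeezed X"
      using hyperD(3)[OF L zw(1)] hyperD(3)[OF L zw(2)] .
    have uv: "(u n, v n) \<in> K n \<or> (v n, u n) \<in> K n" for n
      using K[of n] refl(1) u(1) v(1) by blast
    show ?thesis
    proof (cases "\<forall>\<^sub>F n in sequentially. (u n, v n) \<notin> K n")
      case False
      then obtain r :: "nat \<Rightarrow> nat" where r: "strict_mono r" "\<And>n. (u (r n), v (r n)) \<in> K (r n)"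
        using frequently_subseq[of "\<lambda>n. (u n, v n) \<in> K n"] by blast
      have "(z, w) \<in> L"
        by (rule pair_seq_limit[of "\<lambda>n. K (r n)" L "\<lambda>n. u (r n)" "\<lambda>n. v (r n)", OF KH L P.hseq_subseq[OF lim r(1)] r(2) M])
          (rule strict_mono_subseq_tendsto[OF r(1)], fact)+
      then show ?thesis ..
    next
      case True
      then obtain N where N: "\<And>n. n \<ge> N \<Longrightarrow> (u n, v n) \<notin> K n"
        unfolding eventually_sequentially by blast
      define r where "r n = n + N" for n
      have r: "strict_mono r" "(v (r n), u (r n)) \<in> K (r n)" for n
        using uv[of "n + N"] N[of "n + N"] by (simp_all add: r_def strict_mono_def)
      have "(w, z) \<in> L"
        by (rule pair_seq_limit[of "\<lambda>n. K (r n)" L "\<lambda>n. v (r n)" "\<lambda>n. u (r n)", OF KH L P.hseq_subseq[OF lim r(1)] r(2) M(2,1)])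
          (rule strict_mono_subseq_tendsto[OF r(1)], fact)+
      then show ?thesis ..
    qed
  qed
  ultimately show "L \<in> ?S"
    using L by blast
qed blast

lemma chain_seq_compact:
  assumes K: "\<And>n. K n \<in> hyper" and L: "L \<in> hyper" and lim: "P.hseq K L"
    and abc: "\<And>n. (a n, b n) \<in> K n" "\<And>n. (b n, c n) \<in> K n"
  obtains a' b' c' r where "(a', b') \<in> L" "(b', c') \<in> L" "subseq r"
    "null (\<lambda>n. d (a (r n)) a')" "null (\<lambda>n. d (b (r n)) b')" "null (\<lambda>n. d (c (r n)) c')"
proof -
  obtain a' b' r where r: "(a', b') \<in> L" "subseq r"
    "null (\<lambda>n. d (a (r n)) a')" "null (\<lambda>n. d (b (r n)) b')"
    by (rule pair_seq_compact[of K L a b, OF K L lim abc(1)])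
  obtain b'' c' s where s: "(b'', c') \<in> L" "subseq s"
    "null (\<lambda>n. d (b (r (s n))) b'')" "null (\<lambda>n. d (c (r (s n))) c')"
    by (rule pair_seq_compact[of "\<lambda>n. K (r n)" L "\<lambda>n. b (r n)" "\<lambda>n. c (r n)", OF K L P.hseq_subseq[OF lim r(2)] abc(2)])
  have "b'' = b'"
    by (rule Z.seq_unique[of "\<lambda>n. b (r (s n))" b'' b', OF hyperD(4)[OF K abc(1)] hyperD(3)[OF L s(1)] hyperD(4)[OF L r(1)]
          s(3) strict_mono_subseq_tendsto[OF s(2) r(4)]])
  have mono: "strict_mono (\<lambda>n. r (s n))"
    using r(2) s(2) unfolding strict_mono_def by blast
  show thesis
    by (rule that[OF r(1) _ mono strict_mono_subseq_tendsto[OF s(2) r(3)] strict_mono_subseq_tendsto[OF s(2) r(4)] s(4)])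
      (use s(1) \<open>b'' = b'\<close> in simp)
qed

text \<open>The bound \<open>c\<close> on the times keeps the limit away from infinity, where
  convergence says nothing about first coordinates.\<close>

lemma real_time_limit:
  assumes u: "\<And>n. u n \<in> squeezed X" "a \<in> squeezed X" "null (\<lambda>n. d (u n) a)"
    and t: "\<And>n. snd (u n) = ereal (t n)" "\<And>n. \<bar>t n\<bar> \<le> c"
  obtains x s where "a = (Some x, ereal s)" "x \<in> topspace X" "\<bar>s\<bar> \<le> c" "(\<lambda>n. ereal (t n)) \<longlonglongrightarrow> ereal s"
    "limitin X (\<lambda>n. the (fst (u n))) x sequentially"
proof -
  have lim: "(\<lambda>n. ereal (t n)) \<longlonglongrightarrow> snd a"
    using lim_time[of u a, OF u] t(1) by simp
  have "snd a \<le> ereal c"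
    by (rule LIMSEQ_le_const2[OF lim]) (use t(2) in \<open>simp add: abs_le_iff\<close>)
  moreover have "ereal (- c) \<le> snd a"
    by (rule LIMSEQ_le_const[OF lim]) (use t(2) in \<open>simp add: abs_le_iff minus_le_iff\<close>)
  ultimately obtain s where s: "snd a = ereal s" "\<bar>s\<bar> \<le> c"
    by (cases "snd a") auto
  then obtain x where a: "a = (Some x, ereal s)" "x \<in> topspace X"
    using squeezed_real[of a X] u(2) by auto
  have "limitin X (\<lambda>n. the (fst (u n))) x sequentially"
    by (rule lim_val[OF u(1) u(2)[unfolded a(1)] u(3)[unfolded a(1)]])
  then show thesis
    using that a s lim by simp
qed

text \<open>The failure is quantified so that it survives limits: \<open>y\<close> stays at distance
  \<open>e\<close> from the segment, at a bounded time. Each point of the limiting segment is a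
  limit of points of the approximating segments, hence has distance at least \<open>e\<close> from
  the limit of the points \<open>y\<close>.\<close>

lemma closed_bad_segment:
  "closedin H.mtopology {K \<in> hyper. \<exists>x y w t. ((Some x, ereal t), (Some y, ereal t)) \<in> K \<and>
     ((Some y, ereal t), (Some w, ereal t)) \<in> K \<and> \<bar>t\<bar> \<le> c \<and>
     (\<forall>y'\<in>B x w. e \<le> d (Some y, ereal t) (Some y', ereal t))}" (is "closedin _ ?S")
proof (rule P.hyper_closedI)
  fix K L assume K: "\<And>n. K n \<in> ?S" and L: "L \<in> hyper" and lim: "P.hseq K L"
  have KH: "K n \<in> hyper" for n using K by blast
  have "\<exists>x y w t. ((Some x, ereal t), (Some y, ereal t)) \<in> K n \<and>
     ((Some y, ereal t), (Some w, ereal t)) \<in> K n \<and> \<bar>t\<bar> \<le> c \<and>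
     (\<forall>y'\<in>B x w. e \<le> d (Some y, ereal t) (Some y', ereal t))" for n
    using K[of n] by blast
  then obtain x y w t where zw: "\<And>n. ((Some (x n), ereal (t n)), (Some (y n), ereal (t n))) \<in> K n"
    "\<And>n. ((Some (y n), ereal (t n)), (Some (w n), ereal (t n))) \<in> K n" "\<And>n. \<bar>t n\<bar> \<le> c"
    "\<And>n. \<forall>y'\<in>B (x n) (w n). e \<le> d (Some (y n), ereal (t n)) (Some y', ereal (t n))"
    by metis
  have in1: "(Some (x n), ereal (t n)) \<in> squeezed X" and in2: "(Some (y n), ereal (t n)) \<in> squeezed X"
    and in3: "(Some (w n), ereal (t n)) \<in> squeezed X" for n
    using hyperD(3,4)[OF KH zw(1)] hyperD(4)[OF KH zw(2)] .
  obtain a b v r where r: "(a, b) \<in> L" "(b, v) \<in> L" "subseq r"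
    "null (\<lambda>n. d (Some (x (r n)), ereal (t (r n))) a)"
    "null (\<lambda>n. d (Some (y (r n)), ereal (t (r n))) b)"
    "null (\<lambda>n. d (Some (w (r n)), ereal (t (r n))) v)"
    by (rule chain_seq_compact[of K L "\<lambda>n. (Some (x n), ereal (t n))" "\<lambda>n. (Some (y n), ereal (t n))"
          "\<lambda>n. (Some (w n), ereal (t n))", OF KH L lim zw(1,2)])
  have M: "a \<in> squeezed X" "b \<in> squeezed X" "v \<in> squeezed X"
    using hyperD(3,4)[OF L r(1)] hyperD(4)[OF L r(2)] .
  obtain x' s where a: "a = (Some x', ereal s)" "x' \<in> topspace X" "\<bar>s\<bar> \<le> c" "(\<lambda>n. ereal (t (r n))) \<longlonglongrightarrow> ereal s"
    and ax: "limitin X (\<lambda>n. the (fst (Some (x (r n)), ereal (t (r n))))) x' sequentially"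
    by (rule real_time_limit[of "\<lambda>n. (Some (x (r n)), ereal (t (r n)))" a "\<lambda>n. t (r n)" c, OF in1 M(1) r(4) _ zw(3)])
      simp_all
  obtain y' s' where b: "b = (Some y', ereal s')" "(\<lambda>n. ereal (t (r n))) \<longlonglongrightarrow> ereal s'"
    by (rule real_time_limit[of "\<lambda>n. (Some (y (r n)), ereal (t (r n)))" b "\<lambda>n. t (r n)" c, OF in2 M(2) r(5) _ zw(3)])
      simp_all
  obtain w' s'' where v: "v = (Some w', ereal s'')" "(\<lambda>n. ereal (t (r n))) \<longlonglongrightarrow> ereal s''"
    and vx: "limitin X (\<lambda>n. the (fst (Some (w (r n)), ereal (t (r n))))) w' sequentially"
    by (rule real_time_limit[of "\<lambda>n. (Some (w (r n)), ereal (t (r n)))" v "\<lambda>n. t (r n)" c, OF in3 M(3) r(6) _ zw(3)])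
      simp_all
  have s: "s' = s" "s'' = s"
    using LIMSEQ_unique[OF a(4) b(2)] LIMSEQ_unique[OF a(4) v(2)] by auto
  have tops: "x n \<in> topspace X" "w n \<in> topspace X" for n
    using in1[of n] in3[of n] by auto
  have "e \<le> d b (Some u, ereal s)" if u: "u \<in> B x' w'" for u
  proof -
    obtain us where us: "\<And>n. us n \<in> B (x (r n)) (w (r n))" "limitin X us u sequentially"
      using between_approx[of "\<lambda>n. x (r n)" "\<lambda>n. w (r n)" x' w' u, OF tops] ax vx u by auto
    have usM: "us n \<in> topspace X" for n
      using us(1)[of n] bt_subset[OF tops] by blast
    have uM: "u \<in> topspace X"
      using us(2) limitin_topspace by fast
    have "null (\<lambda>n. d (Some (us n), ereal (t (r n))) (Some u, ereal s))"
      by (rule lim_real) (use usM uM a(4) us(2) in auto)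
    then have "(\<lambda>n. d (Some (y (r n)), ereal (t (r n))) (Some (us n), ereal (t (r n)))) \<longlonglongrightarrow> d b (Some u, ereal s)"
      by (rule Z.seq_dist[OF in2 _ M(2) _ r(5), rotated 2]) (use usM uM in auto)
    then show ?thesis
      by (rule LIMSEQ_le_const) (use zw(4) us(1) in blast)
  qed
  then show "L \<in> ?S"
    using L r(1,2) a(3) unfolding a(1) b(1) v(1) s by blast
qed blast

text \<open>Here the missing point varies with the segments; continuity and compactness of segments
  give it a limit in the limiting segment. Every pair of the limiting relation is approximated by
  pairs at distance at least \<open>e\<close>, so the limit point is still missing by
  \<open>e\<close>.\<close>

lemma closed_bad_filled:
  "closedin H.mtopology {K \<in> hyper. \<exists>x w y t. ((Some x, ereal t), (Some w, ereal t)) \<in> K \<and> \<bar>t\<bar> \<le> c \<and>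
     y \<in> B x w \<and> (\<forall>k\<in>K. e \<le> d_pair d ((Some y, ereal t), (Some y, ereal t)) k)}" (is "closedin _ ?S")
proof (rule P.hyper_closedI)
  fix K L assume K: "\<And>n. K n \<in> ?S" and L: "L \<in> hyper" and lim: "P.hseq K L"
  have KH: "K n \<in> hyper" for n using K by blast
  have "\<exists>x w y t. ((Some x, ereal t), (Some w, ereal t)) \<in> K n \<and> \<bar>t\<bar> \<le> c \<and>
     y \<in> B x w \<and> (\<forall>k\<in>K n. e \<le> d_pair d ((Some y, ereal t), (Some y, ereal t)) k)" for n
    using K[of n] by blast
  then obtain x w y t where zw: "\<And>n. ((Some (x n), ereal (t n)), (Some (w n), ereal (t n))) \<in> K n" "\<And>n. \<bar>t n\<bar> \<le> c"
    "\<And>n. y n \<in> B (x n) (w n)" "\<And>n. \<forall>k\<in>K n. e \<le> d_pair d ((Some (y n), ereal (t n)), (Some (y n), ereal (t n))) k"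
    by metis
  have in1: "(Some (x n), ereal (t n)) \<in> squeezed X" and in3: "(Some (w n), ereal (t n)) \<in> squeezed X" for n
    using hyperD(3,4)[OF KH zw(1)] .
  obtain a v r where r: "(a, v) \<in> L" "subseq r"
    "null (\<lambda>n. d (Some (x (r n)), ereal (t (r n))) a)"
    "null (\<lambda>n. d (Some (w (r n)), ereal (t (r n))) v)"
    by (rule pair_seq_compact[of K L "\<lambda>n. (Some (x n), ereal (t n))" "\<lambda>n. (Some (w n), ereal (t n))", OF KH L lim zw(1)])
  have M: "a \<in> squeezed X" "v \<in> squeezed X"
    using hyperD(3,4)[OF L r(1)] .
  obtain x' s where a: "a = (Some x', ereal s)" "x' \<in> topspace X" "\<bar>s\<bar> \<le> c" "(\<lambda>n. ereal (t (r n))) \<longlonglongrightarrow> ereal s"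
    and ax: "limitin X (\<lambda>n. the (fst (Some (x (r n)), ereal (t (r n))))) x' sequentially"
    by (rule real_time_limit[of "\<lambda>n. (Some (x (r n)), ereal (t (r n)))" a "\<lambda>n. t (r n)" c, OF in1 M(1) r(3) _ zw(2)])
      simp_all
  obtain w' s'' where v: "v = (Some w', ereal s'')" "w' \<in> topspace X" "(\<lambda>n. ereal (t (r n))) \<longlonglongrightarrow> ereal s''"
    and vx: "limitin X (\<lambda>n. the (fst (Some (w (r n)), ereal (t (r n))))) w' sequentially"
    by (rule real_time_limit[of "\<lambda>n. (Some (w (r n)), ereal (t (r n)))" v "\<lambda>n. t (r n)" c, OF in3 M(2) r(4) _ zw(2)])
      simp_all
  have s: "s'' = s"
    using LIMSEQ_unique[OF a(4) v(3)] by auto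
  have tops: "x n \<in> topspace X" "w n \<in> topspace X" for n
    using in1[of n] in3[of n] by auto
  obtain u q where u: "u \<in> B x' w'" "subseq q" "limitin X (\<lambda>n. y (r (q n))) u sequentially"
    using between_compact[of "\<lambda>n. x (r n)" "\<lambda>n. w (r n)" x' w' "\<lambda>n. y (r n)", OF tops _ _ zw(3)] ax vx by auto
  have yM: "y n \<in> topspace X" for n
    using zw(3)[of n] bt_subset[OF tops] by blast
  have uM: "u \<in> topspace X"
    using u(3) limitin_topspace by fast
  have rq: "strict_mono (\<lambda>n. r (q n))"
    using r(2) u(2) unfolding strict_mono_def by blast
  have tq: "(\<lambda>n. ereal (t (r (q n)))) \<longlonglongrightarrow> ereal s"
    using LIMSEQ_subseq_LIMSEQ[OF a(4) u(2)] by (simp add: o_def)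
  have lu: "null (\<lambda>n. d (Some (y (r (q n))), ereal (t (r (q n)))) (Some u, ereal s))"
    by (rule lim_real) (use yM uM tq u(3) in auto)
  have "\<forall>k\<in>L. e \<le> d_pair d ((Some u, ereal s), (Some u, ereal s)) k"
    by (rule pair_seq_away[of "\<lambda>n. K (r (q n))" L, OF KH L P.hseq_subseq[OF lim rq] _ _ _ _ lu lu zw(4)])
      (use yM uM in auto)
  then show "L \<in> ?S"
    using L r(1) a(3) u(1) unfolding a(1) v(1) s by blast
qed blast

end

lemma (in Metric_space) d_pair_mcomplete:
  assumes mcomplete
  shows "Metric_space.mcomplete (M \<times> M) (d_pair d)"
proof -
  interpret P: Metric_space "M \<times> M" "d_pair d"
    by (rule Metric_space_d_pair)
  show ?thesis
    unfolding P.mcomplete_def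
  proof (intro allI impI)
    fix \<sigma> assume C: "P.MCauchy \<sigma>"
    then have \<sigma>: "\<sigma> n \<in> M \<times> M" for n
      unfolding P.MCauchy_def by blast
    have le: "d (fst x) (fst y) \<le> d_pair d x y" "d (snd x) (snd y) \<le> d_pair d x y" for x y :: "'a \<times> 'a"
      by (auto simp: d_pair_def split: prod.splits)
    have cau: "\<exists>N. \<forall>n n'. N \<le> n \<longrightarrow> N \<le> n' \<longrightarrow> d_pair d (\<sigma> n) (\<sigma> n') < \<epsilon>" if "\<epsilon> > 0" for \<epsilon>
      using C that unfolding P.MCauchy_def by blast
    have M: "fst (\<sigma> n) \<in> M" "snd (\<sigma> n) \<in> M" for n
      using \<sigma>[of n] by (auto simp: mem_Times_iff)
    have "MCauchy f" if f: "\<And>n. f n \<in> M" "\<And>n k. d (f n) (f k) \<le> d_pair d (\<sigma> n) (\<sigma> k)" for f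
      unfolding MCauchy_def
    proof (intro conjI allI impI)
      show "range f \<subseteq> M"
        using f(1) by blast
      fix \<epsilon> :: real assume "\<epsilon> > 0"
      then obtain N where "\<forall>n n'. N \<le> n \<longrightarrow> N \<le> n' \<longrightarrow> d_pair d (\<sigma> n) (\<sigma> n') < \<epsilon>"
        using cau by blast
      then show "\<exists>N. \<forall>n n'. N \<le> n \<longrightarrow> N \<le> n' \<longrightarrow> d (f n) (f n') < \<epsilon>"
        using le_less_trans[OF f(2)] by blast
    qed
    from this[of "\<lambda>n. fst (\<sigma> n)", OF M(1) le(1)] this[of "\<lambda>n. snd (\<sigma> n)", OF M(2) le(2)]
    obtain a b where ab: "limitin mtopology (\<lambda>n. fst (\<sigma> n)) a sequentially" "limitin mtopology (\<lambda>n. snd (\<sigma> n)) b sequentially"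
      using assms unfolding mcomplete_def by blast
    have "null (\<lambda>n. d_pair d (fst (\<sigma> n), snd (\<sigma> n)) (a, b))"
      unfolding d_pair_tendsto_iff[of "\<lambda>n. fst (\<sigma> n)" "\<lambda>n. snd (\<sigma> n)"]
      using ab by (simp add: limitin_metric_dist_null)
    then have "limitin P.mtopology \<sigma> (a, b) sequentially"
      using P.seq_limitin_iff[of \<sigma> "(a, b)"] \<sigma> limitin_mspace[OF ab(1)] limitin_mspace[OF ab(2)] by simp
    then show "\<exists>x. limitin P.mtopology \<sigma> x sequentially"
      by blast
  qed
qed

lemma (in Metric_space) d_pair_separable:
  assumes "separable_space mtopology"
  shows "separable_space (Metric_space.mtopology (M \<times> M) (d_pair d))"
proof -
  obtain C where C: "countable C" "C \<subseteq> M" "\<And>x e. x \<in> M \<Longrightarrow> e > 0 \<Longrightarrow> \<exists>c\<in>C. d x c < e"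
    using assms separable_space_metric[OF Metric_space_axioms] by blast
  have "\<exists>c\<in>C \<times> C. d_pair d z c < e" if "z \<in> M \<times> M" "e > 0" for z e
  proof -
    have "fst z \<in> M" "snd z \<in> M"
      using that(1) by (auto simp: mem_Times_iff)
    then obtain c1 c2 where "c1 \<in> C" "d (fst z) c1 < e" "c2 \<in> C" "d (snd z) c2 < e"
      using C(3)[OF _ \<open>e > 0\<close>] by meson
    then show ?thesis
      by (intro bexI[of _ "(c1, c2)"]) (auto simp: d_pair_def split: prod.splits)
  qed
  moreover have "countable (C \<times> C)" "C \<times> C \<subseteq> M \<times> M"
    using C(1,2) by auto
  ultimately show ?thesis
    unfolding separable_space_metric[OF Metric_space_d_pair] by blast
qed

lemma closed_ereal_times:
  assumes "closed (I :: real set)"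
  shows "closed (ereal ` I \<union> {-\<infinity>, \<infinity>})"
  unfolding closed_sequential_limits
proof (intro allI impI)
  fix u l assume *: "(\<forall>n. u n \<in> ereal ` I \<union> {-\<infinity>, \<infinity>}) \<and> u \<longlonglongrightarrow> l"
  show "l \<in> ereal ` I \<union> {-\<infinity>, \<infinity>}"
  proof (cases l)
    case (real s)
    have "\<forall>\<^sub>F n in sequentially. - \<infinity> < u n \<and> u n < \<infinity>"
      using * real by (intro eventually_conj order_tendstoD[of u l]) auto
    then obtain N where N: "\<And>n. n \<ge> N \<Longrightarrow> - \<infinity> < u n \<and> u n < \<infinity>"
      unfolding eventually_sequentially by blast
    have "\<exists>y. y \<in> I \<and> u (n + N) = ereal y" for n
      using *[THEN conjunct1, rule_format, of "n + N"] N[of "n + N"] by auto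
    then obtain y where y: "\<And>n. y n \<in> I" "\<And>n. u (n + N) = ereal (y n)"
      by metis
    have "(\<lambda>n. ereal (y n)) \<longlonglongrightarrow> ereal s"
      using LIMSEQ_ignore_initial_segment[of u l N] * real by (simp add: y)
    then have "y \<longlonglongrightarrow> s"
      by (simp add: lim_ereal)
    then have "s \<in> I"
      using closed_sequentially[OF assms] y(1) by blast
    then show ?thesis
      by (simp add: real)
  qed auto
qed

lemma finite_endpoints: "finite (endpoints I)"
proof -
  define S1 S2 where "S1 = {t \<in> I. \<forall>s\<in>I. t \<le> s}" and "S2 = {t \<in> I. \<forall>s\<in>I. s \<le> t}"
  have "S1 \<subseteq> {a}" if "a \<in> S1" for a
    using that unfolding S1_def by (auto intro: antisym)
  then have "finite S1"
    by (metis finite.emptyI finite_insert finite_subset ex_in_conv)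
  have "S2 \<subseteq> {a}" if "a \<in> S2" for a
    using that unfolding S2_def by (auto intro: antisym)
  then have "finite S2"
    by (metis finite.emptyI finite_insert finite_subset ex_in_conv)
  have "endpoints I = S1 \<union> S2"
    by (auto simp: endpoints_def S1_def S2_def)
  then show ?thesis
    using \<open>finite S1\<close> \<open>finite S2\<close> by simp
qed

context path_space begin

lemma away_le:
  assumes "m \<le> n" "1 / real (Suc m) \<le> (x::real)"
  shows "1 / real (Suc n) \<le> x"
proof -
  have "1 / real (Suc n) \<le> 1 / real (Suc m)"
    using assms(1) by (intro divide_left_mono) auto
  then show ?thesis
    using assms(2) by linarith
qed

lemma dist_away:
  assumes "z \<in> squeezed X" "w \<in> squeezed X" "z \<noteq> w"
  shows "\<exists>n. 1 / real (Suc n) \<le> d z w"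
proof -
  have "0 < d z w"
    using assms by simp
  then obtain n where "1 / real (Suc n) < d z w"
    by (rule nat_approx_posE)
  then show ?thesis
    by (intro exI[of _ n]) simp
qed

lemma segment_away:
  assumes M: "x \<in> topspace X" "w \<in> topspace X" "y \<in> topspace X" and y: "y \<notin> B x w"
  shows "\<exists>n. \<forall>y'\<in>B x w. 1 / real (Suc n) \<le> d (Some y, ereal t) (Some y', ereal t)"
proof (rule ccontr)
  assume "\<not> ?thesis"
  then have "\<exists>y'. y' \<in> B x w \<and> d (Some y', ereal t) (Some y, ereal t) \<le> 1 / real (Suc n)" for n
    using Z.commute by (metis less_imp_le not_le)
  then obtain v where v: "\<And>n. v n \<in> B x w" "\<And>n. d (Some (v n), ereal t) (Some y, ereal t) \<le> 1 / real (Suc n)"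
    by metis
  have "null (\<lambda>n. d (Some (v n), ereal t) (Some y, ereal t))"
    by (rule Lim_null_comparison[OF always_eventually lim_1_over_Suc]) (use v(2) in simp)
  then have "limitin X (\<lambda>n. the (fst (Some (v n), ereal t))) y sequentially"
    by (rule lim_val[rotated 2]) (use v(1) bt_subset M in auto)
  then have lim: "limitin X v y sequentially"
    by simp
  have "y \<in> B x w"
    by (rule between_closed[of "\<lambda>n. x" "\<lambda>n. w" x w v y, OF M(1,2) _ _ v(1) lim]) (use M in auto)
  then show False
    using y by blast
qed

lemma d_pair_self: "a \<in> squeezed X \<Longrightarrow> b \<in> squeezed X \<Longrightarrow> d_pair d (a, b) (a, b) = 0"
  by (simp add: d_pair_def)

lemma gdelta_bad:
  assumes "\<And>n::nat. closedin H.mtopology {K \<in> hyper. Bad n K}"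
    and "\<And>K. K \<in> hyper \<Longrightarrow> \<not> Q K \<Longrightarrow> \<exists>n. Bad n K" and "\<And>K n. K \<in> hyper \<Longrightarrow> Q K \<Longrightarrow> \<not> Bad n K"
  shows "gdelta_in H.mtopology {K \<in> hyper. Q K}"
proof -
  have "gdelta_in H.mtopology {K \<in> hyper. \<forall>n. \<not> Bad n K}"
    by (rule gdelta_in_complements[of H.mtopology Bad, unfolded H.topspace_mtopology]) (rule assms(1))
  moreover have "{K \<in> hyper. \<forall>n. \<not> Bad n K} = {K \<in> hyper. Q K}"
    using assms(2,3) by blast
  ultimately show ?thesis
    by simp
qed

lemma gdelta_segment:
  "gdelta_in H.mtopology {K \<in> hyper. \<forall>x y w t. ((Some x, ereal t), (Some y, ereal t)) \<in> K \<longrightarrow>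
     ((Some y, ereal t), (Some w, ereal t)) \<in> K \<longrightarrow> y \<in> B x w}"
proof (rule gdelta_bad[OF closed_bad_segment])
  fix K assume K: "K \<in> hyper" and "\<not> (\<forall>x y w t. ((Some x, ereal t), (Some y, ereal t)) \<in> K \<longrightarrow>
     ((Some y, ereal t), (Some w, ereal t)) \<in> K \<longrightarrow> y \<in> B x w)"
  then obtain x y w t where zw: "((Some x, ereal t), (Some y, ereal t)) \<in> K" "((Some y, ereal t), (Some w, ereal t)) \<in> K" "y \<notin> B x w"
    by blast
  have "x \<in> topspace X" "w \<in> topspace X" "y \<in> topspace X"
    using hyperD(3,4)[OF K zw(1)] hyperD(4)[OF K zw(2)] by auto
  then obtain m where m: "\<forall>y'\<in>B x w. 1 / real (Suc m) \<le> d (Some y, ereal t) (Some y', ereal t)"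
    using segment_away zw(3) by blast
  obtain k where k: "\<bar>t\<bar> \<le> real k"
    using real_arch_simple by blast
  \<comment> \<open>One index serves both as the bound on the time and as the size of the failure;
    enlarging it weakens both requirements.\<close>
  have "\<forall>y'\<in>B x w. 1 / real (Suc (max m k)) \<le> d (Some y, ereal t) (Some y', ereal t)"
    using m away_le[of m "max m k"] by simp
  moreover have "\<bar>t\<bar> \<le> real (max m k)"
    using k by linarith
  ultimately show "\<exists>n. \<exists>x y w t. ((Some x, ereal t), (Some y, ereal t)) \<in> K \<and> ((Some y, ereal t), (Some w, ereal t)) \<in> K \<and>
      \<bar>t\<bar> \<le> real n \<and> (\<forall>y'\<in>B x w. 1 / real (Suc n) \<le> d (Some y, ereal t) (Some y', ereal t))"
    using zw(1,2) by blast
next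
  fix K n assume K: "K \<in> hyper" and a: "\<forall>x y w t. ((Some x, ereal t), (Some y, ereal t)) \<in> K \<longrightarrow>
     ((Some y, ereal t), (Some w, ereal t)) \<in> K \<longrightarrow> y \<in> B x w"
  show "\<not> (\<exists>x y w t. ((Some x, ereal t), (Some y, ereal t)) \<in> K \<and> ((Some y, ereal t), (Some w, ereal t)) \<in> K \<and>
      \<bar>t\<bar> \<le> real n \<and> (\<forall>y'\<in>B x w. 1 / real (Suc n) \<le> d (Some y, ereal t) (Some y', ereal t)))"
  proof
    assume "\<exists>x y w t. ((Some x, ereal t), (Some y, ereal t)) \<in> K \<and> ((Some y, ereal t), (Some w, ereal t)) \<in> K \<and>
      \<bar>t\<bar> \<le> real n \<and> (\<forall>y'\<in>B x w. 1 / real (Suc n) \<le> d (Some y, ereal t) (Some y', ereal t))"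
    then obtain x y w t where zw: "((Some x, ereal t), (Some y, ereal t)) \<in> K"
      and "1 / real (Suc n) \<le> d (Some y, ereal t) (Some y, ereal t)"
      using a by blast
    then show False
      using Z.mdist_zero[OF hyperD(4)[OF K zw]] by (simp add: divide_le_0_iff)
  qed
qed

lemma gdelta_filled:
  "gdelta_in H.mtopology {K \<in> hyper. \<forall>x w y t. ((Some x, ereal t), (Some w, ereal t)) \<in> K \<longrightarrow> y \<in> B x w \<longrightarrow>
     ((Some y, ereal t), (Some y, ereal t)) \<in> K}"
proof (rule gdelta_bad[OF closed_bad_filled])
  fix K assume K: "K \<in> hyper" and "\<not> (\<forall>x w y t. ((Some x, ereal t), (Some w, ereal t)) \<in> K \<longrightarrow> y \<in> B x w \<longrightarrow>
     ((Some y, ereal t), (Some y, ereal t)) \<in> K)"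
  then obtain x w y t where zw: "((Some x, ereal t), (Some w, ereal t)) \<in> K" "y \<in> B x w" "((Some y, ereal t), (Some y, ereal t)) \<notin> K"
    by blast
  have "x \<in> topspace X" "w \<in> topspace X"
    using hyperD(3,4)[OF K zw(1)] by auto
  then have "y \<in> topspace X"
    using zw(2) bt_subset by blast
  then have "((Some y, ereal t), (Some y, ereal t)) \<in> squeezed X \<times> squeezed X"
    by simp
  then obtain m where m: "\<forall>k\<in>K. 1 / real (Suc m) \<le> d_pair d ((Some y, ereal t), (Some y, ereal t)) k"
    using P.compact_away[OF hyperD(1)[OF K] _ zw(3)] by blast
  obtain k where k: "\<bar>t\<bar> \<le> real k"
    using real_arch_simple by blast
  have "\<forall>j\<in>K. 1 / real (Suc (max m k)) \<le> d_pair d ((Some y, ereal t), (Some y, ereal t)) j"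
    using m away_le[of m "max m k"] by simp
  moreover have "\<bar>t\<bar> \<le> real (max m k)"
    using k by linarith
  ultimately show "\<exists>n. \<exists>x w y t. ((Some x, ereal t), (Some w, ereal t)) \<in> K \<and> \<bar>t\<bar> \<le> real n \<and>
      y \<in> B x w \<and> (\<forall>k\<in>K. 1 / real (Suc n) \<le> d_pair d ((Some y, ereal t), (Some y, ereal t)) k)"
    using zw(1,2) by blast
next
  fix K n assume K: "K \<in> hyper" and a: "\<forall>x w y t. ((Some x, ereal t), (Some w, ereal t)) \<in> K \<longrightarrow> y \<in> B x w \<longrightarrow>
     ((Some y, ereal t), (Some y, ereal t)) \<in> K"
  show "\<not> (\<exists>x w y t. ((Some x, ereal t), (Some w, ereal t)) \<in> K \<and> \<bar>t\<bar> \<le> real n \<and>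
      y \<in> B x w \<and> (\<forall>k\<in>K. 1 / real (Suc n) \<le> d_pair d ((Some y, ereal t), (Some y, ereal t)) k))"
  proof
    assume "\<exists>x w y t. ((Some x, ereal t), (Some w, ereal t)) \<in> K \<and> \<bar>t\<bar> \<le> real n \<and>
      y \<in> B x w \<and> (\<forall>k\<in>K. 1 / real (Suc n) \<le> d_pair d ((Some y, ereal t), (Some y, ereal t)) k)"
    then obtain y t where y: "((Some y, ereal t), (Some y, ereal t)) \<in> K"
      and "1 / real (Suc n) \<le> d_pair d ((Some y, ereal t), (Some y, ereal t)) ((Some y, ereal t), (Some y, ereal t))"
      using a by blast
    then show False
      using d_pair_self[OF hyperD(3,4)[OF K y]] by (simp add: divide_le_0_iff)
  qed
qed

lemma gdelta_filled_orders: "gdelta_in H.mtopology (fo ` paths X)"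
proof -
  have "fo ` paths X = {K \<in> hyper. good_order K}"
    using filled_order_hyper good_filled_order good_order_path by blast
  also have "\<dots> = {K \<in> hyper. \<forall>z w. (z, w) \<in> K \<longrightarrow> snd z \<le> snd w} \<inter>
     ({K \<in> hyper. (\<forall>z w. (z, w) \<in> K \<longrightarrow> (z, z) \<in> K \<and> (w, w) \<in> K) \<and>
        (\<forall>z w. (z, z) \<in> K \<longrightarrow> (w, w) \<in> K \<longrightarrow> (z, w) \<in> K \<or> (w, z) \<in> K)} \<inter>
     ({K \<in> hyper. \<forall>x y w t. ((Some x, ereal t), (Some y, ereal t)) \<in> K \<longrightarrow>
        ((Some y, ereal t), (Some w, ereal t)) \<in> K \<longrightarrow> y \<in> B x w} \<inter>
     {K \<in> hyper. \<forall>x w y t. ((Some x, ereal t), (Some w, ereal t)) \<in> K \<longrightarrow> y \<in> B x w \<longrightarrow>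
        ((Some y, ereal t), (Some y, ereal t)) \<in> K}))"
    unfolding good_order_def
    by (rule set_eqI, unfold Int_iff mem_Collect_eq, rule iffI; elim conjE; intro conjI; assumption)
  finally show ?thesis
    by (simp only:) (intro gdelta_in_Int closed_imp_gdelta_in H.metrizable_space_mtopology
        closed_good_time closed_good_total gdelta_segment gdelta_filled)
qed

section \<open>Paths over a given interval\<close>

lemma closed_times_in:
  assumes "closed E"
  shows "closedin H.mtopology {K \<in> hyper. \<forall>z w. (z, w) \<in> K \<longrightarrow> snd z \<in> E}" (is "closedin _ ?S")
proof (rule P.hyper_closedI)
  fix K L assume K: "\<And>n. K n \<in> ?S" and L: "L \<in> hyper" and lim: "P.hseq K L"
  have KH: "K n \<in> hyper" for n using K by blast
  have "snd z \<in> E" if zw: "(z, w) \<in> L" for z w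
  proof -
    obtain u v where uv: "\<forall>n. (u n, v n) \<in> K n" "null (\<lambda>n. d (u n) z)" "null (\<lambda>n. d (v n) w)"
      by (rule pair_seq_approx[OF lim zw])
    have "(\<lambda>n. snd (u n)) \<longlonglongrightarrow> snd z"
      by (rule lim_time[of u z, OF hyperD(3)[OF KH] hyperD(3)[OF L zw] uv(2)]) (use uv(1) in blast)
    moreover have "snd (u n) \<in> E" for n
      using K[of n] uv(1) by blast
    ultimately show ?thesis
      using closed_sequentially[OF assms, of "\<lambda>n. snd (u n)"] by blast
  qed
  then show "L \<in> ?S"
    using L by blast
qed blast

lemma closed_times_all:
  "closedin H.mtopology {K \<in> hyper. \<forall>t\<in>E. \<exists>z w. (z, w) \<in> K \<and> snd z = t}" (is "closedin _ ?S")
proof (rule P.hyper_closedI)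
  fix K L assume K: "\<And>n. K n \<in> ?S" and L: "L \<in> hyper" and lim: "P.hseq K L"
  have KH: "K n \<in> hyper" for n using K by blast
  have "\<exists>z w. (z, w) \<in> L \<and> snd z = t" if t: "t \<in> E" for t
  proof -
    have "\<exists>z w. (z, w) \<in> K n \<and> snd z = t" for n
      using K[of n] t by blast
    then obtain z w where zw: "\<And>n. (z n, w n) \<in> K n" "\<And>n. snd (z n) = t"
      by metis
    obtain a b r where r: "(a, b) \<in> L" "subseq r"
      "null (\<lambda>n. d (z (r n)) a)" "null (\<lambda>n. d (w (r n)) b)"
      by (rule pair_seq_compact[of K L z w, OF KH L lim zw(1)])
    have "(\<lambda>n. snd (z (r n))) \<longlonglongrightarrow> snd a"
      by (rule lim_time[of "\<lambda>n. z (r n)" a, OF hyperD(3)[OF KH zw(1)] hyperD(3)[OF L r(1)] r(3)])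
    then have "snd a = t"
      by (simp add: zw(2) LIMSEQ_const_iff)
    then show ?thesis
      using r(1) by blast
  qed
  then show "L \<in> ?S"
    using L by blast
qed blast

lemma closed_bad_jump:
  assumes "closed F"
  shows "closedin H.mtopology {K \<in> hyper. \<exists>z w. (z, w) \<in> K \<and> snd z = snd w \<and> snd z \<in> F \<and> e \<le> d z w}"
    (is "closedin _ ?S")
proof (rule P.hyper_closedI)
  fix K L assume K: "\<And>n. K n \<in> ?S" and L: "L \<in> hyper" and lim: "P.hseq K L"
  have KH: "K n \<in> hyper" for n using K by blast
  have "\<exists>z w. (z, w) \<in> K n \<and> snd z = snd w \<and> snd z \<in> F \<and> e \<le> d z w" for n
    using K[of n] by blast
  then obtain z w where zw: "\<And>n. (z n, w n) \<in> K n" "\<And>n. snd (z n) = snd (w n)" "\<And>n. snd (z n) \<in> F" "\<And>n. e \<le> d (z n) (w n)"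
    by metis
  obtain a b r where r: "(a, b) \<in> L" "subseq r"
    "null (\<lambda>n. d (z (r n)) a)" "null (\<lambda>n. d (w (r n)) b)"
    by (rule pair_seq_compact[of K L z w, OF KH L lim zw(1)])
  have M: "a \<in> squeezed X" "b \<in> squeezed X"
    using hyperD(3,4)[OF L r(1)] .
  have ta: "(\<lambda>n. snd (z (r n))) \<longlonglongrightarrow> snd a"
    by (rule lim_time[of "\<lambda>n. z (r n)" a, OF hyperD(3)[OF KH zw(1)] M(1) r(3)])
  have "(\<lambda>n. snd (w (r n))) \<longlonglongrightarrow> snd b"
    by (rule lim_time[of "\<lambda>n. w (r n)" b, OF hyperD(4)[OF KH zw(1)] M(2) r(4)])
  then have "snd a = snd b"
    using LIMSEQ_unique[OF ta] by (simp add: zw(2))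
  moreover have "snd a \<in> F"
    using closed_sequentially[OF assms _ ta] zw(3) by blast
  moreover have "(\<lambda>n. d (z (r n)) (w (r n))) \<longlonglongrightarrow> d a b"
    by (rule Z.seq_dist[OF hyperD(3)[OF KH zw(1)] hyperD(4)[OF KH zw(1)] M r(3,4)])
  then have "e \<le> d a b"
    by (rule LIMSEQ_le_const) (use zw(4) in blast)
  ultimately show "L \<in> ?S"
    using L r(1) by blast
qed blast

text \<open>Membership is expressed by the order alone, so that it becomes a condition on elements
  of the hyperspace. The two clauses on times are closed; the absence of jumps at the endpoints is a
  G-delta condition, by excluding jumps of size \<open>1 / real (Suc n)\<close>.\<close>

lemma D_paths_iff:
  assumes p: "p \<in> paths X"
  shows "p \<in> D_paths I X \<longleftrightarrow>
    (\<forall>z w. (z, w) \<in> fo p \<longrightarrow> snd z \<in> ereal ` I \<union> {-\<infinity>, \<infinity>}) \<and>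
    (\<forall>t\<in>ereal ` I \<union> {-\<infinity>, \<infinity>}. \<exists>z w. (z, w) \<in> fo p \<and> snd z = t) \<and>
    (\<forall>z w. (z, w) \<in> fo p \<longrightarrow> snd z = snd w \<longrightarrow> snd z \<in> ereal ` endpoints I \<longrightarrow> z = w)"
proof -
  let ?E = "ereal ` I \<union> {-\<infinity>, \<infinity>}"
  note ord = filled_corder[OF p]
  have T: "(\<exists>z w. (z, w) \<in> fo p \<and> snd z = t) \<longleftrightarrow> t \<in> ext_times p" for t
  proof
    assume "\<exists>z w. (z, w) \<in> fo p \<and> snd z = t"
    then obtain z w where zw: "(z, w) \<in> fo p" "snd z = t"
      by blast
    then show "t \<in> ext_times p"
      using snd_filled[OF p, of z] filled_order_dom[OF zw(1)] by simp
  next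
    assume "t \<in> ext_times p"
    then obtain z where z: "z \<in> fst p" "snd z = t"
      unfolding ext_times_def by blast
    then have "(z, z) \<in> fo p"
      using Z.corder_refl[OF ord subsetD[OF path_sub_filled[OF p]]] by blast
    then show "\<exists>z w. (z, w) \<in> fo p \<and> snd z = t"
      using z(2) by blast
  qed
  have "(\<forall>z w. (z, w) \<in> fo p \<longrightarrow> snd z \<in> ?E) \<longleftrightarrow> ext_times p \<subseteq> ?E"
    unfolding subset_eq Ball_def T[symmetric] by metis
  moreover have "(\<forall>t\<in>?E. \<exists>z w. (z, w) \<in> fo p \<and> snd z = t) \<longleftrightarrow> ?E \<subseteq> ext_times p"
    unfolding T by (rule subset_eq[symmetric])
  moreover have "(\<forall>t\<in>endpoints I. path_left p t = path_right p t) \<longleftrightarrow>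
     (\<forall>z w. (z, w) \<in> fo p \<longrightarrow> snd z = snd w \<longrightarrow> snd z \<in> ereal ` endpoints I \<longrightarrow> z = w)"
    if E: "ext_times p = ?E"
  proof
    assume lr: "\<forall>t\<in>endpoints I. path_left p t = path_right p t"
    show "\<forall>z w. (z, w) \<in> fo p \<longrightarrow> snd z = snd w \<longrightarrow> snd z \<in> ereal ` endpoints I \<longrightarrow> z = w"
    proof (intro allI impI)
      fix z w assume zw: "(z, w) \<in> fo p" "snd z = snd w" "snd z \<in> ereal ` endpoints I"
      then obtain t where t: "t \<in> endpoints I" "snd z = ereal t" "snd w = ereal t"
        by auto
      have single: "v = (Some (path_left p t), ereal t)" if "v \<in> fl p" "snd v = ereal t" for v
        using p that(1)
      proof (cases rule: filled_cases)
        case (1 x s)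
        then have s: "s = t"
          using that(2) by simp
        have "path_right p t = path_left p t"
          using lr t(1) by simp
        then have "x \<in> B (path_left p t) (path_left p t)"
          using 1(3) s by simp
        then show ?thesis
          using bt_self[OF path_left_right(4)[OF p 1(2)]] 1(1) s by simp
      qed (use that(2) in auto)
      show "z = w"
        using single[of z] single[of w] filled_order_dom[OF zw(1)] t by simp
    qed
  next
    assume eq: "\<forall>z w. (z, w) \<in> fo p \<longrightarrow> snd z = snd w \<longrightarrow> snd z \<in> ereal ` endpoints I \<longrightarrow> z = w"
    show "\<forall>t\<in>endpoints I. path_left p t = path_right p t"
    proof
      fix t assume t: "t \<in> endpoints I"
      then have "t \<in> times p"
        using E by (auto simp: times_def endpoints_def)
      then have "((Some (path_left p t), ereal t), (Some (path_right p t), ereal t)) \<in> fo p"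
        using path_left_right(3)[OF p] path_order_eq[OF p] by blast
      then have "(Some (path_left p t), ereal t) = (Some (path_right p t), ereal t)"
        using eq[rule_format] t by (metis (no_types, lifting) imageI snd_conv)
      then show "path_left p t = path_right p t"
        by simp
    qed
  qed
  ultimately show ?thesis
    unfolding D_paths_def using p by (auto simp only: mem_Collect_eq set_eq_subset)
qed

lemma gdelta_D_paths:
  assumes "closed_real_interval I"
  shows "gdelta_in H.mtopology (fo ` D_paths I X)"
proof -
  let ?E = "ereal ` I \<union> {-\<infinity>, \<infinity>}" and ?F = "ereal ` endpoints I"
  define S1 where "S1 = {K \<in> hyper. \<forall>z w. (z, w) \<in> K \<longrightarrow> snd z \<in> ?E}"
  define S2 where "S2 = {K \<in> hyper. \<forall>t\<in>?E. \<exists>z w. (z, w) \<in> K \<and> snd z = t}"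
  define S3 where "S3 = {K \<in> hyper. \<forall>z w. (z, w) \<in> K \<longrightarrow> snd z = snd w \<longrightarrow> snd z \<in> ?F \<longrightarrow> z = w}"
  have E: "closed ?E"
    using assms by (intro closed_ereal_times) (simp add: closed_real_interval_def)
  have F: "closed ?F"
    by (intro finite_imp_closed finite_imageI finite_endpoints)
  have 1: "gdelta_in H.mtopology S1"
    unfolding S1_def by (intro closed_imp_gdelta_in H.metrizable_space_mtopology closed_times_in E)
  have 2: "gdelta_in H.mtopology S2"
    unfolding S2_def by (intro closed_imp_gdelta_in H.metrizable_space_mtopology closed_times_all)
  have 3: "gdelta_in H.mtopology S3"
    unfolding S3_def
  proof (rule gdelta_bad[OF closed_bad_jump[OF F]])
    fix K assume K: "K \<in> hyper" and "\<not> (\<forall>z w. (z, w) \<in> K \<longrightarrow> snd z = snd w \<longrightarrow> snd z \<in> ?F \<longrightarrow> z = w)"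
    then obtain z w where zw: "(z, w) \<in> K" "snd z = snd w" "snd z \<in> ?F" "z \<noteq> w"
      by blast
    then show "\<exists>n::nat. \<exists>z w. (z, w) \<in> K \<and> snd z = snd w \<and> snd z \<in> ?F \<and> 1 / real (Suc n) \<le> d z w"
      using dist_away[OF hyperD(3,4)[OF K zw(1)]] by blast
  next
    fix K n assume K: "K \<in> hyper" and a: "\<forall>z w. (z, w) \<in> K \<longrightarrow> snd z = snd w \<longrightarrow> snd z \<in> ?F \<longrightarrow> z = w"
    show "\<not> (\<exists>z w. (z, w) \<in> K \<and> snd z = snd w \<and> snd z \<in> ?F \<and> 1 / real (Suc n) \<le> d z w)"
    proof
      assume "\<exists>z w. (z, w) \<in> K \<and> snd z = snd w \<and> snd z \<in> ?F \<and> 1 / real (Suc n) \<le> d z w"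
      then obtain z where "(z, z) \<in> K" "1 / real (Suc n) \<le> d z z"
        using a by blast
      then show False
        using Z.mdist_zero[OF hyperD(3)[OF K]] by (simp add: divide_le_0_iff)
    qed
  qed
  have "fo p \<in> S1 \<inter> (S2 \<inter> S3) \<longleftrightarrow> p \<in> D_paths I X" if "p \<in> paths X" for p
    unfolding D_paths_iff[OF that] S1_def S2_def S3_def using filled_order_hyper[OF that] by simp
  moreover have "D_paths I X \<subseteq> paths X"
    by (auto simp: D_paths_def)
  ultimately have "fo ` D_paths I X = fo ` paths X \<inter> (S1 \<inter> (S2 \<inter> S3))"
    by blast
  then show ?thesis
    using gdelta_in_Int[OF gdelta_filled_orders gdelta_in_Int[OF 1 gdelta_in_Int[OF 2 3]]] by simp
qed

text \<open>Sending a path to its order is an isometry for \<open>d_part\<close> into the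
  hyperspace, and G-delta subsets inherit complete metrizability.\<close>

lemma polish_gdelta_paths:
  assumes Z: "Z.mcomplete" "separable_space Z.mtopology"
    and P: "P \<subseteq> paths X" and gd: "gdelta_in H.mtopology (fo ` P)"
  shows "polish (Metric_space.mtopology P (d_part X B d))"
proof -
  let ?S = "fo ` P"
  have S: "?S \<subseteq> hyper"
    using P filled_order_hyper by blast
  interpret sub: Submetric hyper hyper_dist ?S
    by unfold_locales (rule S)
  interpret PP: Metric_space P "d_part X B d"
    by (rule Metric_space.subspace[OF Metric_space_d_part P])
  interpret iso: Metric_space12 P "d_part X B d" ?S hyper_dist ..
  have "hyper_dist (fo p) (fo q) = d_part X B d p q" if "p \<in> P" "q \<in> P" for p q
    using that P by (auto simp: d_part_def pair_mtop)
  then have "homeomorphic_map PP.mtopology sub.sub.mtopology (fo)"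
    by (intro iso.isometry_imp_homeomorphic_map) auto
  then have hom: "PP.mtopology homeomorphic_space sub.sub.mtopology"
    by (rule homeomorphic_map_imp_homeomorphic_space)
  have "completely_metrizable_space H.mtopology"
    by (intro H.completely_metrizable_space_mtopology P.hausdorff_mcomplete Z.d_pair_mcomplete Z)
  then have "completely_metrizable_space sub.sub.mtopology"
    unfolding sub.mtopology_submetric using gd by (rule completely_metrizable_space_gdelta_in)
  moreover have "separable_space H.mtopology"
    by (intro P.hausdorff_separable Z.d_pair_separable Z)
  then have "separable_space sub.sub.mtopology"
    by (rule separable_space_metric_subset[OF H.Metric_space_axioms _ S])
  ultimately show ?thesis
    unfolding polish_def
    using homeomorphic_completely_metrizable_space[OF hom] homeomorphic_separable_space[OF hom] by blast
qed

lemma D_paths_sub: "D_paths I X \<subseteq> paths X"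
  by (auto simp: D_paths_def)

lemma polish_paths:
  assumes X: "polish X"
  shows "polish (Metric_space.mtopology (paths X) (d_tot X B d))"
    and "closed_real_interval I \<Longrightarrow> polish (Metric_space.mtopology (D_paths I X) (d_tot X B d))"
proof -
  \<comment> \<open>The given \<open>d\<close> may be incomplete. It is exchanged for a complete
    metric \<open>D\<close> of the squeezed space, which leaves the topology of \<open>d_tot\<close>
    unchanged.\<close>
  obtain D where D: "metric_generates (squeezed X) D (squeezed_topology X)"
    "Metric_space.mcomplete (squeezed X) D" "separable_space (squeezed_topology X)"
    by (rule polish_squeezed[OF X])
  interpret Y: path_space X B D
    using path_space_axioms D(1) unfolding path_space_def by blast
  have Z: "Y.Z.mcomplete" "separable_space Y.Z.mtopology"
    using D Y.mtop by simp_all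
  have eq: "Metric_space.mtopology (paths X) (d_tot X B d) = Metric_space.mtopology (paths X) (d_tot X B D)"
    using d_tot_topology_indep[OF D(1)] by simp
  show "polish (Metric_space.mtopology (paths X) (d_tot X B d))"
    unfolding eq Y.d_tot_d_part_topology[OF order_refl]
    by (rule Y.polish_gdelta_paths[OF Z order_refl Y.gdelta_filled_orders])
  have sub: "Metric_space.mtopology (D_paths I X) (d_tot X B d') =
      subtopology (Metric_space.mtopology (paths X) (d_tot X B d')) (D_paths I X)"
    if "path_space X B d'" for d'
  proof -
    interpret S: Submetric "paths X" "d_tot X B d'" "D_paths I X"
      using path_space.Metric_space_d_tot[OF that] D_paths_sub
      by (simp add: Submetric_def Submetric_axioms_def)
    show ?thesis
      by (rule S.mtopology_submetric)
  qed
  \<comment> \<open>Independence of the metric was shown for the space of all paths; subspace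
    topologies carry it over to \<open>D_paths\<close>.\<close>
  show "polish (Metric_space.mtopology (D_paths I X) (d_tot X B d))" if "closed_real_interval I"
    unfolding sub[OF path_space_axioms] eq sub[OF Y.path_space_axioms, symmetric]
      Y.d_tot_d_part_topology[OF D_paths_sub]
    by (rule Y.polish_gdelta_paths[OF Z D_paths_sub Y.gdelta_D_paths[OF that]])
qed

end

section \<open>Parametrising compact chains\<close>

lemma tendsto_subseq_criterion:
  fixes X :: "nat \<Rightarrow> 'b::topological_space"
  assumes "\<And>r::nat \<Rightarrow> nat. strict_mono r \<Longrightarrow> \<exists>s. subseq s \<and> (\<lambda>n. X (r (s n))) \<longlonglongrightarrow> l"
  shows "X \<longlonglongrightarrow> l"
  unfolding tendsto_def
proof (intro allI impI, rule ccontr)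
  fix S assume S: "open S" "l \<in> S" and "\<not> (\<forall>\<^sub>F n in sequentially. X n \<in> S)"
  then have "\<not> (\<forall>\<^sub>F n in sequentially. \<not> X n \<notin> S)"
    by simp
  then obtain r :: "nat \<Rightarrow> nat" where r: "strict_mono r" "\<And>n. X (r n) \<notin> S"
    using frequently_subseq[of "\<lambda>n. X n \<notin> S"] by blast
  obtain s :: "nat \<Rightarrow> nat" where s: "strict_mono s" "(\<lambda>n. X (r (s n))) \<longlonglongrightarrow> l"
    using assms[OF r(1)] by blast
  have "\<forall>\<^sub>F n in sequentially. X (r (s n)) \<in> S"
    using topological_tendstoD[OF s(2) S] .
  then show False
    using r(2) by simp
qed

lemma tendsto_iff_dist0: "(null (\<lambda>n. dist (f n) l)) \<longleftrightarrow> f \<longlonglongrightarrow> l"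
  by (rule tendsto_dist_iff[symmetric])

text \<open>\<open>F\<close> is a strictly increasing function on the chain, in general with jumps; \<open>\<gamma>\<close> is its generalised
  inverse. As a monotone surjection onto a densely ordered chain, \<open>\<gamma>\<close> is continuous.\<close>

lemma chain_param:
  fixes K :: "'b::euclidean_space set"
  assumes ord: "Met_TC.corder K le"
    and dense: "\<And>x y. (x, y) \<in> le \<Longrightarrow> x \<noteq> y \<Longrightarrow> \<exists>z. (x, z) \<in> le \<and> (z, y) \<in> le \<and> z \<noteq> x \<and> z \<noteq> y"
  shows "\<exists>\<gamma>. continuous_on {0..1::real} \<gamma> \<and> \<gamma> ` {0..1} = K \<and>
    (\<forall>s\<in>{0..1}. \<forall>t\<in>{0..1}. s \<le> t \<longrightarrow> (\<gamma> s, \<gamma> t) \<in> le)"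
proof -
  note dom = Met_TC.corder_dom[OF ord] and refl = Met_TC.corder_refl[OF ord]
    and asym = Met_TC.corder_antisym[OF ord] and tran = Met_TC.corder_trans[OF ord]
    and total = Met_TC.corder_total[OF ord]
  obtain D where D: "countable D" "D \<subseteq> K" "K \<subseteq> closure D"
    using separable[of K] by blast
  have Kne: "K \<noteq> {}"
    by (rule Met_TC.corder_nonempty[OF ord])
  then have Dne: "D \<noteq> {}"
    using D(3) by auto
  define w where "w = from_nat_into D"
  have wD: "range w = D"
    unfolding w_def by (rule range_from_nat_into[OF Dne D(1)])
  have wK: "w n \<in> K" for n
    using wD D(2) by blast
  \<comment> \<open>By density of the chain there is a point strictly between \<open>x\<close> and
    \<open>y\<close>; as strict inequalities are open, members of \<open>D\<close> near it lie
    between \<open>x\<close> and \<open>y\<close> too.\<close>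
  have mid: "\<exists>n. (x, w n) \<in> le \<and> (w n, y) \<in> le \<and> w n \<noteq> x" if xy: "(x, y) \<in> le" "x \<noteq> y" for x y
  proof (rule ccontr)
    assume no: "\<not> ?thesis"
    obtain z where z: "(x, z) \<in> le" "(z, y) \<in> le" "z \<noteq> x" "z \<noteq> y"
      using dense[OF xy] by blast
    have "z \<in> closure D"
      using D(3) dom(2)[OF z(1)] by blast
    then obtain v where v: "\<And>n. v n \<in> D" "v \<longlonglongrightarrow> z"
      unfolding closure_sequential by blast
    have vl: "null (\<lambda>n. dist (v n) z)"
      using v(2) by (simp add: tendsto_iff_dist0)
    have "(z, x) \<notin> le" "(y, z) \<notin> le"
      using z asym by blast+
    then have "\<forall>\<^sub>F n in sequentially. (v n, x) \<notin> le" "\<forall>\<^sub>F n in sequentially. (y, v n) \<notin> le"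
      using Met_TC.corder_eventually_not[OF ord dom(2)[OF z(1)] dom(1)[OF xy(1)] _ vl, of "\<lambda>n. x"]
        Met_TC.corder_eventually_not[OF ord dom(2)[OF xy(1)] dom(2)[OF z(1)] _ _ vl, of "\<lambda>n. y"] by simp_all
    then have "\<forall>\<^sub>F n in sequentially. (v n, x) \<notin> le \<and> (y, v n) \<notin> le"
      by (rule eventually_conj)
    then obtain n where n: "(v n, x) \<notin> le" "(y, v n) \<notin> le"
      using eventually_sequentially by auto
    obtain m where m: "v n = w m"
      using v(1)[of n] wD by blast
    have "(x, v n) \<in> le" "(v n, y) \<in> le"
      using n total[of "v n" x] total[of y "v n"] wK[of m] m dom[OF xy(1)] by auto
    moreover have "v n \<noteq> x"
      using n(1) refl dom(1)[OF xy(1)] by blast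
    ultimately show False
      using no m by metis
  qed
  \<comment> \<open>\<open>F z\<close> adds the weights \<open>(1 / 2) ^ n\<close> of those
    \<open>w n\<close> that do not exceed \<open>z\<close>. It is strictly increasing by
    \<open>mid\<close>, and its values lie between 0 and 2, whence the factor 2 in
    \<open>\<gamma>\<close>.\<close>
  define f where "f z n = (1 / 2 :: real) ^ n * (if (w n, z) \<in> le then 1 else 0)" for z n
  define F where "F z = (\<Sum>n. f z n)" for z
  have fb: "0 \<le> f z n" "f z n \<le> (1 / 2) ^ n" for z n
    by (auto simp: f_def)
  have geo: "summable (\<lambda>n. (1 / 2 :: real) ^ n)"
    by (rule summable_geometric) simp
  have sf: "summable (f z)" for z
    by (rule summable_comparison_test'[OF geo]) (use fb in auto)
  have F0: "0 \<le> F z" for z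
    unfolding F_def by (rule suminf_nonneg[OF sf fb(1)])
  have F2: "F z \<le> 2" for z
  proof -
    have "F z \<le> (\<Sum>n. (1 / 2 :: real) ^ n)"
      unfolding F_def by (rule suminf_le[OF fb(2) sf geo])
    also have "\<dots> = 2"
      using suminf_geometric[of "1 / 2 :: real"] by simp
    finally show ?thesis .
  qed
  have fmono: "f x n \<le> f y n" if "(x, y) \<in> le" for x y n
    using tran[OF _ that, of "w n"] by (auto simp: f_def)
  have Fless: "F x < F y" if xy: "(x, y) \<in> le" "x \<noteq> y" for x y
  proof -
    obtain n where n: "(x, w n) \<in> le" "(w n, y) \<in> le" "w n \<noteq> x"
      using mid[OF xy] by blast
    have "(w n, x) \<notin> le"
      using n asym by blast
    then have "0 < f y n - f x n"
      using n(2) by (simp add: f_def)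
    then have "0 < (\<Sum>n. f y n - f x n)"
      using fmono[OF xy(1)] by (intro suminf_pos2[of _ n] summable_diff sf) auto
    also have "\<dots> = F y - F x"
      unfolding F_def by (rule suminf_diff[OF sf sf, symmetric])
    finally show ?thesis by simp
  qed
  \<comment> \<open>Testing only the strict predecessors of \<open>z\<close> makes
    \<open>S s\<close> closed although \<open>F\<close> may jump. So it has a largest element, the
    generalised inverse at \<open>s\<close>.\<close>
  define S where "S s = {z \<in> K. \<forall>z'. (z', z) \<in> le \<longrightarrow> z' \<noteq> z \<longrightarrow> F z' \<le> s}" for s
  have S_closed: "x \<in> S s" if \<sigma>S: "\<And>n::nat. \<sigma> n \<in> S s" and "x \<in> K" "null (\<lambda>n. dist (\<sigma> n) x)" for \<sigma> x s
  proof -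
    have "F z' \<le> s" if z': "(z', x) \<in> le" "z' \<noteq> x" for z'
    proof -
      have "(x, z') \<notin> le"
        using z' asym by blast
      then have "\<forall>\<^sub>F n in sequentially. (\<sigma> n, z') \<notin> le"
        using Met_TC.corder_eventually_not[OF ord \<open>x \<in> K\<close> dom(1)[OF z'(1)] _ \<open>(\<lambda>n. dist (\<sigma> n) x) \<longlonglongrightarrow> 0\<close>, of "\<lambda>n. z'"]
        by simp
      then obtain n where n: "(\<sigma> n, z') \<notin> le"
        using eventually_sequentially by auto
      have \<sigma>n: "\<sigma> n \<in> S s"
        by (rule \<sigma>S)
      then have "\<sigma> n \<in> K"
        by (simp add: S_def)
      then have "(z', \<sigma> n) \<in> le" "z' \<noteq> \<sigma> n"
        using n total[of z' "\<sigma> n"] refl dom(1)[OF z'(1)] by auto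
      then show ?thesis
        using \<sigma>n unfolding S_def by blast
    qed
    then show ?thesis
      using \<open>x \<in> K\<close> by (simp add: S_def)
  qed
  obtain k0 where k0: "k0 \<in> K" "\<forall>x\<in>K. (k0, x) \<in> le"
    using Met_TC.corder_min[OF ord order_refl Kne] by blast
  have S_ne: "S s \<noteq> {}" for s
  proof -
    have "k0 \<in> S s"
      unfolding S_def using k0 dom asym by blast
    then show ?thesis by blast
  qed
  have "\<exists>m\<in>S s. \<forall>x\<in>S s. (x, m) \<in> le" for s
  proof (rule Met_TC.corder_max[OF ord _ S_ne])
    show "S s \<subseteq> K"
      by (auto simp: S_def)
    show "\<And>(\<sigma>::nat \<Rightarrow> 'b) x. (\<And>n. \<sigma> n \<in> S s) \<Longrightarrow> x \<in> K \<Longrightarrow> null (\<lambda>n. dist (\<sigma> n) x) \<Longrightarrow> x \<in> S s"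
      by (rule S_closed)
  qed
  then obtain g where g: "\<And>s. g s \<in> S s" "\<And>s x. x \<in> S s \<Longrightarrow> (x, g s) \<in> le"
    by metis
  have gK: "g s \<in> K" for s
    using g(1)[of s] by (simp add: S_def)
  have gmono: "(g s, g t) \<in> le" if "s \<le> t" for s t
  proof (rule g(2))
    show "g s \<in> S t"
      using g(1)[of s] that unfolding S_def by (auto intro: order_trans)
  qed
  have above: "s < F z1" if z1: "z1 \<in> K" "(g s, z1) \<in> le" "g s \<noteq> z1" for s z1
  proof -
    have "z1 \<notin> S s"
      using g(2) z1 asym by blast
    then obtain z' where z': "(z', z1) \<in> le" "z' \<noteq> z1" "\<not> F z' \<le> s"
      using z1(1) unfolding S_def by blast
    then show ?thesis
      using Fless[OF z'(1,2)] by linarith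
  qed
  have below: "F z2 \<le> s" if "(z2, g s) \<in> le" "z2 \<noteq> g s" for s z2
    using g(1)[of s] that unfolding S_def by blast
  \<comment> \<open>If \<open>g (F z)\<close> were beyond \<open>z\<close>, a point strictly between
    them would have an \<open>F\<close> value larger than \<open>F z\<close> and, by
    \<open>below\<close>, at most \<open>F z\<close>.\<close>
  have gF: "g (F z) = z" if z: "z \<in> K" for z
  proof (rule ccontr)
    assume ne: "g (F z) \<noteq> z"
    have "z \<in> S (F z)"
      unfolding S_def using z Fless by (auto intro: less_imp_le)
    then have le: "(z, g (F z)) \<in> le"
      by (rule g(2))
    obtain z' where z': "(z, z') \<in> le" "(z', g (F z)) \<in> le" "z' \<noteq> z" "z' \<noteq> g (F z)"
      using dense[OF le] ne by metis
    show False
      using below[OF z'(2,4)] Fless[OF z'(1)] z'(3) by force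
  qed
  have cont: "(\<lambda>n. g (u n)) \<longlonglongrightarrow> g s" if u: "u \<longlonglongrightarrow> s" for u s
  proof (rule tendsto_subseq_criterion)
    fix r :: "nat \<Rightarrow> nat" assume r: "strict_mono r"
    obtain y q where y: "y \<in> K" "strict_mono q" "null (\<lambda>n. dist (g (u (r (q n)))) y)"
      by (rule Met_TC.compact_seq[OF Met_TC.corder_compact[OF ord], of "\<lambda>n. g (u (r n))"]) (rule gK)
    define v where "v n = u (r (q n))" for n
    have v: "v \<longlonglongrightarrow> s"
      unfolding v_def by (rule strict_mono_subseq_tendsto[OF y(2) strict_mono_subseq_tendsto[OF r u]])
    have yl: "null (\<lambda>n. dist (g (v n)) y)"
      using y(3) by (simp add: v_def)
    have "y = g s"
    proof (rule ccontr)
      assume ne: "y \<noteq> g s"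
      consider "(y, g s) \<in> le" | "(g s, y) \<in> le"
        using total[OF y(1) gK] by blast
      then show False
      proof cases
        case 1
        \<comment> \<open>Two intermediate points are taken: terms below \<open>z1\<close> give
          \<open>s \<le> F z1\<close> in the limit, where strictness is lost, and \<open>z2\<close>
          restores it through \<open>F z1 < F z2\<close> and \<open>F z2 \<le> s\<close>.\<close>
        obtain z1 where z1: "(y, z1) \<in> le" "(z1, g s) \<in> le" "z1 \<noteq> y" "z1 \<noteq> g s"
          using dense[OF 1 ne] by blast
        obtain z2 where z2: "(z1, z2) \<in> le" "(z2, g s) \<in> le" "z2 \<noteq> z1" "z2 \<noteq> g s"
          using dense[OF z1(2,4)] by blast
        have "(z1, y) \<notin> le"
          using z1 asym by blast
        then have "\<forall>\<^sub>F n in sequentially. (z1, g (v n)) \<notin> le"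
          using Met_TC.corder_eventually_not[OF ord dom(2)[OF z1(1)] y(1) _ _ yl, of "\<lambda>n. z1"] by simp
        then obtain N where N: "\<And>n. n \<ge> N \<Longrightarrow> (z1, g (v n)) \<notin> le"
          unfolding eventually_sequentially by blast
        have "v n \<le> F z1" if "n \<ge> N" for n
        proof -
          have "(g (v n), z1) \<in> le" "g (v n) \<noteq> z1"
            using N[OF that] total[OF gK dom(2)[OF z1(1)], of "v n"] refl[OF dom(2)[OF z1(1)]] by auto
          then show ?thesis
            using above[OF dom(2)[OF z1(1)]] by (simp add: less_imp_le)
        qed
        then have "s \<le> F z1"
          using LIMSEQ_le_const2[OF v] by blast
        moreover have "F z1 < F z2"
          using Fless[OF z2(1)] z2(3) by blast
        moreover have "F z2 \<le> s"
          by (rule below[OF z2(2,4)])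
        ultimately show False by linarith
      next
        case 2
        obtain z1 where z1: "(g s, z1) \<in> le" "(z1, y) \<in> le" "z1 \<noteq> g s" "z1 \<noteq> y"
          using dense[OF 2] ne by metis
        obtain z2 where z2: "(z1, z2) \<in> le" "(z2, y) \<in> le" "z2 \<noteq> z1" "z2 \<noteq> y"
          using dense[OF z1(2,4)] by blast
        have "(y, z2) \<notin> le"
          using z2 asym by blast
        then have "\<forall>\<^sub>F n in sequentially. (g (v n), z2) \<notin> le"
          using Met_TC.corder_eventually_not[OF ord y(1) dom(1)[OF z2(2)] _ yl, of "\<lambda>n. z2"] by simp
        then obtain N where N: "\<And>n. n \<ge> N \<Longrightarrow> (g (v n), z2) \<notin> le"
          unfolding eventually_sequentially by blast
        have "F z2 \<le> v n" if "n \<ge> N" for n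
        proof (rule below)
          show "(z2, g (v n)) \<in> le" "z2 \<noteq> g (v n)"
            using N[OF that] total[OF gK dom(1)[OF z2(2)], of "v n"] refl[OF dom(1)[OF z2(2)]] by auto
        qed
        then have "F z2 \<le> s"
          using LIMSEQ_le_const[OF v] by blast
        moreover have "F z1 < F z2"
          using Fless[OF z2(1)] z2(3) by blast
        moreover have "s < F z1"
          using above[OF dom(2)[OF z1(1)] z1(1)] z1(3) by blast
        ultimately show False by linarith
      qed
    qed
    then show "\<exists>q. subseq q \<and> (\<lambda>n. g (u (r (q n)))) \<longlonglongrightarrow> g s"
      using y(2) yl by (intro exI[of _ q]) (simp add: tendsto_iff_dist0 v_def)
  qed
  define \<gamma> where "\<gamma> s = g (2 * s)" for s
  have "continuous_on {0..1} \<gamma>"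
    unfolding continuous_on_sequentially
  proof (intro allI ballI impI)
    fix u :: "nat \<Rightarrow> real" and a assume "(\<forall>n. u n \<in> {0..1}) \<and> u \<longlonglongrightarrow> a"
    then have "(\<lambda>n. 2 * u n) \<longlonglongrightarrow> 2 * a"
      by (intro tendsto_intros) simp
    then show "(\<gamma> \<circ> u) \<longlonglongrightarrow> \<gamma> a"
      unfolding \<gamma>_def o_def by (rule cont)
  qed
  moreover have "\<gamma> ` {0..1} = K"
  proof
    show "\<gamma> ` {0..1} \<subseteq> K"
      using gK by (auto simp: \<gamma>_def)
    show "K \<subseteq> \<gamma> ` {0..1}"
    proof
      fix z assume "z \<in> K"
      then have "\<gamma> (F z / 2) = z"
        by (simp add: \<gamma>_def gF)
      moreover have "F z / 2 \<in> {0..1}"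
        using F0[of z] F2[of z] by simp
      ultimately show "z \<in> \<gamma> ` {0..1}"
        by (metis imageI)
    qed
  qed
  moreover have "\<forall>s\<in>{0..1}. \<forall>t\<in>{0..1}. s \<le> t \<longrightarrow> (\<gamma> s, \<gamma> t) \<in> le"
    using gmono by (simp add: \<gamma>_def)
  ultimately show ?thesis
    by blast
qed

section \<open>Real-valued paths\<close>

lemma betweenness_closed_segment: "betweenness UNIV (closed_segment :: real \<Rightarrow> real \<Rightarrow> real set)"
  unfolding betweenness_def
  by (auto simp: closed_segment_eq_real_ivl split: if_splits)

text \<open>Points with the same affine parameter are matched; their difference is the convex
  combination of the differences of the ends.\<close>

lemma hclose_closed_segment:
  fixes x z :: real
  assumes "\<bar>x - x'\<bar> \<le> r" "\<bar>z - z'\<bar> \<le> r"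
  shows "hclose dist r (closed_segment x z) (closed_segment x' z')"
proof -
  have *: "dist ((1 - u) * x + u * z) ((1 - u) * x' + u * z') \<le> r" if u: "0 \<le> u" "u \<le> 1" for u
  proof -
    have "dist ((1 - u) * x + u * z) ((1 - u) * x' + u * z') = \<bar>(1 - u) * (x - x') + u * (z - z')\<bar>"
      by (simp add: dist_real_def algebra_simps)
    also have "\<dots> \<le> \<bar>(1 - u) * (x - x')\<bar> + \<bar>u * (z - z')\<bar>"
      by (rule abs_triangle_ineq)
    also have "\<dots> = (1 - u) * \<bar>x - x'\<bar> + u * \<bar>z - z'\<bar>"
      using u by (simp add: abs_mult)
    also have "\<dots> \<le> (1 - u) * r + u * r"
      using u assms by (intro add_mono mult_left_mono) auto
    finally show ?thesis
      by (simp add: algebra_simps)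
  qed
  show ?thesis
    unfolding hclose_def
  proof (intro conjI ballI)
    fix y assume "y \<in> closed_segment x z"
    then obtain u where u: "y = (1 - u) * x + u * z" "0 \<le> u" "u \<le> 1"
      by (auto simp: closed_segment_def)
    then show "\<exists>y'\<in>closed_segment x' z'. dist y y' \<le> r"
      using * by (intro bexI[of _ "(1 - u) * x' + u * z'"]) (auto simp: closed_segment_def)
  next
    fix y assume "y \<in> closed_segment x' z'"
    then obtain u where u: "y = (1 - u) * x' + u * z'" "0 \<le> u" "u \<le> 1"
      by (auto simp: closed_segment_def)
    then show "\<exists>y'\<in>closed_segment x z. dist y' y \<le> r"
      using * by (intro bexI[of _ "(1 - u) * x + u * z"]) (auto simp: closed_segment_def)
  qed
qed

lemma proper_closed_segment: "proper_betweenness euclideanreal closed_segment"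
proof -
  interpret H: Metric_space "nonempty_compacts euclideanreal" "hausdorff_dist euclideanreal dist"
    using Met_TC.Metric_space_hausdorff_dist[where 'a = real] by simp
  have seg: "closed_segment x z \<in> nonempty_compacts euclideanreal" for x z :: real
    by (simp add: nonempty_compacts_def)
  have "continuous_map (prod_topology euclideanreal euclideanreal) H.mtopology (\<lambda>(x, z). closed_segment x z)"
    unfolding H.continuous_map_to_metric
  proof (intro ballI allI impI)
    fix c :: "real \<times> real" and e :: real assume e: "e > 0"
    obtain x z where c: "c = (x, z)"
      by (cases c)
    have "(case c' of (x, z) \<Rightarrow> closed_segment x z) \<in> H.mball (case c of (x, z) \<Rightarrow> closed_segment x z) e"
      if c': "c' \<in> ball c (e / 2)" for c'
    proof -
      obtain x' z' where c'': "c' = (x', z')"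
        by (cases c')
      have d: "dist c c' < e / 2"
        using c' by simp
      have "\<bar>x - x'\<bar> \<le> e / 2" "\<bar>z - z'\<bar> \<le> e / 2"
        using d dist_fst_le[of c c'] dist_snd_le[of c c'] unfolding c c'' by (simp_all add: dist_real_def)
      then have "hclose dist (e / 2) (closed_segment x z) (closed_segment x' z')"
        by (rule hclose_closed_segment)
      then have "hausdorff_dist euclideanreal dist (closed_segment x z) (closed_segment x' z') \<le> e / 2"
        by (rule Met_TC.hausdorff_dist_le[where 'a = real, unfolded mtopology_is_euclidean, OF seg seg])
      then show ?thesis
        using e seg by (simp add: c c'')
    qed
    then show "\<exists>U. openin (prod_topology euclideanreal euclideanreal) U \<and> c \<in> U \<and>
        (\<forall>c'\<in>U. (case c' of (x, z) \<Rightarrow> closed_segment x z) \<in> H.mball (case c of (x, z) \<Rightarrow> closed_segment x z) e)"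
      using e by (intro exI[of _ "ball c (e / 2)"]) (simp add: euclidean_product_topology)
  qed
  moreover have "metric_generates (topspace euclideanreal) dist euclideanreal"
    by (simp add: metric_generates_def Met_TC.Metric_space_axioms)
  ultimately show ?thesis
    unfolding proper_betweenness_def using betweenness_closed_segment by auto
qed

definition emb :: "real \<times> real \<Rightarrow> real sqz" where
  "emb z = (Some (fst z), ereal (snd z))"

lemma emb_simps [simp]: "emb (x, t) = (Some x, ereal t)" "snd (emb z) = ereal (snd z)"
  by (simp_all add: emb_def)

lemma emb_inj: "emb z = emb w \<Longrightarrow> z = w"
  by (simp add: emb_def prod_eq_iff)

lemma emb_squeezed [simp]: "emb z \<in> squeezed euclideanreal"
  by (simp add: emb_def)

text \<open>The maximum metric, in which \<open>rho_M1\<close> is measured; \<open>rho_M2\<close> is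
  the Hausdorff distance for the Euclidean metric, which is equivalent up to a factor 2.\<close>

abbreviation supd :: "real \<times> real \<Rightarrow> real \<times> real \<Rightarrow> real" where
  "supd \<equiv> d_pair dist"

lemma Metric_space_supd: "Metric_space UNIV supd"
  using Met_TC.Metric_space_d_pair[where 'a = real] by simp

lemma mtopology_supd: "Metric_space.mtopology UNIV supd = euclidean"
  using Met_TC.mtopology_d_pair[where 'a = real] by (simp add: euclidean_product_topology)

interpretation E: Metric_space UNIV supd
  by (rule Metric_space_supd)

lemma supd_tendsto_iff: "null (\<lambda>n. supd (\<sigma> n) z) \<longleftrightarrow> \<sigma> \<longlonglongrightarrow> z"
  using E.seq_limitin_iff[of \<sigma> z] by (simp add: mtopology_supd)

locale real_path_space =
  fixes d :: "real sqz \<Rightarrow> real sqz \<Rightarrow> real" and I :: "real set"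
  assumes d: "metric_generates (squeezed euclideanreal) d (squeezed_topology euclideanreal)"
    and I: "closed_real_interval I"
begin

sublocale path_space euclideanreal closed_segment d
  by unfold_locales (rule metrizable_space_euclidean proper_closed_segment d)+

lemma emb_lim_iff: "null (\<lambda>n. d (emb (\<sigma> n)) (emb z)) \<longleftrightarrow> \<sigma> \<longlonglongrightarrow> z"
proof -
  have "null (\<lambda>n. d (emb (\<sigma> n)) (emb z)) \<longleftrightarrow> squeezed_lim euclideanreal (\<lambda>n. emb (\<sigma> n)) (emb z)"
    by (rule squeezed_lim_iff[OF metrizable_space_euclidean d]) simp_all
  also have "\<dots> \<longleftrightarrow> (\<lambda>n. snd (\<sigma> n)) \<longlonglongrightarrow> snd z \<and> (\<lambda>n. fst (\<sigma> n)) \<longlonglongrightarrow> fst z"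
    by (simp add: squeezed_lim_def emb_def lim_ereal)
  also have "\<dots> \<longleftrightarrow> \<sigma> \<longlonglongrightarrow> z"
    using tendsto_Pair[of "\<lambda>n. fst (\<sigma> n)" "fst z" sequentially "\<lambda>n. snd (\<sigma> n)" "snd z"]
      tendsto_fst[of \<sigma> z] tendsto_snd[of \<sigma> z] by auto
  finally show ?thesis .
qed

abbreviation DI :: "real path set" where
  "DI \<equiv> D_paths I euclideanreal"

lemma D_path: "p \<in> DI \<Longrightarrow> p \<in> paths euclideanreal"
  using D_paths_sub by blast

lemma D_times:
  assumes "p \<in> DI"
  shows "times p = I"
  using assms by (auto simp: D_paths_def times_def)

lemma D_endpoint:
  assumes "p \<in> DI" "t \<in> endpoints I"
  shows "path_left p t = path_right p t"
  using assms by (auto simp: D_paths_def)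

lemma filled_emb:
  assumes "p \<in> DI"
  shows "emb (x, t) \<in> fl p \<longleftrightarrow> t \<in> I \<and> x \<in> closed_segment (path_left p t) (path_right p t)"
  using filled_iff(1)[OF D_path[OF assms], of x "ereal t"] D_times[OF assms] by simp

lemma filled_inf:
  assumes "p \<in> DI"
  shows "(None, -\<infinity>) \<in> fl p" "(None, \<infinity>) \<in> fl p"
proof -
  have E: "ext_times p = ereal ` I \<union> {-\<infinity>, \<infinity>}"
    using assms by (simp add: D_paths_def)
  have "(None, t) \<in> fl p" if "t = -\<infinity> \<or> t = \<infinity>" for t
    unfolding filled_def using E that D_times[OF assms] by auto
  then show "(None, -\<infinity>) \<in> fl p" "(None, \<infinity>) \<in> fl p"
    by simp_all
qed

lemma filled_real:
  assumes "p \<in> DI" "u \<in> fl p"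
  shows "(\<exists>z. u = emb z \<and> snd z \<in> I) \<or> u = (None, -\<infinity>) \<or> u = (None, \<infinity>)"
  using D_path[OF assms(1)] assms(2)
proof (cases rule: filled_cases)
  case (1 x t)
  then show ?thesis
    using D_times[OF assms(1)] by (intro disjI1 exI[of _ "(x, t)"]) simp
next
  case (2 t)
  then show ?thesis
    by (cases t) auto
qed

lemma fibre_seq:
  assumes p: "p \<in> DI" and z: "\<And>n. emb (z n) \<in> fl p"
    and t: "(\<lambda>n. snd (z n)) \<longlonglongrightarrow> t" and tI: "t \<in> I"
  shows "\<exists>x. emb (x, t) \<in> fl p \<and> (\<exists>r. subseq r \<and> (\<lambda>n. z (r n)) \<longlonglongrightarrow> (x, t))"
proof -
  obtain l r where l: "l \<in> fl p" "strict_mono r" "null (\<lambda>n. d (emb (z (r n))) l)"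
    by (rule Z.compact_seq[OF filled_compact[OF D_path[OF p]], of "\<lambda>n. emb (z n)"]) (rule z)
  have "(\<lambda>n. snd (emb (z (r n)))) \<longlonglongrightarrow> snd l"
    by (rule lim_time[of "\<lambda>n. emb (z (r n))" l, OF emb_squeezed _ l(3)]) (use filled_sub[OF D_path[OF p]] l(1) in blast)
  moreover have "(\<lambda>n. snd (emb (z (r n)))) \<longlonglongrightarrow> ereal t"
    using strict_mono_subseq_tendsto[OF l(2) t] by (simp add: lim_ereal)
  ultimately have "snd l = ereal t"
    by (rule LIMSEQ_unique)
  then obtain x where x: "l = emb (x, t)"
    using filled_real[OF p l(1)] by (auto simp: emb_def)
  then show ?thesis
    using l emb_lim_iff[of "\<lambda>n. z (r n)" "(x, t)"] by auto
qed

lemma path_right_filled: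
  assumes "p \<in> DI" "t \<in> I"
  shows "emb (path_right p t, t) \<in> fl p" "emb (path_left p t, t) \<in> fl p"
  using assms by (simp_all add: filled_emb del: emb_simps)

lemma left_least:
  assumes p: "p \<in> DI" and le: "(emb (x, t), emb (path_left p t, t)) \<in> fo p"
  shows "x = path_left p t"
proof -
  have "t \<in> times p" "x \<in> closed_segment (path_left p t) (path_left p t)"
    using le filled_order_fibre[OF D_path[OF p], of x t "path_left p t"] by simp_all
  then show ?thesis by simp
qed

lemma right_greatest:
  assumes p: "p \<in> DI" and le: "(emb (path_right p t, t), emb (x, t)) \<in> fo p"
  shows "x = path_right p t"
proof -
  have "path_right p t \<in> closed_segment (path_left p t) x" "x \<in> closed_segment (path_left p t) (path_right p t)"
    using le filled_order_fibre[OF D_path[OF p], of "path_right p t" t x] by simp_all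
  then show ?thesis
    using bt_antisym[of "path_left p t" x "path_right p t"] by simp
qed

text \<open>All \<open>z n\<close> precede the left point over \<open>t\<close>, hence so does every
  subsequential limit. Such a limit also lies over \<open>t\<close>, where the left point is the
  first one.\<close>

lemma left_limit_seq:
  assumes p: "p \<in> DI" and z: "\<And>n. emb (z n) \<in> fl p" "\<And>n. snd (z n) < t"
    and t: "(\<lambda>n. snd (z n)) \<longlonglongrightarrow> t" and tI: "t \<in> I"
  shows "z \<longlonglongrightarrow> (path_left p t, t)"
proof (rule tendsto_subseq_criterion)
  fix r :: "nat \<Rightarrow> nat" assume r: "strict_mono r"
  obtain x q where x: "emb (x, t) \<in> fl p" "subseq q" "(\<lambda>n. z (r (q n))) \<longlonglongrightarrow> (x, t)"
    using fibre_seq[of p "\<lambda>n. z (r n)" t, OF p z(1) strict_mono_subseq_tendsto[OF r t] tI] by blast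
  have "(emb (x, t), emb (path_left p t, t)) \<in> fo p"
  proof (rule Z.corder_closed[of _ _ "\<lambda>n. emb (z (r (q n)))" "\<lambda>n. emb (path_left p t, t)",
        OF filled_corder[OF D_path[OF p]] _ x(1) path_right_filled(2)[OF p tI]])
    show "(emb (z (r (q n))), emb (path_left p t, t)) \<in> fo p" for n
      by (rule filled_order_time(2)[OF z(1) path_right_filled(2)[OF p tI]]) (use z(2) in simp)
    show "null (\<lambda>n. d (emb (z (r (q n)))) (emb (x, t)))"
      by (rule emb_lim_iff[of "\<lambda>n. z (r (q n))" "(x, t)", THEN iffD2, OF x(3)])
    show "null (\<lambda>n. d (emb (path_left p t, t)) (emb (path_left p t, t)))"
      by (simp add: Z.mdist_zero[OF emb_squeezed] del: emb_simps)
  qed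
  then have "x = path_left p t"
    by (rule left_least[OF p])
  then show "\<exists>q. subseq q \<and> (\<lambda>n. z (r (q n))) \<longlonglongrightarrow> (path_left p t, t)"
    using x by blast
qed

lemma right_limit_seq:
  assumes p: "p \<in> DI" and z: "\<And>n. emb (z n) \<in> fl p" "\<And>n. t < snd (z n)"
    and t: "(\<lambda>n. snd (z n)) \<longlonglongrightarrow> t" and tI: "t \<in> I"
  shows "z \<longlonglongrightarrow> (path_right p t, t)"
proof (rule tendsto_subseq_criterion)
  fix r :: "nat \<Rightarrow> nat" assume r: "strict_mono r"
  obtain x q where x: "emb (x, t) \<in> fl p" "subseq q" "(\<lambda>n. z (r (q n))) \<longlonglongrightarrow> (x, t)"
    using fibre_seq[of p "\<lambda>n. z (r n)" t, OF p z(1) strict_mono_subseq_tendsto[OF r t] tI] by blast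
  have "(emb (path_right p t, t), emb (x, t)) \<in> fo p"
  proof (rule Z.corder_closed[of _ _ "\<lambda>n. emb (path_right p t, t)" "\<lambda>n. emb (z (r (q n)))",
        OF filled_corder[OF D_path[OF p]] _ path_right_filled(1)[OF p tI] x(1)])
    show "(emb (path_right p t, t), emb (z (r (q n)))) \<in> fo p" for n
      by (rule filled_order_time(2)[OF path_right_filled(1)[OF p tI] z(1)]) (use z(2) in simp)
    show "null (\<lambda>n. d (emb (z (r (q n)))) (emb (x, t)))"
      by (rule emb_lim_iff[of "\<lambda>n. z (r (q n))" "(x, t)", THEN iffD2, OF x(3)])
    show "null (\<lambda>n. d (emb (path_right p t, t)) (emb (path_right p t, t)))"
      by (simp add: Z.mdist_zero[OF emb_squeezed] del: emb_simps)
  qed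
  then have "x = path_right p t"
    by (rule right_greatest[OF p])
  then show "\<exists>q. subseq q \<and> (\<lambda>n. z (r (q n))) \<longlonglongrightarrow> (path_right p t, t)"
    using x by blast
qed

lemma I_between: "a \<in> I \<Longrightarrow> b \<in> I \<Longrightarrow> a \<le> t \<Longrightarrow> t \<le> b \<Longrightarrow> t \<in> I"
  using I unfolding closed_real_interval_def is_interval_1 by blast

lemma path_right_at_left:
  assumes p: "p \<in> DI" and s: "s \<in> I" "s < t" and t: "t \<in> I"
  shows "(path_right p \<longlongrightarrow> path_left p t) (at_left t)"
proof (rule tendsto_at_left_sequentially[OF s(2)])
  fix S assume S: "\<And>n. S n < t" "\<And>n. s < S n" "S \<longlonglongrightarrow> t"
  have SI: "S n \<in> I" for n
    by (rule I_between[OF s(1) t]) (use S in \<open>auto intro: less_imp_le\<close>)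
  have "(\<lambda>n. (path_right p (S n), S n)) \<longlonglongrightarrow> (path_left p t, t)"
    by (rule left_limit_seq[OF p path_right_filled(1)[OF p SI] _ _ t]) (use S in auto)
  then show "(\<lambda>n. path_right p (S n)) \<longlonglongrightarrow> path_left p t"
    using tendsto_fst by fastforce
qed

lemma left_limit_path:
  assumes p: "p \<in> DI" and ab: "{a..b} \<subseteq> I" "a \<le> t" "t \<le> b"
  shows "left_limit a (path_right p) t = (if t = a then path_right p a else path_left p t)"
proof (cases "t = a")
  case False
  have "(path_right p \<longlongrightarrow> path_left p t) (at_left t)"
    by (rule path_right_at_left[OF p, of a]) (use ab False in auto)
  then show ?thesis
    using False by (simp add: left_limit_def tendsto_Lim)
qed (simp add: left_limit_def)

text \<open>Continuity identifies the right value with the limit from the left, which is the left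
  value. Conversely, without a jump the fibre is a single point, so every subsequential limit is
  determined. At an endpoint of \<open>I\<close> both sides hold by definition.\<close>

lemma good_point_iff:
  assumes p: "p \<in> DI" and t: "t \<in> I"
  shows "good_point I (path_right p) t \<longleftrightarrow> path_left p t = path_right p t"
proof
  assume g: "good_point I (path_right p) t"
  show "path_left p t = path_right p t"
  proof (cases "t \<in> endpoints I")
    case True
    then show ?thesis by (rule D_endpoint[OF p])
  next
    case False
    then obtain s where s: "s \<in> I" "s < t"
      using t unfolding endpoints_def by fastforce
    have cont: "continuous (at t within I) (path_right p)"
      using g False by (simp add: good_point_def)
    have "at_left t \<le> at t within I"
    proof -
      have "at_left t = at t within {s..t}"
        using s(2) by (simp add: at_within_Icc_at_left)
      moreover have "{s..t} \<subseteq> I"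
        using I_between[OF s(1) t] by auto
      ultimately show ?thesis
        by (simp add: at_le)
    qed
    then have "(path_right p \<longlongrightarrow> path_right p t) (at_left t)"
      using cont unfolding continuous_within by (rule tendsto_mono)
    then show ?thesis
      using tendsto_unique[OF trivial_limit_at_left_real path_right_at_left[OF p s t]] by blast
  qed
next
  assume eq: "path_left p t = path_right p t"
  have "continuous (at t within I) (path_right p)"
    unfolding continuous_within_sequentially
  proof (intro allI impI)
    fix S assume S: "(\<forall>n. S n \<in> I) \<and> S \<longlonglongrightarrow> t"
    have "(\<lambda>n. path_right p (S n)) \<longlonglongrightarrow> path_right p t"
    proof (rule tendsto_subseq_criterion)
      fix r :: "nat \<Rightarrow> nat" assume r: "strict_mono r"
      have lim: "(\<lambda>n. snd (path_right p (S (r n)), S (r n))) \<longlonglongrightarrow> t"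
        using strict_mono_subseq_tendsto[OF r conjunct2[OF S]] by simp
      have "emb (path_right p (S (r n)), S (r n)) \<in> fl p" for n
        using path_right_filled(1)[OF p] S by blast
      then obtain x q where x: "emb (x, t) \<in> fl p" "subseq q"
        "(\<lambda>n. (path_right p (S (r (q n))), S (r (q n)))) \<longlonglongrightarrow> (x, t)"
        using fibre_seq[OF p _ lim t] by blast
      have "x = path_right p t"
        using x(1) eq by (simp add: filled_emb[OF p] del: emb_simps)
      then show "\<exists>q. subseq q \<and> (\<lambda>n. path_right p (S (r (q n)))) \<longlonglongrightarrow> path_right p t"
        using tendsto_fst[OF x(3)] x(2) by auto
    qed
    then show "(path_right p \<circ> S) \<longlonglongrightarrow> path_right p t"
      by (simp add: o_def)
  qed
  then show "good_point I (path_right p) t"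
    by (simp add: good_point_def)
qed

text \<open>Over an interval the filled set determines the direction of each jump: the left value is
  the limit from earlier times, and the right value is then the other end of the segment. At the
  endpoints of \<open>I\<close> there is no jump.\<close>

lemma filled_inj:
  assumes p: "p \<in> DI" and q: "q \<in> DI" and eq: "fl p = fl q"
  shows "p = q"
proof -
  have lr: "path_left p t = path_left q t \<and> path_right p t = path_right q t" if t: "t \<in> I" for t
  proof -
    have seg: "closed_segment (path_left p t) (path_right p t) = closed_segment (path_left q t) (path_right q t)"
      using eq t filled_emb[OF p, of _ t] filled_emb[OF q, of _ t] by blast
    show ?thesis
    proof (cases "t \<in> endpoints I")
      case True
      then show ?thesis
        using seg D_endpoint[OF p] D_endpoint[OF q] by simp
    next
      case False
      then obtain s where s: "s \<in> I" "s < t"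
        using t unfolding endpoints_def by fastforce
      define S where "S n = t - (t - s) / real (Suc n)" for n
      have St: "S n < t" "s \<le> S n" for n
      proof -
        have "(t - s) / real (Suc n) \<le> (t - s) / 1"
          using s(2) by (intro divide_left_mono) auto
        then show "S n < t" "s \<le> S n"
          using s(2) by (simp_all add: S_def)
      qed
      have SI: "S n \<in> I" for n
        by (rule I_between[OF s(1) t]) (use St[of n] in auto)
      have "(\<lambda>n. t - (t - s) * (1 / real (Suc n))) \<longlonglongrightarrow> t - (t - s) * 0"
        by (intro tendsto_intros lim_1_over_Suc)
      then have Sl: "(\<lambda>n. snd (path_right p (S n), S n)) \<longlonglongrightarrow> t"
        by (simp add: S_def)
      have "(\<lambda>n. (path_right p (S n), S n)) \<longlonglongrightarrow> (path_left p t, t)"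
        by (rule left_limit_seq[OF p path_right_filled(1)[OF p SI] _ Sl t]) (use St in simp)
      moreover have "(\<lambda>n. (path_right p (S n), S n)) \<longlonglongrightarrow> (path_left q t, t)"
        by (rule left_limit_seq[OF q path_right_filled(1)[OF p SI, unfolded eq] _ Sl t]) (use St in simp)
      ultimately have left: "path_left p t = path_left q t"
        using LIMSEQ_unique by blast
      moreover have "path_right p t = path_right q t"
        using seg left by (auto simp: closed_segment_eq_real_ivl Icc_eq_Icc split: if_splits)
      ultimately show ?thesis ..
    qed
  qed
  have "fo p \<subseteq> fo q"
    if p: "p \<in> DI" and q: "q \<in> DI" and eq: "fl p = fl q"
      and lr: "\<And>t. t \<in> I \<Longrightarrow> path_left p t = path_left q t" for p q
  proof
    fix zw assume zw: "zw \<in> fo p"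
    obtain z w where [simp]: "zw = (z, w)"
      by (cases zw)
    have F: "z \<in> fl q" "w \<in> fl q"
      using zw filled_order_dom[of z w p] eq by simp_all
    have "snd z < snd w \<or> (\<exists>x y t. z = (Some x, ereal t) \<and> w = (Some y, ereal t) \<and> x \<in> closed_segment (path_left p t) y) \<or> z = w"
      using zw unfolding filled_order_def by simp
    then show "zw \<in> fo q"
    proof (elim disjE exE conjE)
      fix x y t assume *: "z = (Some x, ereal t)" "w = (Some y, ereal t)" "x \<in> closed_segment (path_left p t) y"
      then have "t \<in> I"
        using F(1) filled_emb[OF q, of x t] by simp
      then show ?thesis
        using F * lr unfolding filled_order_def by auto
    qed (use F in \<open>auto simp: filled_order_def\<close>)
  qed
  then have "fo p = fo q"
    using p q eq lr by (metis subset_antisym)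
  then show ?thesis
    by (rule filled_order_inj[OF D_path[OF p] D_path[OF q]])
qed

definition gr :: "real \<Rightarrow> real \<Rightarrow> real path \<Rightarrow> (real \<times> real) set" where
  "gr a b p = completed_graph a b (path_right p)"

definition gle :: "real \<Rightarrow> real \<Rightarrow> real path \<Rightarrow> (real \<times> real) rel" where
  "gle a b p = {(z, w). z \<in> gr a b p \<and> w \<in> gr a b p \<and> graph_le a (path_right p) z w}"

text \<open>The two ends of the window differ: over \<open>b\<close> the whole segment belongs to
  the graph, over \<open>a\<close> only the right value, because \<open>left_limit\<close> at
  \<open>a\<close> is the value itself by convention.\<close>

lemma gr_iff:
  assumes p: "p \<in> DI" and ab: "{a..b} \<subseteq> I"
  shows "z \<in> gr a b p \<longleftrightarrow> a \<le> snd z \<and> snd z \<le> b \<and> emb z \<in> fl p \<and>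
    (snd z = a \<longrightarrow> fst z = path_right p a)"
proof -
  obtain x t where z: "z = (x, t)"
    by (cases z)
  show ?thesis
  proof (cases "a \<le> t \<and> t \<le> b")
    case True
    then have "t \<in> I"
      using ab by auto
    then show ?thesis
      using True left_limit_path[OF p ab, of t] filled_emb[OF p, of x t]
      by (auto simp: z gr_def completed_graph_def simp del: emb_simps)
  qed (auto simp: z gr_def completed_graph_def)
qed

lemma gle_iff:
  assumes p: "p \<in> DI" and ab: "{a..b} \<subseteq> I"
  shows "(z, w) \<in> gle a b p \<longleftrightarrow> z \<in> gr a b p \<and> w \<in> gr a b p \<and> (emb z, emb w) \<in> fo p"
proof (cases "z \<in> gr a b p \<and> w \<in> gr a b p")
  case True
  obtain x s where z: "z = (x, s)" by (cases z)
  obtain y t where w: "w = (y, t)" by (cases w)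
  have F: "emb z \<in> fl p" "emb w \<in> fl p"
    and bnd: "a \<le> s" "s \<le> b" "a \<le> t" "t \<le> b" and at_a: "s = a \<longrightarrow> x = path_right p a" "t = a \<longrightarrow> y = path_right p a"
    using True unfolding gr_iff[OF p ab] by (auto simp: z w simp del: emb_simps)
  have "graph_le a (path_right p) z w \<longleftrightarrow> (emb z, emb w) \<in> fo p"
  proof -
    consider "s < t" | "t < s" | "s = t" "t = a" | "s = t" "t \<noteq> a"
      by fastforce
    then show ?thesis
    proof cases
      case 1
      then show ?thesis
        using filled_order_time(2)[OF F] by (simp add: graph_le_def z w)
    next
      case 2
      then have "(emb z, emb w) \<notin> fo p"
        using filled_order_time(1)[of "emb z" "emb w" p] by (auto simp: z w)
      then show ?thesis
        using 2 by (simp add: graph_le_def z w)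
    next
      case 3
      then have "z = w"
        using at_a by (simp add: z w)
      then show ?thesis
        using Z.corder_refl[OF filled_corder[OF D_path[OF p]] F(1)] by (simp add: graph_le_def z w)
    next
      case 4
      have xy: "x \<in> closed_segment (path_left p t) (path_right p t)" "y \<in> closed_segment (path_left p t) (path_right p t)"
        and tI: "t \<in> I"
        using F 4 filled_emb[OF p, of x t] filled_emb[OF p, of y t] by (simp_all add: z w)
      \<comment> \<open>Both points lie on the same side of the left value, so being nearer to it
        means lying between it and the other point.\<close>
      have "\<bar>x - path_left p t\<bar> \<le> \<bar>y - path_left p t\<bar> \<longleftrightarrow> x \<in> closed_segment (path_left p t) y"
        using xy by (auto simp: closed_segment_eq_real_ivl split: if_splits)
      then show ?thesis
        using 4 left_limit_path[OF p ab bnd(3,4)] xy tI D_times[OF p]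
          filled_order_fibre[OF D_path[OF p], of x t y] by (simp add: graph_le_def z w)
    qed
  qed
  then show ?thesis
    using True by (simp add: gle_def)
qed (auto simp: gle_def)

end

section \<open>Parametrisations and monotone correspondences\<close>

lemma supd_eq: "supd z w = max \<bar>fst z - fst w\<bar> \<bar>snd z - snd w\<bar>"
  by (auto simp: d_pair_def dist_real_def split: prod.splits)

text \<open>Monotonicity makes the coordinatewise order on \<open>C\<close> total. It is dense
  because a point strictly between two first coordinates, with any of its partners, lies strictly
  between the two pairs; if the first coordinates agree, the second ones are used. The two
  coordinates of one parametrisation of \<open>C\<close> run in step.\<close>

lemma Cor_plus_param:
  assumes A: "E.corder A le" and A': "E.corder A' le'"
    and dense: "\<And>x y. (x, y) \<in> le \<Longrightarrow> x \<noteq> y \<Longrightarrow> \<exists>z. (x, z) \<in> le \<and> (z, y) \<in> le \<and> z \<noteq> x \<and> z \<noteq> y"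
    and dense': "\<And>x y. (x, y) \<in> le' \<Longrightarrow> x \<noteq> y \<Longrightarrow> \<exists>z. (x, z) \<in> le' \<and> (z, y) \<in> le' \<and> z \<noteq> x \<and> z \<noteq> y"
    and C: "C \<in> Cor_plus A le A' le'" and cl: "E.cclosed A A' C"
  shows "\<exists>\<gamma>1 \<gamma>2. continuous_on {0..1::real} \<gamma>1 \<and> continuous_on {0..1} \<gamma>2 \<and> \<gamma>1 ` {0..1} = A \<and> \<gamma>2 ` {0..1} = A' \<and>
    (\<forall>s\<in>{0..1}. \<forall>t\<in>{0..1}. s \<le> t \<longrightarrow> (\<gamma>1 s, \<gamma>1 t) \<in> le \<and> (\<gamma>2 s, \<gamma>2 t) \<in> le') \<and>
    (\<forall>s\<in>{0..1}. (\<gamma>1 s, \<gamma>2 s) \<in> C)"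
proof -
  define leC where "leC = {(c, c'). c \<in> C \<and> c' \<in> C \<and> (fst c, fst c') \<in> le \<and> (snd c, snd c') \<in> le'}"
  have CC: "C \<in> Corr A A'"
    using C by (simp add: Cor_plus_def)
  have CA: "z \<in> A" "w \<in> A'" if "(z, w) \<in> C" for z w
    using that CC by (auto simp: Corr_def)
  have ex: "\<exists>w. (z, w) \<in> C" if "z \<in> A" for z
    using that CC unfolding Corr_def by blast
  have ex': "\<exists>z. (z, w) \<in> C" if "w \<in> A'" for w
    using that CC unfolding Corr_def by blast
  have mono: "\<not> ((z, z') \<in> le \<and> z \<noteq> z' \<and> (w', w) \<in> le' \<and> w' \<noteq> w)" if "(z, w) \<in> C" "(z', w') \<in> C" for z w z' w'
    using C that unfolding Cor_plus_def by blast
  have up: "(w, w') \<in> le'" if c: "(z, w) \<in> C" "(z', w') \<in> C" and less: "(z, z') \<in> le" "z \<noteq> z'" for z w z' w'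
    using mono[OF c] less E.corder_total[OF A' CA(2)[OF c(1)] CA(2)[OF c(2)]] E.corder_refl[OF A' CA(2)[OF c(1)]] by blast
  have up': "(z, z') \<in> le" if c: "(z, w) \<in> C" "(z', w') \<in> C" and less: "(w, w') \<in> le'" "w \<noteq> w'" for z w z' w'
    using mono[OF c(2,1)] less E.corder_total[OF A CA(1)[OF c(1)] CA(1)[OF c(2)]] E.corder_refl[OF A CA(1)[OF c(1)]] by blast
  have total: "(c, c') \<in> leC \<or> (c', c) \<in> leC" if c: "c \<in> C" "c' \<in> C" for c c'
  proof -
    obtain z w z' w' where zw: "c = (z, w)" "c' = (z', w')"
      by (cases c, cases c')
    note c' = c[unfolded zw]
    show ?thesis
    proof (cases "z = z'")
      case True
      then show ?thesis
        using c' E.corder_total[OF A' CA(2)[OF c'(1)] CA(2)[OF c'(2)]] E.corder_refl[OF A CA(1)[OF c'(1)]]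
        by (auto simp: leC_def zw)
    next
      case False
      then show ?thesis
        using c' E.corder_total[OF A CA(1)[OF c'(1)] CA(1)[OF c'(2)]] up[OF c'] up[OF c'(2,1)]
        by (auto simp: leC_def zw)
    qed
  qed
  have ord: "Met_TC.corder C leC"
    unfolding Met_TC.corder_def
  proof (intro conjI allI impI)
    show "C \<noteq> {}"
      using E.corder_nonempty[OF A] ex by auto
    show "compactin Met_TC.mtopology C"
    proof (rule Met_TC.compact_seqI)
      fix \<sigma> :: "nat \<Rightarrow> (real \<times> real) \<times> (real \<times> real)" assume \<sigma>: "\<And>n. \<sigma> n \<in> C"
      then have \<sigma>C: "(fst (\<sigma> n), snd (\<sigma> n)) \<in> C" for n
        by simp
      obtain x r where 1: "x \<in> A" "strict_mono r" "null (\<lambda>n. supd (fst (\<sigma> (r n))) x)"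
        by (rule E.compact_seq[OF E.corder_compact[OF A], of "\<lambda>n. fst (\<sigma> n)"]) (rule CA(1)[OF \<sigma>C])
      obtain y s where 2: "y \<in> A'" "strict_mono s" "null (\<lambda>n. supd (snd (\<sigma> (r (s n)))) y)"
        by (rule E.compact_seq[OF E.corder_compact[OF A'], of "\<lambda>n. snd (\<sigma> (r n))"]) (rule CA(2)[OF \<sigma>C])
      have 3: "null (\<lambda>n. supd (fst (\<sigma> (r (s n)))) x)"
        by (rule strict_mono_subseq_tendsto[OF 2(2) 1(3)])
      have "(x, y) \<in> C"
        by (rule E.cclosedD[of A A' C "\<lambda>n. fst (\<sigma> (r (s n)))" "\<lambda>n. snd (\<sigma> (r (s n)))", OF cl \<sigma>C 1(1) 2(1) 3 2(3)])
      moreover have "(\<lambda>n. (fst (\<sigma> (r (s n))), snd (\<sigma> (r (s n))))) \<longlonglongrightarrow> (x, y)"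
        using 3 2(3) unfolding supd_tendsto_iff by (rule tendsto_Pair)
      then have "null (\<lambda>n. dist (\<sigma> (r (s n))) (x, y))"
        by (simp add: tendsto_iff_dist0)
      moreover have "strict_mono (\<lambda>n. r (s n))"
        using 1(2) 2(2) unfolding strict_mono_def by blast
      ultimately show "\<exists>l\<in>C. \<exists>r. subseq r \<and> null (\<lambda>n. dist (\<sigma> (r n)) l)"
        by (intro bexI[of _ "(x, y)"] exI[of _ "\<lambda>n. r (s n)"]) simp_all
    qed simp
    have "refl_on C leC"
      unfolding refl_on_def using total by blast
    moreover have "leC \<subseteq> C \<times> C"
      by (auto simp: leC_def)
    moreover have "trans leC"
      by (rule transI) (auto simp: leC_def intro: E.corder_trans[OF A] E.corder_trans[OF A'])
    moreover have "antisym leC"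
      by (rule antisymI) (simp add: leC_def prod_eq_iff[where 'a = "real \<times> real" and 'b = "real \<times> real"],
        use E.corder_antisym[OF A] E.corder_antisym[OF A'] in blast)
    moreover have "total_on C leC"
      by (rule total_onI) (rule total)
    ultimately show "linear_order_on C leC"
      unfolding linear_order_on_def partial_order_on_def preorder_on_def by blast
  next
    fix \<sigma> \<tau> :: "nat \<Rightarrow> (real \<times> real) \<times> (real \<times> real)" and x y
    assume le: "\<forall>n. (\<sigma> n, \<tau> n) \<in> leC" and xy: "x \<in> C" "y \<in> C"
      and lim: "null (\<lambda>n. dist (\<sigma> n) x)" "null (\<lambda>n. dist (\<tau> n) y)"
    have lim': "\<sigma> \<longlonglongrightarrow> x" "\<tau> \<longlonglongrightarrow> y"
      using lim by (simp_all add: tendsto_iff_dist0)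
    have mem: "fst x \<in> A" "snd x \<in> A'" "fst y \<in> A" "snd y \<in> A'"
      using CA[of "fst x" "snd x"] CA[of "fst y" "snd y"] xy by simp_all
    have "(fst x, fst y) \<in> le"
      by (rule E.corder_closed[of A le "\<lambda>n. fst (\<sigma> n)" "\<lambda>n. fst (\<tau> n)", OF A _ mem(1,3)])
        (use le lim' in \<open>auto simp: leC_def supd_tendsto_iff intro: tendsto_fst\<close>)
    moreover have "(snd x, snd y) \<in> le'"
      by (rule E.corder_closed[of A' le' "\<lambda>n. snd (\<sigma> n)" "\<lambda>n. snd (\<tau> n)", OF A' _ mem(2,4)])
        (use le lim' in \<open>auto simp: leC_def supd_tendsto_iff intro: tendsto_snd\<close>)
    ultimately show "(x, y) \<in> leC"
      using xy by (simp add: leC_def)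
  qed
  have dens: "\<exists>u. (c, u) \<in> leC \<and> (u, c') \<in> leC \<and> u \<noteq> c \<and> u \<noteq> c'" if cc: "(c, c') \<in> leC" "c \<noteq> c'" for c c'
  proof -
    obtain z w z' w' where zw: "c = (z, w)" "c' = (z', w')"
      by (cases c, cases c')
    have mem: "(z, w) \<in> C" "(z', w') \<in> C" and le: "(z, z') \<in> le" "(w, w') \<in> le'"
      using cc(1) by (auto simp: leC_def zw)
    show ?thesis
    proof (cases "z = z'")
      case False
      then obtain x where x: "(z, x) \<in> le" "(x, z') \<in> le" "x \<noteq> z" "x \<noteq> z'"
        using dense[OF le(1)] by blast
      obtain y where y: "(x, y) \<in> C"
        using ex E.corder_dom(1)[OF A x(2)] by blast
      have "(w, y) \<in> le'" "(y, w') \<in> le'"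
        using up[OF mem(1) y x(1)] up[OF y mem(2) x(2)] x by blast+
      then show ?thesis
        using x y mem by (intro exI[of _ "(x, y)"]) (simp add: leC_def zw)
    next
      case True
      then have "w \<noteq> w'"
        using cc(2) zw by simp
      then obtain y where y: "(w, y) \<in> le'" "(y, w') \<in> le'" "y \<noteq> w" "y \<noteq> w'"
        using dense'[OF le(2)] by blast
      obtain x where x: "(x, y) \<in> C"
        using ex' E.corder_dom(1)[OF A' y(2)] by blast
      have "(z, x) \<in> le" "(x, z') \<in> le"
        using up'[OF mem(1) x y(1)] up'[OF x mem(2) y(2)] y by blast+
      then show ?thesis
        using x y mem by (intro exI[of _ "(x, y)"]) (simp add: leC_def zw)
    qed
  qed
  obtain \<gamma> where \<gamma>: "continuous_on {0..1::real} \<gamma>" "\<gamma> ` {0..1} = C"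
    "\<forall>s\<in>{0..1}. \<forall>t\<in>{0..1}. s \<le> t \<longrightarrow> (\<gamma> s, \<gamma> t) \<in> leC"
    using chain_param[OF ord dens] by blast
  define \<gamma>1 \<gamma>2 where "\<gamma>1 s = fst (\<gamma> s)" and "\<gamma>2 s = snd (\<gamma> s)" for s
  have "continuous_on {0..1} \<gamma>1" "continuous_on {0..1} \<gamma>2"
    unfolding \<gamma>1_def \<gamma>2_def using \<gamma>(1) by (auto intro: continuous_on_fst continuous_on_snd)
  moreover have "\<gamma>1 ` {0..1} = fst ` C" "\<gamma>2 ` {0..1} = snd ` C"
    unfolding \<gamma>1_def \<gamma>2_def \<gamma>(2)[symmetric] by (simp_all add: image_image)
  moreover have "fst ` C = A"
  proof (intro subset_antisym image_subsetI subsetI)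
    show "fst c \<in> A" if "c \<in> C" for c
      using CA(1)[of "fst c" "snd c"] that by simp
    show "z \<in> fst ` C" if "z \<in> A" for z
      using ex[OF that] fst_conv by (metis image_eqI)
  qed
  moreover have "snd ` C = A'"
  proof (intro subset_antisym image_subsetI subsetI)
    show "snd c \<in> A'" if "c \<in> C" for c
      using CA(2)[of "fst c" "snd c"] that by simp
    show "w \<in> snd ` C" if "w \<in> A'" for w
      using ex'[OF that] snd_conv by (metis image_eqI)
  qed
  moreover have "\<forall>s\<in>{0..1}. \<forall>t\<in>{0..1}. s \<le> t \<longrightarrow> (\<gamma>1 s, \<gamma>1 t) \<in> le \<and> (\<gamma>2 s, \<gamma>2 t) \<in> le'"
    using \<gamma>(3) by (auto simp: leC_def \<gamma>1_def \<gamma>2_def)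
  moreover have "\<forall>s\<in>{0..1}. (\<gamma>1 s, \<gamma>2 s) \<in> C"
    using \<gamma>(2) by (auto simp: \<gamma>1_def \<gamma>2_def)
  ultimately show ?thesis
    by metis
qed

section \<open>Completed graphs\<close>

context real_path_space begin

lemma emb_supd_iff: "null (\<lambda>n. d (emb (\<sigma> n)) (emb z)) \<longleftrightarrow> null (\<lambda>n. supd (\<sigma> n) z)"
  by (simp add: emb_lim_iff supd_tendsto_iff)

lemma gr_ends:
  assumes p: "p \<in> DI" and ab: "{a..b} \<subseteq> I" "a < b"
  shows "(path_right p a, a) \<in> gr a b p" "(path_right p b, b) \<in> gr a b p"
proof -
  have "a \<in> I" "b \<in> I"
    using ab by auto
  then show "(path_right p a, a) \<in> gr a b p" "(path_right p b, b) \<in> gr a b p"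
    unfolding gr_iff[OF p ab(1)] using path_right_filled(1)[OF p] ab(2) by (simp_all del: emb_simps)
qed

lemma fo_right_max:
  assumes p: "p \<in> DI" and z: "emb z \<in> fl p" "snd z \<le> b" and b: "b \<in> I"
  shows "(emb z, emb (path_right p b, b)) \<in> fo p"
proof (cases "snd z = b")
  case True
  have "b \<in> times p"
    using b D_times[OF p] by simp
  moreover have "fst z \<in> closed_segment (path_left p b) (path_right p b)"
    using z(1) True filled_emb[OF p, of "fst z" "snd z"] by (simp add: emb_def)
  ultimately have "((Some (fst z), ereal b), (Some (path_right p b), ereal b)) \<in> fo p"
    unfolding filled_order_fibre[OF D_path[OF p]] by simp
  then show ?thesis
    using True by (simp add: emb_def)
next
  case False
  then show ?thesis
    using z path_right_filled(1)[OF p b] by (intro filled_order_time(2)) auto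
qed

lemma gr_min:
  assumes p: "p \<in> DI" and ab: "{a..b} \<subseteq> I" "a < b" and z: "z \<in> gr a b p"
  shows "(emb (path_right p a, a), emb z) \<in> fo p"
proof -
  have z': "a \<le> snd z" "emb z \<in> fl p" "snd z = a \<longrightarrow> fst z = path_right p a"
    using z unfolding gr_iff[OF p ab(1)] by blast+
  have a: "a \<in> I"
    using ab by auto
  show ?thesis
  proof (cases "snd z = a")
    case True
    then have "z = (path_right p a, a)"
      using z'(3) by (simp add: prod_eq_iff)
    then show ?thesis
      using Z.corder_refl[OF filled_corder[OF D_path[OF p]] z'(2)] by simp
  next
    case False
    then show ?thesis
      using z' path_right_filled(1)[OF p a] by (intro filled_order_time(2)) auto
  qed
qed

lemma gr_corder:
  assumes p: "p \<in> DI" and ab: "{a..b} \<subseteq> I" "a < b"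
  shows "E.corder (gr a b p) (gle a b p)"
  unfolding E.corder_def
proof (intro conjI allI impI)
  note ord = filled_corder[OF D_path[OF p]]
  have F: "emb z \<in> fl p" if "z \<in> gr a b p" for z
    using that unfolding gr_iff[OF p ab(1)] by blast
  show "gr a b p \<noteq> {}"
    using gr_ends[OF p ab] by blast
  show "compactin E.mtopology (gr a b p)"
  proof (rule E.compact_seqI)
    fix \<sigma> :: "nat \<Rightarrow> real \<times> real" assume \<sigma>: "\<And>n. \<sigma> n \<in> gr a b p"
    obtain l r where l: "l \<in> fl p" "strict_mono r" "null (\<lambda>n. d (emb (\<sigma> (r n))) l)"
      by (rule Z.compact_seq[OF Z.corder_compact[OF ord], of "\<lambda>n. emb (\<sigma> n)"]) (rule F[OF \<sigma>])
    have lX: "l \<in> squeezed euclideanreal"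
      using l(1) filled_sub[OF D_path[OF p]] by blast
    obtain x t where x: "l = (Some x, ereal t)" "(\<lambda>n. ereal (snd (\<sigma> (r n)))) \<longlonglongrightarrow> ereal t"
    proof (rule real_time_limit[of "\<lambda>n. emb (\<sigma> (r n))" l "\<lambda>n. snd (\<sigma> (r n))" "max \<bar>a\<bar> \<bar>b\<bar>", OF emb_squeezed lX l(3)])
      show "\<bar>snd (\<sigma> (r n))\<bar> \<le> max \<bar>a\<bar> \<bar>b\<bar>" for n
        using \<sigma>[of "r n"] unfolding gr_iff[OF p ab(1)] by auto
    qed simp_all
    have t: "(\<lambda>n. snd (\<sigma> (r n))) \<longlonglongrightarrow> t"
      using x(2) by (simp add: lim_ereal)
    have "a \<le> snd (\<sigma> n)" "snd (\<sigma> n) \<le> b" for n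
      using \<sigma>[of n] unfolding gr_iff[OF p ab(1)] by blast+
    then have bnd: "a \<le> t" "t \<le> b"
      using LIMSEQ_le_const[OF t] LIMSEQ_le_const2[OF t] by blast+
    have lemb: "l = emb (x, t)"
      using x by simp
    have a: "a \<in> I"
      using ab by auto
    \<comment> \<open>Over \<open>a\<close> the graph contains the right value only. A limit over
      \<open>a\<close> is still preceded by it, and being the last point of its fibre it equals the
      limit.\<close>
    have "(emb (path_right p a, a), l) \<in> fo p"
      by (rule Z.corder_closed[of _ _ "\<lambda>n. emb (path_right p a, a)" "\<lambda>n. emb (\<sigma> (r n))",
            OF ord gr_min[OF p ab \<sigma>] path_right_filled(1)[OF p a] l(1) _ l(3)])
        (simp add: Z.mdist_zero[OF emb_squeezed] del: emb_simps)
    then have "t = a \<longrightarrow> x = path_right p a"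
      using right_greatest[OF p, of a x] lemb by auto
    then have "(x, t) \<in> gr a b p"
      unfolding gr_iff[OF p ab(1)] using bnd l(1) lemb by simp
    moreover have "null (\<lambda>n. supd (\<sigma> (r n)) (x, t))"
      using l(3) unfolding lemb emb_supd_iff .
    ultimately show "\<exists>l\<in>gr a b p. \<exists>r. subseq r \<and> null (\<lambda>n. supd (\<sigma> (r n)) l)"
      using l(2) by blast
  qed simp
  have "refl_on (gr a b p) (gle a b p)"
    unfolding refl_on_def gle_iff[OF p ab(1)] using F Z.corder_refl[OF ord] by blast
  moreover have "gle a b p \<subseteq> gr a b p \<times> gr a b p"
    by (auto simp: gle_def)
  moreover have "trans (gle a b p)"
    by (rule transI) (unfold gle_iff[OF p ab(1)], blast intro: Z.corder_trans[OF ord])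
  moreover have "antisym (gle a b p)"
  proof (rule antisymI)
    fix z w assume "(z, w) \<in> gle a b p" "(w, z) \<in> gle a b p"
    then have "emb z = emb w"
      unfolding gle_iff[OF p ab(1)] using Z.corder_antisym[OF ord] by blast
    then show "z = w"
      by (rule emb_inj)
  qed
  moreover have "total_on (gr a b p) (gle a b p)"
    by (rule total_onI) (unfold gle_iff[OF p ab(1)], use F Z.corder_total[OF ord] in blast)
  ultimately show "linear_order_on (gr a b p) (gle a b p)"
    unfolding linear_order_on_def partial_order_on_def preorder_on_def by blast
next
  fix \<sigma> \<tau> :: "nat \<Rightarrow> real \<times> real" and x y
  note ord = filled_corder[OF D_path[OF p]]
  assume le: "\<forall>n. (\<sigma> n, \<tau> n) \<in> gle a b p" and xy: "x \<in> gr a b p" "y \<in> gr a b p"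
    and lim: "null (\<lambda>n. supd (\<sigma> n) x)" "null (\<lambda>n. supd (\<tau> n) y)"
  have F: "emb z \<in> fl p" if "z \<in> gr a b p" for z
    using that unfolding gr_iff[OF p ab(1)] by blast
  have le': "(emb (\<sigma> n), emb (\<tau> n)) \<in> fo p" for n
    using le unfolding gle_iff[OF p ab(1)] by blast
  have "(emb x, emb y) \<in> fo p"
    by (rule Z.corder_closed[of _ _ "\<lambda>n. emb (\<sigma> n)" "\<lambda>n. emb (\<tau> n)", OF ord le' F[OF xy(1)] F[OF xy(2)]])
      (use lim in \<open>simp_all only: emb_supd_iff\<close>)
  then show "(x, y) \<in> gle a b p"
    unfolding gle_iff[OF p ab(1)] using xy by blast
qed

lemma gr_dense:
  assumes p: "p \<in> DI" and ab: "{a..b} \<subseteq> I" "a < b" and zw: "(z, w) \<in> gle a b p" "z \<noteq> w"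
  shows "\<exists>u. (z, u) \<in> gle a b p \<and> (u, w) \<in> gle a b p \<and> u \<noteq> z \<and> u \<noteq> w"
proof -
  obtain x s where z: "z = (x, s)" by (cases z)
  obtain y t where w: "w = (y, t)" by (cases w)
  have zg: "z \<in> gr a b p" "w \<in> gr a b p" and fo: "(emb z, emb w) \<in> fo p"
    using zw(1) unfolding gle_iff[OF p ab(1)] by blast+
  have zF: "emb z \<in> fl p" "emb w \<in> fl p"
    and bnd: "a \<le> s" "s \<le> b" "a \<le> t" "t \<le> b" and ata: "s = a \<longrightarrow> x = path_right p a" "t = a \<longrightarrow> y = path_right p a"
    using zg unfolding gr_iff[OF p ab(1)] by (auto simp: z w simp del: emb_simps)
  have st: "s \<le> t"
    using filled_order_time(1)[OF fo] by (simp add: z w)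
  have tI: "s \<in> I" "t \<in> I"
    using bnd ab by auto
  show ?thesis
  proof (cases "s < t")
    case True
    define m where "m = (s + t) / 2"
    have m: "s < m" "m < t"
      using True by (auto simp: m_def)
    have mI: "m \<in> I"
      using I_between[OF tI] m by simp
    define u where "u = (path_right p m, m)"
    have ug: "u \<in> gr a b p"
      unfolding gr_iff[OF p ab(1)] u_def using path_right_filled(1)[OF p mI] m bnd by (simp del: emb_simps)
    have "(emb z, emb u) \<in> fo p" "(emb u, emb w) \<in> fo p"
      using m zF path_right_filled(1)[OF p mI] by (auto intro!: filled_order_time(2) simp: z w u_def simp del: emb_simps(1))
    then show ?thesis
      using ug zg m by (intro exI[of _ u]) (simp add: gle_iff[OF p ab(1)] u_def z w)
  next
    case False
    then have s: "s = t"
      using st by simp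
    then have ne: "x \<noteq> y" "t \<noteq> a"
      using zw(2) ata by (auto simp: z w)
    have xy: "x \<in> closed_segment (path_left p t) (path_right p t)" "y \<in> closed_segment (path_left p t) (path_right p t)"
      "x \<in> closed_segment (path_left p t) y"
      using fo unfolding z w s emb_simps filled_order_fibre[OF D_path[OF p]] by blast+
    define u where "u = ((x + y) / 2, t)"
    have mid: "(x + y) / 2 \<in> closed_segment (path_left p t) (path_right p t)"
      "x \<in> closed_segment (path_left p t) ((x + y) / 2)" "(x + y) / 2 \<in> closed_segment (path_left p t) y"
      using xy by (auto simp: closed_segment_eq_real_ivl split: if_splits)
    have ug: "u \<in> gr a b p"
      unfolding gr_iff[OF p ab(1)] u_def using bnd ne tI mid(1) by (simp add: filled_emb[OF p] del: emb_simps)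
    have tt: "t \<in> times p"
      using tI D_times[OF p] by simp
    have "(emb z, emb u) \<in> fo p" "(emb u, emb w) \<in> fo p"
      unfolding z w s u_def emb_simps filled_order_fibre[OF D_path[OF p]] using tt xy mid by blast+
    then show ?thesis
      using ug zg ne by (intro exI[of _ u]) (simp add: gle_iff[OF p ab(1)] u_def z w)
  qed
qed

lemma gr_param:
  assumes p: "p \<in> DI" and q: "q \<in> DI" and ab: "{a..b} \<subseteq> I" "a < b"
    and "E.tclose r (gr a b p) (gle a b p) (gr a b q) (gle a b q)"
  shows "\<exists>\<gamma>1\<in>parametrisations a b (path_right p). \<exists>\<gamma>2\<in>parametrisations a b (path_right q).
    \<forall>s\<in>{0..1}. supd (\<gamma>1 s) (\<gamma>2 s) \<le> r"
proof -
  obtain C where C: "C \<in> Cor_plus (gr a b p) (gle a b p) (gr a b q) (gle a b q)"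
    "E.cclosed (gr a b p) (gr a b q) C" "\<And>z w. (z, w) \<in> C \<Longrightarrow> supd z w \<le> r"
    using E.tclose_closed[OF gr_corder[OF p ab] gr_corder[OF q ab] assms(5)] by blast
  obtain \<gamma>1 \<gamma>2 where \<gamma>: "continuous_on {0..1::real} \<gamma>1" "continuous_on {0..1} \<gamma>2"
    "\<gamma>1 ` {0..1} = gr a b p" "\<gamma>2 ` {0..1} = gr a b q"
    "\<forall>s\<in>{0..1}. \<forall>t\<in>{0..1}. s \<le> t \<longrightarrow> (\<gamma>1 s, \<gamma>1 t) \<in> gle a b p \<and> (\<gamma>2 s, \<gamma>2 t) \<in> gle a b q"
    "\<forall>s\<in>{0..1}. (\<gamma>1 s, \<gamma>2 s) \<in> C"
    using Cor_plus_param[OF gr_corder[OF p ab] gr_corder[OF q ab] gr_dense[OF p ab] gr_dense[OF q ab] C(1,2)] by blast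
  have "\<gamma>1 \<in> parametrisations a b (path_right p)" "\<gamma>2 \<in> parametrisations a b (path_right q)"
    using \<gamma>(1-5) unfolding parametrisations_def gr_def gle_def by auto
  then show ?thesis
    using \<gamma>(6) C(3) by blast
qed

lemma rho_M1_le:
  assumes p: "p \<in> DI" and q: "q \<in> DI" and ab: "{a..b} \<subseteq> I" "a < b"
    and "E.tclose r (gr a b p) (gle a b p) (gr a b q) (gle a b q)"
  shows "rho_M1 a b (path_right p) (path_right q) \<le> r"
proof -
  let ?P = "parametrisations a b (path_right p) \<times> parametrisations a b (path_right q)"
  obtain R where R: "\<And>z w. z \<in> gr a b p \<Longrightarrow> w \<in> gr a b q \<Longrightarrow> supd z w \<le> R"
    using E.compact_dist_bounded[OF E.corder_compact[OF gr_corder[OF p ab]] E.corder_compact[OF gr_corder[OF q ab]]] by blast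
  have "0 \<le> (SUP s\<in>{0..1}. supd (\<gamma>1 s) (\<gamma>2 s))" if "(\<gamma>1, \<gamma>2) \<in> ?P" for \<gamma>1 \<gamma>2
  proof -
    have im: "\<gamma>1 ` {0..1} = gr a b p" "\<gamma>2 ` {0..1} = gr a b q"
      using that unfolding parametrisations_def gr_def by auto
    have "supd (\<gamma>1 s) (\<gamma>2 s) \<le> R" if s: "s \<in> {0..1}" for s
      using R imageI[OF s, of \<gamma>1] imageI[OF s, of \<gamma>2] unfolding im by blast
    then have "bdd_above ((\<lambda>s. supd (\<gamma>1 s) (\<gamma>2 s)) ` {0..1})"
      by (intro bdd_aboveI[of _ R]) auto
    then have "supd (\<gamma>1 0) (\<gamma>2 0) \<le> (SUP s\<in>{0..1}. supd (\<gamma>1 s) (\<gamma>2 s))"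
      by (intro cSUP_upper) auto
    then show ?thesis
      using E.nonneg order_trans by blast
  qed
  then have bel: "bdd_below ((\<lambda>(\<gamma>1, \<gamma>2). SUP s\<in>{0..1}. supd (\<gamma>1 s) (\<gamma>2 s)) ` ?P)"
    by (intro bdd_belowI[of _ 0]) auto
  obtain \<gamma>1 \<gamma>2 where \<gamma>: "(\<gamma>1, \<gamma>2) \<in> ?P" "\<forall>s\<in>{0..1}. supd (\<gamma>1 s) (\<gamma>2 s) \<le> r"
    using gr_param[OF assms] by blast
  have "(SUP s\<in>{0..1}. supd (\<gamma>1 s) (\<gamma>2 s)) \<le> r"
    using \<gamma>(2) by (intro cSUP_least) auto
  then show ?thesis
    unfolding rho_M1_def supd_eq[symmetric] using cINF_lower[OF bel \<gamma>(1)] by simp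
qed

lemma rho_M1_less:
  assumes p: "p \<in> DI" and q: "q \<in> DI" and ab: "{a..b} \<subseteq> I" "a < b"
    and less: "rho_M1 a b (path_right p) (path_right q) < r"
  shows "E.tclose r (gr a b p) (gle a b p) (gr a b q) (gle a b q)"
proof -
  let ?P = "parametrisations a b (path_right p) \<times> parametrisations a b (path_right q)"
  obtain R where R: "\<And>z w. z \<in> gr a b p \<Longrightarrow> w \<in> gr a b q \<Longrightarrow> supd z w \<le> R"
    using E.compact_dist_bounded[OF E.corder_compact[OF gr_corder[OF p ab]] E.corder_compact[OF gr_corder[OF q ab]]] by blast
  obtain r0 where "E.tclose r0 (gr a b p) (gle a b p) (gr a b q) (gle a b q)"
    using E.tclose_exists[OF gr_corder[OF p ab] gr_corder[OF q ab]] by blast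
  \<comment> \<open>Without parametrisations the infimum would carry no information; they exist
    because a monotone correspondence exists at some radius.\<close>
  then have "?P \<noteq> {}"
    using gr_param[OF p q ab] by blast
  then obtain x where "x \<in> (\<lambda>(\<gamma>1, \<gamma>2). SUP s\<in>{0..1}. supd (\<gamma>1 s) (\<gamma>2 s)) ` ?P" "x < r"
    using cInf_lessD[OF _ less[unfolded rho_M1_def supd_eq[symmetric]]] by blast
  then obtain \<gamma>1 \<gamma>2 where \<gamma>: "\<gamma>1 \<in> parametrisations a b (path_right p)" "\<gamma>2 \<in> parametrisations a b (path_right q)"
    and sup: "(SUP s\<in>{0..1}. supd (\<gamma>1 s) (\<gamma>2 s)) < r"
    by auto
  have im: "\<gamma>1 ` {0..1} = gr a b p" "\<gamma>2 ` {0..1} = gr a b q"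
    using \<gamma> unfolding parametrisations_def gr_def by auto
  have "supd (\<gamma>1 s) (\<gamma>2 s) \<le> R" if "s \<in> {0..1}" for s
    using R imageI[OF that, of \<gamma>1] imageI[OF that, of \<gamma>2] unfolding im by blast
  then have "bdd_above ((\<lambda>s. supd (\<gamma>1 s) (\<gamma>2 s)) ` {0..1})"
    by (intro bdd_aboveI[of _ R]) auto
  then have near: "supd (\<gamma>1 s) (\<gamma>2 s) \<le> r" if "s \<in> {0..1}" for s
    using cSUP_upper[OF that, of "\<lambda>s. supd (\<gamma>1 s) (\<gamma>2 s)"] sup by linarith
  have mono1: "(\<gamma>1 s, \<gamma>1 t) \<in> gle a b p" and mono2: "(\<gamma>2 s, \<gamma>2 t) \<in> gle a b q"
    if "s \<in> {0..1}" "t \<in> {0..1}" "s \<le> t" for s t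
    using \<gamma> that im unfolding parametrisations_def gle_def by auto
  \<comment> \<open>The points at equal parameters are paired. They cannot cross, since for any two
    parameters both curves move in the same direction.\<close>
  define C where "C = (\<lambda>s. (\<gamma>1 s, \<gamma>2 s)) ` {0..1}"
  have "C \<in> Corr (gr a b p) (gr a b q)"
    unfolding Corr_def C_def im[symmetric] by auto
  moreover have False if C: "(z1, z2) \<in> C" "(z1', z2') \<in> C" and v: "(z1, z1') \<in> gle a b p" "z1 \<noteq> z1'"
    "(z2', z2) \<in> gle a b q" "z2' \<noteq> z2" for z1 z2 z1' z2'
  proof -
    obtain s t where st: "s \<in> {0..1}" "t \<in> {0..1}" "z1 = \<gamma>1 s" "z2 = \<gamma>2 s" "z1' = \<gamma>1 t" "z2' = \<gamma>2 t"
      using C unfolding C_def by auto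
    show False
    proof (cases "s \<le> t")
      case True
      then show False
        using mono2[OF st(1,2)] v(3,4) st E.corder_antisym[OF gr_corder[OF q ab]] by blast
    next
      case False
      then show False
        using mono1[OF st(2,1)] v(1,2) st E.corder_antisym[OF gr_corder[OF p ab]] by auto
    qed
  qed
  ultimately have "C \<in> Cor_plus (gr a b p) (gle a b p) (gr a b q) (gle a b q)"
    unfolding Cor_plus_def by blast
  then show ?thesis
    unfolding E.tclose_def using near by (intro bexI[of _ C]) (auto simp: C_def)
qed

lemma gr_euclidean_compact:
  assumes "p \<in> DI" "{a..b} \<subseteq> I" "a < b"
  shows "gr a b p \<in> nonempty_compacts (euclidean :: (real \<times> real) topology)"
  using E.corder_compact[OF gr_corder[OF assms]] E.corder_nonempty[OF gr_corder[OF assms]]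
  by (simp add: nonempty_compacts_def mtopology_supd)

lemma rho_M2_le:
  assumes "p \<in> DI" "q \<in> DI" "{a..b} \<subseteq> I" "a < b" "hclose dist r (gr a b p) (gr a b q)"
  shows "rho_M2 a b (path_right p) (path_right q) \<le> r"
  unfolding rho_M2_def gr_def[symmetric]
  by (rule Met_TC.hausdorff_dist_le[where 'a = "real \<times> real", unfolded mtopology_is_euclidean,
        OF gr_euclidean_compact gr_euclidean_compact]) (use assms in auto)

lemma rho_M2_less:
  assumes "p \<in> DI" "q \<in> DI" "{a..b} \<subseteq> I" "a < b" "rho_M2 a b (path_right p) (path_right q) < r"
  shows "hclose dist r (gr a b p) (gr a b q)"
  by (rule Met_TC.hausdorff_dist_less[where 'a = "real \<times> real", unfolded mtopology_is_euclidean,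
        OF gr_euclidean_compact gr_euclidean_compact]) (use assms in \<open>auto simp: rho_M2_def gr_def\<close>)

end

section \<open>Convergence of filled paths and of completed graphs\<close>

context Metric_space begin

text \<open>Pointwise convergence of sets suffices for Hausdorff convergence when sequences picked
  from the sets accumulate in the compact limit: a failure at infinitely many indices produces
  either far points of the sets, which would have to accumulate in \<open>L\<close>, or far points
  of \<open>L\<close>, which would have an approximated accumulation point.\<close>

lemma hclose_eventuallyI:
  assumes L: "compactin mtopology L" and K: "\<And>n. K n \<subseteq> M" and e: "e > 0"
    and approx: "\<And>l. l \<in> L \<Longrightarrow> \<exists>u. (\<forall>n. u n \<in> K n) \<and> null (\<lambda>n. d (u n) l)"
    and sub: "\<And>(r::nat \<Rightarrow> nat) u. strict_mono r \<Longrightarrow> (\<And>n. u n \<in> K (r n)) \<Longrightarrow>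
      \<exists>l\<in>L. \<exists>s. subseq s \<and> null (\<lambda>n. d (u (s n)) l)"
  shows "\<forall>\<^sub>F n in sequentially. hclose d e (K n) L"
proof (rule ccontr)
  assume "\<not> ?thesis"
  then have "\<not> (\<forall>\<^sub>F n in sequentially. \<not> \<not> hclose d e (K n) L)"
    by simp
  then obtain r :: "nat \<Rightarrow> nat" where r: "strict_mono r" "\<And>n. \<not> hclose d e (K (r n)) L"
    using frequently_subseq[of "\<lambda>n. \<not> hclose d e (K n) L"] by blast
  have LM: "L \<subseteq> M"
    by (rule compact_subset[OF L])
  \<comment> \<open>The failures where some point of the set is far from \<open>L\<close>. In the
    other failures some point of \<open>L\<close> is far from the set. Either the first kind occurs
    infinitely often or the second from some index on.\<close>
  define P where "P n \<longleftrightarrow> (\<exists>u\<in>K (r n). \<forall>l\<in>L. \<not> d u l \<le> e)" for n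
  have nP: "\<exists>l\<in>L. \<forall>u\<in>K (r n). \<not> d u l \<le> e" if "\<not> P n" for n
    using r(2)[of n] that unfolding hclose_def P_def by blast
  show False
  proof (cases "\<forall>\<^sub>F n in sequentially. \<not> P n")
    case True
    then obtain N where N: "\<And>n. \<not> P (n + N)"
      unfolding eventually_sequentially by (metis le_add2)
    obtain l where l: "\<And>n. l n \<in> L" "\<And>n u. u \<in> K (r (n + N)) \<Longrightarrow> \<not> d u (l n) \<le> e"
      using nP[OF N] by metis
    obtain x s where x: "x \<in> L" "strict_mono s" "null (\<lambda>n. d (l (s n)) x)"
      by (rule compact_seq[OF L, of l]) (rule l(1))
    obtain u where u: "\<And>n. u n \<in> K n" "null (\<lambda>n. d (u n) x)"
      using approx[OF x(1)] by blast
    have "strict_mono (\<lambda>n. r (s n + N))"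
      using r(1) x(2) by (auto simp: strict_mono_def)
    then have "null (\<lambda>n. d (u (r (s n + N))) x)"
      by (rule strict_mono_subseq_tendsto[OF _ u(2)])
    then have "(\<lambda>n. d (u (r (s n + N))) (l (s n))) \<longlonglongrightarrow> d x x"
      by (intro seq_dist[OF _ _ _ _ _ x(3)]) (use u(1) l(1) x(1) K LM in blast)+
    then have "e \<le> d x x"
      by (rule LIMSEQ_le_const) (intro exI allI impI, rule less_imp_le, use l(2)[OF u(1)] in \<open>simp add: not_le\<close>)
    then show False
      using e x(1) LM by auto
  next
    case False
    then obtain s :: "nat \<Rightarrow> nat" where s: "strict_mono s" "\<And>n. P (s n)"
      using frequently_subseq[of P] by blast
    obtain u where u: "\<And>n. u n \<in> K (r (s n))" "\<And>n l. l \<in> L \<Longrightarrow> \<not> d (u n) l \<le> e"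
      using s(2) unfolding P_def by metis
    have "strict_mono (\<lambda>n. r (s n))"
      using r(1) s(1) by (auto simp: strict_mono_def)
    then obtain l t where l: "l \<in> L" "null (\<lambda>n. d (u (t n)) l)"
      using sub[of "\<lambda>n. r (s n)" u, OF _ u(1)] by blast
    have "e \<le> 0"
      by (rule LIMSEQ_le_const[OF l(2)]) (use u(2)[OF l(1)] in \<open>auto intro: less_imp_le simp: not_le\<close>)
    then show False
      using e by simp
  qed
qed

lemma hseqI_less:
  assumes "f \<longlonglongrightarrow> 0" "\<And>n r. f n < r \<Longrightarrow> hclose d r (K n) L"
  shows "hseq K L"
proof -
  have "null (\<lambda>n. f n + 1 / real (Suc n))"
    using tendsto_add[OF assms(1) lim_1_over_Suc] by simp
  then show ?thesis
    unfolding hseq_def using assms(2) by (intro exI[of _ "\<lambda>n. f n + 1 / real (Suc n)"]) simp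
qed

lemma Id_on_hclose: "hclose (d_pair d) r (Id_on A) (Id_on A') \<longleftrightarrow> hclose d r A A'"
proof -
  have eq: "d_pair d (x, x) (y, y) = d x y" for x y
    by (simp add: d_pair_def)
  have mem: "(\<exists>c\<in>Id_on A. Q c) \<longleftrightarrow> (\<exists>x\<in>A. Q (x, x))" "(\<forall>c\<in>Id_on A. Q c) \<longleftrightarrow> (\<forall>x\<in>A. Q (x, x))"
    for A :: "'a set" and Q
    by (auto simp: Id_on_def)
  show ?thesis
    unfolding hclose_def mem eq ..
qed

lemma Id_on_compact:
  assumes "compactin mtopology A"
  shows "compactin (Metric_space.mtopology (M \<times> M) (d_pair d)) (Id_on A)"
proof -
  interpret P: Metric_space "M \<times> M" "d_pair d"
    by (rule Metric_space_d_pair)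
  show ?thesis
  proof (rule P.compact_seqI)
    show "Id_on A \<subseteq> M \<times> M"
      using compact_subset[OF assms] by auto
    fix \<sigma> :: "nat \<Rightarrow> 'a \<times> 'a" assume \<sigma>: "\<And>n. \<sigma> n \<in> Id_on A"
    then have A: "fst (\<sigma> n) \<in> A" and eq: "\<sigma> n = (fst (\<sigma> n), fst (\<sigma> n))" for n
      by (metis Id_onE fst_conv)+
    obtain l r where l: "l \<in> A" "strict_mono r" "null (\<lambda>n. d (fst (\<sigma> (r n))) l)"
      by (rule compact_seq[OF assms, of "\<lambda>n. fst (\<sigma> n)"]) (rule A)
    have "null (\<lambda>n. d_pair d (\<sigma> (r n)) (l, l))"
      using l(3) by (subst eq) (simp add: d_pair_tendsto_iff)
    then show "\<exists>l\<in>Id_on A. \<exists>r. subseq r \<and> null (\<lambda>n. d_pair d (\<sigma> (r n)) l)"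
      using l(1,2) by blast
  qed
qed

end

lemma tendsto_0_hclose:
  fixes f :: "nat \<Rightarrow> real"
  assumes le: "\<And>e. e > 0 \<Longrightarrow> \<exists>\<eta>>0. \<forall>n. hclose d \<eta> (K n) L \<longrightarrow> f n \<le> e" and nonneg: "\<And>n. 0 \<le> f n"
    and close: "\<And>e. e > 0 \<Longrightarrow> \<forall>\<^sub>F n in sequentially. hclose d e (K n) L"
  shows "f \<longlonglongrightarrow> 0"
proof (rule tendstoI)
  fix e :: real assume e: "e > 0"
  obtain \<eta> where \<eta>: "\<eta> > 0" "\<forall>n. hclose d \<eta> (K n) L \<longrightarrow> f n \<le> e / 2"
    using le[of "e / 2"] e by auto
  show "\<forall>\<^sub>F n in sequentially. dist (f n) 0 < e"
    using close[OF \<eta>(1)] by eventually_elim (use \<eta>(2) nonneg e in \<open>auto intro: le_less_trans\<close>)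
qed

interpretation EE: Metric_space "UNIV \<times> UNIV" "d_pair supd"
  by (rule E.Metric_space_d_pair)

context real_path_space begin

text \<open>The two choices of \<open>S\<close> below, the order and the identity relation of a filled path, treat \<open>d_part\<close>
  with M1 and \<open>d_H\<close> with M2 simultaneously.\<close>

definition path_rel :: "(real path \<Rightarrow> real sqz rel) \<Rightarrow> bool" where
  "path_rel S \<longleftrightarrow> S = fo \<or> S = (\<lambda>p. Id_on (fl p))"

definition graph_rel :: "(real path \<Rightarrow> real sqz rel) \<Rightarrow> real \<Rightarrow> real \<Rightarrow> real path \<Rightarrow> (real \<times> real) rel" where
  "graph_rel S a b p = {(z, w). z \<in> gr a b p \<and> w \<in> gr a b p \<and> (emb z, emb w) \<in> S p}"

lemma graph_rel_order:
  assumes "p \<in> DI" "{a..b} \<subseteq> I"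
  shows "graph_rel (fo) a b p = gle a b p"
  using gle_iff[OF assms] unfolding graph_rel_def by auto

lemma graph_rel_Id:
  assumes "p \<in> DI" "{a..b} \<subseteq> I"
  shows "graph_rel (\<lambda>p. Id_on (fl p)) a b p = Id_on (gr a b p)"
  using gr_iff[OF assms] emb_inj unfolding graph_rel_def Id_on_def by blast

lemma path_rel_filled:
  assumes "path_rel S" "(u, v) \<in> S p"
  shows "u \<in> fl p" "v \<in> fl p"
  using assms filled_order_dom[of u v p] unfolding path_rel_def by auto

lemma path_rel_refl:
  assumes "path_rel S" "p \<in> DI" "u \<in> fl p"
  shows "(u, u) \<in> S p"
  using assms(1,3) Z.corder_refl[OF filled_corder[OF D_path[OF assms(2)]] assms(3)] unfolding path_rel_def by blast

lemma filled_squeezed: "p \<in> DI \<Longrightarrow> u \<in> fl p \<Longrightarrow> u \<in> squeezed euclideanreal"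
  using filled_sub[OF D_path] by blast

lemma path_rel_sub:
  assumes "path_rel S" "p \<in> DI"
  shows "S p \<subseteq> squeezed euclideanreal \<times> squeezed euclideanreal"
  by (rule subrelI) (use path_rel_filled[OF assms(1)] filled_squeezed[OF assms(2)] in blast)

lemma path_rel_compact:
  assumes "path_rel S" and p: "p \<in> DI"
  shows "compactin P.mtopology (S p)"
  using assms(1) Z.corder_pair_compact[OF filled_corder[OF D_path[OF p]]] Z.Id_on_compact[OF filled_compact[OF D_path[OF p]]]
  unfolding path_rel_def Z.mtopology_d_pair nonempty_compacts_def by auto

lemma graph_rel_compact:
  assumes "path_rel S" and p: "p \<in> DI" and ab: "{a..b} \<subseteq> I" "a < b"
  shows "compactin EE.mtopology (graph_rel S a b p)"
  using assms(1) E.corder_pair_compact[OF gr_corder[OF p ab]] E.Id_on_compact[OF E.corder_compact[OF gr_corder[OF p ab]]]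
    graph_rel_order[OF p ab(1)] graph_rel_Id[OF p ab(1)]
  unfolding path_rel_def E.mtopology_d_pair nonempty_compacts_def by auto

lemma hseq_filled:
  assumes S: "path_rel S" and p: "p \<in> DI" and q: "\<And>n. q n \<in> DI" and hs: "P.hseq (\<lambda>n. S (q n)) (S p)"
  shows "Z.hseq (\<lambda>n. fl (q n)) (fl p)"
proof -
  obtain \<delta> where \<delta>: "\<delta> \<longlonglongrightarrow> 0" "\<And>n. hclose (d_pair d) (\<delta> n) (S (q n)) (S p)"
    using hs unfolding P.hseq_def by blast
  have "hclose d (\<delta> n) (fl (q n)) (fl p)" for n
    using S \<delta>(2)[of n] Z.hclose_pair_imp_hclose[OF filled_corder[OF D_path[OF q]] filled_corder[OF D_path[OF p]]]
    unfolding path_rel_def by (auto simp: Z.Id_on_hclose)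
  then show ?thesis
    unfolding Z.hseq_def using \<delta>(1) by blast
qed

text \<open>A limit of graph points lies on the filled path. Only over \<open>a\<close> could it
  fall outside the graph, and there \<open>good\<close> leaves a single value.\<close>

lemma gr_seq:
  assumes p: "p \<in> DI" and q: "\<And>n. q n \<in> DI" and hs: "Z.hseq (\<lambda>n. fl (q n)) (fl p)"
    and ab: "{a..b} \<subseteq> I" "a < b" and good: "path_left p a = path_right p a" and z: "\<And>n. z n \<in> gr a b (q n)"
  shows "\<exists>l\<in>gr a b p. \<exists>s. subseq s \<and> (\<lambda>n. z (s n)) \<longlonglongrightarrow> l"
proof -
  have F: "emb (z n) \<in> fl (q n)" and bz: "a \<le> snd (z n)" "snd (z n) \<le> b" for n
    using z[of n] unfolding gr_iff[OF q ab(1)] by blast+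
  obtain l r where l: "l \<in> fl p" "subseq r" "null (\<lambda>n. d (emb (z (r n))) l)"
    using Z.hseq_compact[of "\<lambda>n. fl (q n)" "fl p" "\<lambda>n. emb (z n)",
        OF hs filled_compact[OF D_path[OF p]] filled_sub[OF D_path[OF q]] F] by blast
  obtain x t where x: "l = (Some x, ereal t)" "(\<lambda>n. ereal (snd (z (r n)))) \<longlonglongrightarrow> ereal t"
  proof (rule real_time_limit[of "\<lambda>n. emb (z (r n))" l "\<lambda>n. snd (z (r n))" "max \<bar>a\<bar> \<bar>b\<bar>",
        OF emb_squeezed filled_squeezed[OF p l(1)] l(3)])
    show "\<bar>snd (z (r n))\<bar> \<le> max \<bar>a\<bar> \<bar>b\<bar>" for n
      using bz[of "r n"] by auto
  qed simp_all
  have t: "(\<lambda>n. snd (z (r n))) \<longlonglongrightarrow> t"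
    using x(2) by (simp add: lim_ereal)
  have bnd: "a \<le> t" "t \<le> b"
    using LIMSEQ_le_const[OF t] LIMSEQ_le_const2[OF t] bz by blast+
  have lemb: "l = emb (x, t)"
    using x by simp
  have "t = a \<longrightarrow> x = path_right p a"
    using l(1) filled_emb[OF p, of x t] good by (auto simp: lemb simp del: emb_simps)
  then have "(x, t) \<in> gr a b p"
    unfolding gr_iff[OF p ab(1)] using bnd l(1) lemb by simp
  moreover have "(\<lambda>n. z (r n)) \<longlonglongrightarrow> (x, t)"
    using l(3) unfolding lemb emb_lim_iff .
  ultimately show ?thesis
    using l(2) by blast
qed

text \<open>A monotone retraction of the filled path onto the graph over the window. Times equal to
  \<open>a\<close> are sent to the initial point, since of that fibre only the right value belongs
  to the graph, while the fibre over \<open>b\<close> is kept.\<close>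

definition clip :: "real \<Rightarrow> real \<Rightarrow> real path \<Rightarrow> real sqz \<Rightarrow> real \<times> real" where
  "clip a b q u = (if snd u \<le> ereal a then (path_right q a, a) else if ereal b < snd u then (path_right q b, b)
     else (the (fst u), real_of_ereal (snd u)))"

lemma clip_mid:
  assumes "q \<in> DI" "u \<in> fl q" "ereal a < snd u" "snd u \<le> ereal b"
  shows "emb (clip a b q u) = u"
  using filled_real[OF assms(1,2)] assms(3,4) by (auto simp: clip_def emb_def)

lemma clip_gr:
  assumes q: "q \<in> DI" and ab: "{a..b} \<subseteq> I" "a < b" and u: "u \<in> fl q"
  shows "clip a b q u \<in> gr a b q"
proof -
  consider "snd u \<le> ereal a" | "ereal b < snd u" "\<not> snd u \<le> ereal a" | "ereal a < snd u" "snd u \<le> ereal b"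
    by fastforce
  then show ?thesis
  proof cases
    case 3
    then have e: "emb (clip a b q u) = u"
      by (rule clip_mid[OF q u])
    have "ereal (snd (clip a b q u)) = snd u"
      using arg_cong[OF e, of snd] by simp
    then show ?thesis
      unfolding gr_iff[OF q ab(1)] e using 3 u by (metis ereal_less(1) ereal_less_eq(3) less_irrefl less_eq_real_def less_ereal.simps(1))
  qed (simp_all add: clip_def gr_ends[OF q ab])
qed

lemma clip_mono:
  assumes q: "q \<in> DI" and ab: "{a..b} \<subseteq> I" "a < b" and uv: "(u, v) \<in> fo q"
  shows "(emb (clip a b q u), emb (clip a b q v)) \<in> fo q"
proof -
  have F: "u \<in> fl q" "v \<in> fl q"
    using filled_order_dom[OF uv] by blast+
  have t: "snd u \<le> snd v"
    by (rule filled_order_time(1)[OF uv])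
  note G = clip_gr[OF q ab F(1)] clip_gr[OF q ab F(2)]
  have b: "b \<in> I"
    using ab by auto
  consider "snd u \<le> ereal a" | "ereal b < snd v" | "ereal a < snd u" "snd v \<le> ereal b"
    by fastforce
  then show ?thesis
  proof cases
    case 1
    then have "clip a b q u = (path_right q a, a)"
      by (simp add: clip_def)
    then show ?thesis
      using gr_min[OF q ab G(2)] by (simp del: emb_simps)
  next
    case 2
    then have "clip a b q v = (path_right q b, b)"
      using ab(2) by (auto simp: clip_def dest: less_le_trans)
    then show ?thesis
      using fo_right_max[OF q _ _ b, of "clip a b q u"] G(1) unfolding gr_iff[OF q ab(1)] by (simp del: emb_simps)
  next
    case 3
    then show ?thesis
      using uv t clip_mid[OF q F(1), of a b] clip_mid[OF q F(2), of a b] by (metis order_trans less_le_trans)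
  qed
qed

lemma clip_time:
  assumes "q \<in> DI" "u \<in> fl q" "a < b"
  shows "ereal (snd (clip a b q u)) = max (ereal a) (min (snd u) (ereal b))"
  using filled_real[OF assms(1,2)] assms(3) by (auto simp: clip_def max_def min_def)

text \<open>Strictly inside the window, clipping is eventually the identity. Over an end of the
  window the graph of \<open>p\<close> has a single point, since \<open>p\<close> does not jump
  there, and convergence of the clipped times identifies the limit.\<close>

lemma clip_lim:
  assumes p: "p \<in> DI" and q: "\<And>n. q n \<in> DI" and hs: "Z.hseq (\<lambda>n. fl (q n)) (fl p)"
    and ab: "{a..b} \<subseteq> I" "a < b" and good: "path_left p a = path_right p a" "path_left p b = path_right p b"
    and u: "\<And>n. u n \<in> fl (q n)" and z: "z \<in> gr a b p" and lim: "null (\<lambda>n. d (u n) (emb z))"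
  shows "(\<lambda>n. clip a b (q n) (u n)) \<longlonglongrightarrow> z"
proof (rule tendsto_subseq_criterion)
  fix r :: "nat \<Rightarrow> nat" assume r: "strict_mono r"
  have zb: "a \<le> snd z" "snd z \<le> b"
    using z unfolding gr_iff[OF p ab(1)] by blast+
  have hr: "Z.hseq (\<lambda>n. fl (q (r n))) (fl p)"
    by (rule Z.hseq_subseq[OF hs r])
  obtain l s where l: "l \<in> gr a b p" "subseq s" "(\<lambda>n. clip a b (q (r (s n))) (u (r (s n)))) \<longlonglongrightarrow> l"
    using gr_seq[of p "\<lambda>n. q (r n)" a b "\<lambda>n. clip a b (q (r n)) (u (r n))", OF p q hr ab good(1) clip_gr[OF q ab u]] by blast
  define v where "v n = u (r (s n))" for n
  define Q where "Q n = q (r (s n))" for n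
  have vF: "v n \<in> fl (Q n)" and QD: "Q n \<in> DI" for n
    unfolding v_def Q_def by (rule u q)+
  have l3: "(\<lambda>n. clip a b (Q n) (v n)) \<longlonglongrightarrow> l"
    using l(3) by (simp add: v_def Q_def)
  have vlim: "null (\<lambda>n. d (v n) (emb z))"
    unfolding v_def by (rule strict_mono_subseq_tendsto[OF l(2) strict_mono_subseq_tendsto[OF r lim]])
  have time: "(\<lambda>n. snd (v n)) \<longlonglongrightarrow> ereal (snd z)"
    using lim_time[of v "emb z", OF filled_squeezed[OF QD vF] emb_squeezed vlim] by simp
  have "(\<lambda>n. max (ereal a) (min (snd (v n)) (ereal b))) \<longlonglongrightarrow> max (ereal a) (min (ereal (snd z)) (ereal b))"
    by (intro tendsto_intros time)
  moreover have "max (ereal a) (min (ereal (snd z)) (ereal b)) = ereal (snd z)"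
    using zb by (simp add: max_def min_def)
  ultimately have "(\<lambda>n. snd (clip a b (Q n) (v n))) \<longlonglongrightarrow> snd z"
    unfolding clip_time[OF QD vF ab(2), symmetric] by (simp add: lim_ereal)
  then have st: "snd l = snd z"
    using LIMSEQ_unique[OF tendsto_snd[OF l3]] by blast
  have "l = z"
  proof (cases "a < snd z \<and> snd z < b")
    case True
    then have "\<forall>\<^sub>F n in sequentially. ereal a < snd (v n)" "\<forall>\<^sub>F n in sequentially. snd (v n) < ereal b"
      using order_tendstoD[OF time, of "ereal a"] order_tendstoD(2)[OF time, of "ereal b"] by simp_all
    then have "\<forall>\<^sub>F n in sequentially. d (v n) (emb z) = d (emb (clip a b (Q n) (v n))) (emb z)"
      by eventually_elim (use clip_mid[OF QD vF, of a _ b] in \<open>simp add: less_imp_le\<close>)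
    then have "null (\<lambda>n. d (emb (clip a b (Q n) (v n))) (emb z))"
      by (rule Lim_transform_eventually[OF vlim])
    then have "(\<lambda>n. clip a b (Q n) (v n)) \<longlonglongrightarrow> z"
      unfolding emb_lim_iff .
    then show ?thesis
      using LIMSEQ_unique[OF l3] by blast
  next
    case False
    then consider "snd z = a" | "snd z = b"
      using zb by linarith
    then show ?thesis
    proof cases
      case 1
      then show ?thesis
        using l(1) z st unfolding gr_iff[OF p ab(1)] by (simp add: prod_eq_iff)
    next
      case 2
      have "fst y = path_right p b" if "y \<in> gr a b p" "snd y = b" for y
        using that filled_emb[OF p, of "fst y" "snd y"] good(2) unfolding gr_iff[OF p ab(1)] by (simp add: emb_def)
      then show ?thesis
        using 2 l(1) z st by (simp add: prod_eq_iff)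
    qed
  qed
  then show "\<exists>s. subseq s \<and> (\<lambda>n. clip a b (q (r (s n))) (u (r (s n)))) \<longlonglongrightarrow> z"
    using l by blast
qed

lemma graph_rel_lim:
  assumes S: "path_rel S" and p: "p \<in> DI" and q: "\<And>n. q n \<in> DI" and hs: "P.hseq (\<lambda>n. S (q n)) (S p)"
    and ab: "{a..b} \<subseteq> I" "a < b" and good: "path_left p a = path_right p a" "path_left p b = path_right p b" and e: "e > 0"
  shows "\<forall>\<^sub>F n in sequentially. hclose (d_pair supd) e (graph_rel S a b (q n)) (graph_rel S a b p)"
proof (rule EE.hclose_eventuallyI[OF graph_rel_compact[OF S p ab] _ e])
  note hF = hseq_filled[OF S p q hs]
  fix l assume "l \<in> graph_rel S a b p"
  then obtain z w where l: "l = (z, w)" "z \<in> gr a b p" "w \<in> gr a b p" "(emb z, emb w) \<in> S p"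
    unfolding graph_rel_def by blast
  obtain uv where uv: "\<And>n. uv n \<in> S (q n)" "null (\<lambda>n. d_pair d (uv n) (emb z, emb w))"
    using P.hseq_approx[OF hs l(4)] by blast
  define u v where "u n = fst (uv n)" and "v n = snd (uv n)" for n
  have uvS: "(u n, v n) \<in> S (q n)" for n
    using uv(1)[of n] by (simp add: u_def v_def)
  note F = path_rel_filled[OF S uvS]
  have "null (\<lambda>n. d_pair d (u n, v n) (emb z, emb w))"
    using uv(2) by (simp add: u_def v_def)
  then have lim: "null (\<lambda>n. d (u n) (emb z))" "null (\<lambda>n. d (v n) (emb w))"
    unfolding Z.d_pair_tendsto_iff by blast+
  have C: "(\<lambda>n. clip a b (q n) (u n)) \<longlonglongrightarrow> z" "(\<lambda>n. clip a b (q n) (v n)) \<longlonglongrightarrow> w"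
    by (rule clip_lim[OF p q hF ab good F(1) l(2) lim(1)], rule clip_lim[OF p q hF ab good F(2) l(3) lim(2)])
  have "(emb (clip a b (q n) (u n)), emb (clip a b (q n) (v n))) \<in> S (q n)" for n
    using S unfolding path_rel_def
  proof
    assume [simp]: "S = fo"
    show ?thesis
      using clip_mono[OF q ab] uvS[of n] by simp
  next
    assume [simp]: "S = (\<lambda>p. Id_on (fl p))"
    show ?thesis
      using uvS[of n] clip_gr[OF q ab F(1), of n] unfolding gr_iff[OF q ab(1)] by (simp add: Id_on_iff)
  qed
  then have "(clip a b (q n) (u n), clip a b (q n) (v n)) \<in> graph_rel S a b (q n)" for n
    unfolding graph_rel_def using clip_gr[OF q ab F(1)] clip_gr[OF q ab F(2)] by blast
  moreover have "null (\<lambda>n. d_pair supd (clip a b (q n) (u n), clip a b (q n) (v n)) l)"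
    unfolding l(1) E.d_pair_tendsto_iff supd_tendsto_iff using C by blast
  ultimately show "\<exists>u. (\<forall>n. u n \<in> graph_rel S a b (q n)) \<and> null (\<lambda>n. d_pair supd (u n) l)"
    by (intro exI[of _ "\<lambda>n. (clip a b (q n) (u n), clip a b (q n) (v n))"]) blast
next
  note hF = hseq_filled[OF S p q hs]
  fix r :: "nat \<Rightarrow> nat" and c assume r: "strict_mono r" and c: "\<And>n. c n \<in> graph_rel S a b (q (r n))"
  define z w where "z n = fst (c n)" and "w n = snd (c n)" for n
  have zw: "z n \<in> gr a b (q (r n))" "w n \<in> gr a b (q (r n))" "(emb (z n), emb (w n)) \<in> S (q (r n))" for n
    using c[of n] by (auto simp: graph_rel_def z_def w_def)
  obtain x s where x: "x \<in> gr a b p" "subseq s" "(\<lambda>n. z (s n)) \<longlonglongrightarrow> x"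
    using gr_seq[of p "\<lambda>n. q (r n)" a b z, OF p q Z.hseq_subseq[OF hF r] ab good(1) zw(1)] by blast
  have rs: "strict_mono (\<lambda>n. r (s n))"
    using r x(2) by (simp add: strict_mono_def)
  obtain y t where y: "y \<in> gr a b p" "subseq t" "(\<lambda>n. w (s (t n))) \<longlonglongrightarrow> y"
    using gr_seq[of p "\<lambda>n. q (r (s n))" a b "\<lambda>n. w (s n)", OF p q Z.hseq_subseq[OF hF rs] ab good(1) zw(2)] by blast
  have x': "(\<lambda>n. z (s (t n))) \<longlonglongrightarrow> x"
    by (rule strict_mono_subseq_tendsto[OF y(2) x(3)])
  have rst: "strict_mono (\<lambda>n. r (s (t n)))"
    using rs y(2) by (simp add: strict_mono_def)
  have "(emb x, emb y) \<in> S p"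
  proof (rule P.hseq_limit[of "\<lambda>n. S (q (r (s (t n))))" "S p" "\<lambda>n. (emb (z (s (t n))), emb (w (s (t n))))",
        OF _ path_rel_compact[OF S p] path_rel_sub[OF S q] zw(3)])
    show "P.hseq (\<lambda>n. S (q (r (s (t n))))) (S p)"
      by (rule P.hseq_subseq[OF hs rst])
    show "null (\<lambda>n. d_pair d (emb (z (s (t n))), emb (w (s (t n)))) (emb x, emb y))"
      unfolding Z.d_pair_tendsto_iff emb_lim_iff using x' y(3) by blast
  qed simp
  then have "(x, y) \<in> graph_rel S a b p"
    unfolding graph_rel_def using x(1) y(1) by blast
  moreover have "null (\<lambda>n. d_pair supd (z (s (t n)), w (s (t n))) (x, y))"
    unfolding E.d_pair_tendsto_iff supd_tendsto_iff using x' y(3) by blast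
  then have "null (\<lambda>n. d_pair supd (c (s (t n))) (x, y))"
    by (simp add: z_def w_def)
  moreover have "strict_mono (\<lambda>n. s (t n))"
    using x(2) y(2) by (simp add: strict_mono_def)
  ultimately show "\<exists>l\<in>graph_rel S a b p. \<exists>s. subseq s \<and> null (\<lambda>n. d_pair supd (c (s n)) l)"
    by blast
qed simp

end

section \<open>From completed graphs back to filled paths\<close>

context real_path_space begin

text \<open>Windows through which a path is fully seen up to time \<open>N\<close> in absolute
  value: an end lies strictly beyond, or it is an endpoint of \<open>I\<close>, where no path jumps
  and no part of the fibre is cut off.\<close>

definition exhausts :: "real \<Rightarrow> real \<Rightarrow> real \<Rightarrow> bool" where
  "exhausts N a b \<longleftrightarrow> a < b \<and> {a..b} \<subseteq> I \<and> (a \<in> endpoints I \<or> a < - N) \<and> (b \<in> endpoints I \<or> N < b)"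

lemma exhausts_gr:
  assumes q: "q \<in> DI" and ex: "exhausts N a b" and z: "emb z \<in> fl q" "\<bar>snd z\<bar> \<le> N"
  shows "z \<in> gr a b q"
proof -
  have ab: "a < b" "{a..b} \<subseteq> I" "a \<in> I" "b \<in> I"
    using ex by (auto simp: exhausts_def)
  have zI: "snd z \<in> I" "fst z \<in> closed_segment (path_left q (snd z)) (path_right q (snd z))"
    using z(1) filled_emb[OF q, of "fst z" "snd z"] by simp_all
  have "a \<le> snd z \<and> (snd z = a \<longrightarrow> fst z = path_right q a)"
  proof (cases "a \<in> endpoints I")
    case True
    then have "a \<le> snd z"
      using ab zI(1) by (force simp: endpoints_def)
    then show ?thesis
      using zI(2) D_endpoint[OF q True] by auto
  next
    case False
    then have "a < snd z"
      using ex z(2) by (auto simp: exhausts_def)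
    then show ?thesis
      by simp
  qed
  moreover have "snd z \<le> b"
  proof (cases "b \<in> endpoints I")
    case True
    then show ?thesis
      using ab zI(1) by (force simp: endpoints_def)
  next
    case False
    then show ?thesis
      using ex z(2) by (auto simp: exhausts_def)
  qed
  ultimately show ?thesis
    unfolding gr_iff[OF q ab(2)] using z(1) by blast
qed

lemma eventually_gr:
  assumes q: "\<And>n::nat. q n \<in> DI" and u: "\<And>n. u n \<in> fl (q n)"
    and lim: "(\<lambda>n. snd (u n)) \<longlonglongrightarrow> ereal c" and ex: "exhausts (\<bar>c\<bar> + 1) a b"
  shows "\<forall>\<^sub>F n in sequentially. \<exists>z. u n = emb z \<and> z \<in> gr a b (q n)"
proof -
  have "\<forall>\<^sub>F n in sequentially. ereal (c - 1) < snd (u n)" "\<forall>\<^sub>F n in sequentially. snd (u n) < ereal (c + 1)"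
    using order_tendstoD(1)[OF lim, of "ereal (c - 1)"] order_tendstoD(2)[OF lim, of "ereal (c + 1)"] by simp_all
  then show ?thesis
  proof eventually_elim
    case (elim n)
    then obtain z where z: "u n = emb z"
      using filled_real[OF q u, of n] by auto
    have "\<bar>snd z\<bar> \<le> \<bar>c\<bar> + 1"
      using elim by (simp add: z)
    then show ?case
      using exhausts_gr[OF q ex, of z n] u[of n] z by metis
  qed
qed

lemma filled_order_inf:
  assumes "q \<in> DI" "u \<in> fl q"
  shows "((None, -\<infinity>), u) \<in> fo q" "(u, (None, \<infinity>)) \<in> fo q"
  using filled_real[OF assms] filled_order_time(2)[OF filled_inf(1)[OF assms(1)] assms(2)]
    filled_order_time(2)[OF assms(2) filled_inf(2)[OF assms(1)]]
    Z.corder_refl[OF filled_corder[OF D_path[OF assms(1)]] assms(2)]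
  by (metis emb_simps(2) ereal_infty_less(1) ereal_less(6) less_ereal.simps(4,5) snd_conv MInfty_neq_ereal(1) ereal_MInfty_lessI ereal_infty_less(2) PInfty_neq_ereal(1))+

text \<open>Pairs at real times are approximated inside a large window. The points at infinity
  belong to every filled path and are its first and last element, so constant sequences approximate
  them.\<close>

lemma path_rel_approx:
  assumes S: "path_rel S" and p: "p \<in> DI" and q: "\<And>n. q n \<in> DI"
    and conv: "\<And>N. \<exists>a b. exhausts N a b \<and> EE.hseq (\<lambda>n. graph_rel S a b (q n)) (graph_rel S a b p)"
    and uv: "(u, v) \<in> S p"
  shows "\<exists>\<sigma> \<tau>. (\<forall>n. (\<sigma> n, \<tau> n) \<in> S (q n)) \<and> null (\<lambda>n. d (\<sigma> n) u) \<and> null (\<lambda>n. d (\<tau> n) v)"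
proof -
  have emb: "\<exists>\<sigma> \<tau>. (\<forall>n. (\<sigma> n, \<tau> n) \<in> S (q n)) \<and> null (\<lambda>n. d (\<sigma> n) (emb z)) \<and> null (\<lambda>n. d (\<tau> n) (emb w))"
    if zw: "(emb z, emb w) \<in> S p" for z w
  proof -
    obtain a b where ab: "exhausts (max \<bar>snd z\<bar> \<bar>snd w\<bar>) a b" "EE.hseq (\<lambda>n. graph_rel S a b (q n)) (graph_rel S a b p)"
      using conv by blast
    have "(z, w) \<in> graph_rel S a b p"
      unfolding graph_rel_def using exhausts_gr[OF p ab(1)] path_rel_filled[OF S zw] zw by simp
    then obtain c where c: "\<And>n. c n \<in> graph_rel S a b (q n)" "null (\<lambda>n. d_pair supd (c n) (z, w))"
      using EE.hseq_approx[OF ab(2)] by blast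
    have "(emb (fst (c n)), emb (snd (c n))) \<in> S (q n)" for n
      using c(1)[of n] by (auto simp: graph_rel_def)
    moreover have "null (\<lambda>n. d_pair supd (fst (c n), snd (c n)) (z, w))"
      using c(2) by simp
    then have "null (\<lambda>n. d (emb (fst (c n))) (emb z))" "null (\<lambda>n. d (emb (snd (c n))) (emb w))"
      unfolding E.d_pair_tendsto_iff emb_supd_iff by blast+
    ultimately show ?thesis
      by (intro exI[of _ "\<lambda>n. emb (fst (c n))"] exI[of _ "\<lambda>n. emb (snd (c n))"]) blast
  qed
  have const: "null (\<lambda>n::nat. d x x)" if "x \<in> fl p" for x
    using filled_squeezed[OF p that] by simp
  have one: "\<exists>\<sigma>. (\<forall>n. \<sigma> n \<in> fl (q n)) \<and> null (\<lambda>n. d (\<sigma> n) x)" if x: "x \<in> fl p" for x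
    using filled_real[OF p x]
  proof (elim disjE exE conjE)
    fix z assume z: "x = emb z"
    have zz: "(emb z, emb z) \<in> S p"
      using path_rel_refl[OF S p x] z by simp
    show ?thesis
      using emb[OF zz] path_rel_filled[OF S] unfolding z by blast
  next
    assume "x = (None, -\<infinity>)"
    then show ?thesis
      using filled_inf(1)[OF q] const[OF x] by (intro exI[of _ "\<lambda>n. x"]) simp
  next
    assume "x = (None, \<infinity>)"
    then show ?thesis
      using filled_inf(2)[OF q] const[OF x] by (intro exI[of _ "\<lambda>n. x"]) simp
  qed
  note F = path_rel_filled[OF S uv]
  \<comment> \<open>In the last two cases an extreme point stands on the wrong side of the pair;
    antisymmetry then makes both points equal, contrary to the case assumption.\<close>
  consider "\<exists>z w. u = emb z \<and> v = emb w" | "u = (None, -\<infinity>)" | "v = (None, \<infinity>)"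
    | "u = (None, \<infinity>)" "v \<noteq> (None, \<infinity>)" | "v = (None, -\<infinity>)" "u \<noteq> (None, -\<infinity>)"
    using filled_real[OF p F(1)] filled_real[OF p F(2)] by blast
  then show ?thesis
  proof cases
    case 1
    then show ?thesis
      using emb uv by blast
  next
    case 2
    show ?thesis
      using S unfolding path_rel_def
    proof
      assume S': "S = fo"
      obtain \<tau> where "\<And>n. \<tau> n \<in> fl (q n)" "null (\<lambda>n. d (\<tau> n) v)"
        using one[OF F(2)] by blast
      then show ?thesis
        using const[OF F(1)] filled_order_inf(1)[OF q] unfolding 2 S'
        by (intro exI[of _ "\<lambda>n. (None, -\<infinity>)"] exI[of _ \<tau>]) simp
    next
      assume S': "S = (\<lambda>p. Id_on (fl p))"
      have "v = u"
        using uv unfolding S' by auto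
      then show ?thesis
        using one[OF F(1)] unfolding S' by blast
    qed
  next
    case 3
    show ?thesis
      using S unfolding path_rel_def
    proof
      assume S': "S = fo"
      obtain \<sigma> where "\<And>n. \<sigma> n \<in> fl (q n)" "null (\<lambda>n. d (\<sigma> n) u)"
        using one[OF F(1)] by blast
      then show ?thesis
        using const[OF F(2)] filled_order_inf(2)[OF q] unfolding 3 S'
        by (intro exI[of _ \<sigma>] exI[of _ "\<lambda>n. (None, \<infinity>)"]) simp
    next
      assume S': "S = (\<lambda>p. Id_on (fl p))"
      have "v = u"
        using uv unfolding S' by auto
      then show ?thesis
        using one[OF F(1)] unfolding S' by blast
    qed
  next
    case 4
    have "(v, u) \<in> fo p"
      unfolding 4(1) by (rule filled_order_inf(2)[OF p F(2)])
    then have "v = u"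
      using S uv Z.corder_antisym[OF filled_corder[OF D_path[OF p]]] unfolding path_rel_def by blast
    then show ?thesis
      using 4 by simp
  next
    case 5
    have "(v, u) \<in> fo p"
      unfolding 5(1) by (rule filled_order_inf(1)[OF p F(1)])
    then have "v = u"
      using S uv Z.corder_antisym[OF filled_corder[OF D_path[OF p]]] unfolding path_rel_def by blast
    then show ?thesis
      using 5 by simp
  qed
qed

text \<open>The times converge along a subsequence in the compact extended line. At an infinite
  limit this is enough; at a real limit \<open>c\<close> the late points lie in the graphs over a
  window that exhausts \<open>\<bar>c\<bar> + 1\<close>, and these graphs converge.\<close>

lemma filled_seq_limit:
  assumes S: "path_rel S" and p: "p \<in> DI" and q: "\<And>n. q n \<in> DI"
    and conv: "\<And>N. \<exists>a b. exhausts N a b \<and> EE.hseq (\<lambda>n. graph_rel S a b (q n)) (graph_rel S a b p)"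
    and u: "\<And>n. u n \<in> fl (q n)"
  shows "\<exists>l\<in>fl p. \<exists>s. subseq s \<and> null (\<lambda>n. d (u (s n)) l)"
proof -
  obtain t s where s: "subseq s" "((\<lambda>n. snd (u n)) \<circ> s) \<longlonglongrightarrow> t"
    using compact_complete_linorder[of "\<lambda>n. snd (u n)"] by blast
  have lim: "(\<lambda>n. snd (u (s n))) \<longlonglongrightarrow> t"
    using s(2) by (simp add: o_def)
  have sq: "u n \<in> squeezed euclideanreal" for n
    by (rule filled_squeezed[OF q u])
  show ?thesis
  proof (cases t)
    case (real c)
    obtain a b where ab: "exhausts (\<bar>c\<bar> + 1) a b" "EE.hseq (\<lambda>n. graph_rel S a b (q n)) (graph_rel S a b p)"
      using conv by blast
    have ab': "{a..b} \<subseteq> I" "a < b"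
      using ab(1) by (simp_all add: exhausts_def)
    obtain k where "\<And>n. \<exists>z. u (s (n + k)) = emb z \<and> z \<in> gr a b (q (s (n + k)))"
      using eventually_gr[OF q u lim[unfolded real] ab(1)] unfolding eventually_sequentially by (metis le_add2)
    then obtain z where z: "\<And>n. u (s (n + k)) = emb (z n)" "\<And>n. z n \<in> gr a b (q (s (n + k)))"
      by metis
    have sk: "strict_mono (\<lambda>n. s (n + k))"
      using s(1) by (simp add: strict_mono_def)
    have "(z n, z n) \<in> graph_rel S a b (q (s (n + k)))" for n
      unfolding graph_rel_def using z(2) path_rel_refl[OF S q u, of "s (n + k)"] z(1)[of n] by simp
    then obtain l r where l: "l \<in> graph_rel S a b p" "subseq r"
      "null (\<lambda>n. d_pair supd (z (r n), z (r n)) l)"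
      using EE.hseq_compact[of "\<lambda>n. graph_rel S a b (q (s (n + k)))" "graph_rel S a b p" "\<lambda>n. (z n, z n)",
          OF EE.hseq_subseq[OF ab(2) sk] graph_rel_compact[OF S p ab']] by auto
    obtain x y where xy: "l = (x, y)"
      by (cases l)
    have "null (\<lambda>n. d (emb (z (r n))) (emb x))"
      using l(3) unfolding xy E.d_pair_tendsto_iff emb_supd_iff by blast
    then have "null (\<lambda>n. d (u (s (r n + k))) (emb x))"
      by (simp add: z(1))
    moreover have "strict_mono (\<lambda>n. s (r n + k))"
      using sk l(2) by (simp add: strict_mono_def)
    moreover have "emb x \<in> fl p"
      using l(1) path_rel_filled[OF S] unfolding graph_rel_def xy by blast
    ultimately show ?thesis
      by blast
  next
    case PInf
    have "null (\<lambda>n. d (u (s n)) (None, \<infinity>))"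
      by (rule lim_inf[of "\<lambda>n. u (s n)", OF sq filled_squeezed[OF p filled_inf(2)[OF p]] lim[unfolded PInf]])
    then show ?thesis
      using s(1) filled_inf(2)[OF p] by blast
  next
    case MInf
    have "null (\<lambda>n. d (u (s n)) (None, -\<infinity>))"
      by (rule lim_inf[of "\<lambda>n. u (s n)", OF sq filled_squeezed[OF p filled_inf(1)[OF p]] lim[unfolded MInf]])
    then show ?thesis
      using s(1) filled_inf(1)[OF p] by blast
  qed
qed

lemma path_rel_closed:
  assumes S: "path_rel S" and p: "p \<in> DI" and q: "\<And>n. q n \<in> DI"
    and conv: "\<And>N. \<exists>a b. exhausts N a b \<and> EE.hseq (\<lambda>n. graph_rel S a b (q n)) (graph_rel S a b p)"
    and uv: "\<And>n. (u n, v n) \<in> S (q n)" and l: "l \<in> fl p" "m \<in> fl p"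
    and lim: "null (\<lambda>n. d (u n) l)" "null (\<lambda>n. d (v n) m)"
  shows "(l, m) \<in> S p"
  using S unfolding path_rel_def
proof
  note F = path_rel_filled[OF S uv]
  note X = filled_squeezed[OF q F(1)] filled_squeezed[OF q F(2)] filled_squeezed[OF p l(1)] filled_squeezed[OF p l(2)]
  {
    assume S': "S = (\<lambda>p. Id_on (fl p))"
    have "v n = u n" for n
      using uv[of n] unfolding S' by auto
    then have "l = m"
      using Z.seq_unique[of u l m, OF X(1,3,4) lim(1)] lim(2) by simp
    then show ?thesis
      using l unfolding S' by blast
  next
    assume S': "S = fo"
    have t: "(\<lambda>n. snd (u n)) \<longlonglongrightarrow> snd l" "(\<lambda>n. snd (v n)) \<longlonglongrightarrow> snd m"
      by (rule lim_time[OF X(1,3) lim(1)], rule lim_time[OF X(2,4) lim(2)])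
    have "snd (u n) \<le> snd (v n)" for n
      using filled_order_time(1) uv unfolding S' by blast
    then have "snd l \<le> snd m"
      using LIMSEQ_le[OF t] by blast
    then consider "snd l < snd m" | "snd l = snd m" "\<exists>z w. l = emb z \<and> m = emb w" | "l = m"
      using filled_real[OF p l(1)] filled_real[OF p l(2)] by fastforce
    then show ?thesis
    proof cases
      case 1
      then show ?thesis
        using filled_order_time(2)[OF l] unfolding S' by blast
    next
      case 2
      then obtain z w where zw: "l = emb z" "m = emb w" "snd w = snd z"
        by auto
      obtain a b where ab: "exhausts (\<bar>snd z\<bar> + 1) a b" "EE.hseq (\<lambda>n. graph_rel S a b (q n)) (graph_rel S a b p)"
        using conv by blast
      have ab': "{a..b} \<subseteq> I" "a < b"
        using ab(1) by (simp_all add: exhausts_def)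
      have "(\<lambda>n. snd (u n)) \<longlonglongrightarrow> ereal (snd z)" "(\<lambda>n. snd (v n)) \<longlonglongrightarrow> ereal (snd z)"
        using t zw by simp_all
      then have "\<forall>\<^sub>F n in sequentially. (\<exists>z. u n = emb z \<and> z \<in> gr a b (q n)) \<and> (\<exists>z. v n = emb z \<and> z \<in> gr a b (q n))"
        by (intro eventually_conj eventually_gr[of q u, OF q F(1) _ ab(1)] eventually_gr[of q v, OF q F(2) _ ab(1)])
      then obtain k where "\<And>n. (\<exists>z. u (n + k) = emb z \<and> z \<in> gr a b (q (n + k))) \<and> (\<exists>z. v (n + k) = emb z \<and> z \<in> gr a b (q (n + k)))"
        unfolding eventually_sequentially by (metis le_add2)
      then obtain x y where xy: "\<And>n. u (n + k) = emb (x n)" "\<And>n. x n \<in> gr a b (q (n + k))"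
        "\<And>n. v (n + k) = emb (y n)" "\<And>n. y n \<in> gr a b (q (n + k))"
        by metis
      have k: "strict_mono (\<lambda>n. n + k)"
        by (simp add: strict_mono_def)
      have "(z, w) \<in> graph_rel S a b p"
      proof (rule EE.hseq_limit[of "\<lambda>n. graph_rel S a b (q (n + k))" _ "\<lambda>n. (x n, y n)",
            OF EE.hseq_subseq[OF ab(2) k] graph_rel_compact[OF S p ab']])
        show "(x n, y n) \<in> graph_rel S a b (q (n + k))" for n
          unfolding graph_rel_def using xy(2,4) uv[of "n + k"] xy(1,3)[of n] by simp
        have "null (\<lambda>n. d (emb (x n)) (emb z))" "null (\<lambda>n. d (emb (y n)) (emb w))"
          using strict_mono_subseq_tendsto[OF k lim(1)] strict_mono_subseq_tendsto[OF k lim(2)]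
          unfolding xy(1,3) zw(1,2) .
        then show "null (\<lambda>n. d_pair supd (x n, y n) (z, w))"
          unfolding E.d_pair_tendsto_iff emb_supd_iff by blast
      qed simp_all
      then show ?thesis
        unfolding graph_rel_def zw(1,2) by blast
    next
      case 3
      then show ?thesis
        using path_rel_refl[OF S p l(1)] by simp
    qed
  }
qed

lemma path_rel_lim:
  assumes S: "path_rel S" and p: "p \<in> DI" and q: "\<And>n. q n \<in> DI" and e: "e > 0"
    and conv: "\<And>N. \<exists>a b. exhausts N a b \<and> EE.hseq (\<lambda>n. graph_rel S a b (q n)) (graph_rel S a b p)"
  shows "\<forall>\<^sub>F n in sequentially. hclose (d_pair d) e (S (q n)) (S p)"
proof (rule P.hclose_eventuallyI[OF path_rel_compact[OF S p] path_rel_sub[OF S q] e])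
  fix l assume l: "l \<in> S p"
  obtain u v where uv: "l = (u, v)"
    by (cases l)
  obtain \<sigma> \<tau> where "\<forall>n. (\<sigma> n, \<tau> n) \<in> S (q n)" "null (\<lambda>n. d (\<sigma> n) u)" "null (\<lambda>n. d (\<tau> n) v)"
    using path_rel_approx[OF S p q conv l[unfolded uv]] by blast
  then show "\<exists>\<sigma>. (\<forall>n. \<sigma> n \<in> S (q n)) \<and> null (\<lambda>n. d_pair d (\<sigma> n) l)"
    unfolding uv using Z.d_pair_tendsto_iff by (intro exI[of _ "\<lambda>n. (\<sigma> n, \<tau> n)"]) blast
next
  fix r :: "nat \<Rightarrow> nat" and c assume r: "strict_mono r" and c: "\<And>n. c n \<in> S (q (r n))"
  have conv': "\<exists>a b. exhausts N a b \<and> EE.hseq (\<lambda>n. graph_rel S a b (q (r (s n)))) (graph_rel S a b p)"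
    if s: "subseq s" for N s
  proof -
    have "strict_mono (\<lambda>n. r (s n))"
      using r s by (simp add: strict_mono_def)
    then show ?thesis
      using conv[of N] EE.hseq_subseq[of _ _ "\<lambda>n. r (s n)"] by blast
  qed
  have id: "strict_mono (\<lambda>n::nat. n)"
    by (simp add: strict_mono_def)
  define u v where "u n = fst (c n)" and "v n = snd (c n)" for n
  have uv: "(u n, v n) \<in> S (q (r n))" for n
    using c[of n] by (simp add: u_def v_def)
  note F = path_rel_filled[OF S uv]
  obtain l s where l: "l \<in> fl p" "subseq s" "null (\<lambda>n. d (u (s n)) l)"
    using filled_seq_limit[OF S p q conv'[OF id] F(1)] by blast
  obtain m t where m: "m \<in> fl p" "subseq t" "null (\<lambda>n. d (v (s (t n))) m)"
    using filled_seq_limit[OF S p q conv'[OF l(2)] F(2)] by blast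
  have st: "strict_mono (\<lambda>n. s (t n))"
    using l(2) m(2) by (simp add: strict_mono_def)
  have l': "null (\<lambda>n. d (u (s (t n))) l)"
    by (rule strict_mono_subseq_tendsto[OF m(2) l(3)])
  have "(l, m) \<in> S p"
    by (rule path_rel_closed[OF S p q conv'[OF st] uv l(1) m(1) l' m(3)])
  moreover have "null (\<lambda>n. d_pair d (u (s (t n)), v (s (t n))) (l, m))"
    unfolding Z.d_pair_tendsto_iff using l' m(3) by blast
  then have "null (\<lambda>n. d_pair d (c (s (t n))) (l, m))"
    by (simp add: u_def v_def)
  ultimately show "\<exists>l\<in>S p. \<exists>s. subseq s \<and> null (\<lambda>n. d_pair d (c (s n)) l)"
    using st by blast
qed

text \<open>Approached from other times, the filled path has only the left and the right value as
  limits over \<open>t\<close>. So the midpoint of a jump is not a limit of points at other times,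
  and a countable dense subset of the real-time part of the filled path has a point at every jump
  time.\<close>

lemma countable_jumps:
  assumes p: "p \<in> DI"
  shows "countable {t \<in> I. path_left p t \<noteq> path_right p t}"
proof -
  obtain D where D: "countable D" "D \<subseteq> {z. emb z \<in> fl p}" "{z. emb z \<in> fl p} \<subseteq> closure D"
    using separable[of "{z. emb z \<in> fl p}"] by blast
  have "t \<in> snd ` D" if t: "t \<in> I" "path_left p t \<noteq> path_right p t" for t
  proof (rule ccontr)
    assume no: "t \<notin> snd ` D"
    define m where "m = ((path_left p t + path_right p t) / 2, t)"
    have "(path_left p t + path_right p t) / 2 \<in> closed_segment (path_left p t) (path_right p t)"
      by (auto simp: closed_segment_eq_real_ivl)
    then have "m \<in> closure D"
      using D(3) t(1) filled_emb[OF p] unfolding m_def by blast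
    then obtain v where v: "\<And>n. v n \<in> D" "v \<longlonglongrightarrow> m"
      unfolding closure_sequential by blast
    have vF: "emb (v n) \<in> fl p" and vt: "snd (v n) \<noteq> t" for n
      using v(1)[of n] D(2) no by auto
    have time: "(\<lambda>n. snd (v n)) \<longlonglongrightarrow> t"
      using tendsto_snd[OF v(2)] by (simp add: m_def)
    show False
    proof (cases "\<forall>\<^sub>F n in sequentially. \<not> snd (v n) < t")
      case True
      then obtain k where "\<And>n. \<not> snd (v (n + k)) < t"
        unfolding eventually_sequentially by (metis le_add2)
      then have "t < snd (v (n + k))" for n
        using vt[of "n + k"] by (metis linorder_neqE_linordered_idom)
      then have "(\<lambda>n. v (n + k)) \<longlonglongrightarrow> (path_right p t, t)"
        by (intro right_limit_seq[OF p vF _ _ t(1)] LIMSEQ_ignore_initial_segment[OF time])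
      then have "m = (path_right p t, t)"
        using LIMSEQ_unique[OF LIMSEQ_ignore_initial_segment[OF v(2)]] by blast
      then show False
        using t(2) by (simp add: m_def)
    next
      case False
      then obtain r :: "nat \<Rightarrow> nat" where r: "strict_mono r" "\<And>n. snd (v (r n)) < t"
        using frequently_subseq[of "\<lambda>n. snd (v n) < t"] by blast
      have "(\<lambda>n. v (r n)) \<longlonglongrightarrow> (path_left p t, t)"
        by (intro left_limit_seq[OF p vF r(2) _ t(1)] strict_mono_subseq_tendsto[OF r(1) time])
      then have "m = (path_left p t, t)"
        using LIMSEQ_unique[OF strict_mono_subseq_tendsto[OF r(1) v(2)]] by blast
      then show False
        using t(2) by (simp add: m_def)
    qed
  qed
  then have "{t \<in> I. path_left p t \<noteq> path_right p t} \<subseteq> snd ` D"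
    by blast
  then show ?thesis
    by (rule countable_subset) (rule countable_image[OF D(1)])
qed

lemma good_between:
  assumes p: "p \<in> DI" and xy: "x \<in> I" "y \<in> I" "x < y"
  shows "\<exists>t. x < t \<and> t < y \<and> path_left p t = path_right p t"
proof (rule ccontr)
  assume no: "\<not> ?thesis"
  have "{x<..<y} \<subseteq> {t \<in> I. path_left p t \<noteq> path_right p t}"
    using no I_between[OF xy(1,2)] by auto
  then have "countable {x<..<y}"
    using countable_subset countable_jumps[OF p] by blast
  then show False
    using uncountable_open_interval[of x y] xy(3) by blast
qed

text \<open>A bounded side of \<open>I\<close> ends at an endpoint, where no path jumps. On an
  unbounded side two points of \<open>I\<close> are taken far out, and a time without jump is found
  between them.\<close>

lemma exhausts_exists:
  assumes p: "p \<in> DI"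
  shows "\<exists>a b. exhausts N a b \<and> path_left p a = path_right p a \<and> path_left p b = path_right p b"
proof -
  obtain x y where xy: "x \<in> I" "y \<in> I" "x < y"
    using I unfolding closed_real_interval_def by blast
  have cl: "closed I"
    using I by (simp add: closed_real_interval_def)
  have "\<exists>a\<in>I. a \<le> x \<and> (a \<in> endpoints I \<or> a < - N) \<and> path_left p a = path_right p a"
  proof (cases "bdd_below I")
    case True
    then have "Inf I \<in> endpoints I" "Inf I \<in> I" "Inf I \<le> x"
      using closed_contains_Inf[OF _ True cl] xy(1) by (auto simp: endpoints_def intro: cInf_lower)
    then show ?thesis
      using D_endpoint[OF p] by blast
  next
    case False
    then obtain s where s: "s \<in> I" "s < min x (- N)"
      unfolding bdd_below_def by (metis not_le)
    obtain s' where s': "s' \<in> I" "s' < s"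
      using False unfolding bdd_below_def by (metis not_le)
    obtain t where t: "s' < t" "t < s" "path_left p t = path_right p t"
      using good_between[OF p s'(1) s(1) s'(2)] by blast
    have "t \<in> I"
      using I_between[OF s'(1) s(1)] t by simp
    then show ?thesis
      using t s(2) by (intro bexI[of _ t]) auto
  qed
  moreover have "\<exists>b\<in>I. y \<le> b \<and> (b \<in> endpoints I \<or> N < b) \<and> path_left p b = path_right p b"
  proof (cases "bdd_above I")
    case True
    then have "Sup I \<in> endpoints I" "Sup I \<in> I" "y \<le> Sup I"
      using closed_contains_Sup[OF _ True cl] xy(2) by (auto simp: endpoints_def intro: cSup_upper)
    then show ?thesis
      using D_endpoint[OF p] by blast
  next
    case False
    then obtain s where s: "s \<in> I" "max y N < s"
      unfolding bdd_above_def by (metis not_le)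
    obtain s' where s': "s' \<in> I" "s < s'"
      using False unfolding bdd_above_def by (metis not_le)
    obtain t where t: "s < t" "t < s'" "path_left p t = path_right p t"
      using good_between[OF p s(1) s'(1) s'(2)] by blast
    have "t \<in> I"
      using I_between[OF s(1) s'(1)] t by simp
    then show ?thesis
      using t s(2) by (intro bexI[of _ t]) auto
  qed
  ultimately obtain a b where a: "a \<in> I" "a \<le> x" "a \<in> endpoints I \<or> a < - N" "path_left p a = path_right p a"
    and b: "b \<in> I" "y \<le> b" "b \<in> endpoints I \<or> N < b" "path_left p b = path_right p b"
    by blast
  have "{a..b} \<subseteq> I"
    using I_between[OF a(1) b(1)] by auto
  then show ?thesis
    using a b xy(3) by (intro exI[of _ a] exI[of _ b]) (simp add: exhausts_def)
qed

lemma exhausts_compact: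
  assumes "compact I"
  shows "exhausts N (Inf I) (Sup I)" "Inf I \<in> endpoints I" "Sup I \<in> endpoints I"
proof -
  obtain x y where xy: "x \<in> I" "y \<in> I" "x < y"
    using I unfolding closed_real_interval_def by blast
  have bd: "bdd_below I" "bdd_above I" "closed I"
    using assms by (auto intro: compact_imp_closed bounded_imp_bdd_below bounded_imp_bdd_above compact_imp_bounded)
  have mem: "Inf I \<in> I" "Sup I \<in> I"
    using closed_contains_Inf[OF _ bd(1,3)] closed_contains_Sup[OF _ bd(2,3)] xy(1) by blast+
  show e: "Inf I \<in> endpoints I" "Sup I \<in> endpoints I"
    using mem bd by (auto simp: endpoints_def intro: cInf_lower cSup_upper)
  have "Inf I \<le> x" "y \<le> Sup I"
    using bd xy by (auto intro: cInf_lower cSup_upper)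
  then have "Inf I < Sup I"
    using xy(3) by linarith
  then show "exhausts N (Inf I) (Sup I)"
    using e I_between[OF mem] by (auto simp: exhausts_def)
qed

end

section \<open>Skorokhod's topologies\<close>

context real_path_space begin

lemma DI_limitin_iff:
  assumes "Metric_space DI \<delta>" "range q \<subseteq> DI" "p \<in> DI"
  shows "limitin (Metric_space.mtopology DI \<delta>) q p sequentially \<longleftrightarrow> null (\<lambda>n. \<delta> (q n) p)"
  using Metric_space.seq_limitin_iff[OF assms(1), of q p] assms(2,3) by blast

text \<open>Both identifications with Skorokhod's topologies are instances. The distances enter only
  through closeness of relations. In \<open>\<rho>_le\<close> the radius depends on
  \<open>p\<close>, because closeness of graph orders bounds the M1 distance only with a modulus
  that belongs to one of the graphs. Windows ending at good points of \<open>p\<close> serve for one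
  direction, exhausting windows for the other.\<close>

lemma skorokhod_topology_eq:
  assumes S: "path_rel S" and \<delta>: "Metric_space DI \<delta>"
    and \<delta>_less: "\<And>p q r. p \<in> DI \<Longrightarrow> q \<in> DI \<Longrightarrow> \<delta> q p < r \<Longrightarrow> hclose (d_pair d) r (S q) (S p)"
    and \<delta>_le: "\<And>p q r. p \<in> DI \<Longrightarrow> q \<in> DI \<Longrightarrow> hclose (d_pair d) r (S q) (S p) \<Longrightarrow> \<delta> q p \<le> r"
    and \<rho>_less: "\<And>a b p q r. {a..b} \<subseteq> I \<Longrightarrow> a < b \<Longrightarrow> p \<in> DI \<Longrightarrow> q \<in> DI \<Longrightarrow>
      \<rho> a b (path_right q) (path_right p) < r \<Longrightarrow> hclose (d_pair supd) r (graph_rel S a b q) (graph_rel S a b p)"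
    and \<rho>_le: "\<And>a b p e. {a..b} \<subseteq> I \<Longrightarrow> a < b \<Longrightarrow> p \<in> DI \<Longrightarrow> e > 0 \<Longrightarrow>
      \<exists>\<eta>>0. \<forall>q\<in>DI. hclose (d_pair supd) \<eta> (graph_rel S a b q) (graph_rel S a b p) \<longrightarrow>
        \<rho> a b (path_right q) (path_right p) \<le> e"
    and \<rho>_metric: "compact I \<Longrightarrow>
      Metric_space DI (\<lambda>p q. if p \<in> DI \<and> q \<in> DI then \<rho> (Inf I) (Sup I) (path_right p) (path_right q) else 0)"
  shows "skorokhod_topology \<rho> I = Metric_space.mtopology DI \<delta>"
proof -
  interpret D: Metric_space DI \<delta> by fact
  have \<rho>_nonneg: "0 \<le> \<rho> a b (path_right q) (path_right p)"
    if ab: "{a..b} \<subseteq> I" "a < b" and p: "p \<in> DI" and q: "q \<in> DI" for a b p q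
  proof (rule field_le_epsilon)
    fix e :: real assume "e > 0"
    then have h: "hclose (d_pair supd) (\<rho> a b (path_right q) (path_right p) + e) (graph_rel S a b q) (graph_rel S a b p)"
      by (intro \<rho>_less[OF ab p q]) simp
    have g: "(path_right q b, b) \<in> gr a b q"
      by (rule gr_ends[OF q ab])
    then have "emb (path_right q b, b) \<in> fl q"
      unfolding gr_iff[OF q ab(1)] by blast
    then have "((path_right q b, b), (path_right q b, b)) \<in> graph_rel S a b q"
      unfolding graph_rel_def using g path_rel_refl[OF S q] by blast
    then have "graph_rel S a b q \<noteq> {}"
      by blast
    then show "0 \<le> \<rho> a b (path_right q) (path_right p) + e"
      by (rule EE.hclose_nonneg[OF h])
  qed
  have fwd: "null (\<lambda>n. \<rho> a b (path_right (q n)) (path_right p))"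
    if lim: "null (\<lambda>n. \<delta> (q n) p)" and p: "p \<in> DI" and q: "\<And>n. q n \<in> DI" and ab: "{a..b} \<subseteq> I" "a < b"
      and good: "path_left p a = path_right p a" "path_left p b = path_right p b" for p q a b
  proof (rule tendsto_0_hclose[where d = "d_pair supd" and K = "\<lambda>n. graph_rel S a b (q n)" and L = "graph_rel S a b p"])
    have hs: "P.hseq (\<lambda>n. S (q n)) (S p)"
      by (rule P.hseqI_less[OF lim \<delta>_less[OF p q]])
    show "\<forall>\<^sub>F n in sequentially. hclose (d_pair supd) e (graph_rel S a b (q n)) (graph_rel S a b p)" if e: "e > 0" for e
      by (rule graph_rel_lim[OF S p q hs ab good e])
    show "\<exists>\<eta>>0. \<forall>n. hclose (d_pair supd) \<eta> (graph_rel S a b (q n)) (graph_rel S a b p) \<longrightarrow>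
        \<rho> a b (path_right (q n)) (path_right p) \<le> e" if e: "e > 0" for e
      using \<rho>_le[OF ab p e] q by blast
  qed (rule \<rho>_nonneg[OF ab p q])
  have bwd: "null (\<lambda>n. \<delta> (q n) p)"
    if p: "p \<in> DI" and q: "\<And>n. q n \<in> DI"
      and lim: "\<And>N. \<exists>a b. exhausts N a b \<and> null (\<lambda>n. \<rho> a b (path_right (q n)) (path_right p))" for p q
  proof (rule tendsto_0_hclose[where d = "d_pair d" and K = "\<lambda>n. S (q n)" and L = "S p"])
    have "\<exists>a b. exhausts N a b \<and> EE.hseq (\<lambda>n. graph_rel S a b (q n)) (graph_rel S a b p)" for N
    proof -
      obtain a b where ab: "exhausts N a b" and l: "null (\<lambda>n. \<rho> a b (path_right (q n)) (path_right p))"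
        using lim by blast
      have ab': "{a..b} \<subseteq> I" "a < b"
        using ab by (simp_all add: exhausts_def)
      have "EE.hseq (\<lambda>n. graph_rel S a b (q n)) (graph_rel S a b p)"
        by (rule EE.hseqI_less[OF l \<rho>_less[OF ab' p q]])
      then show ?thesis
        using ab by blast
    qed
    then show "\<forall>\<^sub>F n in sequentially. hclose (d_pair d) e (S (q n)) (S p)" if e: "e > 0" for e
      by (rule path_rel_lim[OF S p q e])
    show "\<exists>\<eta>>0. \<forall>n. hclose (d_pair d) \<eta> (S (q n)) (S p) \<longrightarrow> \<delta> (q n) p \<le> e" if "e > 0" for e
      using \<delta>_le[OF p q] that by blast
  qed simp
  show ?thesis
  proof (cases "compact I")
    case True
    let ?\<rho> = "\<lambda>p q. if p \<in> DI \<and> q \<in> DI then \<rho> (Inf I) (Sup I) (path_right p) (path_right q) else 0"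
    interpret R: Metric_space DI ?\<rho>
      by (rule \<rho>_metric[OF True])
    note ex = exhausts_compact[OF True]
    have ab: "{Inf I..Sup I} \<subseteq> I" "Inf I < Sup I"
      using ex(1) by (simp_all add: exhausts_def)
    have "R.mtopology = D.mtopology"
    proof (rule metrizable_topology_eqI[OF R.metrizable_space_mtopology D.metrizable_space_mtopology])
      fix q :: "nat \<Rightarrow> real path" and p assume "range q \<subseteq> topspace R.mtopology" "p \<in> topspace R.mtopology"
      then have q: "range q \<subseteq> DI" and p: "p \<in> DI"
        by simp_all
      have qD: "q n \<in> DI" for n
        using q by blast
      have eq: "(\<lambda>n. ?\<rho> (q n) p) = (\<lambda>n. \<rho> (Inf I) (Sup I) (path_right (q n)) (path_right p))"
        using p qD by simp
      show "limitin R.mtopology q p sequentially \<longleftrightarrow> limitin D.mtopology q p sequentially"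
        unfolding DI_limitin_iff[OF \<delta> q p] DI_limitin_iff[OF R.Metric_space_axioms q p] eq
      proof
        assume l: "null (\<lambda>n. \<rho> (Inf I) (Sup I) (path_right (q n)) (path_right p))"
        show "null (\<lambda>n. \<delta> (q n) p)"
          by (rule bwd[OF p qD]) (intro exI conjI, rule ex(1), rule l)
      next
        assume l: "null (\<lambda>n. \<delta> (q n) p)"
        show "null (\<lambda>n. \<rho> (Inf I) (Sup I) (path_right (q n)) (path_right p))"
          by (rule fwd[OF l p qD ab D_endpoint[OF p ex(2)] D_endpoint[OF p ex(3)]])
      qed
    qed simp
    then show ?thesis
      using True by (simp add: skorokhod_topology_def)
  next
    case False
    let ?lim = "\<lambda>q p. \<forall>a b. a < b \<and> {a..b} \<subseteq> I \<and> good_point I (path_right p) a \<and> good_point I (path_right p) b \<longrightarrow>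
      null (\<lambda>n. \<rho> a b (path_right (q n)) (path_right p))"
    have lim: "limitin D.mtopology q p sequentially \<longleftrightarrow> ?lim q p" if q: "range q \<subseteq> DI" and p: "p \<in> DI" for q p
      unfolding DI_limitin_iff[OF \<delta> q p]
    proof
      have qD: "q n \<in> DI" for n
        using q by blast
      {
        assume l: "null (\<lambda>n. \<delta> (q n) p)"
        show "?lim q p"
        proof (intro allI impI)
          fix a b assume ab: "a < b \<and> {a..b} \<subseteq> I \<and> good_point I (path_right p) a \<and> good_point I (path_right p) b"
          then have "a \<in> I" "b \<in> I"
            by auto
          then show "null (\<lambda>n. \<rho> a b (path_right (q n)) (path_right p))"
            by (intro fwd[OF l p qD]) (use ab good_point_iff[OF p] in blast)+
        qed
      next
        assume l: "?lim q p"
        show "null (\<lambda>n. \<delta> (q n) p)"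
        proof (rule bwd[OF p qD])
          fix N
          obtain a b where ab: "exhausts N a b" "path_left p a = path_right p a" "path_left p b = path_right p b"
            using exhausts_exists[OF p] by blast
          then have ab': "a < b" "{a..b} \<subseteq> I" "a \<in> I" "b \<in> I"
            by (auto simp: exhausts_def)
          have "null (\<lambda>n. \<rho> a b (path_right (q n)) (path_right p))"
            using l ab' ab(2,3) good_point_iff[OF p] by simp
          then show "\<exists>a b. exhausts N a b \<and> null (\<lambda>n. \<rho> a b (path_right (q n)) (path_right p))"
            using ab(1) by blast
        qed
      }
    qed
    show ?thesis
      unfolding skorokhod_topology_def Let_def if_not_P[OF False]
    proof (rule the_equality)
      show "metrizable_space D.mtopology \<and> topspace D.mtopology = DI \<and>
          (\<forall>q p. range q \<subseteq> DI \<and> p \<in> DI \<longrightarrow> (limitin D.mtopology q p sequentially \<longleftrightarrow> ?lim q p))"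
        using D.metrizable_space_mtopology lim by simp
      fix T assume T: "metrizable_space T \<and> topspace T = DI \<and>
          (\<forall>q p. range q \<subseteq> DI \<and> p \<in> DI \<longrightarrow> (limitin T q p sequentially \<longleftrightarrow> ?lim q p))"
      show "T = D.mtopology"
      proof (rule metrizable_topology_eqI[OF _ D.metrizable_space_mtopology])
        show "limitin T q p sequentially \<longleftrightarrow> limitin D.mtopology q p sequentially"
          if "range q \<subseteq> topspace T" "p \<in> topspace T" for q p
        proof -
          have q: "range q \<subseteq> DI" "p \<in> DI"
            using that T by simp_all
          then show ?thesis
            unfolding lim[OF q] using T by blast
        qed
      qed (use T in simp_all)
    qed
  qed
qed

lemma gr_inj:
  assumes "compact I" and p: "p \<in> DI" and q: "q \<in> DI" and eq: "gr (Inf I) (Sup I) p = gr (Inf I) (Sup I) q"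
  shows "p = q"
proof (rule filled_inj[OF p q])
  have ab: "{Inf I..Sup I} \<subseteq> I"
    using exhausts_compact(1)[OF assms(1)] by (simp add: exhausts_def)
  have sub: "fl p \<subseteq> fl q"
    if p: "p \<in> DI" and q: "q \<in> DI" and eq: "gr (Inf I) (Sup I) p = gr (Inf I) (Sup I) q" for p q
  proof
    fix u assume u: "u \<in> fl p"
    show "u \<in> fl q"
      using filled_real[OF p u]
    proof (elim disjE exE conjE)
      fix z assume z: "u = emb z"
      have "z \<in> gr (Inf I) (Sup I) q"
        using exhausts_gr[OF p exhausts_compact(1)[OF assms(1)], of z "\<bar>snd z\<bar>"] u eq z by simp
      then show ?thesis
        unfolding gr_iff[OF q ab] z by blast
    qed (use filled_inf[OF q] in simp_all)
  qed
  show "fl p = fl q"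
    using sub[OF p q eq] sub[OF q p eq[symmetric]] by blast
qed

lemma M1_topology_eq: "M1_topology I = Metric_space.mtopology DI (d_part euclideanreal closed_segment d)"
  unfolding M1_topology_def
proof (rule skorokhod_topology_eq[where S = "fo"])
  show "path_rel (fo)"
    by (simp add: path_rel_def)
  show "Metric_space DI (d_part euclideanreal closed_segment d)"
    by (rule Metric_space.subspace[OF Metric_space_d_part D_paths_sub])
  show "hclose (d_pair supd) r (graph_rel (fo) a b q) (graph_rel (fo) a b p)"
    if ab: "{a..b} \<subseteq> I" "a < b" and p: "p \<in> DI" and q: "q \<in> DI" and "rho_M1 a b (path_right q) (path_right p) < r" for a b p q r
    unfolding graph_rel_order[OF p ab(1)] graph_rel_order[OF q ab(1)]
    by (rule E.tclose_imp_hclose_pair[OF gr_corder[OF q ab] gr_corder[OF p ab] rho_M1_less[OF q p ab that(5)]])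
  show "\<exists>\<eta>>0. \<forall>q\<in>DI. hclose (d_pair supd) \<eta> (graph_rel (fo) a b q) (graph_rel (fo) a b p) \<longrightarrow>
      rho_M1 a b (path_right q) (path_right p) \<le> e"
    if ab: "{a..b} \<subseteq> I" "a < b" and p: "p \<in> DI" and e: "e > 0" for a b p e
  proof -
    \<comment> \<open>The modulus belongs to the graph of the fixed path \<open>p\<close>, whereas
      \<open>q\<close> stands first in the distance; symmetry of \<open>hclose\<close> and
      \<open>tclose\<close> exchanges the two.\<close>
    obtain \<eta> where \<eta>: "\<eta> > 0" "\<And>A le. E.corder A le \<Longrightarrow> hclose (d_pair supd) \<eta> (gle a b p) le \<Longrightarrow> E.tclose e (gr a b p) (gle a b p) A le"
      using E.hclose_pair_imp_tclose[OF gr_corder[OF p ab] e] by blast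
    have "rho_M1 a b (path_right q) (path_right p) \<le> e"
      if q: "q \<in> DI" and h: "hclose (d_pair supd) \<eta> (gle a b q) (gle a b p)" for q
      by (rule rho_M1_le[OF q p ab E.tclose_sym[OF \<eta>(2)[OF gr_corder[OF q ab] EE.hclose_sym[OF h]]]])
    then show ?thesis
      using \<eta>(1) graph_rel_order[OF p ab(1)] graph_rel_order[OF _ ab(1)] by (intro exI[of _ \<eta>]) simp
  qed
  show "Metric_space DI (\<lambda>p q. if p \<in> DI \<and> q \<in> DI then rho_M1 (Inf I) (Sup I) (path_right p) (path_right q) else 0)"
    if c: "compact I"
  proof -
    have ab: "{Inf I..Sup I} \<subseteq> I" "Inf I < Sup I"
      using exhausts_compact(1)[OF c] by (simp_all add: exhausts_def)
    note ord = gr_corder[OF _ ab]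
    let ?R = "\<lambda>r p q. E.tclose r (gr (Inf I) (Sup I) p) (gle (Inf I) (Sup I) p) (gr (Inf I) (Sup I) q) (gle (Inf I) (Sup I) q)"
    have close: "hclose supd r (gr (Inf I) (Sup I) p) (gr (Inf I) (Sup I) q)" if "?R r p q" and p: "p \<in> DI" and q: "q \<in> DI" for p q r
      by (rule E.hclose_pair_imp_hclose[OF ord[OF p] ord[OF q] E.tclose_imp_hclose_pair[OF ord[OF p] ord[OF q] that(1)]])
    show ?thesis
    proof (rule metric_from_closeness[where P = DI and R = ?R])
      show "p = q" if p: "p \<in> DI" and q: "q \<in> DI" and r: "\<And>r. r > 0 \<Longrightarrow> ?R r p q" for p q
        by (rule gr_inj[OF c p q E.hclose_limit_eq[OF close[OF r p q] E.corder_compact[OF ord[OF p]] E.corder_compact[OF ord[OF q]]]])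
      show "0 \<le> r" if p: "p \<in> DI" and q: "q \<in> DI" and r: "?R r p q" for p q r
        by (rule E.hclose_nonneg[OF close[OF r p q] E.corder_nonempty[OF ord[OF p]]])
      show "?R (r + s) p u" if "p \<in> DI" "q \<in> DI" "u \<in> DI" "?R r p q" "?R s q u" for p q u r s
        by (rule E.tclose_trans[OF ord[OF that(1)] ord[OF that(2)] ord[OF that(3)] that(4,5)])
      show "?R 0 p p" if "p \<in> DI" for p
        by (rule E.tclose_refl[OF ord[OF that]])
      show "?R r q p" if "?R r p q" for p q r
        by (rule E.tclose_sym[OF that])
    qed (use rho_M1_le[OF _ _ ab] rho_M1_less[OF _ _ ab] in auto)
  qed
qed (use d_part_less[OF D_path D_path] d_part_le[OF D_path D_path] in blast)+

text \<open>On all paths \<open>d_H\<close> need not separate points: two values at a single time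
  can be ordered in two ways with the same filled set. Separation is therefore shown on
  \<open>DI\<close>, through \<open>filled_inj\<close>, and the other axioms on all paths.\<close>

lemma Metric_space_d_H: "Metric_space DI (d_H euclideanreal closed_segment d)"
proof (rule metric_from_closeness[where P = "paths euclideanreal" and
      R = "\<lambda>r p q. hclose d r (fl p) (fl q)"])
  show "p = q" if p: "p \<in> DI" and q: "q \<in> DI"
    and r: "\<And>r. r > 0 \<Longrightarrow> hclose d r (fl p) (fl q)" for p q
    by (rule filled_inj[OF p q Z.hclose_limit_eq[OF r filled_compact[OF D_path[OF p]] filled_compact[OF D_path[OF q]]]])
  show "0 \<le> r" if "p \<in> paths euclideanreal" "hclose d r (fl p) (fl q)" for p q r
    by (rule Z.hclose_nonneg[OF that(2) Z.corder_nonempty[OF filled_corder[OF that(1)]]])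
  show "hclose d (r + s) (fl p) (fl u)"
    if "p \<in> paths euclideanreal" "q \<in> paths euclideanreal" "u \<in> paths euclideanreal"
      "hclose d r (fl p) (fl q)"
      "hclose d s (fl q) (fl u)" for p q u r s
    by (rule Z.hclose_trans[OF that(4,5) filled_sub[OF that(1)] filled_sub[OF that(2)] filled_sub[OF that(3)]])
  show "hclose d 0 (fl p) (fl p)" if "p \<in> paths euclideanreal" for p
    by (rule Z.hclose_refl[OF filled_sub[OF that]])
  show "hclose d r (fl q) (fl p)"
    if "hclose d r (fl p) (fl q)" for p q r
    by (rule Z.hclose_sym[OF that])
  show "d_H euclideanreal closed_segment d p q = 0" if "p \<notin> paths euclideanreal \<or> q \<notin> paths euclideanreal" for p q
    using that by (auto simp: d_H_def)
qed (use d_H_le d_H_less D_paths_sub in blast)+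

lemma hclose_dist_supd: "hclose dist r A A' \<Longrightarrow> hclose supd r A A'" "hclose supd r A A' \<Longrightarrow> hclose dist (2 * r) A A'"
proof -
  have 1: "supd z w \<le> dist z w" for z w
    using dist_fst_le[of z w] dist_snd_le[of z w] by (simp add: supd_eq dist_real_def)
  have 2: "dist z w \<le> 2 * supd z w" for z w
  proof -
    have "dist z w \<le> dist (fst z) (fst w) + dist (snd z) (snd w)"
      unfolding dist_prod_def by (rule sqrt_sum_squares_le_sum) simp_all
    then show ?thesis
      by (auto simp: supd_eq dist_real_def max_def)
  qed
  show "hclose dist r A A' \<Longrightarrow> hclose supd r A A'"
    unfolding hclose_def using order_trans[OF 1] by meson
  have "supd z w \<le> r \<Longrightarrow> dist z w \<le> 2 * r" for z w
    using 2[of z w] by linarith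
  then show "hclose supd r A A' \<Longrightarrow> hclose dist (2 * r) A A'"
    unfolding hclose_def by meson
qed

lemma M2_topology_eq: "M2_topology I = Metric_space.mtopology DI (d_H euclideanreal closed_segment d)"
  unfolding M2_topology_def
proof (rule skorokhod_topology_eq[where S = "\<lambda>p. Id_on (fl p)"])
  show "path_rel (\<lambda>p. Id_on (fl p))"
    by (simp add: path_rel_def)
  show "Metric_space DI (d_H euclideanreal closed_segment d)"
    by (rule Metric_space_d_H)
  show "hclose (d_pair d) r (Id_on (fl q)) (Id_on (fl p))"
    if "p \<in> DI" "q \<in> DI" "d_H euclideanreal closed_segment d q p < r" for p q r
    unfolding Z.Id_on_hclose by (rule d_H_less[OF D_path[OF that(2)] D_path[OF that(1)] that(3)])
  show "d_H euclideanreal closed_segment d q p \<le> r"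
    if "p \<in> DI" "q \<in> DI" "hclose (d_pair d) r (Id_on (fl q)) (Id_on (fl p))" for p q r
    by (rule d_H_le[OF D_path[OF that(2)] D_path[OF that(1)] that(3)[unfolded Z.Id_on_hclose]])
  show "hclose (d_pair supd) r (graph_rel (\<lambda>p. Id_on (fl p)) a b q) (graph_rel (\<lambda>p. Id_on (fl p)) a b p)"
    if ab: "{a..b} \<subseteq> I" "a < b" and p: "p \<in> DI" and q: "q \<in> DI" and "rho_M2 a b (path_right q) (path_right p) < r" for a b p q r
    unfolding graph_rel_Id[OF p ab(1)] graph_rel_Id[OF q ab(1)] E.Id_on_hclose
    by (rule hclose_dist_supd(1)[OF rho_M2_less[OF q p ab that(5)]])
  show "\<exists>\<eta>>0. \<forall>q\<in>DI. hclose (d_pair supd) \<eta> (graph_rel (\<lambda>p. Id_on (fl p)) a b q)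
      (graph_rel (\<lambda>p. Id_on (fl p)) a b p) \<longrightarrow> rho_M2 a b (path_right q) (path_right p) \<le> e"
    if ab: "{a..b} \<subseteq> I" "a < b" and p: "p \<in> DI" and e: "e > 0" for a b p e
  \<comment> \<open>Halved because the Euclidean distance is at most twice the maximum
    distance.\<close>
  proof (intro exI[of _ "e / 2"] conjI ballI impI)
    fix q assume q: "q \<in> DI" and "hclose (d_pair supd) (e / 2) (graph_rel (\<lambda>p. Id_on (fl p)) a b q)
      (graph_rel (\<lambda>p. Id_on (fl p)) a b p)"
    then have "hclose dist e (gr a b q) (gr a b p)"
      unfolding graph_rel_Id[OF p ab(1)] graph_rel_Id[OF q ab(1)] E.Id_on_hclose using hclose_dist_supd(2)[of "e / 2"] by simp
    then show "rho_M2 a b (path_right q) (path_right p) \<le> e"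
      by (rule rho_M2_le[OF q p ab])
  qed (use e in simp)
  show "Metric_space DI (\<lambda>p q. if p \<in> DI \<and> q \<in> DI then rho_M2 (Inf I) (Sup I) (path_right p) (path_right q) else 0)"
    if c: "compact I"
  proof -
    have ab: "{Inf I..Sup I} \<subseteq> I" "Inf I < Sup I"
      using exhausts_compact(1)[OF c] by (simp_all add: exhausts_def)
    note ord = gr_corder[OF _ ab]
    let ?R = "\<lambda>r p q. hclose dist r (gr (Inf I) (Sup I) p) (gr (Inf I) (Sup I) q)"
    show ?thesis
    proof (rule metric_from_closeness[where P = DI and R = ?R])
      show "p = q" if p: "p \<in> DI" and q: "q \<in> DI" and r: "\<And>r. r > 0 \<Longrightarrow> ?R r p q" for p q
        by (rule gr_inj[OF c p q E.hclose_limit_eq[OF hclose_dist_supd(1)[OF r] E.corder_compact[OF ord[OF p]] E.corder_compact[OF ord[OF q]]]])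
      show "0 \<le> r" if p: "p \<in> DI" and r: "?R r p q" for p q r
        by (rule Met_TC.hclose_nonneg[OF r E.corder_nonempty[OF ord[OF p]]])
      show "?R (r + s) p u" if "?R r p q" "?R s q u" for p q u r s
        by (rule Met_TC.hclose_trans[OF that]) simp_all
      show "?R 0 p p" for p
        by (rule Met_TC.hclose_refl) simp
      show "?R r q p" if "?R r p q" for p q r
        by (rule Met_TC.hclose_sym[OF that])
    qed (use rho_M2_le[OF _ _ ab] rho_M2_less[OF _ _ ab] in auto)
  qed
qed

end

theorem theorem1p9:
  fixes X :: "'a topology"
    and B :: "'a \<Rightarrow> 'a \<Rightarrow> 'a set"
    and d :: "'a sqz \<Rightarrow> 'a sqz \<Rightarrow> real"
  assumes "metrizable_space X"
    and "proper_betweenness X B"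
    and "metric_generates (squeezed X) d (squeezed_topology X)"
  shows
    "(\<forall>p\<in>paths X. \<forall>q\<in>paths X.
        d_H X B d p q \<le> d_part X B d p q \<and> d_part X B d p q \<le> d_tot X B d p q)
     \<and>
     (Metric_space (paths X) (d_tot X B d) \<and> Metric_space (paths X) (d_part X B d) \<and>
      Metric_space.mtopology (paths X) (d_tot X B d) =
        Metric_space.mtopology (paths X) (d_part X B d) \<and>
      (\<forall>d'. metric_generates (squeezed X) d' (squeezed_topology X) \<longrightarrow>
         Metric_space.mtopology (paths X) (d_tot X B d') =
           Metric_space.mtopology (paths X) (d_tot X B d)))
     \<and>
     (polish X \<longrightarrow>
        polish (Metric_space.mtopology (paths X) (d_tot X B d)) \<and>
        (\<forall>I. closed_real_interval I \<longrightarrow>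
           polish (Metric_space.mtopology (D_paths I X) (d_tot X B d)) \<and>
           Metric_space.mtopology (D_paths I X) (d_tot X B d) =
             Metric_space.mtopology (D_paths I X) (d_part X B d)))
     \<and>
     (\<forall>dR I. metric_generates (squeezed euclideanreal) dR (squeezed_topology euclideanreal) \<and>
        closed_real_interval I \<longrightarrow>
        metric_generates (D_paths I euclideanreal) (d_tot euclideanreal closed_segment dR)
          (M1_topology I) \<and>
        metric_generates (D_paths I euclideanreal) (d_part euclideanreal closed_segment dR)
          (M1_topology I) \<and>
        metric_generates (D_paths I euclideanreal) (d_H euclideanreal closed_segment dR)
          (M2_topology I))"
proof -
  interpret path_space X B d
    using assms by (rule path_space.intro)
  have R: "metric_generates (D_paths I euclideanreal) (d_tot euclideanreal closed_segment dR) (M1_topology I) \<and>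
      metric_generates (D_paths I euclideanreal) (d_part euclideanreal closed_segment dR) (M1_topology I) \<and>
      metric_generates (D_paths I euclideanreal) (d_H euclideanreal closed_segment dR) (M2_topology I)"
    if dR: "metric_generates (squeezed euclideanreal) dR (squeezed_topology euclideanreal)"
      and I: "closed_real_interval I" for dR I
  proof -
    interpret R: real_path_space dR I
      using dR I by (rule real_path_space.intro)
    show ?thesis
      unfolding metric_generates_def R.M1_topology_eq R.M2_topology_eq
      using Metric_space.subspace[OF R.Metric_space_d_tot R.D_paths_sub] Metric_space.subspace[OF R.Metric_space_d_part R.D_paths_sub]
        R.d_tot_d_part_topology[OF R.D_paths_sub] R.Metric_space_d_H by blast
  qed
  show ?thesis
    using d_H_le_d_part d_part_le_d_tot Metric_space_d_tot Metric_space_d_part d_tot_d_part_topology[OF order_refl]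
      d_tot_topology_indep polish_paths d_tot_d_part_topology[OF D_paths_sub] R by blast
qed

end
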